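(* Let $G$ be of type $\mathbf{D}_n$, $n\ge6$, with cocharacter lattice $X_*(T)=\langle Q^\vee,\omega_1\rangle$. (1) If $n$ is even, then any section given by $\mathcal S(s_i)=t_i\sigma_i$ with $x^2=1$ and $y=-1$ is an optimal section (in fact a homomorphic section), whereas the Tits section $\mathcal N_\circ$ is not; in fact $\mathcal N_\circ(s_i)^2\ne1$ for all $i=1,\dots,n$. If $n$ is odd, then any section given by $\mathcal S(s_i)=t_i\sigma_i$ with $x^2=y^2=1$ and $xy=-1$ is an optimal section (in fact a homomorphic section), whereas the Tits section is not; in fact $\mathcal N_\circ(s_i)^2\ne1$ for all $i=1,\dots,n$. Whether $n$ is even or odd, there are two order profiles of sections. (2) Two sections are $T$-conjugate if and only if they have the same values of $x$ and $y$.
   Context: $F$ is an algebraically closed field, $G$ an almost-simple connected reductive group over $F$, $T$ a maximal torus, $N=N_G(T)$, $W=N/T$, $\pi:N\to W$ the projection. Let $\alpha_1,\dots,\alpha_n$ be the simple roots in Bourbaki numbering ($\alpha_i=e_i-e_{i+1}$ for $i<n$, $\alpha_n=e_{n-1}+e_n$), $s_i$ the corresponding reflections, $\alpha_i^\vee$ the simple coroots, $Q^\vee$ the coroot lattice, $\omega_i$ the fundamental coweights. Fix a realization of the root system: isomorphisms $u_\alpha:\mathbf G_a\to U_\alpha$ onto the root subgroups with $tu_\alpha(x)t^{-1}=u_\alpha(\alpha(t)x)$, such that $\sigma_\alpha=u_\alpha(1)u_{-\alpha}(-1)u_\alpha(1)\in N$ maps to $s_\alpha$ and $u_\alpha(x)u_{-\alpha}(-x^{-1})u_\alpha(x)=\alpha^\vee(x)\sigma_\alpha$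 for $x\in F^\times$; put $\sigma_i=\sigma_{\alpha_i}$. A section is a map $\mathcal S:W\to N$ with $\pi\circ\mathcal S=\mathrm{id}$ satisfying the braid relations (equivalently $\mathcal S$ is multiplicative along reduced expressions). It is determined by $\mathcal S(s_i)=t_i\sigma_i$, $t_i\in T$. The Tits section $\mathcal N_\circ$ is the one with all $t_i=1$. A section is homomorphic if it is a group homomorphism. The order profile of $\mathcal S$ is the Dynkin diagram with the node of each $\alpha_i$ labeled by the order of $\mathcal S(s_i)$. For two sections write $\mathcal S'<\mathcal S$ if the order of $\mathcal S'(s_i)$ is greater than the order of $\mathcal S(s_i)$ for all $i$; this translates to a partial order on order profiles, and a section is called optimal if it has the unique maximal order profile with respect to this partial order. Two sections $\mathcal S,\mathcal S'$ are $T$-conjugate if there is $t\in T$ with $t\mathcal S(w)t^{-1}=\mathcal S'(w)$ for all $w\in W$. Coordinates: the basis of $X_*(T)$ used is $\lambda_i=\alpha_i^\vee$ for $1\le i\le n-1$ and $\lambda_n=\omega_1$, and $(x_1,\dots,x_n)$ denotes $\lambda_1(x_1)\cdots\lambda_n(x_n)\in T$. The sections are exactly those given by $t_i$ of the following form, with $a_{i,i},z\in F^\times$ arbitrary and $x,y\in F^\times$ with $x^2=y^2=1$. For $1\le i\le n-1$ the $k$-th coordinate of $t_i$ is: for $k<i$, $xy^{-1}$ if $k$ is odd and $y^{-1}$ if $k$ is even; for $k=i$, $a_{i,i}$; for $i<k\le n-1$ and $n$ even, $x$ if $k$ is odd and $1$ if $k$ is even; for $i<k\le n-1$ and $n$ odd,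 $1$ if $k$ is odd and $x$ if $k$ is even; for $k=n$, $y$. The $k$-th coordinate of $t_n$ is: for $k\le n-2$, $xy^{-1}z^2$ if $k$ is odd and $y^{-1}z^2$ if $k$ is even; for $k=n-1$, $xz$; for $k=n$, $yz^{-2}$.
   Formalization: The field F is assumed to have characteristic different from 2; in characteristic 2 one has -1=1, so the Tits section satisfies N_∘(s_i)^2=1, it is optimal, there is only one order profile, and the statement fails. *)

theory Defs
  imports
    "HOL-Analysis.Analysis"
    "HOL-Algebra.Generated_Groups"
    "HOL-Algebra.Group_Action"
    "HOL-Algebra.Multiplicative_Group"
    "HOL-Library.Extended_Nat"
begin

section \<open>Linear algebraic groups over an algebraically closed field\<close>

text \<open>
  Varieties are identified with their sets of \<open>F\<close>-points. A linear algebraic group is a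
  Zariski-closed subgroup of some \<open>GL\<^sub>m(F)\<close>; the size \<open>m\<close> is the cardinality of the type \<open>'m\<close>.
\<close>

definition GL :: "('f::field ^'m ^'m) monoid" where
  "GL = \<lparr>carrier = {A. invertible A}, mult = (**), one = mat 1\<rparr>"

abbreviation GL_on :: "('f::field ^'m ^'m) set \<Rightarrow> ('f ^'m ^'m) monoid" where
  "GL_on H \<equiv> GL\<lparr>carrier := H\<rparr>"

definition Ga :: "'f::field monoid" where
  "Ga = \<lparr>carrier = UNIV, mult = (+), one = 0\<rparr>"

definition Gm :: "'f::field monoid" where
  "Gm = \<lparr>carrier = UNIV - {0}, mult = (*), one = 1\<rparr>"

definition Gm_pow :: "nat \<Rightarrow> (nat \<Rightarrow> 'f::field) monoid" where
  "Gm_pow r = \<lparr>carrier = {x. (\<forall>i<r. x i \<noteq> 0) \<and> (\<forall>i\<ge>r. x i = 1)},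
               mult = (\<lambda>x y i. x i * y i), one = (\<lambda>_. 1)\<rparr>"

inductive_set gen_alg :: "('a \<Rightarrow> 'f::field) set \<Rightarrow> ('a \<Rightarrow> 'f) set"
  for C :: "('a \<Rightarrow> 'f) set" where
  const: "(\<lambda>_. c) \<in> gen_alg C"
| gen: "f \<in> C \<Longrightarrow> f \<in> gen_alg C"
| add: "f \<in> gen_alg C \<Longrightarrow> g \<in> gen_alg C \<Longrightarrow> (\<lambda>a. f a + g a) \<in> gen_alg C"
| mult: "f \<in> gen_alg C \<Longrightarrow> g \<in> gen_alg C \<Longrightarrow> (\<lambda>a. f a * g a) \<in> gen_alg C"

text \<open>Generators of the algebras of regular functions of the ambient groups.\<close>

definition GL_coords :: "('f::field ^'m ^'m \<Rightarrow> 'f) set" where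
  "GL_coords = insert (\<lambda>A. inverse (det A)) {(\<lambda>A. A $ i $ j) | i j. True}"

definition Ga_coords :: "('f::field \<Rightarrow> 'f) set" where
  "Ga_coords = {\<lambda>x. x}"

definition Gm_coords :: "('f::field \<Rightarrow> 'f) set" where
  "Gm_coords = {\<lambda>x. x, inverse}"

definition Gm_pow_coords :: "nat \<Rightarrow> ((nat \<Rightarrow> 'f::field) \<Rightarrow> 'f) set" where
  "Gm_pow_coords r = {(\<lambda>x. x i) | i. i < r} \<union> {(\<lambda>x. inverse (x i)) | i. i < r}"

definition regular_map ::
  "('a \<Rightarrow> 'f::field) set \<Rightarrow> 'a set \<Rightarrow> ('b \<Rightarrow> 'f) set \<Rightarrow> ('a \<Rightarrow> 'b) \<Rightarrow> bool" where
  "regular_map C X D \<phi> \<longleftrightarrow> (\<forall>f\<in>D. \<exists>g\<in>gen_alg C. \<forall>x\<in>X. f (\<phi> x) = g x)"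

definition alg_group_iso ::
  "'a monoid \<Rightarrow> ('a \<Rightarrow> 'f::field) set \<Rightarrow> 'b monoid \<Rightarrow> ('b \<Rightarrow> 'f) set \<Rightarrow> ('a \<Rightarrow> 'b) \<Rightarrow> bool" where
  "alg_group_iso A C B D \<phi> \<longleftrightarrow>
     \<phi> \<in> iso A B \<and> regular_map C (carrier A) D \<phi> \<and>
     regular_map D (carrier B) C (inv_into (carrier A) \<phi>)"

definition zariski_closed :: "('f::field ^'m ^'m) set \<Rightarrow> bool" where
  "zariski_closed X \<longleftrightarrow>
     (\<exists>P \<subseteq> gen_alg GL_coords. X = {A \<in> carrier GL. \<forall>f\<in>P. f A = 0})"

definition zariski_connected :: "('f::field ^'m ^'m) set \<Rightarrow> bool" where
  "zariski_connected X \<longleftrightarrow>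
     \<not> (\<exists>A B. zariski_closed A \<and> zariski_closed B \<and> A \<noteq> {} \<and> B \<noteq> {} \<and>
              A \<inter> B = {} \<and> A \<union> B = X)"

definition algebraic_group :: "('f::field ^'m ^'m) set \<Rightarrow> bool" where
  "algebraic_group G \<longleftrightarrow> subgroup G GL \<and> zariski_closed G"

definition unipotent_group :: "('f::field ^'m ^'m) set \<Rightarrow> bool" where
  "unipotent_group H \<longleftrightarrow> (\<forall>A\<in>H. \<exists>k. (((**) (A - mat 1)) ^^ k) (mat 1) = 0)"

text \<open>Connected with trivial unipotent radical.\<close>

definition connected_reductive :: "('f::field ^'m ^'m) set \<Rightarrow> bool" where
  "connected_reductive G \<longleftrightarrow>
     algebraic_group G \<and> zariski_connected G \<and>
     (\<forall>H. H \<lhd> GL_on G \<and> zariski_closed H \<and> zariski_connected H \<and> unipotent_group H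
          \<longrightarrow> H = {mat 1})"

definition almost_simple :: "('f::field ^'m ^'m) set \<Rightarrow> bool" where
  "almost_simple G \<longleftrightarrow>
     \<not> comm_group (GL_on G) \<and>
     (\<forall>H. H \<lhd> GL_on G \<and> zariski_closed H \<and> zariski_connected H \<longrightarrow> H = {mat 1} \<or> H = G)"

definition torus :: "('f::field ^'m ^'m) set \<Rightarrow> bool" where
  "torus T \<longleftrightarrow> algebraic_group T \<and>
     (\<exists>r \<phi>. alg_group_iso (Gm_pow r) (Gm_pow_coords r) (GL_on T) GL_coords \<phi>)"

definition maximal_torus :: "('f::field ^'m ^'m) set \<Rightarrow> ('f ^'m ^'m) set \<Rightarrow> bool" where
  "maximal_torus G T \<longleftrightarrow>
     torus T \<and> T \<subseteq> G \<and> (\<forall>T'. torus T' \<and> T \<subseteq> T' \<and> T' \<subseteq> G \<longrightarrow> T' = T)"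


section \<open>Characters, cocharacters, roots and coroots\<close>

text \<open>Characters and cocharacters are extensional, so that equality is equality as maps.\<close>

definition characters :: "('f::field ^'m ^'m) set \<Rightarrow> ('f ^'m ^'m \<Rightarrow> 'f) set" where
  "characters T = {\<xi> \<in> hom (GL_on T) Gm \<inter> extensional T. regular_map GL_coords T Gm_coords \<xi>}"

definition cocharacters :: "('f::field ^'m ^'m) set \<Rightarrow> ('f \<Rightarrow> 'f ^'m ^'m) set" where
  "cocharacters T = {l \<in> hom Gm (GL_on T) \<inter> extensional (carrier Gm).
                      regular_map Gm_coords (carrier Gm) GL_coords l}"

definition cocharacter_group :: "('f::field ^'m ^'m) set \<Rightarrow> ('f \<Rightarrow> 'f ^'m ^'m) monoid" where
  "cocharacter_group T =
     \<lparr>carrier = cocharacters T, mult = (\<lambda>l m. \<lambda>x\<in>carrier Gm. l x ** m x),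
      one = (\<lambda>x\<in>carrier Gm. mat 1)\<rparr>"

definition has_pairing ::
  "('f::field ^'m ^'m \<Rightarrow> 'f) \<Rightarrow> ('f \<Rightarrow> 'f ^'m ^'m) \<Rightarrow> int \<Rightarrow> bool" where
  "has_pairing \<xi> l k \<longleftrightarrow> (\<forall>x. x \<noteq> 0 \<longrightarrow> \<xi> (l x) = x powi k)"

text \<open>
  The Lie algebra is the tangent space at the identity, i.e. the space of point derivations of
  the algebra of regular functions at \<open>1\<close> that vanish on the ideal of the group; a derivation
  is recorded by its values on the matrix coordinates.
\<close>

definition point_derivation :: "(('f::field ^'m ^'m \<Rightarrow> 'f) \<Rightarrow> 'f) \<Rightarrow> bool" where
  "point_derivation D \<longleftrightarrow>
     (\<forall>c. D (\<lambda>_. c) = 0) \<and>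
     (\<forall>f\<in>gen_alg GL_coords. \<forall>g\<in>gen_alg GL_coords.
        D (\<lambda>A. f A + g A) = D f + D g \<and>
        D (\<lambda>A. f A * g A) = f (mat 1) * D g + g (mat 1) * D f)"

definition lie_algebra :: "('f::field ^'m ^'m) set \<Rightarrow> ('f ^'m ^'m) set" where
  "lie_algebra G =
     {M. \<exists>D. point_derivation D \<and> (\<forall>f\<in>gen_alg GL_coords. (\<forall>A\<in>G. f A = 0) \<longrightarrow> D f = 0) \<and>
             (\<forall>i j. D (\<lambda>A. A $ i $ j) = M $ i $ j)}"

definition root_space ::
  "('f::field ^'m ^'m) set \<Rightarrow> ('f ^'m ^'m) set \<Rightarrow> ('f ^'m ^'m \<Rightarrow> 'f) \<Rightarrow> ('f ^'m ^'m) set" where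
  "root_space G T \<xi> =
     {M \<in> lie_algebra G. \<forall>t\<in>T. t ** M ** matrix_inv t = (\<chi> i j. \<xi> t * M $ i $ j)}"

definition roots :: "('f::field ^'m ^'m) set \<Rightarrow> ('f ^'m ^'m) set \<Rightarrow> ('f ^'m ^'m \<Rightarrow> 'f) set" where
  "roots G T = {\<xi> \<in> characters T. (\<exists>t\<in>T. \<xi> t \<noteq> 1) \<and> root_space G T \<xi> \<noteq> {0}}"

definition neg_char ::
  "('f::field ^'m ^'m) set \<Rightarrow> ('f ^'m ^'m \<Rightarrow> 'f) \<Rightarrow> ('f ^'m ^'m \<Rightarrow> 'f)" where
  "neg_char T \<xi> = (\<lambda>t\<in>T. inverse (\<xi> t))"

text \<open>\<open>l\<close> is the coroot of \<open>\<alpha>\<close>: \<open>\<langle>\<alpha>, l\<rangle> = 2\<close> and \<open>\<xi> \<mapsto> \<xi> - \<langle>\<xi>, l\<rangle>\<alpha>\<close> maps the roots to roots.\<close>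

definition is_coroot ::
  "('f::field ^'m ^'m) set \<Rightarrow> ('f ^'m ^'m) set \<Rightarrow> ('f ^'m ^'m \<Rightarrow> 'f) \<Rightarrow> ('f \<Rightarrow> 'f ^'m ^'m) \<Rightarrow> bool"
  where
  "is_coroot G T \<alpha> l \<longleftrightarrow>
     l \<in> cocharacters T \<and> has_pairing \<alpha> l 2 \<and>
     (\<forall>\<beta>\<in>roots G T. \<exists>k. has_pairing \<beta> l k \<and> (\<lambda>t\<in>T. \<beta> t * \<alpha> t powi (- k)) \<in> roots G T)"

definition is_base ::
  "('f::field ^'m ^'m) set \<Rightarrow> ('f ^'m ^'m) set \<Rightarrow> nat \<Rightarrow> (nat \<Rightarrow> 'f ^'m ^'m \<Rightarrow> 'f) \<Rightarrow> bool" where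
  "is_base G T n a \<longleftrightarrow>
     (\<forall>i\<in>{1..n}. a i \<in> roots G T) \<and>
     (\<forall>c::nat \<Rightarrow> int. (\<forall>t\<in>T. (\<Prod>i=1..n. a i t powi c i) = 1) \<longrightarrow> (\<forall>i\<in>{1..n}. c i = 0)) \<and>
     (\<forall>\<beta>\<in>roots G T. \<exists>c::nat \<Rightarrow> nat.
        (\<forall>t\<in>T. \<beta> t = (\<Prod>i=1..n. a i t ^ c i)) \<or>
        (\<forall>t\<in>T. \<beta> t = inverse (\<Prod>i=1..n. a i t ^ c i)))"

text \<open>\<open>e\<^sub>i - e\<^sub>i\<^sub>+\<^sub>1\<close> for \<open>i < n\<close>, and \<open>e\<^sub>n\<^sub>-\<^sub>1 + e\<^sub>n\<close>.\<close>

definition D_simple :: "nat \<Rightarrow> nat \<Rightarrow> nat \<Rightarrow> int" where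
  "D_simple n i k =
     (if i < n then of_bool (k = i) - of_bool (k = i + 1)
      else of_bool (k = n - 1) + of_bool (k = n))"

text \<open>All roots of \<open>D\<^sub>n\<close> have square length 2, so Cartan integers are dot products.\<close>

definition D_cartan :: "nat \<Rightarrow> nat \<Rightarrow> nat \<Rightarrow> int" where
  "D_cartan n i j = (\<Sum>k=1..n. D_simple n i k * D_simple n j k)"

definition is_root_param ::
  "('f::field ^'m ^'m) set \<Rightarrow> ('f ^'m ^'m) set \<Rightarrow> ('f ^'m ^'m \<Rightarrow> 'f) \<Rightarrow> ('f \<Rightarrow> 'f ^'m ^'m) \<Rightarrow> bool"
  where
  "is_root_param G T \<alpha> v \<longleftrightarrow>
     range v \<subseteq> G \<and> zariski_closed (range v) \<and>
     alg_group_iso Ga Ga_coords (GL_on (range v)) GL_coords v \<and>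
     (\<forall>t\<in>T. \<forall>x. t ** v x ** matrix_inv t = v (\<alpha> t * x))"

text \<open>The root subgroup \<open>U\<^sub>\<alpha>\<close> is the unique closed subgroup admitting such a parametrization.\<close>

definition is_root_subgroup ::
  "('f::field ^'m ^'m) set \<Rightarrow> ('f ^'m ^'m) set \<Rightarrow> ('f ^'m ^'m \<Rightarrow> 'f) \<Rightarrow> ('f ^'m ^'m) set \<Rightarrow> bool"
  where
  "is_root_subgroup G T \<alpha> U \<longleftrightarrow>
     (\<exists>v. is_root_param G T \<alpha> v \<and> range v = U) \<and>
     (\<forall>v. is_root_param G T \<alpha> v \<longrightarrow> range v = U)"


section \<open>Groups with a realization of their root system\<close>

record ('f, 'm::finite) realized_group =
  grp :: "('f ^'m ^'m) set"
  tor :: "('f ^'m ^'m) set"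
  rk :: nat
  sroot :: "nat \<Rightarrow> 'f ^'m ^'m \<Rightarrow> 'f"
  coroot :: "('f ^'m ^'m \<Rightarrow> 'f) \<Rightarrow> 'f \<Rightarrow> 'f ^'m ^'m"
  omega1 :: "'f \<Rightarrow> 'f ^'m ^'m"
  rsub :: "('f ^'m ^'m \<Rightarrow> 'f) \<Rightarrow> 'f \<Rightarrow> 'f ^'m ^'m"

definition Phi :: "('f::field, 'm::finite) realized_group \<Rightarrow> ('f ^'m ^'m \<Rightarrow> 'f) set" where
  "Phi R = roots (grp R) (tor R)"

definition NT :: "('f::field, 'm::finite) realized_group \<Rightarrow> ('f ^'m ^'m) monoid" where
  "NT R = GL_on (normalizer (GL_on (grp R)) (tor R))"

definition Weyl :: "('f::field, 'm::finite) realized_group \<Rightarrow> ('f ^'m ^'m) set monoid" where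
  "Weyl R = NT R Mod tor R"

definition proj :: "('f::field, 'm::finite) realized_group \<Rightarrow> 'f ^'m ^'m \<Rightarrow> ('f ^'m ^'m) set" where
  "proj R g = tor R #>\<^bsub>NT R\<^esub> g"

text \<open>
  The reflection \<open>s\<^sub>\<alpha>\<close> as an element of \<open>W = N/T\<close>: the coset of those elements of \<open>N\<close> that act on
  \<open>T\<close> by \<open>t \<mapsto> t \<alpha>\<^sup>\<or>(\<alpha>(t))\<inverse>\<close>.
\<close>

definition refl ::
  "('f::field, 'm::finite) realized_group \<Rightarrow> ('f ^'m ^'m \<Rightarrow> 'f) \<Rightarrow> ('f ^'m ^'m) set" where
  "refl R \<alpha> = {g \<in> carrier (NT R).
     \<forall>t\<in>tor R. g ** t ** matrix_inv g = t ** matrix_inv (coroot R \<alpha> (\<alpha> t))}"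

definition srefl :: "('f::field, 'm::finite) realized_group \<Rightarrow> nat \<Rightarrow> ('f ^'m ^'m) set" where
  "srefl R i = refl R (sroot R i)"

definition sigma_root ::
  "('f::field, 'm::finite) realized_group \<Rightarrow> ('f ^'m ^'m \<Rightarrow> 'f) \<Rightarrow> 'f ^'m ^'m" where
  "sigma_root R \<alpha> = rsub R \<alpha> 1 ** rsub R (neg_char (tor R) \<alpha>) (- 1) ** rsub R \<alpha> 1"

definition sigma :: "('f::field, 'm::finite) realized_group \<Rightarrow> nat \<Rightarrow> 'f ^'m ^'m" where
  "sigma R i = sigma_root R (sroot R i)"

definition type_D :: "('f::field, 'm::finite) realized_group \<Rightarrow> bool" where
  "type_D R \<longleftrightarrow>
     is_base (grp R) (tor R) (rk R) (sroot R) \<and>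
     (\<forall>\<alpha>\<in>Phi R. is_coroot (grp R) (tor R) \<alpha> (coroot R \<alpha>)) \<and>
     (\<forall>i\<in>{1..rk R}. \<forall>j\<in>{1..rk R}.
        has_pairing (sroot R j) (coroot R (sroot R i)) (D_cartan (rk R) i j))"

text \<open>\<open>X\<^sub>*(T) = \<langle>Q\<^sup>\<or>, \<omega>\<^sub>1\<rangle>\<close>; the coroot lattice is given by its generators, the simple coroots.\<close>

definition cochar_lattice_omega1 :: "('f::field, 'm::finite) realized_group \<Rightarrow> bool" where
  "cochar_lattice_omega1 R \<longleftrightarrow>
     omega1 R \<in> cocharacters (tor R) \<and>
     (\<forall>j\<in>{1..rk R}. has_pairing (sroot R j) (omega1 R) (of_bool (j = 1))) \<and>
     cocharacters (tor R) =
       generate (cocharacter_group (tor R))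
         (insert (omega1 R) ((\<lambda>i. coroot R (sroot R i)) ` {1..rk R}))"

definition realization :: "('f::field, 'm::finite) realized_group \<Rightarrow> bool" where
  "realization R \<longleftrightarrow>
     (\<forall>\<alpha>\<in>Phi R.
        is_root_param (grp R) (tor R) \<alpha> (rsub R \<alpha>) \<and>
        is_root_subgroup (grp R) (tor R) \<alpha> (range (rsub R \<alpha>)) \<and>
        sigma_root R \<alpha> \<in> carrier (NT R) \<and> proj R (sigma_root R \<alpha>) = refl R \<alpha> \<and>
        (\<forall>x. x \<noteq> 0 \<longrightarrow>
           rsub R \<alpha> x ** rsub R (neg_char (tor R) \<alpha>) (- inverse x) ** rsub R \<alpha> x =
           coroot R \<alpha> x ** sigma_root R \<alpha>))"

text \<open>
  \<open>N/T\<close> is generated by the simple reflections. For connected reductive groups this is a standard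
  structure theorem; it is what makes \<open>N/T\<close> a Coxeter group, so that reduced expressions exist.
\<close>

definition weyl_generated :: "('f::field, 'm::finite) realized_group \<Rightarrow> bool" where
  "weyl_generated R \<longleftrightarrow> carrier (Weyl R) = generate (Weyl R) (srefl R ` {1..rk R})"


section \<open>Sections of the Weyl group\<close>

definition word_prod :: "'a monoid \<Rightarrow> (nat \<Rightarrow> 'a) \<Rightarrow> nat list \<Rightarrow> 'a" where
  "word_prod H g is = foldr (\<lambda>i w. g i \<otimes>\<^bsub>H\<^esub> w) is \<one>\<^bsub>H\<^esub>"

definition reduced_word :: "('f::field, 'm::finite) realized_group \<Rightarrow> nat list \<Rightarrow> bool" where
  "reduced_word R is \<longleftrightarrow> set is \<subseteq> {1..rk R} \<and>
     (\<forall>js. set js \<subseteq> {1..rk R} \<and>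
           word_prod (Weyl R) (srefl R) js = word_prod (Weyl R) (srefl R) is
           \<longrightarrow> length is \<le> length js)"

type_synonym ('f, 'm) sect = "('f ^'m ^'m) set \<Rightarrow> 'f ^'m ^'m"

text \<open>The braid relations are stated in the form of multiplicativity along reduced expressions.\<close>

definition is_section ::
  "('f::field, 'm::finite) realized_group \<Rightarrow> ('f, 'm) sect \<Rightarrow> bool" where
  "is_section R S \<longleftrightarrow>
     S \<in> carrier (Weyl R) \<rightarrow>\<^sub>E carrier (NT R) \<and>
     (\<forall>w\<in>carrier (Weyl R). proj R (S w) = w) \<and>
     (\<forall>is. reduced_word R is \<longrightarrow>
        S (word_prod (Weyl R) (srefl R) is) = word_prod (NT R) (\<lambda>i. S (srefl R i)) is)"

definition given_by ::
  "('f::field, 'm::finite) realized_group \<Rightarrow> (nat \<Rightarrow> 'f ^'m ^'m) \<Rightarrow> ('f, 'm) sect \<Rightarrow> bool" where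
  "given_by R t S \<longleftrightarrow> (\<forall>i\<in>{1..rk R}. S (srefl R i) = t i ** sigma R i)"

definition section_of ::
  "('f::field, 'm::finite) realized_group \<Rightarrow> (nat \<Rightarrow> 'f ^'m ^'m) \<Rightarrow> ('f, 'm) sect" where
  "section_of R t = (THE S. is_section R S \<and> given_by R t S)"

definition tits_section :: "('f::field, 'm::finite) realized_group \<Rightarrow> ('f, 'm) sect" where
  "tits_section R = section_of R (\<lambda>_. mat 1)"

definition homomorphic ::
  "('f::field, 'm::finite) realized_group \<Rightarrow> ('f, 'm) sect \<Rightarrow> bool" where
  "homomorphic R S \<longleftrightarrow> S \<in> hom (Weyl R) (NT R)"

text \<open>The library function \<open>group.ord\<close> is \<open>0\<close> on elements of infinite order.\<close>

definition elt_order :: "'f::field ^'m ^'m \<Rightarrow> enat" where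
  "elt_order g = (if group.ord GL g = 0 then \<infinity> else enat (group.ord GL g))"

definition order_profile ::
  "('f::field, 'm::finite) realized_group \<Rightarrow> ('f, 'm) sect \<Rightarrow> nat \<Rightarrow> enat" where
  "order_profile R S = (\<lambda>i\<in>{1..rk R}. elt_order (S (srefl R i)))"

definition order_profiles :: "('f::field, 'm::finite) realized_group \<Rightarrow> (nat \<Rightarrow> enat) set" where
  "order_profiles R = order_profile R ` {S. is_section R S}"

text \<open>Note the reversal: a smaller profile has larger orders, at every node.\<close>

definition profile_less ::
  "('f::field, 'm::finite) realized_group \<Rightarrow> (nat \<Rightarrow> enat) \<Rightarrow> (nat \<Rightarrow> enat) \<Rightarrow> bool" where
  "profile_less R p q \<longleftrightarrow> (\<forall>i\<in>{1..rk R}. p i > q i)"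

definition maximal_profile ::
  "('f::field, 'm::finite) realized_group \<Rightarrow> (nat \<Rightarrow> enat) \<Rightarrow> bool" where
  "maximal_profile R p \<longleftrightarrow>
     p \<in> order_profiles R \<and> \<not> (\<exists>q\<in>order_profiles R. profile_less R p q)"

definition optimal :: "('f::field, 'm::finite) realized_group \<Rightarrow> ('f, 'm) sect \<Rightarrow> bool" where
  "optimal R S \<longleftrightarrow> is_section R S \<and> (\<forall>p. maximal_profile R p \<longleftrightarrow> p = order_profile R S)"

definition T_conjugate ::
  "('f::field, 'm::finite) realized_group \<Rightarrow> ('f, 'm) sect \<Rightarrow> ('f, 'm) sect \<Rightarrow> bool" where
  "T_conjugate R S S' \<longleftrightarrow>
     (\<exists>t\<in>tor R. \<forall>w\<in>carrier (Weyl R). t ** S w ** matrix_inv t = S' w)"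


section \<open>Coordinates on the torus and the parametrization of sections\<close>

definition lam :: "('f::field, 'm::finite) realized_group \<Rightarrow> nat \<Rightarrow> 'f \<Rightarrow> 'f ^'m ^'m" where
  "lam R i = (if i < rk R then coroot R (sroot R i) else omega1 R)"

definition tor_coords ::
  "('f::field, 'm::finite) realized_group \<Rightarrow> (nat \<Rightarrow> 'f) \<Rightarrow> 'f ^'m ^'m" where
  "tor_coords R x = finprod (GL_on (tor R)) (\<lambda>k. lam R k (x k)) {1..rk R}"

definition t_coord ::
  "nat \<Rightarrow> (nat \<Rightarrow> 'f::field) \<Rightarrow> 'f \<Rightarrow> 'f \<Rightarrow> 'f \<Rightarrow> nat \<Rightarrow> nat \<Rightarrow> 'f" where
  "t_coord n a z x y i k =
     (if i < n then
        (if k < i then (if odd k then x * inverse y else inverse y)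
         else if k = i then a i
         else if k < n then
           (if even n then (if odd k then x else 1) else (if odd k then 1 else x))
         else y)
      else
        (if k + 2 \<le> n then (if odd k then x * inverse y * z\<^sup>2 else inverse y * z\<^sup>2)
         else if k + 1 = n then x * z
         else y * inverse (z\<^sup>2)))"

definition t_elt ::
  "('f::field, 'm::finite) realized_group \<Rightarrow> (nat \<Rightarrow> 'f) \<Rightarrow> 'f \<Rightarrow> 'f \<Rightarrow> 'f \<Rightarrow> nat \<Rightarrow> 'f ^'m ^'m"
  where
  "t_elt R a z x y i = tor_coords R (t_coord (rk R) a z x y i)"

definition admissible ::
  "('f::field, 'm::finite) realized_group \<Rightarrow> (nat \<Rightarrow> 'f) \<Rightarrow> 'f \<Rightarrow> 'f \<Rightarrow> 'f \<Rightarrow> bool" where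
  "admissible R a z x y \<longleftrightarrow>
     (\<forall>i\<in>{1..<rk R}. a i \<noteq> 0) \<and> z \<noteq> 0 \<and> x\<^sup>2 = 1 \<and> y\<^sup>2 = 1"

definition has_xy ::
  "('f::field, 'm::finite) realized_group \<Rightarrow> ('f, 'm) sect \<Rightarrow> 'f \<Rightarrow> 'f \<Rightarrow> bool" where
  "has_xy R S x y \<longleftrightarrow> (\<exists>a z. admissible R a z x y \<and> given_by R (t_elt R a z x y) S)"

end

theory Submission
  imports Defs "HOL-Algebra.Zassenhaus"
begin

hide_const (open) UnivPoly.up_ring.monom UnivPoly.up_ring.coeff Module.smult

text \<open>
  In suitable coordinates \<open>d\<^sub>1, \<dots>, d\<^sub>n\<close> on \<open>T\<close>, dual to the \<open>e\<^sub>i\<close>, the elements \<open>\<sigma>\<^sub>i\<close> act by signed permutations. The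
  braid relations for the \<open>t\<^sub>i\<sigma>\<^sub>i\<close> then become monomial equations between the coordinates of the
  \<open>t\<^sub>i\<close>. Their solutions are described by two common signs \<open>p\<close>, \<open>q\<close> and one free unit \<open>b\<^sub>i\<close> for each node:
  two coordinates of \<open>t\<^sub>i\<close>, those moved by \<open>s\<^sub>i\<close>, are \<open>b\<^sub>i\<close> and \<open>q b\<^sub>i\<^sup>\<plusminus>\<^sup>1\<close>, and all others equal \<open>p\<close>.
  The square of \<open>t\<^sub>i\<sigma>\<^sub>i\<close> has coordinates \<open>-q\<close> at the two places and \<open>1\<close> elsewhere, so its order is 2 or 4 according
  to \<open>q\<close> alone. Conjugation by \<open>t\<close> multiplies \<open>b\<^sub>i\<close> by \<open>\<alpha>\<^sub>i(t)\<close>, and these values can be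
  prescribed arbitrarily. For the \<open>\<sigma>\<^sub>i\<close> themselves, the commutation of orthogonal
  ones rests on that of their root subgroups, which holds because the lowest-order terms of commutators are tangent to \<open>G\<close>.
\<close>

section \<open>The Weyl group of type D\<close>

text \<open>Beyond what the hypotheses state, the structure of G has to be derived. The coordinate
  cocharacters are \<open>omega1\<close> minus successive simple coroots. That the last two of them
  add up to the coroot of \<alpha>_n needs almost-simplicity: the difference of both sides takes
  values whose normal closure centralizes the Lie algebra. The simple roots determine coordinates
  only up to a common sign, and the sign -1 is excluded because half the sum of the coordinate
  cocharacters is not in the lattice; this uses characteristic other than 2. For adjacent nodes,
  conjugation gives the braid relation of the \<sigma>_i only up to a value of the coroot of
  \<alpha>_j; exchanging i and j produces a second such factor, and independence of the two coroots
  makes both trivial. To turn relations between the lifts of s_i into sections on all of N/T, words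
  in N/T are compared with signed permutations, for which the exchange condition and Matsumoto's
  theorem are proved directly. The parity of n in the statement is an effect of the coordinates: p
  is always x, whereas q is y for even n and xy for odd n.\<close>

definition swap_neg :: "int \<Rightarrow> int \<Rightarrow> int \<Rightarrow> int" where
  "swap_neg a b k = (if k = a then - b else if k = - b then a else if k = b then - a else if k = - a then b else k)"

text \<open>With e_{-k} = -e_k every root is e_a + e_b for a pair of signed indices; e_i - e_{i+1}
  is the pair (i, -i-1). This treats both shapes of simple roots alike, and
  \<open>swap_neg a b\<close>, which sends a to -b and b to -a, is the reflection in e_a +
  e_b.\<close>

definition simple_fst :: "nat \<Rightarrow> nat \<Rightarrow> int" where
  "simple_fst n i = (if i < n then int i else int n - 1)"

definition simple_snd :: "nat \<Rightarrow> nat \<Rightarrow> int" where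
  "simple_snd n i = (if i < n then - int i - 1 else int n)"

definition simple_perm :: "nat \<Rightarrow> nat \<Rightarrow> int \<Rightarrow> int" where
  "simple_perm n i = swap_neg (simple_fst n i) (simple_snd n i)"

definition word_perm :: "nat \<Rightarrow> nat list \<Rightarrow> int \<Rightarrow> int" where
  "word_perm n ws = foldr (\<lambda>i f. simple_perm n i \<circ> f) ws id"

text \<open>The positive roots are e_i + e_j and e_i - e_j with 0 < i < j, so the entry of smaller
  absolute value decides the sign.\<close>

definition pos_root :: "int \<Rightarrow> int \<Rightarrow> bool" where
  "pos_root a b \<longleftrightarrow> (if \<bar>a\<bar> < \<bar>b\<bar> then 0 < a else 0 < b)"

definition signed_idx :: "nat \<Rightarrow> int \<Rightarrow> bool" where
  "signed_idx n k \<longleftrightarrow> k \<noteq> 0 \<and> \<bar>k\<bar> \<le> int n"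

definition D_adj :: "nat \<Rightarrow> nat \<Rightarrow> nat \<Rightarrow> bool" where
  "D_adj n i j \<longleftrightarrow> (j = i + 1 \<and> j < n) \<or> (i = j + 1 \<and> i < n) \<or> (i + 2 = n \<and> j = n) \<or> (i = n \<and> j + 2 = n)"

lemma word_perm_simps [simp]:
  "word_perm n [] = id" "word_perm n (i # ws) = simple_perm n i \<circ> word_perm n ws"
  by (auto simp: word_perm_def)

lemma word_perm_append: "word_perm n (ws @ js) = word_perm n ws \<circ> word_perm n js"
  by (induction ws) (auto simp: o_assoc)

locale D_weyl =
  fixes n :: nat
  assumes n_ge: "4 \<le> n"
begin

abbreviation "sp \<equiv> simple_perm n"
abbreviation "wp \<equiv> word_perm n"
abbreviation "sa \<equiv> simple_fst n"
abbreviation "sb \<equiv> simple_snd n"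

lemmas simple_defs = simple_perm_def swap_neg_def simple_fst_def simple_snd_def

lemma simple_perm_cases:
  assumes "i \<in> {1..n}"
  obtains "0 < i \<and> i < n" "sa i = int i" "sb i = - int i - 1"
    "\<And>k. sp i k = (if k = int i then int i + 1 else if k = int i + 1 then int i
          else if k = - int i then - int i - 1 else if k = - int i - 1 then - int i else k)"
  | "i = n" "sa i = int n - 1" "sb i = int n"
    "\<And>k. sp i k = (if k = int n - 1 then - int n else if k = - int n then int n - 1
          else if k = int n then 1 - int n else if k = 1 - int n then int n else k)"
  using assms n_ge by (cases "i < n") (auto simp: simple_defs)

lemma simple_perm_invol [simp]: "i \<in> {1..n} \<Longrightarrow> sp i (sp i k) = k"
  by (erule simple_perm_cases) (use n_ge in auto)

lemma simple_perm_invol_o [simp]: "i \<in> {1..n} \<Longrightarrow> sp i \<circ> sp i = id"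
  by (rule ext) simp

lemma simple_perm_minus: "i \<in> {1..n} \<Longrightarrow> sp i (- k) = - sp i k"
  by (erule simple_perm_cases) (use n_ge in auto)

lemma simple_perm_idx: "i \<in> {1..n} \<Longrightarrow> signed_idx n (sp i k) = signed_idx n k"
  by (erule simple_perm_cases) (use n_ge in \<open>auto simp: signed_idx_def\<close>)

lemma word_perm_minus: "set ws \<subseteq> {1..n} \<Longrightarrow> wp ws (- k) = - wp ws k"
  by (induction ws) (auto simp: simple_perm_minus)

lemma word_perm_idx: "set ws \<subseteq> {1..n} \<Longrightarrow> signed_idx n (wp ws k) = signed_idx n k"
  by (induction ws) (auto simp: simple_perm_idx)

lemma word_perm_rev [simp]: "set ws \<subseteq> {1..n} \<Longrightarrow> wp (rev ws) (wp ws k) = k"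
  by (induction ws arbitrary: k) (auto simp: word_perm_append)

lemma word_perm_rev' [simp]: "set ws \<subseteq> {1..n} \<Longrightarrow> wp ws (wp (rev ws) k) = k"
  using word_perm_rev[of "rev ws" k] by simp

lemma word_perm_inj: "set ws \<subseteq> {1..n} \<Longrightarrow> wp ws k = wp ws l \<longleftrightarrow> k = l"
  by (metis word_perm_rev)

lemma word_perm_abs: "set ws \<subseteq> {1..n} \<Longrightarrow> \<bar>wp ws k\<bar> = \<bar>wp ws l\<bar> \<longleftrightarrow> \<bar>k\<bar> = \<bar>l\<bar>"
  by (metis abs_eq_iff word_perm_inj word_perm_minus)

lemma word_perm_cong_rev:
  assumes "set ws \<subseteq> {1..n}" "set js \<subseteq> {1..n}" "wp ws = wp js"
  shows "wp (rev ws) = wp (rev js)"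
proof
  fix k
  have "wp js (wp (rev ws) k) = k" using word_perm_rev'[OF assms(1)] assms(3) by metis
  thus "wp (rev ws) k = wp (rev js) k" by (metis assms(2) word_perm_rev)
qed

lemma simple_idx: "i \<in> {1..n} \<Longrightarrow> signed_idx n (sa i) \<and> signed_idx n (sb i) \<and> \<bar>sa i\<bar> \<noteq> \<bar>sb i\<bar>"
  by (erule simple_perm_cases) (use n_ge in \<open>auto simp: signed_idx_def\<close>)

lemma simple_pos: "i \<in> {1..n} \<Longrightarrow> pos_root (sa i) (sb i)"
  by (erule simple_perm_cases) (use n_ge in \<open>auto simp: pos_root_def\<close>)

lemma simple_perm_simple: "i \<in> {1..n} \<Longrightarrow> sp i (sa i) = - sb i \<and> sp i (sb i) = - sa i"
  by (erule simple_perm_cases) (use n_ge in auto)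

lemma pos_root_minus:
  "a \<noteq> 0 \<Longrightarrow> b \<noteq> 0 \<Longrightarrow> \<bar>a\<bar> \<noteq> \<bar>b\<bar> \<Longrightarrow> pos_root (- a) (- b) \<longleftrightarrow> \<not> pos_root a b"
  by (auto simp: pos_root_def)

lemma pos_root_commute: "\<bar>a\<bar> \<noteq> \<bar>b\<bar> \<Longrightarrow> pos_root a b = pos_root b a"
  by (auto simp: pos_root_def)

text \<open>The identity (e_a + e_b) + (e_{-b} + e_c) = e_a + e_c shows this as closure of the
  negative roots under those sums that are roots.\<close>

lemma neg_root_add:
  "\<lbrakk>\<not> pos_root a b; \<not> pos_root (- b) c; \<bar>a\<bar> \<noteq> \<bar>b\<bar>; \<bar>b\<bar> \<noteq> \<bar>c\<bar>; \<bar>a\<bar> \<noteq> \<bar>c\<bar>; a \<noteq> 0; b \<noteq> 0; c \<noteq> 0\<rbrakk> \<Longrightarrow> \<not> pos_root a c"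
  by (auto simp: pos_root_def split: if_splits)

text \<open>On signed indices a simple reflection only moves two neighbouring absolute values, so
  positivity can change only for a pair formed from these two. The disjunction reflects that a root
  is an unordered pair.\<close>

lemma simple_flip:
  assumes "i \<in> {1..n}" "signed_idx n a" "signed_idx n b" "\<bar>a\<bar> \<noteq> \<bar>b\<bar>"
    and "pos_root a b" "\<not> pos_root (sp i a) (sp i b)"
  shows "(a = sa i \<and> b = sb i) \<or> (a = sb i \<and> b = sa i)"
  using assms(1)
proof (cases i rule: simple_perm_cases)
  case 1
  define m where "m = int i"
  have m: "0 < m" using 1 by (simp add: m_def)
  have a: "a \<noteq> 0" "b \<noteq> 0" using assms by (auto simp: signed_idx_def)
  show ?thesis using a assms(4-) m unfolding 1(2-4) pos_root_def m_def[symmetric]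
    by (smt (verit))
next
  case 2
  define m where "m = int n"
  have m: "4 \<le> m" using n_ge by (simp add: m_def)
  have a: "a \<noteq> 0" "b \<noteq> 0" "\<bar>a\<bar> \<le> m" "\<bar>b\<bar> \<le> m" using assms by (auto simp: signed_idx_def m_def)
  show ?thesis using a assms(4-) m unfolding 2(2-4) pos_root_def m_def[symmetric]
    by (smt (verit))
qed

lemma swap_neg_simple:
  "i \<in> {1..n} \<Longrightarrow> swap_neg (sa i) (sb i) = sp i \<and> swap_neg (sb i) (sa i) = sp i"
  using simple_idx[of i] by (auto simp: simple_perm_def swap_neg_def signed_idx_def fun_eq_iff)

lemma swap_neg_conj:
  assumes "i \<in> {1..n}"
  shows "swap_neg a b \<circ> sp i = sp i \<circ> swap_neg (sp i a) (sp i b)"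
proof
  fix k
  have *: "sp i x = y \<longleftrightarrow> x = sp i y" for x y using assms by (metis simple_perm_invol)
  show "(swap_neg a b \<circ> sp i) k = (sp i \<circ> swap_neg (sp i a) (sp i b)) k"
    using assms by (auto simp: swap_neg_def simple_perm_minus *)
qed

text \<open>Follow the root \<beta> = e_a + e_b through the inverse of the word. At the letter j
  where it turns negative it must be the simple root of j, by \<open>simple_flip\<close>. Deleting
  this letter multiplies the element on the left by the reflection in \<beta>.\<close>

lemma deletion_aux:
  assumes "set ws \<subseteq> {1..n}" "signed_idx n a" "signed_idx n b" "\<bar>a\<bar> \<noteq> \<bar>b\<bar>"
    "pos_root a b" "\<not> pos_root (wp (rev ws) a) (wp (rev ws) b)"
  shows "\<exists>js. set js \<subseteq> {1..n} \<and> Suc (length js) = length ws \<and> wp js = swap_neg a b \<circ> wp ws"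
  using assms
proof (induction ws arbitrary: a b)
  case Nil
  thus ?case by simp
next
  case (Cons j ws)
  have j: "j \<in> {1..n}" using Cons.prems by auto
  show ?case
  proof (cases "pos_root (sp j a) (sp j b)")
    case True
    have "\<bar>sp j a\<bar> \<noteq> \<bar>sp j b\<bar>" using word_perm_abs[of "[j]" a b] j Cons.prems(4) by simp
    moreover have "\<not> pos_root (wp (rev ws) (sp j a)) (wp (rev ws) (sp j b))"
      using Cons.prems(6) by (simp add: word_perm_append)
    ultimately have "\<exists>js. set js \<subseteq> {1..n} \<and> Suc (length js) = length ws \<and>
        wp js = swap_neg (sp j a) (sp j b) \<circ> wp ws"
      using Cons.prems True j by (intro Cons.IH) (auto simp: simple_perm_idx)
    then obtain js where js: "set js \<subseteq> {1..n}" "Suc (length js) = length ws"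
      "wp js = swap_neg (sp j a) (sp j b) \<circ> wp ws" by blast
    have "wp (j # js) = swap_neg a b \<circ> wp (j # ws)"
      unfolding word_perm_simps js(3) o_assoc swap_neg_conj[OF j] ..
    thus ?thesis using js j by (intro exI[of _ "j # js"]) auto
  next
    case False
    have "swap_neg a b = sp j"
      using simple_flip[OF j Cons.prems(2-5) False] swap_neg_simple[OF j] by auto
    thus ?thesis using j Cons.prems(1)
      by (intro exI[of _ ws]) (auto simp: o_assoc)
  qed
qed

lemma exchange:
  assumes "set ws \<subseteq> {1..n}" "i \<in> {1..n}" "\<not> pos_root (wp (rev ws) (sa i)) (wp (rev ws) (sb i))"
  obtains js where "set js \<subseteq> {1..n}" "Suc (length js) = length ws" "wp js = sp i \<circ> wp ws"
  using deletion_aux[OF assms(1) _ _ _ simple_pos[OF assms(2)] assms(3)] simple_idx[OF assms(2)]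
  by (auto simp: simple_perm_def)

section \<open>Reduced words and the length criterion\<close>

definition red :: "nat list \<Rightarrow> bool" where
  "red ws \<longleftrightarrow> set ws \<subseteq> {1..n} \<and> (\<forall>js. set js \<subseteq> {1..n} \<and> wp js = wp ws \<longrightarrow> length ws \<le> length js)"

lemma redD: "red ws \<Longrightarrow> set ws \<subseteq> {1..n}"
  by (simp add: red_def)

lemma red_min: "red ws \<Longrightarrow> set js \<subseteq> {1..n} \<Longrightarrow> wp js = wp ws \<Longrightarrow> length ws \<le> length js"
  by (simp add: red_def)

lemma red_length: "red ws \<Longrightarrow> set js \<subseteq> {1..n} \<Longrightarrow> wp js = wp ws \<Longrightarrow> length js = length ws \<Longrightarrow> red js"
  by (simp add: red_def)

lemma red_exists:
  assumes "set ws \<subseteq> {1..n}"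
  obtains js where "red js" "wp js = wp ws"
proof -
  define P where "P js \<longleftrightarrow> set js \<subseteq> {1..n} \<and> wp js = wp ws" for js
  have "P ws" using assms by (simp add: P_def)
  then obtain js where "P js" "\<forall>ks. P ks \<longrightarrow> length js \<le> length ks"
    using ex_has_least_nat[of P ws length] by blast
  thus ?thesis using that[of js] unfolding P_def red_def by auto
qed

lemma red_tail:
  assumes "red (i # ws)"
  shows "red ws"
proof -
  have "length ws \<le> length js" if "set js \<subseteq> {1..n}" "wp js = wp ws" for js
    using red_min[OF assms, of "i # js"] redD[OF assms] that by simp
  thus ?thesis using redD[OF assms] by (simp add: red_def)
qed

lemma root_ne:
  assumes "set ws \<subseteq> {1..n}" "i \<in> {1..n}"
  shows "wp ws (sa i) \<noteq> 0" "wp ws (sb i) \<noteq> 0" "\<bar>wp ws (sa i)\<bar> \<noteq> \<bar>wp ws (sb i)\<bar>"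
  using word_perm_idx[OF assms(1)] simple_idx[OF assms(2)] word_perm_abs[OF assms(1)]
  by (auto simp: signed_idx_def)

lemma simple_conj_pos:
  assumes "set ws \<subseteq> {1..n}" "i \<in> {1..n}"
  shows "pos_root (wp ws (sp i (sa i))) (wp ws (sp i (sb i))) \<longleftrightarrow> \<not> pos_root (wp ws (sa i)) (wp ws (sb i))"
proof -
  have "pos_root (wp ws (sp i (sa i))) (wp ws (sp i (sb i))) \<longleftrightarrow> pos_root (- wp ws (sb i)) (- wp ws (sa i))"
    using simple_perm_simple[OF assms(2)] by (simp add: word_perm_minus[OF assms(1)])
  also have "\<dots> \<longleftrightarrow> \<not> pos_root (wp ws (sb i)) (wp ws (sa i))"
    using root_ne[OF assms] by (intro pos_root_minus) auto
  also have "\<dots> \<longleftrightarrow> \<not> pos_root (wp ws (sa i)) (wp ws (sb i))"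
    using root_ne[OF assms] pos_root_commute by auto
  finally show ?thesis .
qed

text \<open>Let w be the element of the word. If w^-1 \<alpha>_i is negative, exchange yields a word
  for s_i w that is shorter than the one for w. If it is positive, the inverse of s_i w makes
  \<alpha>_i negative, and exchange applied to a reduced word of s_i w yields a word for w with one
  letter less.\<close>

lemma red_Cons_iff:
  assumes "red ws" "i \<in> {1..n}"
  shows "red (i # ws) \<longleftrightarrow> pos_root (wp (rev ws) (sa i)) (wp (rev ws) (sb i))"
proof
  assume r: "red (i # ws)"
  show "pos_root (wp (rev ws) (sa i)) (wp (rev ws) (sb i))"
  proof (rule ccontr)
    assume "\<not> ?thesis"
    then obtain js where "set js \<subseteq> {1..n}" "Suc (length js) = length ws" "wp js = sp i \<circ> wp ws"
      using exchange redD[OF assms(1)] assms(2) by blast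
    thus False using red_min[OF r, of js] by simp
  qed
next
  assume pos: "pos_root (wp (rev ws) (sa i)) (wp (rev ws) (sb i))"
  obtain q where q: "red q" "wp q = wp (i # ws)"
    using red_exists[of "i # ws"] redD[OF assms(1)] assms(2) by auto
  have "wp (rev q) = wp (rev (i # ws))"
    using word_perm_cong_rev[OF _ _ q(2)] redD[OF q(1)] redD[OF assms(1)] assms(2) by auto
  hence "\<not> pos_root (wp (rev q) (sa i)) (wp (rev q) (sb i))"
    using simple_conj_pos[of "rev ws" i] redD[OF assms(1)] assms(2) pos
    by (simp add: word_perm_append)
  then obtain js where js: "set js \<subseteq> {1..n}" "Suc (length js) = length q" "wp js = sp i \<circ> wp q"
    using exchange redD[OF q(1)] assms(2) by blast
  have "wp js = wp ws" using js(3) q(2) assms(2) by (simp add: o_assoc)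
  hence "length (i # ws) \<le> length q" using red_min[OF assms(1) js(1)] js(2) by simp
  moreover have "length q \<le> length (i # ws)"
    using red_min[OF q(1), of "i # ws"] q(2) redD[OF assms(1)] assms(2) by auto
  ultimately show "red (i # ws)"
    using red_length[OF q(1), of "i # ws"] q(2) redD[OF assms(1)] assms(2) by auto
qed

lemma red_extract:
  assumes "red ws" "i \<in> {1..n}" "\<not> pos_root (wp (rev ws) (sa i)) (wp (rev ws) (sb i))"
  obtains js where "red (i # js)" "wp (i # js) = wp ws" "wp js = sp i \<circ> wp ws"
    "Suc (length js) = length ws"
proof -
  obtain js where js: "set js \<subseteq> {1..n}" "Suc (length js) = length ws" "wp js = sp i \<circ> wp ws"
    using exchange assms redD by blast
  have "wp (i # js) = wp ws" using js(3) assms(2) by (simp add: o_assoc)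
  thus ?thesis using that[of js] red_length[OF assms(1), of "i # js"] js assms(2) by auto
qed

lemma adj_sym: "D_adj n i j \<Longrightarrow> D_adj n j i"
  by (auto simp: D_adj_def)

text \<open>This is s_j s_i \<alpha>_j = \<alpha>_i for neighbours; since a root does not order its
  two indices, they may come out swapped.\<close>

lemma simple_perm_adj:
  assumes "i \<in> {1..n}" "j \<in> {1..n}" "D_adj n i j"
  shows "(sp j (sp i (sa j)) = sa i \<and> sp j (sp i (sb j)) = sb i) \<or>
         (sp j (sp i (sa j)) = sb i \<and> sp j (sp i (sb j)) = sa i)"
proof -
  from assms(3) consider "j = i + 1" "j < n" | "i = j + 1" "i < n" | "i + 2 = n" "j = n" | "i = n" "j + 2 = n"
    by (auto simp: D_adj_def)
  thus ?thesis
    by cases (use assms(1,2) n_ge in \<open>simp_all add: simple_defs\<close>)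
qed

text \<open>For neighbours s_j \<alpha>_i = \<alpha>_i + \<alpha>_j, so this is additivity of
  negative roots transported by a word. In Matsumoto's theorem it provides the second letter of the
  braid.\<close>

lemma neg_root_adj:
  assumes "i \<in> {1..n}" "j \<in> {1..n}" "D_adj n i j" "set ws \<subseteq> {1..n}"
    and "\<not> pos_root (wp ws (sa i)) (wp ws (sb i))" "\<not> pos_root (wp ws (sa j)) (wp ws (sb j))"
  shows "\<not> pos_root (wp ws (sp j (sa i))) (wp ws (sp j (sb i)))"
proof -
  have *: "\<not> pos_root (wp ws a) (wp ws c)"
    if "\<not> pos_root (wp ws a) (wp ws b)" "\<not> pos_root (wp ws (- b)) (wp ws c)"
      "\<bar>a\<bar> \<noteq> \<bar>b\<bar>" "\<bar>b\<bar> \<noteq> \<bar>c\<bar>" "\<bar>a\<bar> \<noteq> \<bar>c\<bar>" "signed_idx n a" "signed_idx n b" "signed_idx n c" for a b c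
    using neg_root_add[of "wp ws a" "wp ws b" "wp ws c"] that word_perm_minus[OF assms(4)]
      word_perm_idx[OF assms(4)] word_perm_abs[OF assms(4)] by (auto simp: signed_idx_def)
  from assms(3) consider "j = i + 1" "j < n" | "i = j + 1" "i < n" | "i + 2 = n" "j = n" | "i = n" "j + 2 = n"
    by (auto simp: D_adj_def)
  thus ?thesis
  proof cases
    case 1
    have "sp j (sa i) = int i" "sp j (sb i) = - int i - 2" "sa i = int i" "sb i = - int i - 1"
      "sa j = - (- int i - 1)" "sb j = - int i - 2"
      using 1 assms(1,2) n_ge by (simp_all add: simple_defs)
    thus ?thesis using *[of "int i" "- int i - 1" "- int i - 2"] assms(1,2,5,6) 1 n_ge by (auto simp: signed_idx_def)
  next
    case 2
    have "sp j (sa i) = int j" "sp j (sb i) = - int j - 2" "sa j = int j" "sb j = - int j - 1"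
      "sa i = - (- int j - 1)" "sb i = - int j - 2"
      using 2 assms(1,2) n_ge by (simp_all add: simple_defs)
    thus ?thesis using *[of "int j" "- int j - 1" "- int j - 2"] assms(1,2,5,6) 2 n_ge by (auto simp: signed_idx_def)
  next
    case 3
    have "sp j (sa i) = int i" "sp j (sb i) = int n" "sa i = int i" "sb i = - int i - 1"
      "sa j = - (- int i - 1)" "sb j = int n"
      using 3 assms(1,2) n_ge by (simp_all add: simple_defs)
    thus ?thesis using *[of "int i" "- int i - 1" "int n"] assms(1,2,5,6) 3 n_ge by (auto simp: signed_idx_def)
  next
    case 4
    have "sp j (sa i) = int j" "sp j (sb i) = int n" "sa j = int j" "sb j = - int j - 1"
      "sa i = - (- int j - 1)" "sb i = int n"
      using 4 assms(1,2) n_ge by (simp_all add: simple_defs)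
    thus ?thesis using *[of "int j" "- int j - 1" "int n"] assms(1,2,5,6) 4 n_ge by (auto simp: signed_idx_def)
  qed
qed

lemma not_adj_fixes:
  assumes "i \<in> {1..n}" "j \<in> {1..n}" "i \<noteq> j" "\<not> D_adj n i j" 
  shows "(sp j (sa i) = sa i \<and> sp j (sb i) = sb i) \<or> (sp j (sa i) = sb i \<and> sp j (sb i) = sa i)"
proof -
  have "(i < n \<and> j < n \<and> i + 1 < j) \<or> (i < n \<and> j < n \<and> j + 1 < i) \<or> (i + 1 = n \<and> j = n) \<or>
      (i + 2 < n \<and> j = n) \<or> (i = n \<and> j + 1 = n) \<or> (i = n \<and> j + 2 < n)"
    using assms unfolding D_adj_def atLeastAtMost_iff by presburger
  then consider "i < n" "j < n" "i + 1 < j" | "i < n" "j < n" "j + 1 < i" | "i + 1 = n" "j = n"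
    | "i + 2 < n" "j = n" | "i = n" "j + 1 = n" | "i = n" "j + 2 < n" by blast
  thus ?thesis
    by cases (use assms(1,2) n_ge in \<open>simp_all add: simple_defs\<close>)
qed

lemma simple_perm_commute:
  assumes "i \<in> {1..n}" "j \<in> {1..n}" "i \<noteq> j" "\<not> D_adj n i j" 
  shows "sp i \<circ> sp j = sp j \<circ> sp i"
proof -
  have "swap_neg (sp j (sa i)) (sp j (sb i)) = sp i"
    using not_adj_fixes[OF assms] swap_neg_simple[OF assms(1)] by auto
  thus ?thesis using swap_neg_conj[OF assms(2), of "sa i" "sb i"] by (simp add: simple_perm_def)
qed

text \<open>The reflection in s_j s_i \<alpha>_j is s_j s_i s_j s_i s_j, and it equals s_i because
  that root is \<alpha>_i.\<close>

lemma simple_perm_braid: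
  assumes "i \<in> {1..n}" "j \<in> {1..n}" "D_adj n i j" 
  shows "sp i \<circ> (sp j \<circ> sp i) = sp j \<circ> (sp i \<circ> sp j)"
proof -
  have "swap_neg (sp j (sp i (sa j))) (sp j (sp i (sb j))) = sp i"
    using simple_perm_adj[OF assms] swap_neg_simple[OF assms(1)] by auto
  hence "sp j \<circ> (sp i \<circ> sp j) = sp j \<circ> (sp i \<circ> swap_neg (sp i (sp i (sa j))) (sp i (sp i (sb j))))"
    using assms swap_neg_simple[OF assms(2)] by simp
  also have "\<dots> = sp j \<circ> (swap_neg (sp i (sa j)) (sp i (sb j)) \<circ> sp i)"
    using swap_neg_conj[OF assms(1)] by metis
  also have "\<dots> = (sp j \<circ> swap_neg (sp j (sp j (sp i (sa j)))) (sp j (sp j (sp i (sb j))))) \<circ> sp i"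
    using assms by (simp add: o_assoc)
  also have "\<dots> = swap_neg (sp j (sp i (sa j))) (sp j (sp i (sb j))) \<circ> sp j \<circ> sp i"
    using swap_neg_conj[OF assms(2)] by metis
  also have "\<dots> = sp i \<circ> (sp j \<circ> sp i)"
    using \<open>swap_neg (sp j (sp i (sa j))) (sp j (sp i (sb j))) = sp i\<close> by (simp add: o_assoc)
  finally show ?thesis ..
qed

lemma red_Nil: "red []" by (simp add: red_def)

lemma red_single: "i \<in> {1..n} \<Longrightarrow> red [i]"
  using red_Cons_iff[OF red_Nil] simple_pos by simp

lemma red_pair:
  assumes "i \<in> {1..n}" "j \<in> {1..n}" "i \<noteq> j"
  shows "red [i, j]"
proof -
  have "pos_root (sp j (sa i)) (sp j (sb i))"
  proof (rule ccontr)
    assume "\<not> ?thesis"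
    hence "(sa i = sa j \<and> sb i = sb j) \<or> (sa i = sb j \<and> sb i = sa j)"
      using simple_flip[OF assms(2), of "sa i" "sb i"] simple_idx[OF assms(1)] simple_pos[OF assms(1)] by auto
    thus False using assms n_ge by (auto simp: simple_fst_def simple_snd_def split: if_splits)
  qed
  thus ?thesis using red_Cons_iff[OF red_single[OF assms(2)] assms(1)] by simp
qed

lemma red_triple:
  assumes "i \<in> {1..n}" "j \<in> {1..n}" "D_adj n i j"
  shows "red [i, j, i]"
proof -
  have ne: "i \<noteq> j" using assms(3) by (auto simp: D_adj_def)
  have "pos_root (sp i (sp j (sa i))) (sp i (sp j (sb i)))"
    using simple_perm_adj[OF assms(2,1) adj_sym[OF assms(3)]] simple_pos[OF assms(2)]
      pos_root_commute simple_idx[OF assms(2)] by metis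
  thus ?thesis using red_Cons_iff[OF red_pair[OF assms(2,1)] assms(1)] ne by simp
qed

end

section \<open>Matsumoto's theorem for families satisfying the braid relations\<close>

lemma word_prod_simps [simp]:
  "word_prod H g [] = \<one>\<^bsub>H\<^esub>" "word_prod H g (i # ws) = g i \<otimes>\<^bsub>H\<^esub> word_prod H g ws"
  by (auto simp: word_prod_def)

lemma word_prod_closed:
  "Group.monoid G \<Longrightarrow> (\<And>i. i \<in> set ws \<Longrightarrow> g i \<in> carrier G) \<Longrightarrow> word_prod G g ws \<in> carrier G"
  by (induction ws) (auto simp: monoid.m_closed)

lemma word_prod_append:
  "Group.monoid G \<Longrightarrow> (\<And>i. i \<in> set ws \<union> set js \<Longrightarrow> g i \<in> carrier G) \<Longrightarrow>
    word_prod G g (ws @ js) = word_prod G g ws \<otimes>\<^bsub>G\<^esub> word_prod G g js"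
  by (induction ws) (auto simp: monoid.m_assoc word_prod_closed)

locale D_braid = D_weyl n + Group.monoid G for n and G :: "'a monoid" (structure) +
  fixes g :: "nat \<Rightarrow> 'a"
  assumes g_closed: "i \<in> {1..n} \<Longrightarrow> g i \<in> carrier G"
    and g_comm: "i \<in> {1..n} \<Longrightarrow> j \<in> {1..n} \<Longrightarrow> i \<noteq> j \<Longrightarrow> \<not> D_adj n i j \<Longrightarrow> g i \<otimes> g j = g j \<otimes> g i"
    and g_braid: "i \<in> {1..n} \<Longrightarrow> j \<in> {1..n} \<Longrightarrow> D_adj n i j \<Longrightarrow> g i \<otimes> (g j \<otimes> g i) = g j \<otimes> (g i \<otimes> g j)"
begin

abbreviation "wg \<equiv> word_prod G g"

lemma wg_closed: "set ws \<subseteq> {1..n} \<Longrightarrow> wg ws \<in> carrier G"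
  by (rule word_prod_closed[OF monoid_axioms], rule g_closed, blast)

text \<open>If two reduced words of w start with different letters i and j, then w^-1 makes both
  \<alpha>_i and \<alpha>_j negative, so w also has reduced words starting with the two sides of the
  braid relation of i and j. Induction on the length matches each given word with one of these, and
  the braid relation matches these two.\<close>

lemma red_word_prod_eq:
  assumes "red ws" "red js" "wp ws = wp js"
  shows "wg ws = wg js"
  using assms
proof (induction "length ws" arbitrary: ws js rule: less_induct)
  case less
  have len: "length ws = length js"
    using red_min[OF less.prems(1), of js] red_min[OF less.prems(2), of ws] less.prems redD by auto
  show ?case
  proof (cases ws)
    case Nil
    thus ?thesis using len by simp
  next
    case ws: (Cons i u)
    then obtain j v where js: "js = j # v" using len by (cases js) auto
    note r = less.prems(1,2)[unfolded ws js]
    have i: "i \<in> {1..n}" and j: "j \<in> {1..n}" and u: "set u \<subseteq> {1..n}" and v: "set v \<subseteq> {1..n}"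
      using redD[OF r(1)] redD[OF r(2)] by auto
    have ru: "red u" and rv: "red v" using r red_tail by auto
    have w: "sp i \<circ> wp u = sp j \<circ> wp v" using less.prems(3) ws js by simp
    have wv: "wp v = sp j \<circ> wp (i # u)" using w j by (simp add: o_assoc)
    have wu: "wp u = sp i \<circ> wp (j # v)" using w i
      by (metis comp_assoc comp_id fun.map_id simple_perm_invol_o word_perm_simps(2) id_comp)
    show ?thesis
    proof (cases "i = j")
      case True
      have "wp u = wp v" using wu True i by (simp add: o_assoc)
      hence "wg u = wg v" using less.hyps[of u v] ru rv ws by simp
      thus ?thesis using ws js True by simp
    next
      case False
      \<comment> \<open>\<open>R\<close> is a word for w^-1, spelled from the first word;
        \<open>Rj\<close> allows it to be read from the second word as well.\<close>
      define R where "R = rev (i # u)"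
      have R: "set R \<subseteq> {1..n}" using i u by (auto simp: R_def)
      have Rj: "wp R = wp (rev (j # v))" unfolding R_def
        using word_perm_cong_rev[of "i # u" "j # v"] w i j u v by auto
      have rvR: "wp (rev v) k = wp R (sp j k)" for k
        using Rj j by (simp add: word_perm_append)
      have ruR: "wp (rev u) k = wp R (sp i k)" for k
        using i by (simp add: R_def word_perm_append)
      have ni: "\<not> pos_root (wp R (sa i)) (wp R (sb i))"
      proof -
        have "pos_root (wp (rev u) (sa i)) (wp (rev u) (sb i))" using red_Cons_iff[OF ru i] r by simp
        thus ?thesis using simple_conj_pos[OF R i] ruR by simp
      qed
      have nj: "\<not> pos_root (wp R (sa j)) (wp R (sb j))"
      proof -
        have "pos_root (wp (rev v) (sa j)) (wp (rev v) (sb j))" using red_Cons_iff[OF rv j] r by simp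
        thus ?thesis using simple_conj_pos[OF R j] rvR by simp
      qed
      show ?thesis
      proof (cases "D_adj n i j")
        case adj: False
        have "\<not> pos_root (wp (rev v) (sa i)) (wp (rev v) (sb i))"
          using not_adj_fixes[OF i j False adj] ni rvR pos_root_commute root_ne[OF R i] by metis
        then obtain x where x: "red (i # x)" "wp (i # x) = wp v" "Suc (length x) = length v"
          using red_extract[OF rv i] by metis
        have xs: "set x \<subseteq> {1..n}" using redD[OF x(1)] by simp
        have "wp (j # x) = wp u"
        proof -
          have "wp u = sp i \<circ> (sp j \<circ> (sp i \<circ> wp x))" using wu x(2) by simp
          also have "\<dots> = sp i \<circ> (sp i \<circ> (sp j \<circ> wp x))"
            using simple_perm_commute[OF i j False adj] by (simp add: o_assoc)
          also have "\<dots> = wp (j # x)" using i by (simp add: o_assoc)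
          finally show ?thesis ..
        qed
        hence jx: "red (j # x)" "wp (j # x) = wp u"
          using red_length[OF ru, of "j # x"] xs j x(3) len ws js by auto
        have "wg u = wg (j # x)" using less.hyps[of u "j # x"] ru jx ws by simp
        moreover have "wg v = wg (i # x)" using less.hyps[of v "i # x"] rv x len ws js by simp
        ultimately show ?thesis
          using ws js g_comm[OF i j False adj] wg_closed[OF xs] g_closed i j by (simp flip: m_assoc)
      next
        case adj: True
        \<comment> \<open>As w^-1 makes \<alpha>_i + \<alpha>_j negative, the tail after j can be
          chosen to begin with i, and what follows with j: a reduced word of w begins with j, i,
          j.\<close>
        have "\<not> pos_root (wp (rev v) (sa i)) (wp (rev v) (sb i))"
          using neg_root_adj[OF i j adj R ni nj] rvR by simp
        then obtain v' where v': "red (i # v')" "wp (i # v') = wp v" "wp v' = sp i \<circ> wp v" "Suc (length v') = length v"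
          using red_extract[OF rv i] by metis
        have rv': "red v'" using v'(1) red_tail by blast
        have "wp (rev (i # v')) = wp (rev v)"
          using word_perm_cong_rev[OF redD[OF v'(1)] v v'(2)] .
        hence "wp (rev v') k = wp R (sp j (sp i k))" for k
          using rvR i by (simp add: word_perm_append fun_eq_iff) (metis simple_perm_invol i)
        hence "\<not> pos_root (wp (rev v') (sa j)) (wp (rev v') (sb j))"
          using simple_perm_adj[OF i j adj] ni pos_root_commute root_ne[OF R i] by metis
        then obtain x where x: "red (j # x)" "wp (j # x) = wp v'" "Suc (length x) = length v'"
          using red_extract[OF rv' j] by metis
        have xs: "set x \<subseteq> {1..n}" using redD[OF x(1)] by simp
        have vx: "wp (i # j # x) = wp v" using v'(2) x(2) by simp
        have rvx: "red (i # j # x)" using red_length[OF rv, of "i # j # x"] vx xs i j x v' by auto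
        have "wp (j # i # x) = wp u"
        proof -
          have "wp u = sp i \<circ> (sp j \<circ> (sp i \<circ> (sp j \<circ> wp x)))" using wu vx by simp
          also have "\<dots> = sp i \<circ> (sp j \<circ> (sp i \<circ> sp j)) \<circ> wp x" by (simp add: o_assoc)
          also have "\<dots> = sp i \<circ> (sp i \<circ> (sp j \<circ> sp i)) \<circ> wp x" 
            using simple_perm_braid[OF i j adj] by simp
          also have "\<dots> = wp (j # i # x)" using i by (simp add: o_assoc)
          finally show ?thesis ..
        qed
        hence jx: "red (j # i # x)" "wp (j # i # x) = wp u"
          using red_length[OF ru, of "j # i # x"] xs i j x(3) v' len ws js by auto
        have "wg u = wg (j # i # x)" using less.hyps[of u "j # i # x"] ru jx ws by simp
        moreover have "wg v = wg (i # j # x)" using less.hyps[of v "i # j # x"] rv rvx vx len ws js by simp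
        moreover have "g i \<otimes> (g j \<otimes> (g i \<otimes> wg x)) = g j \<otimes> (g i \<otimes> (g j \<otimes> wg x))"
          using g_braid[OF i j adj] wg_closed[OF xs] g_closed i j by (simp flip: m_assoc)
        ultimately show ?thesis using ws js by simp
      qed
    qed
  qed
qed

text \<open>When a letter i is put in front of a reduced word and the result is not reduced, that
  word can be rewritten to begin with i, and the two letters cancel by g_i^2 = 1. So every word has
  a reduced word with the same product, to which Matsumoto's theorem applies. This is what turns
  sections with involutive values into homomorphisms.\<close>

theorem invol_word_prod_eq:
  assumes sq: "\<And>i. i \<in> {1..n} \<Longrightarrow> g i \<otimes> g i = \<one>"
    and "set ws \<subseteq> {1..n}" "set js \<subseteq> {1..n}" "wp ws = wp js"
  shows "wg ws = wg js"
proof -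
  have ex: "\<exists>r. red r \<and> wp r = wp ws \<and> wg r = wg ws" if "set ws \<subseteq> {1..n}" for ws
    using that
  proof (induction ws)
    case Nil
    thus ?case using red_Nil by (intro exI[of _ "[]"]) simp
  next
    case (Cons i ws)
    then obtain r where r: "red r" "wp r = wp ws" "wg r = wg ws" by auto
    have i: "i \<in> {1..n}" using Cons.prems by simp
    show ?case
    proof (cases "pos_root (wp (rev r) (sa i)) (wp (rev r) (sb i))")
      case True
      thus ?thesis using red_Cons_iff[OF r(1) i] r by (intro exI[of _ "i # r"]) simp
    next
      case False
      obtain q where q: "red (i # q)" "wp (i # q) = wp r" "wp q = sp i \<circ> wp r"
        using red_extract[OF r(1) i False] by metis
      have "wg r = g i \<otimes> wg q" using red_word_prod_eq[OF r(1) q(1)] q(2) by simp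
      hence "wg (i # ws) = wg q"
        using sq[OF i] r(3) g_closed[OF i] wg_closed redD[OF red_tail[OF q(1)]]
        by (simp flip: m_assoc)
      thus ?thesis using red_tail[OF q(1)] q(3) r(2) by auto
    qed
  qed
  obtain r s where "red r" "wp r = wp ws" "wg r = wg ws" "red s" "wp s = wp js" "wg s = wg js"
    using ex assms(2,3) by metis
  thus ?thesis using red_word_prod_eq[of r s] assms(4) by simp
qed

end

section \<open>Matrices and regular functions\<close>

lemma GL_simps [simp]:
  "carrier GL = {A. invertible A}" "mult GL = (**)" "one GL = mat 1"
  by (simp_all add: GL_def)

lemma matrix_inv_ex:
  assumes "invertible (A :: 'f::field ^'m ^'m)"
  shows "A ** matrix_inv A = mat 1" "matrix_inv A ** A = mat 1"
proof -
  have "\<exists>B. A ** B = mat 1 \<and> B ** A = mat 1" using assms by (simp add: invertible_def)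
  from someI_ex[OF this] show "A ** matrix_inv A = mat 1" "matrix_inv A ** A = mat 1"
    by (auto simp: matrix_inv_def)
qed

lemma group_GL: "group (GL :: ('f::field ^'m ^'m) monoid)"
proof (rule groupI)
  fix A :: "'f ^'m ^'m"
  assume A: "A \<in> carrier GL"
  show "\<exists>B\<in>carrier GL. B \<otimes>\<^bsub>GL\<^esub> A = \<one>\<^bsub>GL\<^esub>"
    using matrix_inv_ex[of A] A by (intro bexI[of _ "matrix_inv A"]) (auto simp: invertible_def)
next
  show "\<one>\<^bsub>GL\<^esub> \<in> (carrier GL :: ('f ^'m ^'m) set)"
    by (auto simp: invertible_def intro: exI[of _ "mat 1"])
qed (auto simp: invertible_mult matrix_mul_assoc)

lemma matrix_inv_eq:
  assumes "A ** B = mat 1"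
  shows "matrix_inv (A :: 'f::field ^'m ^'m) = B"
proof -
  have "invertible A" using assms matrix_left_right_inverse by (auto simp: invertible_def)
  hence "matrix_inv A ** (A ** B) = B" by (simp add: matrix_mul_assoc matrix_inv_ex)
  thus ?thesis by (simp add: assms)
qed

lemma invertible_matrix_inv: "invertible (A :: 'f::field ^'m ^'m) \<Longrightarrow> invertible (matrix_inv A)"
  using matrix_inv_ex[of A] by (auto simp: invertible_def)

lemma matrix_inv_inv: "invertible (A :: 'f::field ^'m ^'m) \<Longrightarrow> matrix_inv (matrix_inv A) = A"
  by (intro matrix_inv_eq matrix_inv_ex)

lemma inv_GL: "invertible (A :: 'f::field ^'m ^'m) \<Longrightarrow> inv\<^bsub>GL\<^esub> A = matrix_inv A"
  using group.inv_equality[OF group_GL, of "matrix_inv A" A] matrix_inv_ex[of A] invertible_matrix_inv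
  by auto

lemma mult_inv_cancel [simp]:
  fixes A B :: "'f::field ^'m ^'m"
  assumes "invertible A"
  shows "matrix_inv A ** (A ** B) = B" "A ** (matrix_inv A ** B) = B"
    "B ** A ** matrix_inv A = B" "B ** matrix_inv A ** A = B"
  using matrix_inv_ex[OF assms] by (simp_all add: matrix_mul_assoc) (simp_all flip: matrix_mul_assoc)

lemma matrix_inv_mult:
  fixes A B :: "'f::field ^'m ^'m"
  assumes "invertible A" "invertible B"
  shows "matrix_inv (A ** B) = matrix_inv B ** matrix_inv A"
  by (rule matrix_inv_eq) (use assms in \<open>simp add: matrix_mul_assoc matrix_inv_ex\<close>)

lemma matrix_inv_mat1 [simp]: "matrix_inv (mat 1 :: 'f::field ^'m ^'m) = mat 1"
  by (rule matrix_inv_eq) simp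

lemma invertible_mat1 [simp]: "invertible (mat 1 :: 'f::field ^'m ^'m)"
  by (auto simp: invertible_def intro: exI[of _ "mat 1"])

definition scale_mat :: "'f::field \<Rightarrow> 'f ^'m ^'m \<Rightarrow> 'f ^'m ^'m" where
  "scale_mat c M = (\<chi> i j. c * M $ i $ j)"

lemma scale_mat_nth [simp]: "scale_mat c M $ i $ j = c * M $ i $ j"
  by (simp add: scale_mat_def)

lemma matrix_mult_nth: "(A ** B) $ i $ j = (\<Sum>k\<in>UNIV. A $ i $ k * B $ k $ j)"
  by (simp add: matrix_matrix_mult_def)

lemma scale_mat_simps [simp]: "scale_mat 1 M = M" "scale_mat 0 M = 0" "scale_mat c 0 = 0"
  by (simp_all add: vec_eq_iff)

lemma scale_mat_scale [simp]: "scale_mat a (scale_mat b M) = scale_mat (a * b) M"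
  by (simp add: vec_eq_iff mult.assoc)

lemma scale_mat_mult: "A ** scale_mat c M = scale_mat c (A ** M)" "scale_mat c M ** A = scale_mat c (M ** A)"
  by (simp_all add: vec_eq_iff matrix_mult_nth sum_distrib_left mult_ac)

lemma matrix_sum_mult:
  fixes f :: "'i \<Rightarrow> 'f::field ^'m ^'m"
  shows "A ** (\<Sum>i\<in>I. f i) = (\<Sum>i\<in>I. A ** f i)" "(\<Sum>i\<in>I. f i) ** A = (\<Sum>i\<in>I. f i ** A)"
proof -
  show "A ** (\<Sum>i\<in>I. f i) = (\<Sum>i\<in>I. A ** f i)"
    by (simp add: vec_eq_iff matrix_mult_nth sum_distrib_left) (subst sum.swap, simp)
  show "(\<Sum>i\<in>I. f i) ** A = (\<Sum>i\<in>I. f i ** A)"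
    by (simp add: vec_eq_iff matrix_mult_nth sum_distrib_right) (subst sum.swap, simp)
qed

definition is_subspace :: "('f::field ^'m ^'m) set \<Rightarrow> bool" where
  "is_subspace L \<longleftrightarrow> 0 \<in> L \<and> (\<forall>M\<in>L. \<forall>N\<in>L. M + N \<in> L) \<and> (\<forall>c. \<forall>M\<in>L. scale_mat c M \<in> L)"

lemma is_subspaceD:
  assumes "is_subspace L"
  shows "0 \<in> L" "M \<in> L \<Longrightarrow> N \<in> L \<Longrightarrow> M + N \<in> L" "M \<in> L \<Longrightarrow> scale_mat c M \<in> L" 
    "M \<in> L \<Longrightarrow> N \<in> L \<Longrightarrow> M - N \<in> L"
proof -
  show *: "0 \<in> L" "M \<in> L \<Longrightarrow> N \<in> L \<Longrightarrow> M + N \<in> L" "M \<in> L \<Longrightarrow> scale_mat c M \<in> L" for M N c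
    using assms by (auto simp: is_subspace_def)
  assume "M \<in> L" "N \<in> L"
  moreover have "M - N = M + scale_mat (- 1) N" by (simp add: vec_eq_iff)
  ultimately show "M - N \<in> L" using * by metis
qed

lemma is_subspace_sum: "is_subspace L \<Longrightarrow> (\<And>i. i \<in> I \<Longrightarrow> f i \<in> L) \<Longrightarrow> (\<Sum>i\<in>I. f i) \<in> L"
  by (induction I rule: infinite_finite_induct) (auto simp: is_subspaceD)

lemma is_subspace_zero: "is_subspace {0}"
  by (auto simp: is_subspace_def)

lemma gen_alg_sum: "(\<And>i. i \<in> I \<Longrightarrow> f i \<in> gen_alg C) \<Longrightarrow> (\<lambda>x. \<Sum>i\<in>I. f i x) \<in> gen_alg C"
  by (induction I rule: infinite_finite_induct) (auto intro: gen_alg.intros)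

lemma gen_alg_prod: "(\<And>i. i \<in> I \<Longrightarrow> f i \<in> gen_alg C) \<Longrightarrow> (\<lambda>x. \<Prod>i\<in>I. f i x) \<in> gen_alg C"
  by (induction I rule: infinite_finite_induct) (auto intro: gen_alg.intros)

definition regular_fun :: "('a \<Rightarrow> 'f::field) set \<Rightarrow> 'a set \<Rightarrow> ('a \<Rightarrow> 'f) \<Rightarrow> bool" where
  "regular_fun C X f \<longleftrightarrow> (\<exists>g\<in>gen_alg C. \<forall>x\<in>X. f x = g x)"

lemma regular_map_iff: "regular_map C X D \<phi> \<longleftrightarrow> (\<forall>f\<in>D. regular_fun C X (\<lambda>x. f (\<phi> x)))"
  by (simp add: regular_map_def regular_fun_def)

lemma regular_fun_cong: "(\<And>x. x \<in> X \<Longrightarrow> f x = g x) \<Longrightarrow> regular_fun C X f \<longleftrightarrow> regular_fun C X g"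
  by (simp add: regular_fun_def)

lemma regular_map_cong: "(\<And>x. x \<in> X \<Longrightarrow> f x = g x) \<Longrightarrow> regular_map C X D f \<longleftrightarrow> regular_map C X D g"
  by (simp add: regular_map_def)

lemma regular_fun_gen: "f \<in> gen_alg C \<Longrightarrow> regular_fun C X f"
  by (auto simp: regular_fun_def)

lemma regular_fun_const: "regular_fun C X (\<lambda>_. c)"
  by (intro regular_fun_gen gen_alg.intros)

lemma regular_fun_add: "regular_fun C X f \<Longrightarrow> regular_fun C X g \<Longrightarrow> regular_fun C X (\<lambda>x. f x + g x)"
  unfolding regular_fun_def by clarsimp (metis (mono_tags) gen_alg.add)

lemma regular_fun_mult: "regular_fun C X f \<Longrightarrow> regular_fun C X g \<Longrightarrow> regular_fun C X (\<lambda>x. f x * g x)"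
  unfolding regular_fun_def by clarsimp (metis (mono_tags) gen_alg.mult)

lemma regular_fun_sum: "(\<And>i. i \<in> I \<Longrightarrow> regular_fun C X (f i)) \<Longrightarrow> regular_fun C X (\<lambda>x. \<Sum>i\<in>I. f i x)"
  by (induction I rule: infinite_finite_induct) (auto intro: regular_fun_const regular_fun_add)

lemma regular_fun_prod: "(\<And>i. i \<in> I \<Longrightarrow> regular_fun C X (f i)) \<Longrightarrow> regular_fun C X (\<lambda>x. \<Prod>i\<in>I. f i x)"
  by (induction I rule: infinite_finite_induct) (auto intro: regular_fun_const regular_fun_mult)

lemma regular_map_fun:
  assumes "regular_map C X D \<phi>" "f \<in> gen_alg D"
  shows "regular_fun C X (\<lambda>x. f (\<phi> x))"
  using assms(2) by induction
    (use assms(1) in \<open>auto simp: regular_map_iff intro: regular_fun_const regular_fun_add regular_fun_mult\<close>)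

lemma regular_fun_comp:
  "regular_map C X D \<phi> \<Longrightarrow> \<phi> ` X \<subseteq> Y \<Longrightarrow> regular_fun D Y f \<Longrightarrow> regular_fun C X (\<lambda>x. f (\<phi> x))"
proof -
  assume *: "regular_map C X D \<phi>" "\<phi> ` X \<subseteq> Y" "regular_fun D Y f"
  then obtain g where g: "g \<in> gen_alg D" "\<forall>y\<in>Y. f y = g y" by (auto simp: regular_fun_def)
  have "regular_fun C X (\<lambda>x. g (\<phi> x))" using * g regular_map_fun by blast
  thus ?thesis using g *(2) by (subst regular_fun_cong[of X _ "\<lambda>x. g (\<phi> x)"]) auto
qed

lemma regular_map_comp:
  "regular_map C X D \<phi> \<Longrightarrow> \<phi> ` X \<subseteq> Y \<Longrightarrow> regular_map D Y E \<psi> \<Longrightarrow> regular_map C X E (\<lambda>x. \<psi> (\<phi> x))"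
  unfolding regular_map_iff[of _ _ E] by (auto intro: regular_fun_comp[where Y = Y])

lemma GL_coords_entry: "(\<lambda>A. A $ i $ j) \<in> GL_coords"
  by (auto simp: GL_coords_def)

lemma GL_coords_det: "(\<lambda>A. inverse (det A)) \<in> GL_coords"
  by (auto simp: GL_coords_def)

lemma det_gen_alg: "(det :: 'f::field ^'m ^'m \<Rightarrow> 'f) \<in> gen_alg GL_coords"
proof -
  have "(\<lambda>A. \<Sum>p | p permutes (UNIV :: 'm set). of_int (sign p) * (\<Prod>i\<in>UNIV. A $ i $ p i))
      \<in> gen_alg (GL_coords :: ('f ^'m ^'m \<Rightarrow> 'f) set)"
    by (intro gen_alg_sum gen_alg.mult gen_alg.const gen_alg_prod gen_alg.gen GL_coords_entry)
  moreover have "det = (\<lambda>A :: 'f ^'m ^'m. \<Sum>p | p permutes (UNIV :: 'm set). of_int (sign p) * (\<Prod>i\<in>UNIV. A $ i $ p i))"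
    by (simp add: det_def fun_eq_iff)
  ultimately show ?thesis by metis
qed

lemma regular_map_GL:
  fixes \<phi> :: "'a \<Rightarrow> 'f::field ^'m ^'m"
  assumes "\<And>i j. regular_fun C X (\<lambda>x. \<phi> x $ i $ j)" "regular_fun C X (\<lambda>x. inverse (det (\<phi> x)))"
  shows "regular_map C X GL_coords \<phi>"
  using assms by (auto simp: regular_map_iff GL_coords_def)

lemma regular_map_GL_entry: "regular_map C X GL_coords \<phi> \<Longrightarrow> regular_fun C X (\<lambda>x. \<phi> x $ i $ j)"
  using GL_coords_entry by (fastforce simp: regular_map_iff)

lemma regular_map_GL_det: "regular_map C X GL_coords \<phi> \<Longrightarrow> regular_fun C X (\<lambda>x. inverse (det (\<phi> x)))"
  using GL_coords_det by (fastforce simp: regular_map_iff)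

lemma regular_map_GL_mult:
  fixes \<phi> \<psi> :: "'a \<Rightarrow> 'f::field ^'m ^'m"
  assumes "regular_map C X GL_coords \<phi>" "regular_map C X GL_coords \<psi>"
  shows "regular_map C X GL_coords (\<lambda>x. \<phi> x ** \<psi> x)"
proof (rule regular_map_GL)
  show "regular_fun C X (\<lambda>x. (\<phi> x ** \<psi> x) $ i $ j)" for i j
    unfolding matrix_mult_nth
    using assms by (intro regular_fun_sum regular_fun_mult regular_map_GL_entry)
  show "regular_fun C X (\<lambda>x. inverse (det (\<phi> x ** \<psi> x)))"
    unfolding det_mul inverse_mult_distrib
    using assms by (intro regular_fun_mult regular_map_GL_det)
qed

lemma regular_map_const: "regular_map C X D (\<lambda>_. c)"
  by (auto simp: regular_map_iff intro: regular_fun_const)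

lemma regular_map_id: "regular_map C X C (\<lambda>x. x)"
  by (auto simp: regular_map_iff intro!: regular_fun_gen gen_alg.gen)

lemma regular_fun_det: "regular_map C X GL_coords \<phi> \<Longrightarrow> regular_fun C X (\<lambda>x. det (\<phi> x))"
  using regular_map_fun[OF _ det_gen_alg] .

text \<open>Cramer's rule for the columns of the identity; it exhibits the entries of the inverse as
  regular functions on GL.\<close>

lemma matrix_inv_nth:
  fixes A :: "'f::field ^'m ^'m"
  assumes "invertible A"
  shows "matrix_inv A $ k $ l = det (\<chi> i j. if j = k then mat 1 $ i $ l else A $ i $ j) * inverse (det A)"
proof -
  have d: "det A \<noteq> 0" using assms invertible_det_nz by blast
  have "(A ** matrix_inv A) $ i $ l = mat 1 $ i $ l" for i using matrix_inv_ex[OF assms] by simp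
  hence "A *v (\<chi> i. matrix_inv A $ i $ l) = (\<chi> i. mat 1 $ i $ l)"
    by (simp add: vec_eq_iff matrix_vector_mult_def matrix_mult_nth)
  hence "(\<chi> i. matrix_inv A $ i $ l) = (\<chi> k. det (\<chi> i j. if j = k then (\<chi> i. mat 1 $ i $ l) $ i else A $ i $ j) / det A)"
    using cramer[OF d] by blast
  from arg_cong[OF this, of "\<lambda>v. v $ k"] show ?thesis
    by (simp add: divide_inverse cong: if_cong)
qed

lemma regular_map_GL_inv:
  fixes \<phi> :: "'a \<Rightarrow> 'f::field ^'m ^'m"
  assumes r: "regular_map C X GL_coords \<phi>" and inv: "\<And>x. x \<in> X \<Longrightarrow> invertible (\<phi> x)"
  shows "regular_map C X GL_coords (\<lambda>x. matrix_inv (\<phi> x))"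
proof (rule regular_map_GL)
  fix k l
  have "regular_fun C X (\<lambda>x. det (\<chi> i j. if j = k then mat 1 $ i $ l else \<phi> x $ i $ j))"
    unfolding det_def
  proof (intro regular_fun_sum regular_fun_mult regular_fun_const regular_fun_prod)
    fix p i
    show "regular_fun C X (\<lambda>x. (\<chi> i j. if j = k then mat 1 $ i $ l else \<phi> x $ i $ j) $ i $ p i)"
      by (cases "p i = k") (simp_all add: regular_fun_const regular_map_GL_entry[OF r])
  qed
  hence "regular_fun C X (\<lambda>x. det (\<chi> i j. if j = k then mat 1 $ i $ l else \<phi> x $ i $ j) * inverse (det (\<phi> x)))"
    by (intro regular_fun_mult regular_map_GL_det[OF r])
  thus "regular_fun C X (\<lambda>x. matrix_inv (\<phi> x) $ k $ l)"
    by (subst regular_fun_cong) (auto simp: matrix_inv_nth inv)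
next
  have "inverse (det (matrix_inv (\<phi> x))) = det (\<phi> x)" if "x \<in> X" for x
  proof -
    have "det (\<phi> x) * det (matrix_inv (\<phi> x)) = 1"
      using matrix_inv_ex[OF inv[OF that]] by (metis det_I det_mul)
    thus ?thesis by (metis inverse_unique mult.commute)
  qed
  thus "regular_fun C X (\<lambda>x. inverse (det (matrix_inv (\<phi> x))))"
    using regular_fun_det[OF r] by (subst regular_fun_cong) auto
qed

lemma regular_map_GL_conj:
  fixes \<phi> :: "'a \<Rightarrow> 'f::field ^'m ^'m" and A B :: "'f ^'m ^'m"
  assumes "regular_map C X GL_coords \<phi>"
  shows "regular_map C X GL_coords (\<lambda>x. A ** \<phi> x ** B)"
  by (intro regular_map_GL_mult regular_map_const assms)

section \<open>Closed sets\<close>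

lemma zariski_closed_iff:
  "zariski_closed X \<longleftrightarrow> X \<subseteq> {A. invertible A} \<and>
    (\<forall>A. invertible A \<and> (\<forall>f\<in>gen_alg GL_coords. (\<forall>B\<in>X. f B = 0) \<longrightarrow> f A = 0) \<longrightarrow> A \<in> X)"
  (is "?L \<longleftrightarrow> ?R")
proof
  assume ?L
  then obtain P where "P \<subseteq> gen_alg GL_coords" "X = {A \<in> carrier GL. \<forall>f\<in>P. f A = 0}"
    by (auto simp: zariski_closed_def)
  thus ?R by auto
next
  assume ?R
  thus ?L unfolding zariski_closed_def
    by (intro exI[of _ "{f \<in> gen_alg GL_coords. \<forall>B\<in>X. f B = 0}"]) auto
qed

definition zclosure :: "('f::field ^'m ^'m) set \<Rightarrow> ('f ^'m ^'m) set" where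
  "zclosure X = {A. invertible A \<and> (\<forall>f\<in>gen_alg GL_coords. (\<forall>B\<in>X. f B = 0) \<longrightarrow> f A = 0)}"

lemma zclosure_closed: "zariski_closed (zclosure X)"
  unfolding zariski_closed_def zclosure_def
  by (intro exI[of _ "{f \<in> gen_alg GL_coords. \<forall>B\<in>X. f B = 0}"]) auto

lemma zclosure_subset: "X \<subseteq> {A. invertible A} \<Longrightarrow> X \<subseteq> zclosure X"
  by (auto simp: zclosure_def)

lemma zclosure_minimal: "zariski_closed Y \<Longrightarrow> X \<subseteq> Y \<Longrightarrow> zclosure X \<subseteq> Y"
  unfolding zclosure_def zariski_closed_iff by blast

lemma zclosure_invertible: "A \<in> zclosure X \<Longrightarrow> invertible A"
  by (simp add: zclosure_def)

lemma zariski_closed_vimage: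
  fixes X :: "('f::field ^'m ^'m) set" and \<phi> :: "'f ^'m ^'m \<Rightarrow> 'f ^'m ^'m"
  assumes r: "regular_map GL_coords {A. invertible A} GL_coords \<phi>"
    and inv: "\<And>A. invertible A \<Longrightarrow> invertible (\<phi> A)" and X: "zariski_closed X"
  shows "zariski_closed {A. invertible A \<and> \<phi> A \<in> X}"
proof -
  obtain P where P: "P \<subseteq> gen_alg GL_coords" "X = {A \<in> carrier GL. \<forall>f\<in>P. f A = 0}"
    using X by (auto simp: zariski_closed_def)
  have "regular_fun GL_coords {A. invertible A} (\<lambda>A. f (\<phi> A))" if "f \<in> P" for f
    using regular_map_fun[OF r] P(1) that by blast
  then obtain q where q: "\<And>f. f \<in> P \<Longrightarrow> q f \<in> gen_alg GL_coords"
    "\<And>f A. f \<in> P \<Longrightarrow> invertible A \<Longrightarrow> f (\<phi> A) = q f A"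
    unfolding regular_fun_def by (metis mem_Collect_eq)
  have "{A. invertible A \<and> \<phi> A \<in> X} = {A \<in> carrier GL. \<forall>f\<in>q ` P. f A = 0}"
    using q(2) P(2) inv by auto
  moreover have "q ` P \<subseteq> gen_alg GL_coords" using q(1) by auto
  ultimately show ?thesis unfolding zariski_closed_def by meson
qed

lemma zclosure_regular:
  fixes X Y :: "('f::field ^'m ^'m) set" and \<phi> :: "'f ^'m ^'m \<Rightarrow> 'f ^'m ^'m"
  assumes r: "regular_map GL_coords {A. invertible A} GL_coords \<phi>"
    and inv: "\<And>A. invertible A \<Longrightarrow> invertible (\<phi> A)"
    and sub: "X \<subseteq> {A. invertible A}" and im: "\<And>A. A \<in> X \<Longrightarrow> \<phi> A \<in> zclosure Y" and A: "A \<in> zclosure X"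
  shows "\<phi> A \<in> zclosure Y"
proof -
  have "zclosure X \<subseteq> {A. invertible A \<and> \<phi> A \<in> zclosure Y}"
    using sub im by (intro zclosure_minimal zariski_closed_vimage[OF r inv zclosure_closed]) auto
  thus ?thesis using A by auto
qed

lemma regular_map_GL_lr: "regular_map GL_coords X GL_coords (\<lambda>A :: 'f::field ^'m ^'m. B ** A ** (C :: 'f ^'m ^'m) :: 'f ^'m ^'m)"
  by (intro regular_map_GL_conj regular_map_id)

lemma zclosure_lr:
  fixes X Y :: "('f::field ^'m ^'m) set"
  assumes "invertible B" "invertible C" "X \<subseteq> {A. invertible A}"
    and "\<And>A. A \<in> X \<Longrightarrow> B ** A ** C \<in> zclosure Y" "A \<in> zclosure X"
  shows "B ** A ** C \<in> zclosure Y"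
  using zclosure_regular[OF regular_map_GL_lr _ assms(3-5)] assms(1,2) by (simp add: invertible_mult)

text \<open>Left multiplication by an element of H preserves H, hence its closure. Therefore right
  multiplication by an element of the closure maps H into the closure, and so it maps the closure
  into itself.\<close>

lemma zclosure_subgroup:
  fixes H :: "('f::field ^'m ^'m) set"
  assumes "subgroup H GL"
  shows "subgroup (zclosure H) GL"
proof -
  interpret H: subgroup H GL by fact
  have inv: "H \<subseteq> {A. invertible A}" using H.subset by simp
  have HC: "B ** A \<in> zclosure H" if "B \<in> H" "A \<in> zclosure H" for A B
    using zclosure_lr[of B "mat 1" H H A] inv that H.m_closed zclosure_subset[OF inv] by auto
  have CC: "A ** B \<in> zclosure H" if "A \<in> zclosure H" "B \<in> zclosure H" for A B
    using zclosure_lr[of "mat 1" B H H A] inv that HC zclosure_invertible[OF that(2)] by auto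
  have IC: "matrix_inv A \<in> zclosure H" if "A \<in> zclosure H" for A
  proof (rule zclosure_regular[OF _ _ inv _ that])
    show "regular_map GL_coords {A. invertible A} GL_coords (matrix_inv :: 'f ^'m ^'m \<Rightarrow> _)"
      by (intro regular_map_GL_inv regular_map_id) auto
    fix A assume A: "A \<in> H"
    hence "invertible A" using inv by auto
    hence "matrix_inv A \<in> H" using H.m_inv_closed[OF A] by (simp add: inv_GL)
    thus "matrix_inv A \<in> zclosure H" using zclosure_subset[OF inv] by auto
  next
  qed (rule invertible_matrix_inv)
  show ?thesis
  proof (rule group.subgroupI[OF group_GL])
    show "zclosure H \<noteq> {}" using H.one_closed zclosure_subset[OF inv] by blast
  qed (use CC IC in \<open>auto simp: inv_GL zclosure_invertible\<close>)
qed

section \<open>Polynomial curves\<close>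

text \<open>If the field were finite, the product of all X - x, plus 1, would be a nonconstant
  polynomial without roots.\<close>

lemma infinite_alg_closed: "infinite (UNIV :: 'f::alg_closed_field set)"
proof
  assume fin: "finite (UNIV :: 'f set)"
  define p :: "'f poly" where "p = (\<Prod>x\<in>UNIV. [:- x, 1:])"
  have "degree p = card (UNIV :: 'f set)" unfolding p_def
    by (subst degree_prod_sum_eq) auto
  hence "degree (p + 1) > 0"
    using fin by (simp add: degree_add_eq_left card_gt_0_iff)
  then obtain x where "poly (p + 1) x = 0" using alg_closed_imp_poly_has_root by blast
  moreover have "poly p x = 0" unfolding p_def poly_prod
    using fin by (intro prod_zero) auto
  ultimately show False by simp
qed

lemma poly_eqI_nonzero:
  fixes p q :: "'f::alg_closed_field poly"
  assumes "\<And>x. x \<noteq> 0 \<Longrightarrow> poly p x = poly q x"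
  shows "p = q"
proof (rule ccontr)
  assume "p \<noteq> q"
  hence "finite {x. poly (p - q) x = 0}" by (intro poly_roots_finite) simp
  moreover have "UNIV - {0} \<subseteq> {x. poly (p - q) x = 0}" using assms by auto
  ultimately have "finite (UNIV - {0} :: 'f set)" using finite_subset by blast
  thus False using infinite_alg_closed[where 'f = 'f] by simp
qed

lemma ex_pow_ne_1:
  assumes "k \<noteq> (0 :: int)"
  shows "\<exists>x :: 'f::alg_closed_field. x \<noteq> 0 \<and> x powi k \<noteq> 1"
proof (rule ccontr)
  assume "\<not> ?thesis"
  hence *: "x powi k = 1" if "x \<noteq> 0" for x :: 'f using that by blast
  have "x ^ nat \<bar>k\<bar> = 1" if "x \<noteq> 0" for x :: 'f
    using *[OF that] by (cases "k \<ge> 0") (auto simp: power_int_def field_simps that split: if_splits)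
  hence "monom 1 (nat \<bar>k\<bar>) = (1 :: 'f poly)"
    by (intro poly_eqI_nonzero) (simp add: poly_monom)
  hence "degree (monom (1 :: 'f) (nat \<bar>k\<bar>)) = 0" by simp
  thus False using assms by (simp add: degree_monom_eq)
qed

text \<open>Regular functions on G_m are Laurent polynomials; the power x^N clears the
  denominator.\<close>

lemma gen_alg_Gm_poly: "f \<in> gen_alg Gm_coords \<Longrightarrow> \<exists>p N. \<forall>x. x \<noteq> 0 \<longrightarrow> f x * x ^ N = poly p x"
proof (induction rule: gen_alg.induct)
  case (const c)
  show ?case by (intro exI[of _ "[:c:]"] exI[of _ 0]) simp
next
  case (gen f)
  then consider "f = (\<lambda>x. x)" | "f = inverse" by (auto simp: Gm_coords_def)
  thus ?case
  proof cases
    case 1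
    thus ?thesis by (intro exI[of _ "[:0, 1:]"] exI[of _ 0]) simp
  next
    case 2
    thus ?thesis by (intro exI[of _ 1] exI[of _ 1]) simp
  qed
next
  case (add f g)
  obtain p M where "\<forall>x. x \<noteq> 0 \<longrightarrow> f x * x ^ M = poly p x" using add.IH(1) by auto
  moreover obtain q N where "\<forall>x. x \<noteq> 0 \<longrightarrow> g x * x ^ N = poly q x" using add.IH(2) by auto
  moreover have "(f x + g x) * x ^ (M + N) = (f x * x ^ M) * x ^ N + (g x * x ^ N) * x ^ M" for x
    by (simp add: power_add algebra_simps)
  ultimately have "\<forall>x. x \<noteq> 0 \<longrightarrow> (f x + g x) * x ^ (M + N) = poly (p * monom 1 N + q * monom 1 M) x"
    by (simp add: poly_monom)
  thus ?case by (intro exI)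
next
  case (mult f g)
  obtain p M where "\<forall>x. x \<noteq> 0 \<longrightarrow> f x * x ^ M = poly p x" using mult.IH(1) by auto
  moreover obtain q N where "\<forall>x. x \<noteq> 0 \<longrightarrow> g x * x ^ N = poly q x" using mult.IH(2) by auto
  moreover have "(f x * g x) * x ^ (M + N) = (f x * x ^ M) * (g x * x ^ N)" for x
    by (simp add: power_add algebra_simps)
  ultimately have "\<forall>x. x \<noteq> 0 \<longrightarrow> (f x * g x) * x ^ (M + N) = poly (p * q) x"
    by (metis poly_mult)
  thus ?case by (intro exI)
qed

lemma Gm_simps [simp]:
  "carrier Gm = UNIV - {0}" "mult Gm = (*)" "one Gm = 1"
  by (simp_all add: Gm_def)

lemma regular_fun_Gm_poly:
  assumes "regular_fun Gm_coords (UNIV - {0}) f"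
  obtains p N where "\<And>x. x \<noteq> 0 \<Longrightarrow> f x * x ^ N = poly p x"
  using assms gen_alg_Gm_poly unfolding regular_fun_def by (metis DiffI UNIV_I singletonD)

text \<open>Irreducibility of G_m: after clearing denominators the claim is that the polynomial ring
  is a domain, since a polynomial vanishing on all nonzero elements of an infinite field is
  zero.\<close>

lemma regular_fun_Gm_domain:
  fixes f g :: "'f::alg_closed_field \<Rightarrow> 'f"
  assumes f: "regular_fun Gm_coords (UNIV - {0}) f" and g: "regular_fun Gm_coords (UNIV - {0}) g"
    and z: "\<And>x. x \<noteq> 0 \<Longrightarrow> f x * g x = 0"
  shows "(\<forall>x. x \<noteq> 0 \<longrightarrow> f x = 0) \<or> (\<forall>x. x \<noteq> 0 \<longrightarrow> g x = 0)"
proof -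
  obtain p M where p: "\<And>x. x \<noteq> 0 \<Longrightarrow> f x * x ^ M = poly p x" using regular_fun_Gm_poly[OF f] by blast
  obtain q N where q: "\<And>x. x \<noteq> 0 \<Longrightarrow> g x * x ^ N = poly q x" using regular_fun_Gm_poly[OF g] by blast
  have "p * q = 0"
  proof (rule poly_eqI_nonzero)
    fix x :: 'f assume "x \<noteq> 0"
    thus "poly (p * q) x = poly 0 x" using p[of x] q[of x] z[of x] by (auto simp flip: p q)
  qed
  hence "p = 0 \<or> q = 0" by simp
  thus ?thesis using p q by force
qed

text \<open>If p(x) = f(x) x^N is a polynomial, multiplicativity gives p(cx) = f(c) c^N p(x).
  Comparing one nonzero coefficient, of degree i, gives f(c) c^N = c^i, so f is the power i -
  N.\<close>

lemma regular_hom_Gm: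
  fixes f :: "'f::alg_closed_field \<Rightarrow> 'f"
  assumes "regular_fun Gm_coords (UNIV - {0}) f" and nz: "\<And>x. x \<noteq> 0 \<Longrightarrow> f x \<noteq> 0"
    and hom: "\<And>x y. x \<noteq> 0 \<Longrightarrow> y \<noteq> 0 \<Longrightarrow> f (x * y) = f x * f y"
  shows "\<exists>k::int. \<forall>x. x \<noteq> 0 \<longrightarrow> f x = x powi k"
proof -
  obtain p N where p: "\<And>x. x \<noteq> 0 \<Longrightarrow> f x * x ^ N = poly p x"
    using regular_fun_Gm_poly[OF assms(1)] by blast
  have "p \<noteq> 0" using p[of 1] nz[of 1] by auto
  then obtain i where i: "coeff p i \<noteq> 0" by (metis leading_coeff_0_iff)
  have "f c = c powi (int i - int N)" if c: "c \<noteq> 0" for c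
  proof -
    have "pcompose p [:0, c:] = smult (f c * c ^ N) p"
    proof (rule poly_eqI_nonzero)
      fix x :: 'f assume x: "x \<noteq> 0"
      have "poly p (x * c) = f (x * c) * (x * c) ^ N" using p[of "x * c"] x c by simp
      also have "\<dots> = (f c * c ^ N) * poly p x"
        using hom[OF x c] p[OF x, symmetric] by (simp add: power_mult_distrib mult_ac)
      finally show "poly (pcompose p [:0, c:]) x = poly (smult (f c * c ^ N) p) x"
        by (simp add: poly_pcompose)
    qed
    hence "coeff (pcompose p [:0, c:]) i = f c * c ^ N * coeff p i" by simp
    moreover have "coeff (pcompose p [:0, c:]) i = c ^ i * coeff p i"
      by (simp add: coeff_pcompose_linear)
    ultimately have "f c * c ^ N = c ^ i" using i by simp
    thus ?thesis using c by (simp add: power_int_diff field_simps)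
  qed
  thus ?thesis by blast
qed

section \<open>Independence of characters\<close>

text \<open>Artin's independence argument, modulo a subspace. Subtracting \<open>ch k s\<close>
  times the relation at t from the relation at \<open>op s t\<close> removes the term k and
  multiplies the term i by \<open>ch i s - ch k s\<close>, which is nonzero for a suitable s. With L
  = {0} this is ordinary independence; with L the Lie algebra it shows that weight components stay
  inside it. The operation is abstract so that the powers on the multiplicative group are covered
  too.\<close>

lemma char_sum_subspace:
  fixes ch :: "'i \<Rightarrow> 'a \<Rightarrow> 'f::field" and M :: "'i \<Rightarrow> 'f ^'m ^'m"
  assumes "finite Y" "is_subspace L" "e \<in> T"
    and "\<And>i. i \<in> Y \<Longrightarrow> ch i e = 1"
    and "\<And>s t. s \<in> T \<Longrightarrow> t \<in> T \<Longrightarrow> op s t \<in> T"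
    and "\<And>i s t. i \<in> Y \<Longrightarrow> s \<in> T \<Longrightarrow> t \<in> T \<Longrightarrow> ch i (op s t) = ch i s * ch i t"
    and "\<And>i j. i \<in> Y \<Longrightarrow> j \<in> Y \<Longrightarrow> i \<noteq> j \<Longrightarrow> \<exists>t\<in>T. ch i t \<noteq> ch j t"
    and "\<And>t. t \<in> T \<Longrightarrow> (\<Sum>i\<in>Y. scale_mat (ch i t) (M i)) \<in> L"
    and "j \<in> Y"
  shows "M j \<in> L"
  using assms(1,4-)
proof (induction Y arbitrary: M j rule: finite_induct)
  case empty
  thus ?case by simp
next
  case (insert k Y)
  note sub = is_subspaceD[OF assms(2)]
  have Y: "M i \<in> L" if i: "i \<in> Y" for i
  proof -
    obtain s where s: "s \<in> T" "ch i s \<noteq> ch k s"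
      using insert.prems(4)[of i k] insert.hyps(2) i by auto
    have "scale_mat (ch i s - ch k s) (M i) \<in> L"
    proof (rule insert.IH[where M = "\<lambda>i. scale_mat (ch i s - ch k s) (M i)"])
      fix t assume t: "t \<in> T"
      have "(\<Sum>i\<in>insert k Y. scale_mat (ch i (op s t)) (M i)) -
          scale_mat (ch k s) (\<Sum>i\<in>insert k Y. scale_mat (ch i t) (M i)) \<in> L"
        by (intro sub(4) sub(3) insert.prems(5) insert.prems(2) s t)
      also have "(\<Sum>i\<in>insert k Y. scale_mat (ch i (op s t)) (M i)) -
          scale_mat (ch k s) (\<Sum>i\<in>insert k Y. scale_mat (ch i t) (M i)) =
          (\<Sum>i\<in>insert k Y. scale_mat (ch i t * (ch i s - ch k s)) (M i))"
      proof -
        have "scale_mat (ch k s) (\<Sum>i\<in>insert k Y. scale_mat (ch i t) (M i)) =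
            (\<Sum>i\<in>insert k Y. scale_mat (ch k s * ch i t) (M i))"
          by (simp add: vec_eq_iff sum_distrib_left mult_ac)
        moreover have "(\<Sum>i\<in>insert k Y. scale_mat (ch i (op s t)) (M i)) =
            (\<Sum>i\<in>insert k Y. scale_mat (ch i s * ch i t) (M i))"
          using insert.prems(3) s(1) t by (intro sum.cong) auto
        ultimately show ?thesis
          by (simp only: sum_subtractf[symmetric]) (rule sum.cong, simp_all add: vec_eq_iff algebra_simps)
      qed
      also have "\<dots> = (\<Sum>i\<in>Y. scale_mat (ch i t) (scale_mat (ch i s - ch k s) (M i)))"
        using insert.hyps by simp
      finally show "(\<Sum>i\<in>Y. scale_mat (ch i t) (scale_mat (ch i s - ch k s) (M i))) \<in> L" .
    next
      show "ch i e = 1" if "i \<in> Y" for i using insert.prems(1) that by simp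
      show "ch i (op s t) = ch i s * ch i t" if "i \<in> Y" "s \<in> T" "t \<in> T" for i s t
        using insert.prems(3) that by simp
      show "\<exists>t\<in>T. ch i t \<noteq> ch j t" if "i \<in> Y" "j \<in> Y" "i \<noteq> j" for i j
        using insert.prems(4) that by simp
    qed (fact insert.prems(2), fact i)
    hence "scale_mat (inverse (ch i s - ch k s)) (scale_mat (ch i s - ch k s) (M i)) \<in> L" by (rule sub(3))
    thus ?thesis using s by simp
  qed
  have "(\<Sum>i\<in>insert k Y. scale_mat (ch i e) (M i)) \<in> L" using insert.prems(5) assms(3) by blast
  moreover have "(\<Sum>i\<in>insert k Y. scale_mat (ch i e) (M i)) = M k + (\<Sum>i\<in>Y. M i)"
    using insert.hyps insert.prems(1) by simp
  ultimately have "(M k + (\<Sum>i\<in>Y. M i)) - (\<Sum>i\<in>Y. M i) \<in> L"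
    using sub(4) is_subspace_sum[OF assms(2), of Y M] Y by metis
  hence "M k \<in> L" by simp
  thus ?case using Y insert.prems(6) by auto
qed

section \<open>The Lie algebra\<close>

lemma point_derivationD:
  assumes "point_derivation D"
  shows "D (\<lambda>_. c) = 0"
    "f \<in> gen_alg GL_coords \<Longrightarrow> g \<in> gen_alg GL_coords \<Longrightarrow> D (\<lambda>A. f A + g A) = D f + D g"
    "f \<in> gen_alg GL_coords \<Longrightarrow> g \<in> gen_alg GL_coords \<Longrightarrow>
      D (\<lambda>A. f A * g A) = f (mat 1) * D g + g (mat 1) * D f"
  using assms by (auto simp: point_derivation_def)

lemma point_derivation_scale:
  assumes "point_derivation D" "f \<in> gen_alg GL_coords"
  shows "D (\<lambda>A. c * f A) = c * D f"
  using point_derivationD(3)[OF assms(1) gen_alg.const assms(2), of c] point_derivationD(1)[OF assms(1)]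
  by simp

lemma point_derivation_sum:
  assumes "point_derivation D" "\<And>i. i \<in> I \<Longrightarrow> f i \<in> gen_alg GL_coords"
  shows "D (\<lambda>A. \<Sum>i\<in>I. f i A) = (\<Sum>i\<in>I. D (f i))"
  using assms(2)
proof (induction I rule: infinite_finite_induct)
  case (insert i I)
  thus ?case
    using point_derivationD(2)[OF assms(1), of "f i" "\<lambda>A. \<Sum>i\<in>I. f i A"] by (simp add: gen_alg_sum)
qed (simp_all add: point_derivationD(1)[OF assms(1)])

lemma lie_algebra_subspace: "is_subspace (lie_algebra G)"
  unfolding is_subspace_def
proof (intro conjI ballI allI)
  show "0 \<in> lie_algebra G"
    unfolding lie_algebra_def by (auto intro!: exI[of _ "\<lambda>_. 0"] simp: point_derivation_def)
next
  fix M N assume "M \<in> lie_algebra G" "N \<in> lie_algebra G"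
  then obtain D E where D: "point_derivation D" "point_derivation E"
    "\<forall>f\<in>gen_alg GL_coords. (\<forall>A\<in>G. f A = 0) \<longrightarrow> D f = 0" "\<forall>i j. D (\<lambda>A. A $ i $ j) = M $ i $ j"
    "\<forall>f\<in>gen_alg GL_coords. (\<forall>A\<in>G. f A = 0) \<longrightarrow> E f = 0" "\<forall>i j. E (\<lambda>A. A $ i $ j) = N $ i $ j"
    by (auto simp: lie_algebra_def)
  show "M + N \<in> lie_algebra G"
    unfolding lie_algebra_def using D
    by (auto intro!: exI[of _ "\<lambda>f. D f + E f"] simp: point_derivation_def algebra_simps)
next
  fix M c assume "M \<in> lie_algebra G"
  then obtain D where D: "point_derivation D" 
    "\<forall>f\<in>gen_alg GL_coords. (\<forall>A\<in>G. f A = 0) \<longrightarrow> D f = 0" "\<forall>i j. D (\<lambda>A. A $ i $ j) = M $ i $ j"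
    by (auto simp: lie_algebra_def)
  show "scale_mat c M \<in> lie_algebra G"
    unfolding lie_algebra_def using D
    by (auto intro!: exI[of _ "\<lambda>f. c * D f"] simp: point_derivation_def algebra_simps)
qed

lemma regular_fun_UNIV: "regular_fun C UNIV f \<Longrightarrow> f \<in> gen_alg C"
  unfolding regular_fun_def by (metis UNIV_I ext)

text \<open>Conjugation by g fixes the identity and preserves both G and the regular functions, so a
  derivation at the identity can be pulled back along it.\<close>

lemma lie_algebra_Ad:
  fixes G :: "('f::field ^'m ^'m) set"
  assumes G: "subgroup G GL" and g: "g \<in> G" and M: "M \<in> lie_algebra G"
  shows "g ** M ** matrix_inv g \<in> lie_algebra G"
proof -
  interpret G: subgroup G GL by fact
  have inv: "invertible g" using G.subset g by auto
  have h: "matrix_inv g \<in> G" using G.m_inv_closed[OF g] inv by (simp add: inv_GL)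
  define cj where "cj A = g ** A ** matrix_inv g" for A :: "'f ^'m ^'m"
  have cj1: "cj (mat 1) = mat 1" by (simp add: cj_def matrix_inv_ex inv)
  have cjG: "cj A \<in> G" if "A \<in> G" for A using G.m_closed g h that by (simp add: cj_def)
  have r: "(\<lambda>A. f (cj A)) \<in> gen_alg GL_coords" if "f \<in> gen_alg GL_coords" for f :: "'f ^'m ^'m \<Rightarrow> 'f"
    using regular_map_fun[OF regular_map_GL_lr that, of UNIV] unfolding cj_def by (rule regular_fun_UNIV)
  obtain D where D: "point_derivation D" 
    "\<forall>f\<in>gen_alg GL_coords. (\<forall>A\<in>G. f A = 0) \<longrightarrow> D f = 0" "\<forall>i j. D (\<lambda>A. A $ i $ j) = M $ i $ j"
    using M by (auto simp: lie_algebra_def)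
  define E where "E f = D (\<lambda>A. f (cj A))" for f
  have "point_derivation E"
    using D(1) r unfolding point_derivation_def E_def by (auto simp: cj1)
  moreover have "E f = 0" if "f \<in> gen_alg GL_coords" "\<forall>A\<in>G. f A = 0" for f
    using D(2)[rule_format, OF r[OF that(1)]] that(2) cjG by (simp add: E_def)
  moreover have "E (\<lambda>A. A $ i $ j) = (g ** M ** matrix_inv g) $ i $ j" for i j
  proof -
    have e: "(\<lambda>A :: 'f ^'m ^'m. A $ k $ l) \<in> gen_alg GL_coords" for k l
      by (intro gen_alg.gen GL_coords_entry)
    have "E (\<lambda>A. A $ i $ j) = D (\<lambda>A. \<Sum>l\<in>UNIV. \<Sum>k\<in>UNIV. (matrix_inv g $ l $ j * g $ i $ k) * A $ k $ l)"
      by (simp add: E_def cj_def matrix_mult_nth sum_distrib_left sum_distrib_right mult_ac)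
    also have "\<dots> = (\<Sum>l\<in>UNIV. \<Sum>k\<in>UNIV. (matrix_inv g $ l $ j * g $ i $ k) * M $ k $ l)"
      by (simp add: point_derivation_sum[OF D(1)] point_derivation_scale[OF D(1) e] D(3) e
          gen_alg_sum gen_alg.mult gen_alg.const)
    also have "\<dots> = (g ** M ** matrix_inv g) $ i $ j"
      by (simp add: matrix_mult_nth sum_distrib_left sum_distrib_right mult_ac)
    finally show ?thesis .
  qed
  ultimately show ?thesis unfolding lie_algebra_def by blast
qed

text \<open>The lowest-order coefficient of a polynomial curve through the identity is a tangent vector.\<close>

lemma lie_algebra_curve:
  fixes G :: "('f::alg_closed_field ^'m ^'m) set"
  assumes \<gamma>: "\<And>s. \<gamma> s \<in> G" and G: "G \<subseteq> {A. invertible A}" and k: "0 < k"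
    and P: "\<And>s i j. \<gamma> s $ i $ j = poly (P i j) s"
    and one: "\<gamma> 0 = mat 1" and low: "\<And>i j l. 0 < l \<Longrightarrow> l < k \<Longrightarrow> coeff (P i j) l = 0"
  shows "(\<chi> i j. coeff (P i j) k) \<in> lie_algebra G"
proof -
  have prod: "coeff (p * q) l = 0" if "0 < l" "l < k" "\<forall>l. 0 < l \<and> l < k \<longrightarrow> coeff p l = 0"
    "\<forall>l. 0 < l \<and> l < k \<longrightarrow> coeff q l = 0" for p q :: "'f poly" and l
    unfolding coeff_mult
  proof (intro sum.neutral ballI)
    fix i assume "i \<in> {..l}"
    thus "coeff p i * coeff q (l - i) = 0" using that by (cases "i = 0") auto
  qed
  have prodk: "coeff (p * q) k = coeff p 0 * coeff q k + coeff q 0 * coeff p k"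
    if "\<forall>l. 0 < l \<and> l < k \<longrightarrow> coeff p l = 0" for p q :: "'f poly"
  proof -
    have "coeff (p * q) k = (\<Sum>i\<in>{0, k}. coeff p i * coeff q (k - i))"
      unfolding coeff_mult by (rule sum.mono_neutral_right) (use that in auto)
    thus ?thesis using k by (simp add: mult.commute)
  qed
  \<comment> \<open>\<open>Q f p\<close>: along the curve f is the polynomial p, whose coefficients
    in degrees 1 to k-1 vanish. Such functions form an algebra, and on it the coefficient of degree
    k obeys the Leibniz rule by \<open>prodk\<close>.\<close>
  define Q where "Q f p \<longleftrightarrow> (\<forall>s. f (\<gamma> s) = poly p s) \<and> (\<forall>l. 0 < l \<and> l < k \<longrightarrow> coeff p l = 0)"
    for f and p :: "'f poly"
  have uniq: "p = q" if "Q f p" "Q f q" for f p q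
    using that by (intro poly_eqI_nonzero) (metis Q_def)
  have Qadd: "Q (\<lambda>A. f A + g A) (p + q)" if "Q f p" "Q g q" for f g p q
    using that by (simp add: Q_def)
  have Qmult: "Q (\<lambda>A. f A * g A) (p * q)" if "Q f p" "Q g q" for f g p q
    using that prod by (simp add: Q_def)
  have Qconst: "Q (\<lambda>_. c) [:c:]" for c by (simp add: Q_def coeff_pCons split: nat.splits)
  have Qentry: "Q (\<lambda>A. A $ i $ j) (P i j)" for i j using P low by (simp add: Q_def)
  have Qsum: "\<exists>p. Q (\<lambda>A. \<Sum>i\<in>I. f i A) p" if "\<And>i. i \<in> I \<Longrightarrow> \<exists>p. Q (f i) p" for I :: "('m \<Rightarrow> 'm) set" and f
    using that
  proof (induction I rule: infinite_finite_induct)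
    case (insert i I)
    obtain p where p: "Q (f i) p" using insert.prems by auto
    obtain q where "Q (\<lambda>A. \<Sum>i\<in>I. f i A) q" using insert.IH insert.prems by auto
    from Qadd[OF p this] show ?case using insert.hyps by auto
  qed (use Qconst[of 0] in auto)
  have Qprod: "\<exists>p. Q (\<lambda>A. \<Prod>i\<in>I. f i A) p" if "\<And>i. i \<in> I \<Longrightarrow> \<exists>p. Q (f i) p" for I :: "'m set" and f
    using that
  proof (induction I rule: infinite_finite_induct)
    case (insert i I)
    obtain p where p: "Q (f i) p" using insert.prems by auto
    obtain q where "Q (\<lambda>A. \<Prod>i\<in>I. f i A) q" using insert.IH insert.prems by auto
    from Qmult[OF p this] show ?case using insert.hyps by auto
  qed (use Qconst[of 1] in auto)
  have "\<exists>p. Q (\<lambda>A. \<Sum>p | p permutes (UNIV :: 'm set). of_int (sign p) * (\<Prod>i\<in>UNIV. A $ i $ p i)) p"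
  proof (rule Qsum)
    fix p
    have "\<exists>q. Q (\<lambda>A. \<Prod>i\<in>UNIV. A $ i $ p i) q" using Qentry by (intro Qprod) blast
    then obtain q where "Q (\<lambda>A. \<Prod>i\<in>UNIV. A $ i $ p i) q" ..
    from Qmult[OF Qconst this] show "\<exists>q. Q (\<lambda>A. of_int (sign p) * (\<Prod>i\<in>UNIV. A $ i $ p i)) q" by blast
  qed
  then obtain d where d: "Q det d" unfolding det_def[abs_def] by blast
  \<comment> \<open>The determinant along the curve is a polynomial without zeros, hence constant,
    and it is 1 at the parameter 0. So its inverse, the remaining generator of the regular
    functions, is polynomial along the curve as well.\<close>
  have "poly d s \<noteq> 0" for s
  proof -
    have "invertible (\<gamma> s)" using \<gamma> G by auto
    thus ?thesis using d invertible_det_nz[of "\<gamma> s"] by (simp add: Q_def)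
  qed
  hence "degree d = 0" using alg_closed_imp_poly_has_root by blast
  then obtain c where c: "d = [:c:]" by (meson degree_eq_zeroE)
  have "poly d 0 = 1" using d by (metis Q_def det_I one)
  hence "d = [:1:]" using c by simp
  hence Qdet: "Q (\<lambda>A. inverse (det A)) [:1:]" using d by (auto simp: Q_def)
  have Qex: "\<exists>p. Q f p" if "f \<in> gen_alg GL_coords" for f
    using that
  proof (induction rule: gen_alg.induct)
    case (const c)
    show ?case using Qconst[of c] by blast
  next
    case (gen f)
    thus ?case using Qentry Qdet unfolding GL_coords_def by blast
  next
    case (add f g)
    thus ?case using Qadd by blast
  next
    case (mult f g)
    thus ?case using Qmult by blast
  qed
  define q where "q f = (THE p. Q f p)" for f
  have q: "q f = p" if "Q f p" for f p unfolding q_def using that uniq by blast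
  have qQ: "Q f (q f)" if "f \<in> gen_alg GL_coords" for f using Qex[OF that] q by blast
  have q0: "coeff (q f) 0 = f (mat 1)" if "f \<in> gen_alg GL_coords" for f
    using qQ[OF that] one by (metis Q_def poly_0_coeff_0)
  define D where "D f = coeff (q f) k" for f
  have "point_derivation D"
    unfolding point_derivation_def
  proof (intro conjI allI ballI)
    show "D (\<lambda>_. c) = 0" for c using q[OF Qconst] k by (simp add: D_def coeff_pCons split: nat.splits)
    fix f g :: "'f ^'m ^'m \<Rightarrow> 'f" assume fg: "f \<in> gen_alg GL_coords" "g \<in> gen_alg GL_coords"
    show "D (\<lambda>A. f A + g A) = D f + D g"
      using q[OF Qadd[OF qQ[OF fg(1)] qQ[OF fg(2)]]] by (simp add: D_def)
    show "D (\<lambda>A. f A * g A) = f (mat 1) * D g + g (mat 1) * D f"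
      using q[OF Qmult[OF qQ[OF fg(1)] qQ[OF fg(2)]]] prodk[of "q f" "q g"] qQ[OF fg(1)] q0 fg
      by (simp add: D_def Q_def)
  qed
  moreover have "D f = 0" if "f \<in> gen_alg GL_coords" "\<forall>A\<in>G. f A = 0" for f
  proof -
    have "Q f 0" using that(2) \<gamma> by (simp add: Q_def)
    thus ?thesis using q by (simp add: D_def)
  qed
  moreover have "D (\<lambda>A. A $ i $ j) = (\<chi> i j. coeff (P i j) k) $ i $ j" for i j
    using q[OF Qentry] by (simp add: D_def)
  ultimately show ?thesis unfolding lie_algebra_def by blast
qed

section \<open>Tori\<close>

lemma GL_subgroup_facts:
  assumes "subgroup H (GL :: ('f::field ^'m ^'m) monoid)"
  shows "A \<in> H \<Longrightarrow> invertible A" "mat 1 \<in> H" "A \<in> H \<Longrightarrow> B \<in> H \<Longrightarrow> A ** B \<in> H"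
    "A \<in> H \<Longrightarrow> matrix_inv A \<in> H" "group (GL_on H)" "A \<in> H \<Longrightarrow> inv\<^bsub>GL_on H\<^esub> A = matrix_inv A"
proof -
  interpret H: subgroup H GL by fact
  show *: "invertible A" if "A \<in> H" for A using that H.subset by auto
  show "mat 1 \<in> H" "A \<in> H \<Longrightarrow> B \<in> H \<Longrightarrow> A ** B \<in> H" using H.one_closed H.m_closed by auto
  show "A \<in> H \<Longrightarrow> matrix_inv A \<in> H" using H.m_inv_closed inv_GL * by metis
  show "group (GL_on H)" by (rule H.subgroup_is_group[OF group_GL])
  show "A \<in> H \<Longrightarrow> inv\<^bsub>GL_on H\<^esub> A = matrix_inv A"
    using group.m_inv_consistent[OF group_GL assms] inv_GL * by metis
qed

lemma torus_subgroup: "torus T \<Longrightarrow> subgroup T GL"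
  by (simp add: torus_def algebraic_group_def)

lemma charactersD:
  assumes T: "subgroup T GL" and "\<xi> \<in> characters T"
  shows "s \<in> T \<Longrightarrow> t \<in> T \<Longrightarrow> \<xi> (s ** t) = \<xi> s * \<xi> t" "t \<in> T \<Longrightarrow> \<xi> t \<noteq> 0" "\<xi> (mat 1) = 1"
    "\<xi> \<in> extensional T" "t \<in> T \<Longrightarrow> \<xi> (matrix_inv t) = inverse (\<xi> t)"
proof -
  note H = GL_subgroup_facts[OF T]
  show *: "s \<in> T \<Longrightarrow> t \<in> T \<Longrightarrow> \<xi> (s ** t) = \<xi> s * \<xi> t" "t \<in> T \<Longrightarrow> \<xi> t \<noteq> 0" "\<xi> \<in> extensional T" for s t
    using assms by (auto simp: characters_def hom_def)
  have "\<xi> (mat 1 ** mat 1) = \<xi> (mat 1) * \<xi> (mat 1)" using *(1) H(2) by blast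
  thus one: "\<xi> (mat 1) = 1" using *(2)[OF H(2)] by simp
  show "\<xi> (matrix_inv t) = inverse (\<xi> t)" if "t \<in> T"
    using *(1)[OF that H(4)[OF that]] one *(2)[OF that] matrix_inv_ex[OF H(1)[OF that]]
    by (metis inverse_unique)
qed

lemma charactersI:
  assumes "\<And>s t. s \<in> T \<Longrightarrow> t \<in> T \<Longrightarrow> \<xi> (s ** t) = \<xi> s * \<xi> t" "\<And>t. t \<in> T \<Longrightarrow> \<xi> t \<noteq> 0"
    and "\<xi> \<in> extensional T" "regular_fun GL_coords T \<xi>" "regular_fun GL_coords T (\<lambda>t. inverse (\<xi> t))"
  shows "\<xi> \<in> characters T"
  using assms by (auto simp: characters_def hom_def regular_map_iff Gm_coords_def)

lemma character_regular:
  assumes "\<xi> \<in> characters T"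
  shows "regular_fun GL_coords T \<xi>" "regular_fun GL_coords T (\<lambda>t. inverse (\<xi> t))"
  using assms by (auto simp: characters_def regular_map_iff Gm_coords_def)

lemma regular_fun_restrict [simp]:
  "regular_fun C X (restrict f X) = regular_fun C X f"
  "regular_fun C X (\<lambda>x. inverse (if x \<in> X then f x else c)) = regular_fun C X (\<lambda>x. inverse (f x))"
  by (auto intro!: regular_fun_cong)

lemma characters_one: "subgroup T GL \<Longrightarrow> (\<lambda>t\<in>T. 1) \<in> characters T"
  by (rule charactersI) (auto simp: GL_subgroup_facts regular_fun_const)

lemma characters_mult:
  assumes "subgroup T GL" "\<xi> \<in> characters T" "\<eta> \<in> characters T"
  shows "(\<lambda>t\<in>T. \<xi> t * \<eta> t) \<in> characters T"
proof (rule charactersI)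
  show "regular_fun GL_coords T (\<lambda>t\<in>T. \<xi> t * \<eta> t)"
    using regular_fun_mult[OF character_regular(1)[OF assms(2)] character_regular(1)[OF assms(3)]]
    by simp
  show "regular_fun GL_coords T (\<lambda>t. inverse ((\<lambda>t\<in>T. \<xi> t * \<eta> t) t))"
    using regular_fun_mult[OF character_regular(2)[OF assms(2)] character_regular(2)[OF assms(3)]]
    by simp
qed (use charactersD[OF assms(1,2)] charactersD[OF assms(1,3)] GL_subgroup_facts[OF assms(1)] in auto)

section \<open>Regular functions on a torus and weight decompositions\<close>

definition char_span :: "('f::field ^'m ^'m) set \<Rightarrow> ('f ^'m ^'m \<Rightarrow> 'f) \<Rightarrow> bool" where
  "char_span T f \<longleftrightarrow> (\<exists>Y c. finite Y \<and> Y \<subseteq> characters T \<and> (\<forall>t\<in>T. f t = (\<Sum>\<xi>\<in>Y. c \<xi> * \<xi> t)))"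

lemma char_span_cong: "char_span T f \<Longrightarrow> (\<And>t. t \<in> T \<Longrightarrow> f t = g t) \<Longrightarrow> char_span T g"
  unfolding char_span_def by auto

lemma char_span_single: "\<xi> \<in> characters T \<Longrightarrow> char_span T (\<lambda>t. c * \<xi> t)"
  unfolding char_span_def by (intro exI[of _ "{\<xi>}"] exI[of _ "\<lambda>_. c"]) auto

lemma char_span_zero: "char_span T (\<lambda>_. 0)"
  unfolding char_span_def by (intro exI[of _ "{}"]) auto

lemma char_span_add:
  assumes "char_span T f" "char_span T g"
  shows "char_span T (\<lambda>t. f t + g t)"
proof -
  obtain Y c where Y: "finite Y" "Y \<subseteq> characters T" "\<And>t. t \<in> T \<Longrightarrow> f t = (\<Sum>\<xi>\<in>Y. c \<xi> * \<xi> t)"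
    using assms(1) by (auto simp: char_span_def)
  obtain Z d where Z: "finite Z" "Z \<subseteq> characters T" "\<And>t. t \<in> T \<Longrightarrow> g t = (\<Sum>\<xi>\<in>Z. d \<xi> * \<xi> t)"
    using assms(2) by (auto simp: char_span_def)
  let ?c = "\<lambda>\<xi>. (if \<xi> \<in> Y then c \<xi> else 0) + (if \<xi> \<in> Z then d \<xi> else 0)"
  have "f t + g t = (\<Sum>\<xi>\<in>Y \<union> Z. ?c \<xi> * \<xi> t)" if "t \<in> T" for t
  proof -
    have "f t = (\<Sum>\<xi>\<in>Y \<union> Z. (if \<xi> \<in> Y then c \<xi> else 0) * \<xi> t)"
      unfolding Y(3)[OF that] using Y(1) Z(1) by (intro sum.mono_neutral_cong_left) auto
    moreover have "g t = (\<Sum>\<xi>\<in>Y \<union> Z. (if \<xi> \<in> Z then d \<xi> else 0) * \<xi> t)"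
      unfolding Z(3)[OF that] using Y(1) Z(1) by (intro sum.mono_neutral_cong_left) auto
    ultimately show ?thesis by (simp add: distrib_right sum.distrib)
  qed
  thus ?thesis unfolding char_span_def using Y Z by (intro exI[of _ "Y \<union> Z"] exI[of _ ?c]) auto
qed

lemma char_span_sum: "(\<And>i. i \<in> I \<Longrightarrow> char_span T (f i)) \<Longrightarrow> char_span T (\<lambda>t. \<Sum>i\<in>I. f i t)"
  by (induction I rule: infinite_finite_induct) (auto intro: char_span_zero char_span_add)

lemma char_span_mult:
  assumes T: "subgroup T GL" and "char_span T f" "char_span T g"
  shows "char_span T (\<lambda>t. f t * g t)"
proof -
  obtain Y c where Y: "finite Y" "Y \<subseteq> characters T" "\<And>t. t \<in> T \<Longrightarrow> f t = (\<Sum>\<xi>\<in>Y. c \<xi> * \<xi> t)"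
    using assms(2) by (auto simp: char_span_def)
  obtain Z d where Z: "finite Z" "Z \<subseteq> characters T" "\<And>t. t \<in> T \<Longrightarrow> g t = (\<Sum>\<xi>\<in>Z. d \<xi> * \<xi> t)"
    using assms(3) by (auto simp: char_span_def)
  have "char_span T (\<lambda>t. \<Sum>\<xi>\<in>Y. \<Sum>\<eta>\<in>Z. (c \<xi> * d \<eta>) * (\<lambda>t\<in>T. \<xi> t * \<eta> t) t)"
    using Y(2) Z(2) by (intro char_span_sum char_span_single characters_mult[OF T]) auto
  thus ?thesis
    by (rule char_span_cong) (simp add: Y(3) Z(3) sum_product mult_ac)
qed

lemma Gm_pow_simps:
  "carrier (Gm_pow r) = {x. (\<forall>i<r. x i \<noteq> 0) \<and> (\<forall>i\<ge>r. x i = 1)}"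
  "mult (Gm_pow r) x y i = x i * y i" "one (Gm_pow r) i = 1"
  by (simp_all add: Gm_pow_def)

locale split_torus =
  fixes T :: "('f::alg_closed_field ^'m ^'m) set" and r :: nat
    and \<phi> :: "(nat \<Rightarrow> 'f) \<Rightarrow> 'f ^'m ^'m" and \<psi> :: "'f ^'m ^'m \<Rightarrow> nat \<Rightarrow> 'f"
  assumes T: "subgroup T GL"
    and \<phi>_in: "x \<in> carrier (Gm_pow r) \<Longrightarrow> \<phi> x \<in> T"
    and \<psi>_in: "t \<in> T \<Longrightarrow> \<psi> t \<in> carrier (Gm_pow r)"
    and \<phi>\<psi>: "t \<in> T \<Longrightarrow> \<phi> (\<psi> t) = t"
    and \<psi>\<phi>: "x \<in> carrier (Gm_pow r) \<Longrightarrow> \<psi> (\<phi> x) = x"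
    and \<phi>_mult: "x \<in> carrier (Gm_pow r) \<Longrightarrow> y \<in> carrier (Gm_pow r) \<Longrightarrow> \<phi> (\<lambda>i. x i * y i) = \<phi> x ** \<phi> y"
    and \<phi>_regular: "regular_map (Gm_pow_coords r) (carrier (Gm_pow r)) GL_coords \<phi>"
    and \<psi>_regular: "regular_map GL_coords T (Gm_pow_coords r) \<psi>"

lemma torus_split:
  assumes "torus T"
  obtains r \<phi> \<psi> where "split_torus T r \<phi> \<psi>"
proof -
  obtain r \<phi> where iso: "alg_group_iso (Gm_pow r) (Gm_pow_coords r) (GL_on T) GL_coords \<phi>"
    using assms by (auto simp: torus_def)
  define \<psi> where "\<psi> = inv_into (carrier (Gm_pow r)) \<phi>"
  have h: "\<phi> \<in> hom (Gm_pow r) (GL_on T)" and b: "bij_betw \<phi> (carrier (Gm_pow r)) T"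
    using iso by (auto simp: alg_group_iso_def iso_def)
  have "split_torus T r \<phi> \<psi>"
  proof (rule split_torus.intro)
    show "subgroup T GL" using assms torus_subgroup by blast
    show "\<phi> x \<in> T" if "x \<in> carrier (Gm_pow r)" for x using b that by (auto simp: bij_betw_def)
    show "\<psi> t \<in> carrier (Gm_pow r)" if "t \<in> T" for t
      unfolding \<psi>_def using b that by (intro inv_into_into) (auto simp: bij_betw_def)
    show "\<phi> (\<psi> t) = t" if "t \<in> T" for t
      unfolding \<psi>_def using b that by (intro f_inv_into_f) (auto simp: bij_betw_def)
    show "\<psi> (\<phi> x) = x" if "x \<in> carrier (Gm_pow r)" for x
      unfolding \<psi>_def using b that by (intro inv_into_f_f) (auto simp: bij_betw_def)
    show "\<phi> (\<lambda>i. x i * y i) = \<phi> x ** \<phi> y" if "x \<in> carrier (Gm_pow r)" "y \<in> carrier (Gm_pow r)" for x y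
      using hom_mult[OF h that] by (simp add: Gm_pow_def)
    show "regular_map (Gm_pow_coords r) (carrier (Gm_pow r)) GL_coords \<phi>"
      "regular_map GL_coords T (Gm_pow_coords r) \<psi>"
      using iso by (auto simp: alg_group_iso_def \<psi>_def)
  qed
  thus ?thesis using that by blast
qed

context split_torus
begin

lemmas TH = GL_subgroup_facts[OF T]

lemma \<psi>_mult: "s \<in> T \<Longrightarrow> t \<in> T \<Longrightarrow> \<psi> (s ** t) i = \<psi> s i * \<psi> t i"
proof -
  assume st: "s \<in> T" "t \<in> T"
  have "(\<lambda>i. \<psi> s i * \<psi> t i) \<in> carrier (Gm_pow r)"
    using \<psi>_in[OF st(1)] \<psi>_in[OF st(2)] by (auto simp: Gm_pow_simps)
  moreover have "\<phi> (\<lambda>i. \<psi> s i * \<psi> t i) = s ** t"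
    using \<phi>_mult[OF \<psi>_in[OF st(1)] \<psi>_in[OF st(2)]] \<phi>\<psi> st by simp
  ultimately show ?thesis using \<psi>\<phi> by metis
qed

lemma T_commute: "s \<in> T \<Longrightarrow> t \<in> T \<Longrightarrow> s ** t = t ** s"
  using \<phi>_mult[OF \<psi>_in \<psi>_in, of s t] \<phi>_mult[OF \<psi>_in \<psi>_in, of t s] by (simp add: \<phi>\<psi> mult.commute)

lemma \<psi>_nz: "t \<in> T \<Longrightarrow> \<psi> t i \<noteq> 0"
  using \<psi>_in[of t] by (cases "i < r") (auto simp: Gm_pow_simps)

lemma coord_regular:
  assumes "i < r"
  shows "regular_fun GL_coords T (\<lambda>t. \<psi> t i)" "regular_fun GL_coords T (\<lambda>t. inverse (\<psi> t i))"
proof -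
  have "(\<lambda>x. x i) \<in> Gm_pow_coords r" "(\<lambda>x. inverse (x i)) \<in> Gm_pow_coords r"
    using assms by (auto simp: Gm_pow_coords_def)
  thus "regular_fun GL_coords T (\<lambda>t. \<psi> t i)" "regular_fun GL_coords T (\<lambda>t. inverse (\<psi> t i))"
    using \<psi>_regular by (fastforce simp: regular_map_iff)+
qed

lemma coord_characters:
  assumes "i < r"
  shows "(\<lambda>t\<in>T. \<psi> t i) \<in> characters T" "(\<lambda>t\<in>T. inverse (\<psi> t i)) \<in> characters T"
proof -
  show "(\<lambda>t\<in>T. \<psi> t i) \<in> characters T"
    by (rule charactersI) (use coord_regular[OF assms] TH(3) \<psi>_mult \<psi>_nz in auto)
  show "(\<lambda>t\<in>T. inverse (\<psi> t i)) \<in> characters T"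
    by (rule charactersI) (use coord_regular[OF assms] TH(3) \<psi>_mult \<psi>_nz in auto)
qed

lemma gen_alg_char_span: "g \<in> gen_alg (Gm_pow_coords r) \<Longrightarrow> char_span T (\<lambda>t. g (\<psi> t))"
proof (induction rule: gen_alg.induct)
  case (const c)
  show ?case using char_span_single[OF characters_one[OF T], of c] by (rule char_span_cong) simp
next
  case (gen f)
  then consider i where "i < r" "f = (\<lambda>x. x i)" | i where "i < r" "f = (\<lambda>x. inverse (x i))"
    by (auto simp: Gm_pow_coords_def)
  thus ?case
  proof cases
    case 1
    show ?thesis using char_span_single[OF coord_characters(1)[OF 1(1)], of 1]
      by (rule char_span_cong) (simp add: 1)
  next
    case 2
    show ?thesis using char_span_single[OF coord_characters(2)[OF 2(1)], of 1]
      by (rule char_span_cong) (simp add: 2)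
  qed
qed (auto intro: char_span_add char_span_mult[OF T])

text \<open>Through the isomorphism with a power of G_m, a regular function on T becomes a
  polynomial in the coordinates and their inverses, and each monomial is a character.\<close>

lemma regular_char_span:
  assumes "regular_fun GL_coords T f"
  shows "char_span T f"
proof -
  have "regular_fun (Gm_pow_coords r) (carrier (Gm_pow r)) (\<lambda>x. f (\<phi> x))"
    using \<phi>_in by (intro regular_fun_comp[OF \<phi>_regular _ assms]) auto
  then obtain g where g: "g \<in> gen_alg (Gm_pow_coords r)" "\<forall>x\<in>carrier (Gm_pow r). f (\<phi> x) = g x"
    by (auto simp: regular_fun_def)
  show ?thesis using gen_alg_char_span[OF g(1)]
    by (rule char_span_cong) (metis \<psi>_in \<phi>\<psi> g(2))
qed

lemma T_zero_sum:
  fixes N :: "('f ^'m ^'m \<Rightarrow> 'f) \<Rightarrow> 'f ^'m ^'m"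
  assumes "finite Y" "Y \<subseteq> characters T" "is_subspace L"
    and "\<And>t. t \<in> T \<Longrightarrow> (\<Sum>\<xi>\<in>Y. scale_mat (\<xi> t) (N \<xi>)) \<in> L" "\<xi> \<in> Y"
  shows "N \<xi> \<in> L"
proof (rule char_sum_subspace[OF assms(1,3) TH(2), where ch = "\<lambda>\<xi>. \<xi>" and op = "(**)"])
  show "\<exists>t\<in>T. i t \<noteq> j t" if "i \<in> Y" "j \<in> Y" "i \<noteq> j" for i j
    using that assms(2) charactersD(4)[OF T, of i] charactersD(4)[OF T, of j] extensionalityI by blast
qed (use assms charactersD[OF T] TH in auto)

text \<open>The entries of t M t^-1 are regular functions of t, hence combinations of characters,
  and \<open>N \<xi>\<close> collects the coefficients of \<xi>. That \<open>N \<xi>\<close> has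
  weight \<xi> follows by comparing the expansions at s t with the conjugate by s of the expansion
  at t, using independence.\<close>

lemma conj_weights:
  fixes M :: "'f ^'m ^'m"
  obtains Y N where "finite Y" "Y \<subseteq> characters T"
    "\<And>t. t \<in> T \<Longrightarrow> t ** M ** matrix_inv t = (\<Sum>\<xi>\<in>Y. scale_mat (\<xi> t) (N \<xi>))"
    "\<And>\<xi> t. \<xi> \<in> Y \<Longrightarrow> t \<in> T \<Longrightarrow> t ** N \<xi> ** matrix_inv t = scale_mat (\<xi> t) (N \<xi>)"
proof -
  have "char_span T (\<lambda>t. (t ** M ** matrix_inv t) $ i $ j)" for i j
  proof (rule regular_char_span)
    have "regular_fun GL_coords T (\<lambda>t. \<Sum>l\<in>UNIV. (\<Sum>k\<in>UNIV. t $ i $ k * M $ k $ l) * matrix_inv t $ l $ j)"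
      using TH by (intro regular_fun_sum regular_fun_mult regular_fun_const
        regular_map_GL_entry[OF regular_map_GL_inv[OF regular_map_id]] regular_map_GL_entry[OF regular_map_id]) auto
    thus "regular_fun GL_coords T (\<lambda>t. (t ** M ** matrix_inv t) $ i $ j)"
      by (simp add: matrix_mult_nth)
  qed
  define good where "good i j Yc \<longleftrightarrow> finite (fst Yc) \<and> fst Yc \<subseteq> characters T \<and>
    (\<forall>t\<in>T. (t ** M ** matrix_inv t) $ i $ j = (\<Sum>\<xi>\<in>fst Yc. snd Yc \<xi> * \<xi> t))" for i j Yc
  have "\<exists>Yc. good i j Yc" for i j
    using \<open>char_span T (\<lambda>t. (t ** M ** matrix_inv t) $ i $ j)\<close> by (auto simp: good_def char_span_def)
  then obtain F where F: "\<And>i j. good i j (F i j)" by metis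
  define Y c where "Y i j = fst (F i j)" and "c i j = snd (F i j)" for i j
  have Y: "finite (Y i j)" "Y i j \<subseteq> characters T"
    "\<And>t. t \<in> T \<Longrightarrow> (t ** M ** matrix_inv t) $ i $ j = (\<Sum>\<xi>\<in>Y i j. c i j \<xi> * \<xi> t)" for i j
    using F[of i j] by (auto simp: good_def Y_def c_def)
  define Z where "Z = (\<Union>i. \<Union>j. Y i j)"
  define N where "N \<xi> = (\<chi> i j. if \<xi> \<in> Y i j then c i j \<xi> else 0)" for \<xi>
  have Z: "finite Z" "Z \<subseteq> characters T" using Y(1,2) unfolding Z_def by (simp, blast)
  have N: "t ** M ** matrix_inv t = (\<Sum>\<xi>\<in>Z. scale_mat (\<xi> t) (N \<xi>))" if "t \<in> T" for t
  proof -
    have "(t ** M ** matrix_inv t) $ i $ j = (\<Sum>\<xi>\<in>Z. scale_mat (\<xi> t) (N \<xi>)) $ i $ j" for i j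
      unfolding Y(3)[OF that] sum_component using Z
      by (intro sum.mono_neutral_cong_left) (auto simp: Z_def N_def mult.commute)
    thus ?thesis by (simp add: vec_eq_iff)
  qed
  have "s ** N \<xi> ** matrix_inv s = scale_mat (\<xi> s) (N \<xi>)" if "\<xi> \<in> Z" "s \<in> T" for \<xi> s
  proof -
    have "s ** N \<xi> ** matrix_inv s - scale_mat (\<xi> s) (N \<xi>) \<in> {0}"
    proof (rule T_zero_sum[OF Z is_subspace_zero, where N = "\<lambda>\<xi>. s ** N \<xi> ** matrix_inv s - scale_mat (\<xi> s) (N \<xi>)"])
      fix t assume t: "t \<in> T"
      have "(\<Sum>\<xi>\<in>Z. scale_mat (\<xi> t) (s ** N \<xi> ** matrix_inv s)) = s ** (t ** M ** matrix_inv t) ** matrix_inv s"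
        unfolding N[OF t] by (simp add: matrix_sum_mult scale_mat_mult)
      also have "\<dots> = (s ** t) ** M ** matrix_inv (s ** t)"
        using TH that t by (simp add: matrix_inv_mult matrix_mul_assoc)
      also have "\<dots> = (\<Sum>\<xi>\<in>Z. scale_mat (\<xi> t) (scale_mat (\<xi> s) (N \<xi>)))"
        unfolding N[OF TH(3)[OF that(2) t]]
        using Z(2) charactersD(1)[OF T] that t by (intro sum.cong) (auto simp: mult.commute subset_iff)
      finally have "(\<Sum>\<xi>\<in>Z. scale_mat (\<xi> t) (s ** N \<xi> ** matrix_inv s)) -
          (\<Sum>\<xi>\<in>Z. scale_mat (\<xi> t) (scale_mat (\<xi> s) (N \<xi>))) = 0" by simp
      thus "(\<Sum>\<xi>\<in>Z. scale_mat (\<xi> t) (s ** N \<xi> ** matrix_inv s - scale_mat (\<xi> s) (N \<xi>))) \<in> {0}"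
        by (simp add: vec_eq_iff sum_subtractf right_diff_distrib mult.assoc)
    qed (rule that)
    thus ?thesis by simp
  qed
  thus ?thesis using that Z N by blast
qed

text \<open>The weight components lie in the Lie algebra because all t M t^-1 do, by independence of
  characters modulo this subspace.\<close>

lemma lie_algebra_weights:
  assumes G: "subgroup G GL" "T \<subseteq> G" and M: "M \<in> lie_algebra G"
  obtains Y N where "finite Y" "Y \<subseteq> characters T" "M = (\<Sum>\<xi>\<in>Y. N \<xi>)"
    "\<And>\<xi>. \<xi> \<in> Y \<Longrightarrow> N \<xi> \<in> lie_algebra G"
    "\<And>\<xi> t. \<xi> \<in> Y \<Longrightarrow> t \<in> T \<Longrightarrow> t ** N \<xi> ** matrix_inv t = scale_mat (\<xi> t) (N \<xi>)"
proof -
  obtain Y N where Y: "finite Y" "Y \<subseteq> characters T"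
    "\<And>t. t \<in> T \<Longrightarrow> t ** M ** matrix_inv t = (\<Sum>\<xi>\<in>Y. scale_mat (\<xi> t) (N \<xi>))"
    "\<And>\<xi> t. \<xi> \<in> Y \<Longrightarrow> t \<in> T \<Longrightarrow> t ** N \<xi> ** matrix_inv t = scale_mat (\<xi> t) (N \<xi>)"
    by (rule conj_weights[where M = M]) blast
  have "N \<xi> \<in> lie_algebra G" if "\<xi> \<in> Y" for \<xi>
  proof (rule T_zero_sum[OF Y(1,2) lie_algebra_subspace _ that])
    fix t assume t: "t \<in> T"
    hence tG: "t \<in> G" using G(2) by auto
    show "(\<Sum>\<xi>\<in>Y. scale_mat (\<xi> t) (N \<xi>)) \<in> lie_algebra G"
      using lie_algebra_Ad[OF G(1) tG M] Y(3)[OF t] by simp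
  qed
  moreover have "M = (\<Sum>\<xi>\<in>Y. N \<xi>)"
  proof -
    have "M = (\<Sum>\<xi>\<in>Y. scale_mat (\<xi> (mat 1)) (N \<xi>))" using Y(3)[OF TH(2)] by simp
    also have "\<dots> = (\<Sum>\<xi>\<in>Y. N \<xi>)" 
    proof (rule sum.cong[OF refl])
      fix \<xi> assume "\<xi> \<in> Y"
      hence "\<xi> (mat 1) = 1" using Y(2) charactersD(3)[OF T] by blast
      thus "scale_mat (\<xi> (mat 1)) (N \<xi>) = N \<xi>" by simp
    qed
    finally show ?thesis .
  qed
  ultimately show ?thesis using that[of Y N] Y(1,2,4) by blast
qed

lemma weight_is_root:
  assumes "\<xi> \<in> characters T" "t \<in> T" "\<xi> t \<noteq> 1" "N \<in> lie_algebra G" "N \<noteq> 0"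
    "\<And>t. t \<in> T \<Longrightarrow> t ** N ** matrix_inv t = scale_mat (\<xi> t) N"
  shows "\<xi> \<in> roots G T"
  using assms by (auto simp: roots_def root_space_def scale_mat_def)

text \<open>A nonzero weight component whose weight is nontrivial at z would be a root vector, and z
  is killed by all roots; so z fixes every weight component.\<close>

lemma root_kernel_Ad:
  assumes G: "subgroup G GL" "T \<subseteq> G" and M: "M \<in> lie_algebra G"
    and z: "z \<in> T" "\<And>\<xi>. \<xi> \<in> roots G T \<Longrightarrow> \<xi> z = 1"
  shows "z ** M ** matrix_inv z = M"
proof -
  obtain Y N where Y: "finite Y" "Y \<subseteq> characters T" "M = (\<Sum>\<xi>\<in>Y. N \<xi>)"
    "\<And>\<xi>. \<xi> \<in> Y \<Longrightarrow> N \<xi> \<in> lie_algebra G"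
    "\<And>\<xi> t. \<xi> \<in> Y \<Longrightarrow> t \<in> T \<Longrightarrow> t ** N \<xi> ** matrix_inv t = scale_mat (\<xi> t) (N \<xi>)"
    by (rule lie_algebra_weights[OF G M]) blast
  have "z ** N \<xi> ** matrix_inv z = N \<xi>" if \<xi>: "\<xi> \<in> Y" for \<xi>
  proof (cases "N \<xi> = 0 \<or> \<xi> z = 1")
    case True
    thus ?thesis using Y(5)[OF \<xi> z(1)] by auto
  next
    case False
    hence "\<xi> \<in> roots G T" using weight_is_root[of \<xi> z "N \<xi>"] Y \<xi> z(1) by blast
    thus ?thesis using z(2) False by blast
  qed
  thus ?thesis unfolding Y(3) by (simp add: matrix_sum_mult)
qed

end

section \<open>Normal closures\<close>

text \<open>For a multiplicative \<kappa> with values in G this is the abstract normal subgroup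
  generated by these values; inverses are covered because the inverse of \<kappa> x is a value of
  \<kappa>.\<close>

inductive_set conj_words :: "('f::field ^'m ^'m) set \<Rightarrow> ('f \<Rightarrow> 'f ^'m ^'m) \<Rightarrow> ('f ^'m ^'m) set"
  for G \<kappa> where
  one: "mat 1 \<in> conj_words G \<kappa>"
| step: "h \<in> conj_words G \<kappa> \<Longrightarrow> g \<in> G \<Longrightarrow> x \<noteq> 0 \<Longrightarrow> h ** (g ** \<kappa> x ** matrix_inv g) \<in> conj_words G \<kappa>"

locale one_parameter_subgroup =
  fixes G :: "('f::alg_closed_field ^'m ^'m) set" and \<kappa> :: "'f \<Rightarrow> 'f ^'m ^'m"
  assumes G: "subgroup G GL"
    and \<kappa>_in: "x \<noteq> 0 \<Longrightarrow> \<kappa> x \<in> G"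
    and \<kappa>_mult: "x \<noteq> 0 \<Longrightarrow> y \<noteq> 0 \<Longrightarrow> \<kappa> (x * y) = \<kappa> x ** \<kappa> y"
    and \<kappa>_regular: "regular_map Gm_coords (UNIV - {0}) GL_coords \<kappa>"
begin

lemmas GH = GL_subgroup_facts[OF G]

abbreviation "W \<equiv> conj_words G \<kappa>"

lemma \<kappa>_one: "\<kappa> 1 = mat 1"
proof -
  have "\<kappa> 1 ** \<kappa> 1 = \<kappa> 1" using \<kappa>_mult[of 1 1] by simp
  moreover have i: "invertible (\<kappa> 1)" using GH(1)[OF \<kappa>_in[of 1]] by simp
  ultimately show ?thesis by (metis mult_inv_cancel(1)[OF i] matrix_inv_ex(2)[OF i])
qed

lemma \<kappa>_inv: "x \<noteq> 0 \<Longrightarrow> matrix_inv (\<kappa> x) = \<kappa> (inverse x)"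
  using \<kappa>_mult[of x "inverse x"] \<kappa>_one by (intro matrix_inv_eq) simp

lemma words_in: "h \<in> W \<Longrightarrow> h \<in> G"
  by (induction rule: conj_words.induct) (use GH \<kappa>_in in auto)

lemma words_mult:
  assumes "h \<in> W" "k \<in> W"
  shows "h ** k \<in> W"
  using assms(2)
proof (induction rule: conj_words.induct)
  case (step k g x)
  show ?case using conj_words.step[OF step.IH step.hyps(2,3)] by (simp add: matrix_mul_assoc)
qed (simp add: assms(1))

lemma words_gen: "g \<in> G \<Longrightarrow> x \<noteq> 0 \<Longrightarrow> g ** \<kappa> x ** matrix_inv g \<in> W"
  using conj_words.step[OF conj_words.one] by fastforce

lemma words_inv: "h \<in> W \<Longrightarrow> matrix_inv h \<in> W"
proof (induction rule: conj_words.induct)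
  case one
  show ?case by (simp add: conj_words.one)
next
  case (step h g x)
  have "matrix_inv (h ** (g ** \<kappa> x ** matrix_inv g)) = (g ** \<kappa> (inverse x) ** matrix_inv g) ** matrix_inv h"
    using GH(1)[OF words_in[OF step.hyps(1)]] GH(1)[OF step.hyps(2)] GH(1)[OF \<kappa>_in[OF step.hyps(3)]]
    by (simp add: matrix_inv_mult invertible_mult invertible_matrix_inv matrix_inv_inv
        \<kappa>_inv[OF step.hyps(3)] matrix_mul_assoc)
  thus ?case using words_mult words_gen step by simp
qed

lemma words_conj:
  assumes "h \<in> W" "k \<in> G"
  shows "k ** h ** matrix_inv k \<in> W"
  using assms(1)
proof (induction rule: conj_words.induct)
  case one
  show ?case using GH(1)[OF assms(2)] by (simp add: matrix_inv_ex conj_words.one)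
next
  case (step h g x)
  have i: "invertible k" "invertible g" using GH step assms by auto
  have "k ** (h ** (g ** \<kappa> x ** matrix_inv g)) ** matrix_inv k =
      (k ** h ** matrix_inv k) ** ((k ** g) ** \<kappa> x ** matrix_inv (k ** g))"
    by (simp add: matrix_inv_mult i matrix_mul_assoc)
  thus ?case using conj_words.step[OF step.IH GH(3)[OF assms(2) step.hyps(2)] step.hyps(3)] by simp
qed

lemma words_subgroup: "subgroup W GL"
proof (rule group.subgroupI[OF group_GL])
  show "W \<noteq> {}" using conj_words.one by blast
  show "W \<subseteq> carrier GL" using words_in GH by auto
qed (use words_in GH words_inv words_mult in \<open>auto simp: inv_GL\<close>)

definition nclosure :: "('f ^'m ^'m) set" where "nclosure = zclosure W"

lemma W_inv: "W \<subseteq> {A. invertible A}"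
  using words_in GH by auto

lemma \<kappa>_nclosure: "x \<noteq> 0 \<Longrightarrow> \<kappa> x \<in> nclosure"
  using words_gen[OF GH(2), of x] zclosure_subset[OF W_inv] by (auto simp: nclosure_def)

lemma nclosure_minimal: "zariski_closed K \<Longrightarrow> W \<subseteq> K \<Longrightarrow> nclosure \<subseteq> K"
  unfolding nclosure_def by (rule zclosure_minimal)

lemma nclosure_normal:
  assumes "zariski_closed G"
  shows "nclosure \<lhd> GL_on G"
proof (rule group.normal_invI[OF GH(5)])
  have sub: "nclosure \<subseteq> G" using assms words_in by (intro nclosure_minimal) auto
  show "subgroup nclosure (GL_on G)"
    using group.subgroup_incl[OF group_GL _ G sub] zclosure_subgroup[OF words_subgroup]
    by (simp add: nclosure_def)
  fix x h assume x: "x \<in> carrier (GL_on G)" and h: "h \<in> nclosure"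
  have "x ** h ** matrix_inv x \<in> nclosure"
    unfolding nclosure_def
  proof (rule zclosure_lr[OF _ _ W_inv])
    show "x ** A ** matrix_inv x \<in> zclosure W" if "A \<in> W" for A
      using words_conj[OF that] x zclosure_subset[OF W_inv] by auto
  qed (use x h GH invertible_matrix_inv in \<open>auto simp: nclosure_def\<close>)
  thus "x \<otimes>\<^bsub>GL_on G\<^esub> h \<otimes>\<^bsub>GL_on G\<^esub> inv\<^bsub>GL_on G\<^esub> x \<in> nclosure" using GH x by simp
qed

text \<open>Each word is joined to the identity by images of the (irreducible) multiplicative group.\<close>

lemma nclosure_connected: "zariski_connected nclosure"
  unfolding zariski_connected_def
proof
  assume "\<exists>A B. zariski_closed A \<and> zariski_closed B \<and> A \<noteq> {} \<and> B \<noteq> {} \<and> A \<inter> B = {} \<and> A \<union> B = nclosure"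
  then obtain A B where AB: "zariski_closed A" "zariski_closed B" "A \<noteq> {}" "B \<noteq> {}" "A \<inter> B = {}" "A \<union> B = nclosure"
    by blast
  \<comment> \<open>By symmetry it suffices to consider the piece containing the identity: it will
    contain every word, hence the closure, leaving the other piece empty.\<close>
  have *: "nclosure \<subseteq> A" if A: "zariski_closed A" and B: "zariski_closed B" and one: "mat 1 \<in> A"
    and dis: "A \<inter> B = {}" and un: "A \<union> B = nclosure" for A B
  proof (rule nclosure_minimal[OF A])
    obtain P where P: "P \<subseteq> gen_alg GL_coords" "A = {M \<in> carrier GL. \<forall>f\<in>P. f M = 0}"
      using A by (auto simp: zariski_closed_def)
    obtain Q where Q: "Q \<subseteq> gen_alg GL_coords" "B = {M \<in> carrier GL. \<forall>f\<in>Q. f M = 0}"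
      using B by (auto simp: zariski_closed_def)
    have "h \<in> A" if "h \<in> W" for h
      using that
    proof (induction rule: conj_words.induct)
      case one
      show ?case by fact
    next
      case (step h g x)
      define c where "c x = h ** (g ** \<kappa> x ** matrix_inv g)" for x
      have cW: "c y \<in> W" if "y \<noteq> 0" for y unfolding c_def by (rule conj_words.step) (use step that in auto)
      have cn: "c y \<in> A \<union> B" if "y \<noteq> 0" for y using cW[OF that] un zclosure_subset[OF W_inv] by (auto simp: nclosure_def)
      have inv: "invertible (c y)" if "y \<noteq> 0" for y using cW[OF that] W_inv by auto
      have c1: "c 1 \<in> A" using step.IH GH(1)[OF step.hyps(2)] by (simp add: c_def \<kappa>_one matrix_inv_ex)
      have r: "regular_map Gm_coords (UNIV - {0}) GL_coords c"
        unfolding c_def by (intro regular_map_GL_mult regular_map_const \<kappa>_regular)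
      have "c x \<in> A"
      proof (rule ccontr)
        assume "c x \<notin> A"
        then obtain f where f: "f \<in> P" "f (c x) \<noteq> 0" using inv[OF step.hyps(3)] P(2) by auto
        have "c 1 \<notin> B" using c1 dis by auto
        then obtain q where q: "q \<in> Q" "q (c 1) \<noteq> 0" using inv[of 1] Q(2) by auto
        \<comment> \<open>Every point of the curve c lies in A or in B, so the product of f and q
          vanishes along it. By irreducibility one factor vanishes identically, contrary to f at x
          or to q at 1.\<close>
        have "(\<forall>x. x \<noteq> 0 \<longrightarrow> f (c x) = 0) \<or> (\<forall>x. x \<noteq> 0 \<longrightarrow> q (c x) = 0)"
        proof (rule regular_fun_Gm_domain)
          show "regular_fun Gm_coords (UNIV - {0}) (\<lambda>x. f (c x))"
            "regular_fun Gm_coords (UNIV - {0}) (\<lambda>x. q (c x))"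
            using regular_map_fun[OF r] P(1) Q(1) f q by auto
          fix y :: 'f assume "y \<noteq> 0"
          thus "f (c y) * q (c y) = 0" using cn[of y] P(2) Q(2) f(1) q(1) by auto
        qed
        thus False using f q step.hyps(3) by auto
      qed
      thus ?case by (simp add: c_def)
    qed
    thus "W \<subseteq> A" by blast
  qed
  have "mat 1 \<in> A \<union> B" using AB(6) \<kappa>_nclosure[of 1] \<kappa>_one by simp
  thus False using *[of A B] *[of B A] AB by blast
qed

text \<open>The elements of GL centralizing the Lie algebra form a closed set K, which contains all
  conjugates of values of \<kappa>, hence their closed normal closure. By almost-simplicity this
  closure is trivial or G, and it is not G because g acts nontrivially on the Lie algebra.\<close>

lemma almost_simple_trivial:
  assumes "almost_simple G" "zariski_closed G"
    and Ad: "\<And>x M. x \<noteq> 0 \<Longrightarrow> M \<in> lie_algebra G \<Longrightarrow> \<kappa> x ** M ** matrix_inv (\<kappa> x) = M"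
    and nontriv: "g \<in> G" "M \<in> lie_algebra G" "g ** M ** matrix_inv g \<noteq> M" and x: "x \<noteq> 0"
  shows "\<kappa> x = mat 1"
proof -
  define K where "K = {A :: 'f ^'m ^'m. invertible A \<and> (\<forall>M\<in>lie_algebra G. A ** M = M ** A)}"
  have K: "zariski_closed K"
  proof -
    define F where "F i j M A = (\<Sum>k\<in>UNIV. A $ i $ k * M $ k $ j) + (- 1) * (\<Sum>k\<in>UNIV. M $ i $ k * A $ k $ j)"
      for i j and M A :: "'f ^'m ^'m"
    define P where "P = {F i j M | i j M. M \<in> lie_algebra G}"
    have "F i j M \<in> gen_alg GL_coords" for i j M
      unfolding F_def[abs_def]
      by (intro gen_alg.add gen_alg.mult gen_alg_sum gen_alg.const gen_alg.gen GL_coords_entry)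
    hence "P \<subseteq> gen_alg GL_coords" unfolding P_def by blast
    moreover have "K = {A \<in> carrier GL. \<forall>f\<in>P. f A = 0}"
    proof -
      have "(\<forall>f\<in>P. f A = 0) \<longleftrightarrow> (\<forall>M\<in>lie_algebra G. \<forall>i j. F i j M A = 0)" for A
        unfolding P_def by blast
      moreover have "(\<forall>i j. F i j M A = 0) \<longleftrightarrow> A ** M = M ** A" for M A
        by (simp add: F_def vec_eq_iff matrix_mult_nth)
      ultimately show ?thesis by (simp add: K_def)
    qed
    ultimately show ?thesis unfolding zariski_closed_def by blast
  qed
  have comm: "A ** M = M ** A \<longleftrightarrow> A ** M ** matrix_inv A = M" if "invertible A" for A M :: "'f ^'m ^'m"
    using mult_inv_cancel[OF that] by metis
  have "W \<subseteq> K"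
  proof
    fix h assume "h \<in> W"
    thus "h \<in> K"
    proof (induction rule: conj_words.induct)
      case one
      show ?case by (simp add: K_def)
    next
      case (step h g x)
      have i: "invertible h" "invertible g" "invertible (\<kappa> x)" using GH step words_in \<kappa>_in by auto
      define c where "c = g ** \<kappa> x ** matrix_inv g"
      have ic: "invertible c" using i by (simp add: c_def invertible_mult invertible_matrix_inv)
      have "c ** M = M ** c" if M: "M \<in> lie_algebra G" for M
      proof -
        \<comment> \<open>A conjugate of \<kappa> x centralizes M exactly when \<kappa> x
          centralizes the correspondingly conjugated matrix, which again lies in the Lie
          algebra.\<close>
        define M' where "M' = matrix_inv g ** M ** g"
        have "M' \<in> lie_algebra G" 
          using lie_algebra_Ad[OF G GH(4)[OF step.hyps(2)] M] i by (simp add: M'_def matrix_inv_inv)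
        hence "\<kappa> x ** M' = M' ** \<kappa> x" using Ad[OF step.hyps(3)] comm i by blast
        hence "g ** (\<kappa> x ** M') ** matrix_inv g = g ** (M' ** \<kappa> x) ** matrix_inv g" by simp
        moreover have "g ** (\<kappa> x ** M') ** matrix_inv g = c ** M"
          using i by (simp add: c_def M'_def flip: matrix_mul_assoc) (simp add: matrix_inv_ex)
        moreover have "g ** (M' ** \<kappa> x) ** matrix_inv g = M ** c"
          using i by (simp add: c_def M'_def matrix_mul_assoc matrix_inv_ex)
        ultimately show ?thesis by simp
      qed
      hence "h ** c ** M = M ** (h ** c)" if "M \<in> lie_algebra G" for M
        using step.IH that by (simp add: K_def) (metis matrix_mul_assoc)
      thus ?case using i ic by (simp add: K_def c_def[symmetric] invertible_mult)
    qed
  qed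
  hence sub: "nclosure \<subseteq> K" by (rule nclosure_minimal[OF K])
  have "nclosure = {mat 1} \<or> nclosure = G"
    using assms(1) nclosure_normal[OF assms(2)] nclosure_connected zclosure_closed
    unfolding almost_simple_def nclosure_def by blast
  moreover have "nclosure \<noteq> G"
  proof
    assume "nclosure = G"
    hence "g \<in> K" using sub nontriv(1) by auto
    thus False using nontriv(2,3) comm by (auto simp: K_def)
  qed
  ultimately show ?thesis using \<kappa>_nclosure[OF x] by auto
qed

end

section \<open>Cocharacters\<close>

lemma cocharactersD:
  assumes T: "subgroup T GL" and "l \<in> cocharacters T"
  shows "x \<noteq> 0 \<Longrightarrow> l x \<in> T" "x \<noteq> 0 \<Longrightarrow> y \<noteq> 0 \<Longrightarrow> l (x * y) = l x ** l y"
    "l \<in> extensional (UNIV - {0})" "regular_map Gm_coords (UNIV - {0}) GL_coords l"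
    "l 1 = mat 1" "x \<noteq> 0 \<Longrightarrow> l (inverse x) = matrix_inv (l x)"
proof -
  note H = GL_subgroup_facts[OF T]
  show *: "x \<noteq> 0 \<Longrightarrow> l x \<in> T" "x \<noteq> 0 \<Longrightarrow> y \<noteq> 0 \<Longrightarrow> l (x * y) = l x ** l y"
    "l \<in> extensional (UNIV - {0})" "regular_map Gm_coords (UNIV - {0}) GL_coords l" for x y
    using assms by (auto simp: cocharacters_def hom_def)
  have i: "invertible (l 1)" using H *(1)[of 1] by simp
  have "l 1 ** l 1 = l 1" using *(2)[of 1 1] by simp
  thus one: "l 1 = mat 1" by (metis mult_inv_cancel(1)[OF i] matrix_inv_ex(2)[OF i])
  show "l (inverse x) = matrix_inv (l x)" if "x \<noteq> 0"
    using *(2)[OF that, of "inverse x"] that one by (intro matrix_inv_eq[symmetric]) simp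
qed

lemma cocharactersI:
  assumes "\<And>x. x \<noteq> 0 \<Longrightarrow> l x \<in> T" "\<And>x y. x \<noteq> 0 \<Longrightarrow> y \<noteq> 0 \<Longrightarrow> l (x * y) = l x ** l y"
    and "regular_map Gm_coords (UNIV - {0}) GL_coords l"
  shows "(\<lambda>x\<in>UNIV - {0}. l x) \<in> cocharacters T"
proof -
  have "regular_map Gm_coords (UNIV - {0}) GL_coords (\<lambda>x\<in>UNIV - {0}. l x)"
    using assms(3) by (subst regular_map_cong[where g = l]) auto
  thus ?thesis using assms(1,2) by (auto simp: cocharacters_def hom_def)
qed

lemma cocharacter_group_simps [simp]:
  "carrier (cocharacter_group T) = cocharacters T"
  "mult (cocharacter_group T) l m = (\<lambda>x\<in>UNIV - {0}. l x ** m x)"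
  "one (cocharacter_group T) = (\<lambda>x\<in>UNIV - {0}. mat 1)"
  by (simp_all add: cocharacter_group_def)

lemma regular_fun_Gm_id: "regular_fun Gm_coords X (\<lambda>x. x)" "regular_fun Gm_coords X inverse"
  by (auto intro!: regular_fun_gen gen_alg.gen simp: Gm_coords_def)

lemma regular_fun_power: "regular_fun C X f \<Longrightarrow> regular_fun C X (\<lambda>x. f x ^ k)"
  by (induction k) (auto intro: regular_fun_const regular_fun_mult)

lemma regular_fun_Gm_powi: "regular_fun Gm_coords (UNIV - {0}) (\<lambda>x. x powi k)"
proof (cases "k \<ge> 0")
  case True
  thus ?thesis using regular_fun_power[OF regular_fun_Gm_id(1)] by (simp add: power_int_def)
next
  case False
  thus ?thesis using regular_fun_power[OF regular_fun_Gm_id(2)] by (simp add: power_int_def)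
qed

lemma regular_map_Gm_inverse: "regular_map Gm_coords (UNIV - {0}) Gm_coords (inverse :: 'f::field \<Rightarrow> 'f)"
  using regular_fun_Gm_id by (auto simp: regular_map_iff Gm_coords_def)

lemma regular_map_Gm_comp_inverse:
  "regular_map Gm_coords (UNIV - {0}) D l \<Longrightarrow> regular_map Gm_coords (UNIV - {0}) D (\<lambda>x. l (inverse x))"
  by (rule regular_map_comp[OF regular_map_Gm_inverse]) auto

lemma group_cocharacters:
  fixes T :: "('f::alg_closed_field ^'m ^'m) set"
  assumes T: "subgroup T GL" and comm: "\<And>s t. s \<in> T \<Longrightarrow> t \<in> T \<Longrightarrow> s ** t = t ** s"
  shows "group (cocharacter_group T)"
    "l \<in> cocharacters T \<Longrightarrow> x \<noteq> 0 \<Longrightarrow> (inv\<^bsub>cocharacter_group T\<^esub> l) x = matrix_inv (l x)"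
proof -
  note H = GL_subgroup_facts[OF T] and D = cocharactersD[OF T]
  have closed: "(\<lambda>x\<in>UNIV - {0}. l x ** m x) \<in> cocharacters T"
    if l: "l \<in> cocharacters T" and m: "m \<in> cocharacters T" for l m
  proof (rule cocharactersI)
    fix x y :: 'f assume xy: "x \<noteq> 0" "y \<noteq> 0"
    show "l (x * y) ** m (x * y) = l x ** m x ** (l y ** m y)"
    proof -
      have "l (x * y) ** m (x * y) = l x ** (l y ** m x) ** m y"
        using D(2)[OF l xy] D(2)[OF m xy] by (simp add: matrix_mul_assoc)
      also have "l y ** m x = m x ** l y" using comm D(1)[OF l xy(2)] D(1)[OF m xy(1)] by blast
      finally show ?thesis by (simp add: matrix_mul_assoc)
    qed
  qed (use D l m H in \<open>auto intro: regular_map_GL_mult\<close>)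
  have inv: "(\<lambda>x\<in>UNIV - {0}. l (inverse x)) \<in> cocharacters T" if l: "l \<in> cocharacters T" for l
    by (rule cocharactersI) (use D[OF l] H(4) regular_map_Gm_comp_inverse in auto)
  have one: "(\<lambda>x\<in>UNIV - {0}. mat 1) \<in> cocharacters T"
    by (rule cocharactersI) (use H regular_map_const in auto)
  have ext: "l = m" if "l \<in> extensional (UNIV - {0})" "m \<in> extensional (UNIV - {0})"
    "\<And>x. x \<noteq> 0 \<Longrightarrow> l x = m x" for l m :: "'f \<Rightarrow> 'f ^'m ^'m"
    using extensionalityI[OF that(1,2)] that(3) by auto
  have linv: "(\<lambda>x\<in>UNIV - {0}. (\<lambda>x\<in>UNIV - {0}. l (inverse x)) x ** l x) = (\<lambda>x\<in>UNIV - {0}. mat 1)"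
    if l: "l \<in> cocharacters T" for l
    using D[OF l] H by (intro restrict_ext) (auto simp: matrix_inv_ex)
  show grp: "group (cocharacter_group T)"
  proof (rule groupI)
    fix l assume l: "l \<in> carrier (cocharacter_group T)"
    show "\<one>\<^bsub>cocharacter_group T\<^esub> \<otimes>\<^bsub>cocharacter_group T\<^esub> l = l"
      using D(3) l by (intro ext) auto
    show "\<exists>m\<in>carrier (cocharacter_group T). m \<otimes>\<^bsub>cocharacter_group T\<^esub> l = \<one>\<^bsub>cocharacter_group T\<^esub>"
      using inv linv l by (intro bexI[of _ "\<lambda>x\<in>UNIV - {0}. l (inverse x)"]) auto
  next
    fix l m k
    show "l \<otimes>\<^bsub>cocharacter_group T\<^esub> m \<otimes>\<^bsub>cocharacter_group T\<^esub> k =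
        l \<otimes>\<^bsub>cocharacter_group T\<^esub> (m \<otimes>\<^bsub>cocharacter_group T\<^esub> k)"
      by (simp add: fun_eq_iff restrict_def matrix_mul_assoc)
  qed (use closed one in auto)
  assume l: "l \<in> cocharacters T" and x: "x \<noteq> 0"
  have "inv\<^bsub>cocharacter_group T\<^esub> l = (\<lambda>x\<in>UNIV - {0}. l (inverse x))"
    using linv[OF l] inv[OF l] l by (intro group.inv_equality[OF grp]) auto
  thus "(inv\<^bsub>cocharacter_group T\<^esub> l) x = matrix_inv (l x)" using x D(6)[OF l x] by simp
qed

lemma regular_map_Gm_pow:
  assumes "\<And>i. i < r \<Longrightarrow> regular_fun C X (\<lambda>x. f x i)" "\<And>i. i < r \<Longrightarrow> regular_fun C X (\<lambda>x. inverse (f x i))"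
  shows "regular_map C X (Gm_pow_coords r) f"
  using assms by (auto simp: regular_map_iff Gm_pow_coords_def)

lemma (in split_torus) cocharacter_of_exponents:
  fixes b :: "nat \<Rightarrow> int"
  shows "(\<lambda>x\<in>UNIV - {0}. \<phi> (\<lambda>i. if i < r then x powi b i else 1)) \<in> cocharacters T"
proof (rule cocharactersI)
  have in_car: "(\<lambda>i. if i < r then x powi b i else 1) \<in> carrier (Gm_pow r)" if "x \<noteq> 0" for x :: 'f
    using that by (auto simp: Gm_pow_simps)
  fix x y :: 'f assume x: "x \<noteq> 0"
  show "\<phi> (\<lambda>i. if i < r then x powi b i else 1) \<in> T" using \<phi>_in in_car x by blast
  assume y: "y \<noteq> 0"
  have "(\<lambda>i. if i < r then (x * y) powi b i else 1) =
      (\<lambda>i. (if i < r then x powi b i else 1) * (if i < r then y powi b i else 1))"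
    by (auto simp: power_int_mult_distrib)
  thus "\<phi> (\<lambda>i. if i < r then (x * y) powi b i else 1) =
      \<phi> (\<lambda>i. if i < r then x powi b i else 1) ** \<phi> (\<lambda>i. if i < r then y powi b i else 1)"
    using \<phi>_mult[OF in_car[OF x] in_car[OF y]] by simp
next
  show "regular_map Gm_coords (UNIV - {0}) GL_coords (\<lambda>x. \<phi> (\<lambda>i. if i < r then x powi b i else 1))"
  proof (rule regular_map_comp[OF _ _ \<phi>_regular])
    show "regular_map Gm_coords (UNIV - {0}) (Gm_pow_coords r) (\<lambda>x i. if i < r then x powi b i else 1)"
      by (rule regular_map_Gm_pow) (auto simp: regular_fun_Gm_powi power_int_minus[symmetric])
  qed (auto simp: Gm_pow_simps)
qed

lemma (in split_torus) cocharacter_exponents: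
  assumes l: "l \<in> cocharacters T"
  obtains b :: "nat \<Rightarrow> int" where "\<And>x. x \<noteq> 0 \<Longrightarrow> \<psi> (l x) = (\<lambda>i. if i < r then x powi b i else 1)"
proof -
  note D = cocharactersD[OF T l]
  have "\<exists>b::int. \<forall>x. x \<noteq> 0 \<longrightarrow> \<psi> (l x) i = x powi b" if "i < r" for i
  proof (rule regular_hom_Gm)
    show "regular_fun Gm_coords (UNIV - {0}) (\<lambda>x. \<psi> (l x) i)"
      by (rule regular_fun_comp[OF D(4) _ coord_regular(1)[OF that]]) (use D(1) in auto)
  qed (use D \<psi>_nz \<psi>_mult in auto)
  then obtain b :: "nat \<Rightarrow> int" where b: "\<And>i x. i < r \<Longrightarrow> x \<noteq> 0 \<Longrightarrow> \<psi> (l x) i = x powi b i"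
    by metis
  have "\<psi> (l x) = (\<lambda>i. if i < r then x powi b i else 1)" if "x \<noteq> 0" for x
    using b \<psi>_in[OF D(1)[OF that]] that by (auto simp: Gm_pow_simps)
  thus ?thesis using that by blast
qed

lemma powi_eq_iff:
  "(\<forall>x :: 'f::alg_closed_field. x \<noteq> 0 \<longrightarrow> x powi p = x powi q) \<longleftrightarrow> p = q"
proof
  assume *: "\<forall>x :: 'f. x \<noteq> 0 \<longrightarrow> x powi p = x powi q"
  have "x powi (p - q) = 1" if "x \<noteq> 0" for x :: 'f
    using * that by (simp add: power_int_diff)
  thus "p = q" using ex_pow_ne_1[of "p - q", where 'f = 'f] by force
qed auto

lemma minus_one_ne_one:
  assumes "CHAR('f::field) \<noteq> 2"
  shows "(- 1 :: 'f) \<noteq> 1"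
proof
  assume "(- 1 :: 'f) = 1"
  hence "(2 :: 'f) = 0" by (metis add.right_inverse one_add_one)
  hence "of_nat 2 = (0 :: 'f)" by simp
  hence "CHAR('f) dvd 2" by (simp only: of_nat_eq_0_iff_char_dvd)
  moreover have "CHAR('f) \<noteq> 1" using of_nat_eq_0_iff_char_dvd[of 1, where 'a = 'f] by auto
  ultimately show False using assms two_is_prime_nat by (auto simp: prime_nat_iff)
qed

text \<open>In split coordinates l is given by integer exponents. Triviality at -1 makes every
  exponent even, as -1 differs from 1, and halving the exponents gives m.\<close>

lemma (in split_torus) cocharacter_half:
  assumes l: "l \<in> cocharacters T" and m1: "l (- 1) = mat 1" and char: "CHAR('f) \<noteq> 2"
  obtains m where "m \<in> cocharacters T" "\<And>x. x \<noteq> 0 \<Longrightarrow> l x = m x ** m x"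
proof -
  obtain b :: "nat \<Rightarrow> int" where b: "\<And>x. x \<noteq> 0 \<Longrightarrow> \<psi> (l x) = (\<lambda>i. if i < r then x powi b i else 1)"
    using cocharacter_exponents[OF l] by blast
  have one: "\<psi> (mat 1) i = 1" for i
    using \<psi>_mult[OF TH(2) TH(2), of i] \<psi>_nz[OF TH(2), of i] by simp
  have ev: "even (b i)" if "i < r" for i
  proof (rule ccontr)
    assume "odd (b i)"
    moreover have "(- 1 :: 'f) powi b i = 1" using fun_cong[OF b[of "- 1"], of i] m1 one that by simp
    ultimately show False using minus_one_ne_one[OF char] by simp
  qed
  define m where "m = (\<lambda>x\<in>UNIV - {0}. \<phi> (\<lambda>i. if i < r then x powi (b i div 2) else 1))"
  have "l x = m x ** m x" if x: "x \<noteq> 0" for x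
  proof -
    have c: "(\<lambda>i. if i < r then x powi (b i div 2) else 1) \<in> carrier (Gm_pow r)"
      using x by (auto simp: Gm_pow_simps)
    have "m x ** m x = \<phi> (\<lambda>i. (if i < r then x powi (b i div 2) else 1) * (if i < r then x powi (b i div 2) else 1))"
      using \<phi>_mult[OF c c] x by (simp add: m_def)
    also have "(\<lambda>i. (if i < r then x powi (b i div 2) else 1) * (if i < r then x powi (b i div 2) else 1)) = \<psi> (l x)"
    proof
      fix i
      show "(if i < r then x powi (b i div 2) else 1) * (if i < r then x powi (b i div 2) else 1) = \<psi> (l x) i"
        using ev[of i] x b[OF x] by (auto simp flip: power_int_add)
    qed
    finally show ?thesis using \<phi>\<psi>[OF cocharactersD(1)[OF T l x]] by simp
  qed
  thus ?thesis using that[of m] cocharacter_of_exponents[of "\<lambda>i. b i div 2"] unfolding m_def by blast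
qed

section \<open>Standard coordinates on the torus\<close>

lemma D_simple_lt: "i < n \<Longrightarrow> D_simple n i k = of_bool (k = i) - of_bool (k = i + 1)"
  by (simp add: D_simple_def)

lemma D_simple_n: "D_simple n n k = of_bool (k = n - 1) + of_bool (k = n)"
  by (simp add: D_simple_def)

lemma D_cartan_lt:
  assumes "1 \<le> i" "i < n"
  shows "D_cartan n i j = D_simple n j i - D_simple n j (i + 1)"
proof -
  have "D_cartan n i j = (\<Sum>k=1..n. of_bool (k = i) * D_simple n j k - of_bool (k = i + 1) * D_simple n j k)"
    unfolding D_cartan_def D_simple_lt[OF assms(2)] by (simp add: algebra_simps)
  also have "\<dots> = (\<Sum>k=1..n. of_bool (k = i) * D_simple n j k) - (\<Sum>k=1..n. of_bool (k = i + 1) * D_simple n j k)"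
    by (rule sum_subtractf)
  also have "(\<Sum>k=1..n. of_bool (k = i) * D_simple n j k) = (\<Sum>k\<in>{i}. D_simple n j k)"
    using assms by (intro sum.mono_neutral_cong_right) auto
  also have "(\<Sum>k=1..n. of_bool (k = i + 1) * D_simple n j k) = (\<Sum>k\<in>{i + 1}. D_simple n j k)"
    using assms by (intro sum.mono_neutral_cong_right) auto
  finally show ?thesis by simp
qed

lemma D_cartan_n:
  assumes "2 \<le> n"
  shows "D_cartan n n j = D_simple n j (n - 1) + D_simple n j n"
proof -
  have "D_cartan n n j = (\<Sum>k=1..n. of_bool (k = n - 1) * D_simple n j k + of_bool (k = n) * D_simple n j k)"
    unfolding D_cartan_def D_simple_n by (simp add: algebra_simps)
  also have "\<dots> = (\<Sum>k=1..n. of_bool (k = n - 1) * D_simple n j k) + (\<Sum>k=1..n. of_bool (k = n) * D_simple n j k)"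
    by (rule sum.distrib)
  also have "(\<Sum>k=1..n. of_bool (k = n - 1) * D_simple n j k) = (\<Sum>k\<in>{n - 1}. D_simple n j k)"
    using assms by (intro sum.mono_neutral_cong_right) auto
  also have "(\<Sum>k=1..n. of_bool (k = n) * D_simple n j k) = (\<Sum>k\<in>{n}. D_simple n j k)"
    using assms by (intro sum.mono_neutral_cong_right) auto
  finally show ?thesis by simp
qed

locale realized_D =
  fixes R :: "('f::alg_closed_field, 'm::finite) realized_group"
  assumes char_ne_2: "CHAR('f) \<noteq> 2"
    and reductive: "connected_reductive (grp R)"
    and simple: "almost_simple (grp R)"
    and maximal: "maximal_torus (grp R) (tor R)"
    and rank: "6 \<le> rk R"
    and type_D: "type_D R"
    and lattice: "cochar_lattice_omega1 R"
    and realization: "realization R"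
    and weyl_gen: "weyl_generated R"
begin

abbreviation "G \<equiv> grp R"
abbreviation "T \<equiv> tor R"
abbreviation "n \<equiv> rk R"
abbreviation "a \<equiv> sroot R"
abbreviation "c i \<equiv> coroot R (sroot R i)"

lemma G_sub: "subgroup G GL" and G_closed: "zariski_closed G"
  using reductive by (auto simp: connected_reductive_def algebraic_group_def)

lemma T_torus: "torus T" and T_G: "T \<subseteq> G"
  using maximal by (auto simp: maximal_torus_def)

lemma T_sub: "subgroup T GL"
  using T_torus by (rule torus_subgroup)

lemmas TH = GL_subgroup_facts[OF T_sub]
lemmas GH = GL_subgroup_facts[OF G_sub]

lemma T_comm: "s \<in> T \<Longrightarrow> t \<in> T \<Longrightarrow> s ** t = t ** s"
  using torus_split[OF T_torus] split_torus.T_commute by metis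

lemma a_root: "i \<in> {1..n} \<Longrightarrow> a i \<in> roots G T"
  and root_combination: "\<beta> \<in> roots G T \<Longrightarrow> \<exists>k::nat \<Rightarrow> nat.
        (\<forall>t\<in>T. \<beta> t = (\<Prod>i=1..n. a i t ^ k i)) \<or> (\<forall>t\<in>T. \<beta> t = inverse (\<Prod>i=1..n. a i t ^ k i))"
  and root_indep: "(\<forall>t\<in>T. (\<Prod>i=1..n. a i t powi k i) = 1) \<Longrightarrow> i \<in> {1..n} \<Longrightarrow> k i = (0 :: int)"
  using type_D by (auto simp: type_D_def is_base_def)

lemma a_char: "i \<in> {1..n} \<Longrightarrow> a i \<in> characters T"
  using a_root by (auto simp: roots_def)

lemmas aD = charactersD[OF T_sub a_char]

lemma coroot_is: "\<alpha> \<in> roots G T \<Longrightarrow> is_coroot G T \<alpha> (coroot R \<alpha>)"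
  using type_D by (auto simp: type_D_def Phi_def)

lemma c_cochar: "i \<in> {1..n} \<Longrightarrow> c i \<in> cocharacters T"
  using coroot_is[OF a_root] by (simp add: is_coroot_def)

lemma omega_cochar: "omega1 R \<in> cocharacters T"
  using lattice unfolding cochar_lattice_omega1_def by (rule conjunct1)

lemmas cD = cocharactersD[OF T_sub c_cochar]
lemmas omD = cocharactersD[OF T_sub omega_cochar]

lemma a_c: "i \<in> {1..n} \<Longrightarrow> j \<in> {1..n} \<Longrightarrow> x \<noteq> 0 \<Longrightarrow> a j (c i x) = x powi D_cartan n i j"
  using type_D by (auto simp: type_D_def has_pairing_def)

lemma a_omega: "j \<in> {1..n} \<Longrightarrow> x \<noteq> 0 \<Longrightarrow> a j (omega1 R x) = x powi of_bool (j = 1)"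
  using lattice unfolding cochar_lattice_omega1_def has_pairing_def by blast

text \<open>The cocharacters dual to the e_k: \<omega>_1 is the first one, and subtracting the
  coroot of e_k - e_{k+1} leads from index k to k+1. The index 0 is a trivial placeholder.\<close>

primrec eps :: "nat \<Rightarrow> 'f \<Rightarrow> 'f ^'m ^'m" where
  "eps 0 = (\<lambda>x. mat 1)"
| "eps (Suc k) = (\<lambda>x. if k = 0 then omega1 R x else eps k x ** c k (inverse x))"

lemma eps_facts:
  assumes "k \<le> n"
  shows eps_in: "x \<noteq> 0 \<Longrightarrow> eps k x \<in> T"
    and eps_mult: "x \<noteq> 0 \<Longrightarrow> y \<noteq> 0 \<Longrightarrow> eps k (x * y) = eps k x ** eps k y"
    and eps_regular: "regular_map Gm_coords (UNIV - {0}) GL_coords (eps k)"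
proof -
  have "(\<forall>x. x \<noteq> 0 \<longrightarrow> eps k x \<in> T) \<and> (\<forall>x y. x \<noteq> 0 \<longrightarrow> y \<noteq> 0 \<longrightarrow> eps k (x * y) = eps k x ** eps k y) \<and>
      regular_map Gm_coords (UNIV - {0}) GL_coords (eps k)"
    using assms
  proof (induction k)
    case 0
    show ?case using TH by (simp add: regular_map_const)
  next
    case (Suc k)
    show ?case
    proof (cases "k = 0")
      case True
      thus ?thesis using omD by simp
    next
      case False
      hence k: "k \<in> {1..n}" using Suc.prems by simp
      have "eps (Suc k) (x * y) = eps (Suc k) x ** eps (Suc k) y" if xy: "x \<noteq> 0" "y \<noteq> 0" for x y
      proof -
        have "eps (Suc k) (x * y) = eps k x ** (eps k y ** c k (inverse x)) ** c k (inverse y)"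
          using Suc False xy cD(2)[OF k] by (simp add: matrix_mul_assoc)
        also have "eps k y ** c k (inverse x) = c k (inverse x) ** eps k y"
          using Suc xy cD(1)[OF k] by (intro T_comm) auto
        finally show ?thesis using False by (simp add: matrix_mul_assoc)
      qed
      thus ?thesis using Suc False cD(1,4)[OF k] TH(3)
        by (auto intro!: regular_map_GL_mult regular_map_Gm_comp_inverse)
    qed
  qed
  thus "x \<noteq> 0 \<Longrightarrow> eps k x \<in> T" "x \<noteq> 0 \<Longrightarrow> y \<noteq> 0 \<Longrightarrow> eps k (x * y) = eps k x ** eps k y"
    "regular_map Gm_coords (UNIV - {0}) GL_coords (eps k)" by auto
qed

lemma eps_one: "k \<le> n \<Longrightarrow> eps k 1 = mat 1"
proof -
  assume k: "k \<le> n"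
  have i: "invertible (eps k 1)" using TH(1) eps_in[OF k] by simp
  have "eps k 1 ** eps k 1 = eps k 1" using eps_mult[OF k, of 1 1] by simp
  thus ?thesis by (metis mult_inv_cancel(1)[OF i] matrix_inv_ex(2)[OF i])
qed

lemma eps_inverse: "k \<le> n \<Longrightarrow> x \<noteq> 0 \<Longrightarrow> eps k x ** eps k (inverse x) = mat 1"
  using eps_mult[of k x "inverse x"] eps_one by simp

text \<open>The cocharacter \<omega>_1 pairs with the simple roots like the first coordinate, and by
  \<open>D_cartan_lt\<close> subtracting the coroot of index k replaces the coordinate k by the
  coordinate k+1.\<close>

lemma a_eps:
  assumes "j \<in> {1..n}" "k \<in> {1..n}" "x \<noteq> 0"
  shows "a j (eps k x) = x powi D_simple n j k"
  using assms(2)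
proof (induction k)
  case 0
  thus ?case by simp
next
  case (Suc k)
  show ?case
  proof (cases "k = 0")
    case True
    thus ?thesis using a_omega[OF assms(1,3)] assms(1) rank by (auto simp: D_simple_def)
  next
    case False
    hence k: "k \<in> {1..n}" using Suc.prems by simp
    have "a j (eps (Suc k) x) = x powi D_simple n j k * inverse x powi D_cartan n k j"
      using Suc False aD(1)[OF assms(1)] eps_in[of k x] cD(1)[OF k, of "inverse x"] assms a_c[OF k assms(1)] by simp
    also have "D_cartan n k j = D_simple n j k - D_simple n j (Suc k)"
      using D_cartan_lt[of k n j] Suc.prems k by simp
    finally show ?thesis using assms(3) by (simp add: power_int_inverse power_int_diff field_simps)
  qed
qed

lemma c_eps:
  assumes "i \<in> {1..n}" "i < n" "x \<noteq> 0"
  shows "c i x = eps i x ** eps (i + 1) (inverse x)"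
proof -
  have "eps i x ** eps (i + 1) (inverse x) = (eps i x ** eps i (inverse x)) ** c i x"
    using assms by (simp add: matrix_mul_assoc)
  thus ?thesis using eps_inverse[of i x] assms by simp
qed

text \<open>The cocharacter \<open>2\<omega>\<^sub>1 - 2(\<alpha>\<^sub>1\<^sup>\<or> + \<dots> + \<alpha>\<^sub>n\<^sub>-\<^sub>2\<^sup>\<or>) - \<alpha>\<^sub>n\<^sub>-\<^sub>1\<^sup>\<or> - \<alpha>\<^sub>n\<^sup>\<or>\<close> pairs trivially with all roots; it
  vanishes because \<open>G\<close> is almost simple.\<close>

lemma c_n_eps:
  assumes "x \<noteq> 0"
  shows "c n x = eps (n - 1) x ** eps n x"
proof -
  define \<kappa> where "\<kappa> x = eps (n - 1) x ** eps n x ** c n (inverse x)" for x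
  have n: "n \<in> {1..n}" "n - 1 \<in> {1..n}" "n - 1 \<le> n" using rank by auto
  have \<kappa>T: "\<kappa> x \<in> T" if "x \<noteq> 0" for x
    unfolding \<kappa>_def using that by (intro TH(3) eps_in cD(1)[OF n(1)]) auto
  interpret one_parameter_subgroup G \<kappa>
  proof (rule one_parameter_subgroup.intro)
    show "subgroup G GL" by (rule G_sub)
    show "\<kappa> x \<in> G" if "x \<noteq> 0" for x using \<kappa>T that T_G by blast
    show "regular_map Gm_coords (UNIV - {0}) GL_coords \<kappa>"
      unfolding \<kappa>_def using n
      by (intro regular_map_GL_mult eps_regular regular_map_Gm_comp_inverse cD(4)) auto
    fix x y :: 'f assume xy: "x \<noteq> 0" "y \<noteq> 0"
    have t: "eps (n - 1) x \<in> T" "eps n x \<in> T" "c n (inverse x) \<in> T"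
        "eps (n - 1) y \<in> T" "eps n y \<in> T" "c n (inverse y) \<in> T"
      using xy n by (auto intro: eps_in cD(1))
    have "\<kappa> (x * y) = (eps (n - 1) x ** eps (n - 1) y) ** (eps n x ** eps n y) ** (c n (inverse x) ** c n (inverse y))"
      using xy n cD(2)[OF n(1), of "inverse x" "inverse y"] by (simp add: \<kappa>_def eps_mult)
    also have "\<dots> = eps (n - 1) x ** (eps (n - 1) y ** eps n x) ** eps n y ** c n (inverse x) ** c n (inverse y)"
      by (simp add: matrix_mul_assoc)
    also have "eps (n - 1) y ** eps n x = eps n x ** eps (n - 1) y" using t by (intro T_comm)
    also have "eps (n - 1) x ** (eps n x ** eps (n - 1) y) ** eps n y ** c n (inverse x) ** c n (inverse y) =
        eps (n - 1) x ** eps n x ** ((eps (n - 1) y ** eps n y) ** c n (inverse x)) ** c n (inverse y)"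
      by (simp add: matrix_mul_assoc)
    also have "(eps (n - 1) y ** eps n y) ** c n (inverse x) = c n (inverse x) ** (eps (n - 1) y ** eps n y)"
      using t by (intro T_comm TH(3))
    finally show "\<kappa> (x * y) = \<kappa> x ** \<kappa> y" by (simp add: \<kappa>_def matrix_mul_assoc)
  qed
  have a\<kappa>: "a j (\<kappa> x) = 1" if j: "j \<in> {1..n}" and x: "x \<noteq> 0" for j x
  proof -
    have "a j (\<kappa> x) = x powi D_simple n j (n - 1) * x powi D_simple n j n * inverse x powi D_cartan n n j"
      unfolding \<kappa>_def using x n j TH(3) eps_in[of "n - 1" x] eps_in[of n x] cD(1)[OF n(1), of "inverse x"]
      by (simp add: aD(1)[OF j] a_eps[OF j] a_c[OF n(1) j])
    also have "D_cartan n n j = D_simple n j (n - 1) + D_simple n j n" using rank by (intro D_cartan_n) simp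
    finally show ?thesis using x by (simp add: power_int_inverse power_int_add field_simps)
  qed
  have root\<kappa>: "\<beta> (\<kappa> x) = 1" if "\<beta> \<in> roots G T" "x \<noteq> 0" for \<beta> x
    using root_combination[OF that(1)] a\<kappa> \<kappa>T that(2) by force
  obtain r \<phi> \<psi> where split: "split_torus T r \<phi> \<psi>" using torus_split[OF T_torus] .
  have Ad: "\<kappa> x ** M ** matrix_inv (\<kappa> x) = M" if "x \<noteq> 0" "M \<in> lie_algebra G" for x M
    using split_torus.root_kernel_Ad[OF split G_sub T_G that(2) \<kappa>T[OF that(1)]] root\<kappa> that(1) by blast
  \<comment> \<open>A root vector of \<alpha>_1 is moved by some t in T, so G does not centralize
    its Lie algebra. This excludes the alternative that the normal closure is all of G.\<close>
  have one: "1 \<in> {1..n}" using rank by simp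
  obtain t where t: "t \<in> T" "a 1 t \<noteq> 1" and rs: "root_space G T (a 1) \<noteq> {0}"
    using a_root[OF one] by (auto simp: roots_def)
  have "0 \<in> root_space G T (a 1)"
    using is_subspaceD(1)[OF lie_algebra_subspace] by (auto simp: root_space_def vec_eq_iff matrix_mult_nth)
  then obtain M where M: "M \<in> root_space G T (a 1)" "M \<noteq> 0" using rs by blast
  then obtain i j where ij: "M $ i $ j \<noteq> 0" by (auto simp: vec_eq_iff)
  have "t ** M ** matrix_inv t = scale_mat (a 1 t) M" "M \<in> lie_algebra G"
    using M(1) t(1) by (auto simp: root_space_def scale_mat_def)
  moreover have "scale_mat (a 1 t) M \<noteq> M"
  proof
    assume "scale_mat (a 1 t) M = M"
    hence "a 1 t * M $ i $ j = M $ i $ j" by (metis scale_mat_nth)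
    thus False using ij t(2) by simp
  qed
  ultimately have "\<kappa> x = mat 1"
    using almost_simple_trivial[OF simple G_closed Ad, of t M x] t(1) T_G assms by auto
  hence "eps (n - 1) x ** eps n x ** c n (inverse x) ** c n x = c n x" by (simp add: \<kappa>_def)
  thus ?thesis
    using cD(6)[OF n(1) assms] TH(1)[OF cD(1)[OF n(1) assms]] by simp
qed

section \<open>The parametrization of T by coordinate vectors\<close>

primrec tau_upto :: "nat \<Rightarrow> (nat \<Rightarrow> 'f) \<Rightarrow> 'f ^'m ^'m" where
  "tau_upto 0 d = mat 1"
| "tau_upto (Suc k) d = tau_upto k d ** eps (Suc k) (d (Suc k))"

text \<open>Only the values of d at 1, ..., n matter. By \<open>tau_surj\<close> and
  \<open>tau_inj\<close> every element of T is \<open>tau d\<close> for exactly one choice of these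
  values, all nonzero.\<close>

definition tau :: "(nat \<Rightarrow> 'f) \<Rightarrow> 'f ^'m ^'m" where "tau d = tau_upto n d"

definition nz :: "(nat \<Rightarrow> 'f) \<Rightarrow> bool" where "nz d \<longleftrightarrow> (\<forall>k\<in>{1..n}. d k \<noteq> 0)"

lemma nzD: "nz d \<Longrightarrow> 1 \<le> k \<Longrightarrow> k \<le> n \<Longrightarrow> d k \<noteq> 0"
  by (simp add: nz_def)

lemma nz_mult: "nz d \<Longrightarrow> nz e \<Longrightarrow> nz (\<lambda>k. d k * e k)"
  by (simp add: nz_def)

lemma tau_upto_in: "nz d \<Longrightarrow> m \<le> n \<Longrightarrow> tau_upto m d \<in> T"
proof (induction m)
  case (Suc m)
  show ?case using Suc nzD[OF Suc.prems(1), of "Suc m"] eps_in[OF Suc.prems(2)] TH(3)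
    by (simp del: eps.simps)
qed (simp add: TH)

lemma tau_in: "nz d \<Longrightarrow> tau d \<in> T"
  by (simp add: tau_def tau_upto_in)

lemma tau_upto_mult:
  assumes "nz d" "nz e" "m \<le> n"
  shows "tau_upto m (\<lambda>k. d k * e k) = tau_upto m d ** tau_upto m e"
  using assms(3)
proof (induction m)
  case (Suc m)
  have d: "d (Suc m) \<noteq> 0" "e (Suc m) \<noteq> 0" using nzD assms(1,2) Suc.prems by auto
  have "tau_upto (Suc m) (\<lambda>k. d k * e k) =
      tau_upto m d ** (tau_upto m e ** eps (Suc m) (d (Suc m))) ** eps (Suc m) (e (Suc m))"
    using Suc eps_mult[OF Suc.prems d] by (simp add: matrix_mul_assoc del: eps.simps)
  also have "tau_upto m e ** eps (Suc m) (d (Suc m)) = eps (Suc m) (d (Suc m)) ** tau_upto m e"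
    using tau_upto_in[OF assms(2), of m] eps_in[OF Suc.prems d(1)] Suc.prems by (intro T_comm) auto
  finally show ?case by (simp add: matrix_mul_assoc del: eps.simps)
qed simp

lemma tau_mult: "nz d \<Longrightarrow> nz e \<Longrightarrow> tau (\<lambda>k. d k * e k) = tau d ** tau e"
  by (simp add: tau_def tau_upto_mult)

lemma tau_upto_cong: "(\<And>k. 1 \<le> k \<Longrightarrow> k \<le> m \<Longrightarrow> d k = e k) \<Longrightarrow> tau_upto m d = tau_upto m e"
  by (induction m) auto

lemma tau_cong: "(\<And>k. 1 \<le> k \<Longrightarrow> k \<le> n \<Longrightarrow> d k = e k) \<Longrightarrow> tau d = tau e"
  unfolding tau_def by (rule tau_upto_cong)

lemma tau_one: "tau (\<lambda>_. 1) = mat 1"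
proof -
  have "m \<le> n \<Longrightarrow> tau_upto m (\<lambda>_. 1) = mat 1" for m
    by (induction m) (auto simp: eps_one simp del: eps.simps)
  thus ?thesis by (simp add: tau_def)
qed

lemma tau_inverse: "nz d \<Longrightarrow> tau (\<lambda>k. inverse (d k)) = matrix_inv (tau d)"
proof -
  assume d: "nz d"
  have "tau (\<lambda>k. d k * inverse (d k)) = tau (\<lambda>_. 1)" by (rule tau_cong) (use nzD[OF d] in simp)
  moreover have "nz (\<lambda>k. inverse (d k))" using d by (simp add: nz_def)
  ultimately show ?thesis using tau_mult[OF d] tau_one by (intro matrix_inv_eq[symmetric]) simp
qed

lemma tau_single:
  assumes "k \<in> {1..n}" "x \<noteq> 0"
  shows "tau (\<lambda>j. if j = k then x else 1) = eps k x"
proof -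
  have "m \<le> n \<Longrightarrow> tau_upto m (\<lambda>j. if j = k then x else 1) = (if k \<le> m then eps k x else mat 1)" for m
  proof (induction m)
    case 0
    show ?case using assms by simp
  next
    case (Suc m)
    thus ?case using eps_one[OF Suc.prems] by (auto simp: le_Suc_eq simp del: eps.simps)
  qed
  thus ?thesis using assms by (simp add: tau_def)
qed

definition co :: "nat \<Rightarrow> 'f \<Rightarrow> nat \<Rightarrow> 'f" where
  "co i x k = (if i < n then (if k = i then x else if k = i + 1 then inverse x else 1)
     else (if k = n - 1 \<or> k = n then x else 1))"

lemma nz_co: "x \<noteq> 0 \<Longrightarrow> nz (co i x)"
  by (simp add: nz_def co_def)

lemma tau_co:
  assumes "i \<in> {1..n}" "x \<noteq> 0"
  shows "tau (co i x) = c i x"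
proof -
  have two: "tau (\<lambda>j. (if j = k then y else 1) * (if j = l then z else 1)) = eps k y ** eps l z"
    if "k \<in> {1..n}" "l \<in> {1..n}" "y \<noteq> 0" "z \<noteq> 0" for k l y z
    using tau_mult[of "\<lambda>j. if j = k then y else 1" "\<lambda>j. if j = l then z else 1"]
      tau_single[OF that(1,3)] tau_single[OF that(2,4)] that by (simp add: nz_def)
  show ?thesis
  proof (cases "i < n")
    case True
    have "co i x = (\<lambda>j. (if j = i then x else 1) * (if j = i + 1 then inverse x else 1))"
      using True by (auto simp: co_def)
    thus ?thesis using two[of i "i + 1" x "inverse x"] c_eps[OF assms(1) True assms(2)] assms True
      by (simp del: eps.simps)
  next
    case False
    hence i: "i = n" using assms by simp
    have "co i x = (\<lambda>j. (if j = n - 1 then x else 1) * (if j = n then x else 1))"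
      using i rank by (auto simp: co_def fun_eq_iff)
    thus ?thesis using two[of "n - 1" n x x] c_n_eps[OF assms(2)] assms rank i by (simp del: eps.simps)
  qed
qed

lemma a_tau:
  assumes "j \<in> {1..n}" "nz d"
  shows "a j (tau d) = (if j < n then d j * inverse (d (j + 1)) else d (n - 1) * d n)"
proof -
  have "m \<le> n \<Longrightarrow> a j (tau_upto m d) = (\<Prod>k=1..m. d k powi D_simple n j k)" for m
  proof (induction m)
    case 0
    show ?case using aD(3)[OF assms(1)] by simp
  next
    case (Suc m)
    have "a j (tau_upto (Suc m) d) = a j (tau_upto m d) * d (Suc m) powi D_simple n j (Suc m)"
      using Suc aD(1)[OF assms(1) tau_upto_in[OF assms(2), of m] eps_in[OF Suc.prems, of "d (Suc m)"]]
        a_eps[OF assms(1), of "Suc m" "d (Suc m)"] nzD[OF assms(2), of "Suc m"]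
      by (simp del: eps.simps)
    thus ?case using Suc by simp
  qed
  hence "a j (tau d) = (\<Prod>k=1..n. d k powi D_simple n j k)" by (simp add: tau_def)
  also have "\<dots> = (if j < n then d j * inverse (d (j + 1)) else d (n - 1) * d n)"
  proof (cases "j < n")
    case True
    have "(\<Prod>k=1..n. d k powi D_simple n j k) = (\<Prod>k\<in>{j, j + 1}. d k powi D_simple n j k)"
      using True assms(1) by (intro prod.mono_neutral_right) (auto simp: D_simple_def)
    thus ?thesis using True by (simp add: D_simple_def power_int_minus)
  next
    case False
    hence j: "j = n" using assms(1) by simp
    have "(\<Prod>k=1..n. d k powi D_simple n j k) = (\<Prod>k\<in>{n - 1, n}. d k powi D_simple n j k)"
      using j rank by (intro prod.mono_neutral_right) (auto simp: D_simple_def)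
    moreover have "n - 1 \<noteq> n" using rank by simp
    ultimately show ?thesis using j by (simp add: D_simple_def)
  qed
  finally show ?thesis .
qed

text \<open>Here the shape of the lattice enters: X_*(T) is generated by \<omega>_1 and the simple
  coroots, and each of these is an integral combination of the coordinate cocharacters.\<close>

lemma cochar_tau:
  assumes "l \<in> cocharacters T"
  shows "\<exists>m :: nat \<Rightarrow> int. \<forall>x. x \<noteq> 0 \<longrightarrow> l x = tau (\<lambda>k. x powi m k)"
proof -
  let ?S = "insert (omega1 R) ((\<lambda>i. c i) ` {1..n})"
  have nzp: "nz (\<lambda>k. x powi m k)" if "x \<noteq> 0" for x and m :: "nat \<Rightarrow> int"
    using that by (simp add: nz_def)
  have S: "h \<in> cocharacters T \<and> (\<exists>m :: nat \<Rightarrow> int. \<forall>x. x \<noteq> 0 \<longrightarrow> h x = tau (\<lambda>k. x powi m k))" if hS: "h \<in> ?S" for h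
  proof (cases "h = omega1 R")
    case True
    have "omega1 R x = tau (\<lambda>k. x powi (if k = 1 then 1 else 0))" if "x \<noteq> 0" for x
      using tau_single[of 1 x] rank that by (simp add: if_distrib cong: if_cong)
    hence "\<exists>m :: nat \<Rightarrow> int. \<forall>x. x \<noteq> 0 \<longrightarrow> h x = tau (\<lambda>k. x powi m k)"
      unfolding True by (intro exI[of _ "\<lambda>k. if k = 1 then 1 else 0"]) simp
    thus ?thesis using True omega_cochar by simp
  next
    case False
    then obtain i where i: "i \<in> {1..n}" "h = c i" using hS by blast
    have "c i x = tau (\<lambda>k. x powi D_simple n i k)" if "x \<noteq> 0" for x
    proof -
      have "tau (co i x) = tau (\<lambda>k. x powi D_simple n i k)"
        using that rank i(1) by (intro tau_cong) (auto simp: co_def D_simple_def power_int_minus)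
      thus ?thesis using tau_co[OF i(1) that] by simp
    qed
    hence "\<exists>m :: nat \<Rightarrow> int. \<forall>x. x \<noteq> 0 \<longrightarrow> h x = tau (\<lambda>k. x powi m k)"
      unfolding i(2) by (intro exI[of _ "D_simple n i"]) simp
    thus ?thesis using i c_cochar by simp
  qed
  have "l \<in> generate (cocharacter_group T) ?S"
    using lattice assms unfolding cochar_lattice_omega1_def by blast
  thus ?thesis
  proof (induction rule: generate.induct)
    case one
    show ?case by (intro exI[of _ "\<lambda>_. 0"]) (simp add: tau_one)
  next
    case (incl h)
    from S[OF incl] show ?case by simp
  next
    case (inv h)
    from S[OF inv] obtain m :: "nat \<Rightarrow> int" where h: "h \<in> cocharacters T"
      and m: "\<forall>x. x \<noteq> 0 \<longrightarrow> h x = tau (\<lambda>k. x powi m k)" by auto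
    have "(inv\<^bsub>cocharacter_group T\<^esub> h) x = tau (\<lambda>k. x powi (- m k))" if "x \<noteq> 0" for x
      using group_cocharacters(2)[OF T_sub T_comm h that] tau_inverse[OF nzp[OF that, of m]] m that
      by (simp add: power_int_minus)
    thus ?case by (intro exI[of _ "\<lambda>k. - m k"]) simp
  next
    case (eng h1 h2)
    obtain m1 :: "nat \<Rightarrow> int" where m1: "\<forall>x. x \<noteq> 0 \<longrightarrow> h1 x = tau (\<lambda>k. x powi m1 k)"
      using eng.IH(1) by auto
    obtain m2 :: "nat \<Rightarrow> int" where m2: "\<forall>x. x \<noteq> 0 \<longrightarrow> h2 x = tau (\<lambda>k. x powi m2 k)"
      using eng.IH(2) by auto
    note m = m1 m2
    have "(h1 \<otimes>\<^bsub>cocharacter_group T\<^esub> h2) x = tau (\<lambda>k. x powi (m1 k + m2 k))" if "x \<noteq> 0" for x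
      using m that tau_mult[OF nzp[OF that, of m1] nzp[OF that, of m2]] by (simp add: power_int_add)
    thus ?case by (intro exI[of _ "\<lambda>k. m1 k + m2 k"]) simp
  qed
qed

text \<open>The split coordinates of t are adjoined one at a time. Each is the value of a
  cocharacter with a single exponent 1, and \<open>cochar_tau\<close> rewrites that value.\<close>

lemma tau_surj:
  assumes "t \<in> T"
  obtains d where "nz d" "t = tau d"
proof -
  obtain r \<phi> \<psi> where split: "split_torus T r \<phi> \<psi>" using torus_split[OF T_torus] .
  interpret split_torus T r \<phi> \<psi> by fact
  have one: "\<psi> (mat 1) = (\<lambda>_. 1)"
    using \<psi>_mult[OF TH(2) TH(2)] \<psi>_nz[OF TH(2)] by (simp add: fun_eq_iff)
  have "m \<le> r \<Longrightarrow> \<exists>d. nz d \<and> \<phi> (\<lambda>i. if i < m then \<psi> t i else 1) = tau d" for m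
  proof (induction m)
    case 0
    have "\<phi> (\<lambda>_. 1) = mat 1" using \<phi>\<psi>[OF TH(2)] one by simp
    thus ?case using tau_one by (intro exI[of _ "\<lambda>_. 1"]) (simp add: nz_def)
  next
    case (Suc m)
    then obtain d where d: "nz d" "\<phi> (\<lambda>i. if i < m then \<psi> t i else 1) = tau d" by auto
    define x where "x = \<psi> t m"
    have x: "x \<noteq> 0" using \<psi>_nz[OF assms] by (simp add: x_def)
    obtain k :: "nat \<Rightarrow> int" where
      k: "(\<lambda>x\<in>UNIV - {0}. \<phi> (\<lambda>i. if i < r then x powi (if i = m then 1 else 0) else 1)) x = tau (\<lambda>j. x powi k j)"
      using cochar_tau[OF cocharacter_of_exponents[of "\<lambda>i. if i = m then 1 else 0"]] x by auto
    have in1: "(\<lambda>i. if i < m then \<psi> t i else 1) \<in> carrier (Gm_pow r)"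
      using \<psi>_nz[OF assms] Suc.prems by (auto simp: Gm_pow_simps)
    have in2: "(\<lambda>i. if i < r then x powi (if i = m then 1 else 0) else 1) \<in> carrier (Gm_pow r)"
      using x by (auto simp: Gm_pow_simps)
    have "(\<lambda>i. if i < Suc m then \<psi> t i else 1) =
        (\<lambda>i. (if i < m then \<psi> t i else 1) * (if i < r then x powi (if i = m then 1 else 0) else 1))"
      using Suc.prems by (auto simp: x_def less_Suc_eq)
    hence "\<phi> (\<lambda>i. if i < Suc m then \<psi> t i else 1) = tau (\<lambda>j. d j * x powi k j)"
      using \<phi>_mult[OF in1 in2] k d tau_mult[of d "\<lambda>j. x powi k j"] x by (simp add: nz_def)
    thus ?case using d(1) x by (intro exI[of _ "\<lambda>j. d j * x powi k j"]) (simp add: nz_def)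
  qed
  from this[of r] obtain d where d: "nz d" "\<phi> (\<lambda>i. if i < r then \<psi> t i else 1) = tau d" by auto
  have "(\<lambda>i. if i < r then \<psi> t i else 1) = \<psi> t" using \<psi>_in[OF assms] by (auto simp: Gm_pow_simps)
  thus ?thesis using that[OF d(1)] d(2) \<phi>\<psi>[OF assms] by simp
qed

text \<open>Triviality of the simple roots \<alpha>_1, ..., \<alpha>_{n-1} makes all coordinates
  equal, and \<alpha>_n makes their common value 1 or -1. The value -1 would make the sum of all
  coordinate cocharacters trivial at -1, hence divisible by 2 in the lattice.\<close>

lemma tau_kernel:
  assumes d: "nz d" and one: "tau d = mat 1" and k: "k \<in> {1..n}"
  shows "d k = 1"
proof -
  have step: "d j = d (j + 1)" if "1 \<le> j" "j < n" for j
    using a_tau[of j d] d one aD(3)[of j] that nzD[OF d, of "j + 1"] by (simp add: field_simps)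
  have all: "d j = d 1" if "1 \<le> j" "j \<le> n" for j
    using that by (induction j rule: dec_induct) (use step in auto)
  have "d (n - 1) * d n = 1" using a_tau[of n d] d one aD(3)[of n] rank by simp
  hence "d 1 * d 1 = 1" using all[of "n - 1"] all[of n] rank by simp
  hence "d 1 = 1 \<or> d 1 = - 1" by (simp add: square_eq_1_iff)
  moreover have "d 1 \<noteq> - 1"
  proof
    assume m1: "d 1 = - 1"
    have "d j = - 1" if "1 \<le> j" "j \<le> n" for j using all[OF that] m1 by simp
    hence t1: "tau (\<lambda>_. - 1) = mat 1" using tau_cong[of d "\<lambda>_. - 1"] one by simp
    obtain r \<phi> \<psi> where split: "split_torus T r \<phi> \<psi>" using torus_split[OF T_torus] .
    have reg: "regular_map Gm_coords (UNIV - {0}) GL_coords (\<lambda>x. tau_upto m (\<lambda>_. x))" if "m \<le> n" for m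
      using that by (induction m) (auto intro!: regular_map_const regular_map_GL_mult eps_regular simp del: eps.simps)
    have l: "(\<lambda>x\<in>UNIV - {0}. tau (\<lambda>_. x)) \<in> cocharacters T"
    proof (rule cocharactersI)
      show "tau (\<lambda>_. x * y) = tau (\<lambda>_. x) ** tau (\<lambda>_. y)" if "x \<noteq> 0" "y \<noteq> 0" for x y
        using tau_mult[of "\<lambda>_. x" "\<lambda>_. y"] that by (simp add: nz_def)
    qed (use reg tau_in in \<open>auto simp: tau_def nz_def\<close>)
    obtain m where m: "m \<in> cocharacters T" "\<And>x. x \<noteq> 0 \<Longrightarrow> tau (\<lambda>_. x) = m x ** m x"
      using split_torus.cocharacter_half[OF split l _ char_ne_2] t1 by auto
    obtain b :: "nat \<Rightarrow> int" where b: "\<And>x. x \<noteq> 0 \<Longrightarrow> m x = tau (\<lambda>k. x powi b k)" using cochar_tau[OF m(1)] by auto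
    have nzb: "nz (\<lambda>k. x powi b k)" "nz (\<lambda>_. x)" if "x \<noteq> 0" for x using that by (auto simp: nz_def)
    have eq: "a j (tau (\<lambda>_. x)) = a j (tau (\<lambda>k. x powi b k)) * a j (tau (\<lambda>k. x powi b k))"
      if "x \<noteq> 0" "j \<in> {1..n}" for x j
      using m(2)[OF that(1)] b[OF that(1)] aD(1)[OF that(2)] tau_in[OF nzb(1)[OF that(1)]] by simp
    have n: "n \<in> {1..n}" "n - 1 \<in> {1..n}" "n - 1 < n" "n - 1 + 1 = n" using rank by auto
    have dbl: "x powi (2 * p) = x powi p * x powi p" if "x \<noteq> 0" for x :: 'f and p
      unfolding mult_2 by (rule power_int_add) (simp add: that)
    \<comment> \<open>Pairing the half with \<alpha>_n and \<alpha>_{n-1} shows that its last two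
      integer exponents have sum 1 and difference 0, which is absurd.\<close>
    have "x powi 2 = x powi (2 * (b (n - 1) + b n))" if x: "x \<noteq> 0" for x :: 'f
    proof -
      have "x * x = (x powi b (n - 1) * x powi b n) * (x powi b (n - 1) * x powi b n)"
        using eq[OF x n(1)] unfolding a_tau[OF n(1) nzb(1)[OF x]] a_tau[OF n(1) nzb(2)[OF x]] by simp
      also have "x powi b (n - 1) * x powi b n = x powi (b (n - 1) + b n)" using x by (simp add: power_int_add)
      finally show ?thesis unfolding dbl[OF x] power2_eq_square by (simp add: power2_eq_square)
    qed
    hence 1: "2 = 2 * (b (n - 1) + b n)" using powi_eq_iff[of 2 "2 * (b (n - 1) + b n)", where 'f = 'f] by simp
    have "x powi 0 = x powi (2 * (b (n - 1) - b n))" if x: "x \<noteq> 0" for x :: 'f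
    proof -
      have "1 = (x powi b (n - 1) * inverse (x powi b n)) * (x powi b (n - 1) * inverse (x powi b n))"
        using eq[OF x n(2)] n(3,4) x unfolding a_tau[OF n(2) nzb(1)[OF x]] a_tau[OF n(2) nzb(2)[OF x]] by simp
      also have "x powi b (n - 1) * inverse (x powi b n) = x powi (b (n - 1) - b n)"
        using x by (simp add: power_int_diff divide_inverse)
      finally show ?thesis unfolding dbl[OF x] by simp
    qed
    hence 2: "0 = 2 * (b (n - 1) - b n)" using powi_eq_iff[of 0 "2 * (b (n - 1) - b n)", where 'f = 'f] by simp
    show False using 1 2 by presburger
  qed
  ultimately have "d 1 = 1" by blast
  moreover have "d k = d 1" using k by (intro all) auto
  ultimately show ?thesis by simp
qed

lemma tau_inj:
  assumes "nz d" "nz e" "tau d = tau e" "k \<in> {1..n}"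
  shows "d k = e k"
proof -
  have ie: "nz (\<lambda>k. inverse (e k))" using assms(2) by (simp add: nz_def)
  have "tau (\<lambda>k. d k * inverse (e k)) = mat 1"
    using tau_mult[OF assms(1) ie] tau_inverse[OF assms(2)] assms(3) matrix_inv_ex[OF TH(1)[OF tau_in[OF assms(2)]]] by simp
  hence "d k * inverse (e k) = 1" using tau_kernel[OF nz_mult[OF assms(1) ie] _ assms(4)] by simp
  thus ?thesis using nzD[OF assms(2), of k] assms(4) by (simp add: field_simps)
qed

end

section \<open>Root subgroups\<close>

lemma Ga_simps [simp]: "carrier Ga = UNIV" "mult Ga = (+)" "one Ga = 0"
  by (simp_all add: Ga_def)

lemma root_paramD:
  assumes v: "is_root_param G T \<alpha> v" and G: "subgroup G GL"
  shows "v x \<in> G" "v (x + y) = v x ** v y" "v 0 = mat 1" "v (- x) = matrix_inv (v x)"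
    "t \<in> T \<Longrightarrow> t ** v x ** matrix_inv t = v (\<alpha> t * x)" "v x = v y \<longleftrightarrow> x = y"
    "regular_map Ga_coords UNIV GL_coords v" "invertible (v x)"
proof -
  have h: "v \<in> hom Ga (GL_on (range v))" and b: "bij_betw v UNIV (range v)"
    and r: "regular_map Ga_coords UNIV GL_coords v"
    using v by (auto simp: is_root_param_def alg_group_iso_def iso_def)
  show add: "v (x + y) = v x ** v y" for x y using hom_mult[OF h, of x y] by simp
  show in_G: "v x \<in> G" for x using v by (auto simp: is_root_param_def)
  show inv: "invertible (v x)" for x using in_G GL_subgroup_facts[OF G] by blast
  have "v 0 ** v 0 = v 0" using add[of 0 0] by simp
  thus zero: "v 0 = mat 1" by (metis mult_inv_cancel(1)[OF inv] matrix_inv_ex(2)[OF inv])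
  show "v (- x) = matrix_inv (v x)" using add[of x "- x"] zero by (intro matrix_inv_eq[symmetric]) simp
  show "t \<in> T \<Longrightarrow> t ** v x ** matrix_inv t = v (\<alpha> t * x)" using v by (auto simp: is_root_param_def)
  show "v x = v y \<longleftrightarrow> x = y" using b by (auto simp: bij_betw_def inj_on_def)
  show "regular_map Ga_coords UNIV GL_coords v" by (rule r)
qed

text \<open>Bivariate polynomials, as polynomials in \<open>x\<close> over polynomials in \<open>y\<close>.\<close>

definition bipoly :: "('f::field \<Rightarrow> 'f \<Rightarrow> 'f) \<Rightarrow> bool" where
  "bipoly f \<longleftrightarrow> (\<exists>p. \<forall>x y. f x y = poly (poly p [:x:]) y)"

lemma bipoly_const: "bipoly (\<lambda>x y. c)"
  unfolding bipoly_def by (intro exI[of _ "[:[:c:]:]"]) simp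

lemma bipoly_fst: "bipoly (\<lambda>x y. x)"
  unfolding bipoly_def by (intro exI[of _ "[:0, 1:]"]) simp

lemma bipoly_snd: "bipoly (\<lambda>x y. y)"
  unfolding bipoly_def by (intro exI[of _ "[:[:0, 1:]:]"]) simp

lemma bipoly_add: "bipoly f \<Longrightarrow> bipoly g \<Longrightarrow> bipoly (\<lambda>x y. f x y + g x y)"
proof -
  assume "bipoly f" "bipoly g"
  then obtain p q where "\<forall>x y. f x y = poly (poly p [:x:]) y" "\<forall>x y. g x y = poly (poly q [:x:]) y"
    by (auto simp: bipoly_def)
  thus ?thesis unfolding bipoly_def by (intro exI[of _ "p + q"]) simp
qed

lemma bipoly_mult: "bipoly f \<Longrightarrow> bipoly g \<Longrightarrow> bipoly (\<lambda>x y. f x y * g x y)"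
proof -
  assume "bipoly f" "bipoly g"
  then obtain p q where "\<forall>x y. f x y = poly (poly p [:x:]) y" "\<forall>x y. g x y = poly (poly q [:x:]) y"
    by (auto simp: bipoly_def)
  thus ?thesis unfolding bipoly_def by (intro exI[of _ "p * q"]) simp
qed

lemma bipoly_sum: "(\<And>i. i \<in> I \<Longrightarrow> bipoly (f i)) \<Longrightarrow> bipoly (\<lambda>x y. \<Sum>i\<in>I. f i x y)"
  by (induction I rule: infinite_finite_induct) (auto intro: bipoly_const bipoly_add)

lemma bipoly_gen_alg: "f \<in> gen_alg Ga_coords \<Longrightarrow> bipoly g \<Longrightarrow> bipoly (\<lambda>x y. f (g x y))"
  by (induction f rule: gen_alg.induct) (auto simp: Ga_coords_def intro: bipoly_const bipoly_add bipoly_mult)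

definition bimat :: "('f::field \<Rightarrow> 'f \<Rightarrow> 'f ^'m ^'m) \<Rightarrow> bool" where
  "bimat A \<longleftrightarrow> (\<forall>i j. bipoly (\<lambda>x y. A x y $ i $ j))"

lemma bimat_mult: "bimat A \<Longrightarrow> bimat B \<Longrightarrow> bimat (\<lambda>x y. A x y ** B x y)"
  unfolding bimat_def matrix_mult_nth by (intro allI bipoly_sum bipoly_mult) auto

lemma bimat_param:
  assumes "regular_map Ga_coords UNIV GL_coords v" "bipoly g"
  shows "bimat (\<lambda>x y. v (g x y))"
  unfolding bimat_def using regular_fun_UNIV[OF regular_map_GL_entry[OF assms(1)]] assms(2) bipoly_gen_alg
  by blast

text \<open>The powers of s with different exponents are distinct characters of the multiplicative
  group, so independence modulo L isolates each coefficient.\<close>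

lemma power_sum_in:
  fixes N :: "nat \<Rightarrow> 'f::alg_closed_field ^'m ^'m"
  assumes L: "is_subspace L" and s: "\<And>s. s \<noteq> 0 \<Longrightarrow> (\<Sum>l\<le>D. scale_mat (s ^ l) (N l)) \<in> L" and l: "l \<le> D"
  shows "N l \<in> L"
proof (rule char_sum_subspace[where Y = "{..D}" and T = "UNIV - {0}" and op = "(*)" and e = 1 and ch = "\<lambda>l s. s ^ l"])
  show "\<exists>t\<in>UNIV - {0}. t ^ i \<noteq> (t :: 'f) ^ j" if ij: "i \<noteq> j" for i j
  proof -
    obtain x :: 'f where x: "x \<noteq> 0" "x powi (int i - int j) \<noteq> 1" using ex_pow_ne_1[of "int i - int j"] ij by auto
    hence "x ^ i \<noteq> x ^ j" by (simp add: power_int_diff field_simps)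
    thus ?thesis using x(1) by auto
  qed
qed (use L s l in \<open>auto simp: power_mult_distrib\<close>)

text \<open>The lowest-order term in \<open>x\<close> of the commutator of \<open>u x\<close> and \<open>w y\<close> is tangent to \<open>G\<close> and a sum
  of vectors of weight \<open>k\<alpha> + l\<beta>\<close> with \<open>k, l \<ge> 1\<close>.\<close>

lemma root_params_commute:
  fixes G T :: "('f::alg_closed_field ^'m ^'m) set"
  assumes G: "subgroup G GL" and T: "subgroup T GL" "T \<subseteq> G"
    and \<alpha>: "\<alpha> \<in> characters T" and \<beta>: "\<beta> \<in> characters T"
    and u: "is_root_param G T \<alpha> u" and w: "is_root_param G T \<beta> w"
    and nontriv: "\<And>k l. 1 \<le> k \<Longrightarrow> 1 \<le> l \<Longrightarrow> \<exists>t\<in>T. \<alpha> t ^ k * \<beta> t ^ l \<noteq> 1"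
    and no_root: "\<And>k l. 1 \<le> k \<Longrightarrow> 1 \<le> l \<Longrightarrow> (\<lambda>t\<in>T. \<alpha> t ^ k * \<beta> t ^ l) \<notin> roots G T"
  shows "u x ** w y = w y ** u x"
proof -
  note U = root_paramD[OF u G] and Wp = root_paramD[OF w G] and GH = GL_subgroup_facts[OF G]
    and TH = GL_subgroup_facts[OF T(1)]
  define C where "C x y = u x ** w y ** u (- x) ** w (- y)" for x y
  have C0: "C 0 y = mat 1" "C x 0 = mat 1" for x y
    using U(3,4,8) Wp(3,4,8) by (auto simp: C_def matrix_inv_ex)
  have CG: "C x y \<in> G" for x y unfolding C_def by (intro GH(3) U(1) Wp(1))
  have Ct: "t ** C x y ** matrix_inv t = C (\<alpha> t * x) (\<beta> t * y)" if t: "t \<in> T" for t x y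
  proof -
    have i: "invertible t" using TH t by blast
    have "t ** C x y ** matrix_inv t = (t ** u x ** matrix_inv t) ** (t ** w y ** matrix_inv t) **
        (t ** u (- x) ** matrix_inv t) ** (t ** w (- y) ** matrix_inv t)"
      using i by (simp add: C_def matrix_mul_assoc)
    thus ?thesis using U(5)[OF t] Wp(5)[OF t] by (simp add: C_def)
  qed
  have "bimat C"
    unfolding C_def[abs_def]
    by (intro bimat_mult bimat_param[OF U(7)] bimat_param[OF Wp(7)] bipoly_fst bipoly_snd)
      (use bipoly_mult[OF bipoly_const[of "- 1"] bipoly_fst] bipoly_mult[OF bipoly_const[of "- 1"] bipoly_snd] in auto)
  then obtain P where P: "\<And>i j x y. C x y $ i $ j = poly (poly (P i j) [:x:]) y"
    unfolding bimat_def bipoly_def by metis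
  define Q where "Q y i j = map_poly (\<lambda>q. poly q y) (P i j)" for y i j
  have cQ: "coeff (Q y i j) k = poly (coeff (P i j) k) y" for y i j k
    by (simp add: Q_def coeff_map_poly)
  have PQ: "poly (Q y i j) x = C x y $ i $ j" for x y i j
  proof -
    have "poly (map_poly (\<lambda>q. poly q y) p) x = poly (poly p [:x:]) y" for p
      by (induction p) (simp_all add: map_poly_pCons)
    thus ?thesis by (simp add: P Q_def)
  qed
  \<comment> \<open>Strong induction on the order k in x: all lower positive orders have already
    vanished, so the coefficient of x^k is a lowest-order term and is tangent to G for every
    y.\<close>
  have "coeff (P i j) k = 0" if "0 < k" for i j k
    using that
  proof (induction k arbitrary: i j rule: less_induct)
    case (less k)
    define M where "M y = (\<chi> i j. poly (coeff (P i j) k) y)" for y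
    have M_lie: "M y \<in> lie_algebra G" for y
    proof -
      have "(\<chi> i j. coeff (Q y i j) k) \<in> lie_algebra G"
      proof (rule lie_algebra_curve[where \<gamma> = "\<lambda>x. C x y"])
        show "coeff (Q y i j) l = 0" if "0 < l" "l < k" for i j l
          using less.IH that by (simp add: cQ)
      qed (use CG C0 GH less.prems PQ in auto)
      thus ?thesis by (simp add: M_def cQ)
    qed
    define D where "D = (\<Sum>i\<in>UNIV. \<Sum>j\<in>UNIV. degree (coeff (P i j) k))"
    have D: "degree (coeff (P i j) k) \<le> D" for i j
    proof -
      have "degree (coeff (P i j) k) \<le> (\<Sum>j\<in>UNIV. degree (coeff (P i j) k))"
        by (rule member_le_sum) auto
      also have "\<dots> \<le> D" unfolding D_def by (rule member_le_sum) auto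
      finally show ?thesis .
    qed
    define N where "N l = (\<chi> i j. coeff (coeff (P i j) k) l)" for l
    have MN: "M y = (\<Sum>l\<le>D. scale_mat (y ^ l) (N l))" for y
    proof -
      have "M y $ i $ j = (\<Sum>l\<le>D. scale_mat (y ^ l) (N l)) $ i $ j" for i j
      proof -
        have "poly (coeff (P i j) k) y = (\<Sum>l\<le>D. coeff (coeff (P i j) k) l * y ^ l)"
          unfolding poly_altdef using D[of i j]
          by (intro sum.mono_neutral_left) (auto simp: coeff_eq_0)
        thus ?thesis by (simp add: M_def N_def mult.commute)
      qed
      thus ?thesis by (simp add: vec_eq_iff)
    qed
    have NL: "N l \<in> lie_algebra G" if "l \<le> D" for l
      by (rule power_sum_in[OF lie_algebra_subspace _ that]) (use M_lie MN in metis)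
    \<comment> \<open>Compare the coefficients of x^k in t C(x,y) t^-1 = C(\<alpha>(t) x, \<beta>(t)
      y); doing the same in powers of y then gives the weight k\<alpha> + l\<beta> of
      \<open>N l\<close>.\<close>
    have Mt: "t ** M y ** matrix_inv t = scale_mat (\<alpha> t ^ k) (M (\<beta> t * y))" if t: "t \<in> T" for t y
    proof -
      have "(t ** M y ** matrix_inv t) $ i $ j = scale_mat (\<alpha> t ^ k) (M (\<beta> t * y)) $ i $ j" for i j
      proof -
        have "(\<Sum>b\<in>UNIV. \<Sum>a\<in>UNIV. smult (t $ i $ a * matrix_inv t $ b $ j) (Q y a b)) =
            pcompose (Q (\<beta> t * y) i j) [:0, \<alpha> t:]"
        proof (rule poly_eqI_nonzero)
          fix x :: 'f
          have "poly (\<Sum>b\<in>UNIV. \<Sum>a\<in>UNIV. smult (t $ i $ a * matrix_inv t $ b $ j) (Q y a b)) x =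
              (t ** C x y ** matrix_inv t) $ i $ j"
            by (simp add: poly_sum PQ matrix_mult_nth sum_distrib_left sum_distrib_right mult_ac)
          also have "\<dots> = poly (pcompose (Q (\<beta> t * y) i j) [:0, \<alpha> t:]) x"
            unfolding Ct[OF t] by (simp add: poly_pcompose PQ mult.commute)
          finally show "poly (\<Sum>b\<in>UNIV. \<Sum>a\<in>UNIV. smult (t $ i $ a * matrix_inv t $ b $ j) (Q y a b)) x =
            poly (pcompose (Q (\<beta> t * y) i j) [:0, \<alpha> t:]) x" .
        qed
        hence "coeff (\<Sum>b\<in>UNIV. \<Sum>a\<in>UNIV. smult (t $ i $ a * matrix_inv t $ b $ j) (Q y a b)) k =
            coeff (pcompose (Q (\<beta> t * y) i j) [:0, \<alpha> t:]) k" by simp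
        thus ?thesis
          by (simp add: coeff_sum coeff_pcompose_linear cQ M_def matrix_mult_nth sum_distrib_left sum_distrib_right mult_ac)
      qed
      thus ?thesis by (simp add: vec_eq_iff)
    qed
    have Nt: "t ** N l ** matrix_inv t = scale_mat (\<alpha> t ^ k * \<beta> t ^ l) (N l)" if t: "t \<in> T" and l: "l \<le> D" for t l
    proof -
      have "t ** N l ** matrix_inv t - scale_mat (\<alpha> t ^ k * \<beta> t ^ l) (N l) \<in> {0}"
      proof (rule power_sum_in[OF is_subspace_zero _ l, where N = "\<lambda>l. t ** N l ** matrix_inv t - scale_mat (\<alpha> t ^ k * \<beta> t ^ l) (N l)"])
        fix s :: 'f
        have "(\<Sum>l\<le>D. scale_mat (s ^ l) (t ** N l ** matrix_inv t)) = t ** M s ** matrix_inv t"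
          unfolding MN by (simp add: matrix_sum_mult scale_mat_mult)
        also have "\<dots> = scale_mat (\<alpha> t ^ k) (M (\<beta> t * s))" by (rule Mt[OF t])
        also have "\<dots> = (\<Sum>l\<le>D. scale_mat (s ^ l) (scale_mat (\<alpha> t ^ k * \<beta> t ^ l) (N l)))"
          unfolding MN by (simp add: vec_eq_iff sum_distrib_left power_mult_distrib mult_ac)
        finally have "(\<Sum>l\<le>D. scale_mat (s ^ l) (t ** N l ** matrix_inv t)) -
            (\<Sum>l\<le>D. scale_mat (s ^ l) (scale_mat (\<alpha> t ^ k * \<beta> t ^ l) (N l))) = 0" by simp
        thus "(\<Sum>l\<le>D. scale_mat (s ^ l) (t ** N l ** matrix_inv t - scale_mat (\<alpha> t ^ k * \<beta> t ^ l) (N l))) \<in> {0}"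
          by (simp add: vec_eq_iff sum_subtractf right_diff_distrib mult.assoc)
      qed
      thus ?thesis by simp
    qed
    \<comment> \<open>The term of order 0 in y is read off at y = 0, where the commutator is the
      identity for all x.\<close>
    have N0: "N 0 = 0"
    proof -
      have "Q 0 i j = [:mat 1 $ i $ j:]" for i j
        by (rule poly_eqI_nonzero) (simp add: PQ C0)
      hence "coeff (Q 0 i j) k = 0" for i j using less.prems by (simp add: coeff_pCons split: nat.splits)
      thus ?thesis by (simp add: N_def vec_eq_iff cQ poly_0_coeff_0)
    qed
    have "N l = 0" if l: "1 \<le> l" "l \<le> D" for l
    proof (rule ccontr)
      assume "N l \<noteq> 0"
      define \<xi> where "\<xi> = (\<lambda>t\<in>T. \<alpha> t ^ k * \<beta> t ^ l)"
      have pw: "(\<lambda>t\<in>T. \<eta> t ^ m) \<in> characters T" if "\<eta> \<in> characters T" for \<eta> m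
      proof (induction m)
        case 0
        thus ?case using characters_one[OF T(1)] by (simp add: restrict_def)
      next
        case (Suc m)
        have e: "(\<lambda>t\<in>T. \<eta> t * (\<lambda>t\<in>T. \<eta> t ^ m) t) = (\<lambda>t\<in>T. \<eta> t ^ Suc m)" by (auto simp: restrict_def)
        show ?case using characters_mult[OF T(1) that Suc] unfolding e .
      qed
      have "(\<lambda>t\<in>T. (\<lambda>t\<in>T. \<alpha> t ^ k) t * (\<lambda>t\<in>T. \<beta> t ^ l) t) = \<xi>" by (auto simp: restrict_def \<xi>_def)
      hence ch: "\<xi> \<in> characters T" using characters_mult[OF T(1) pw[OF \<alpha>, of k] pw[OF \<beta>, of l]] by simp
      have "\<xi> \<in> roots G T"
        using ch nontriv[of k l] less.prems l \<open>N l \<noteq> 0\<close> NL[OF l(2)] Nt[OF _ l(2)]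
        unfolding roots_def root_space_def by (auto simp: \<xi>_def scale_mat_def)
      thus False using no_root[of k l] less.prems l by (simp add: \<xi>_def)
    qed
    hence Nz: "N l = 0" if "l \<le> D" for l using N0 that by (cases l) auto
    have "coeff (coeff (P i j) k) l = 0" for l
    proof (cases "l \<le> D")
      case True
      thus ?thesis using Nz[OF True] by (simp add: N_def vec_eq_iff)
    next
      case False
      thus ?thesis using D[of i j] by (intro coeff_eq_0) simp
    qed
    thus ?case by (simp add: poly_eq_iff)
  qed
  hence "coeff (Q y i j) k = 0" if "0 < k" for y i j k using that by (simp add: cQ)
  hence Qc: "Q y i j = [:coeff (Q y i j) 0:]" for y i j
    by (simp add: poly_eq_iff coeff_pCons split: nat.splits)
  have "poly (Q y i j) x = coeff (Q y i j) 0" for y i j x by (subst Qc) simp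
  hence "C x y $ i $ j = C 0 y $ i $ j" for i j using PQ by metis
  hence "C x y = mat 1" using C0 by (simp add: vec_eq_iff)
  hence "u x ** w y ** matrix_inv (u x) ** matrix_inv (w y) = mat 1" by (simp add: C_def U(4) Wp(4))
  hence "u x ** w y ** matrix_inv (u x) ** matrix_inv (w y) ** w y ** u x = w y ** u x" by simp
  thus ?thesis using U(8) Wp(8) by simp
qed

section \<open>The normalizer and the elements \<open>\<sigma>\<^sub>i\<close>\<close>

lemma alg_group_iso_conj:
  fixes v :: "'f::field \<Rightarrow> 'f ^'m ^'m" and g :: "'f ^'m ^'m"
  assumes iso: "alg_group_iso Ga Ga_coords (GL_on (range v)) GL_coords v"
    and closed: "zariski_closed (range v)" and g: "invertible g"
  shows "alg_group_iso Ga Ga_coords (GL_on (range (\<lambda>x. g ** v x ** matrix_inv g))) GL_coords (\<lambda>x. g ** v x ** matrix_inv g)"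
    and "zariski_closed (range (\<lambda>x. g ** v x ** matrix_inv g))"
proof -
  define w where "w x = g ** v x ** matrix_inv g" for x
  have h: "v \<in> hom Ga (GL_on (range v))" and b: "bij_betw v UNIV (range v)"
    and r: "regular_map Ga_coords UNIV GL_coords v"
    and ri: "regular_map GL_coords (range v) Ga_coords (inv_into UNIV v)"
    using iso by (auto simp: alg_group_iso_def iso_def)
  have inj: "inj v" using b by (simp add: bij_betw_def)
  have vw: "matrix_inv g ** w x ** g = v x" for x
    using g by (simp add: w_def matrix_mul_assoc matrix_inv_ex)
  have injw: "inj w" using vw inj by (metis injI injD)
  have inv: "inv_into UNIV w A = inv_into UNIV v (matrix_inv g ** A ** g)" if "A \<in> range w" for A
  proof -
    obtain x where "A = w x" using \<open>A \<in> range w\<close> by blast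
    thus ?thesis using vw inj injw by simp
  qed
  have v_add: "v (x + y) = v x ** v y" for x y using hom_mult[OF h, of x y] by simp
  have w_add: "w (x + y) = w x ** w y" for x y
    using g v_add by (simp add: w_def matrix_mul_assoc)
  have "w \<in> iso Ga (GL_on (range w))"
    using w_add injw by (auto simp: iso_def hom_def bij_betw_def)
  moreover have "regular_map Ga_coords UNIV GL_coords w"
    unfolding w_def by (rule regular_map_GL_conj[OF r])
  moreover have "regular_map GL_coords (range w) Ga_coords (inv_into UNIV w)"
  proof -
    have "regular_map GL_coords (range w) Ga_coords (\<lambda>A. inv_into UNIV v (matrix_inv g ** A ** g))"
      by (rule regular_map_comp[OF regular_map_GL_lr _ ri]) (use vw in auto)
    thus ?thesis using inv by (subst regular_map_cong) auto
  qed
  ultimately show "alg_group_iso Ga Ga_coords (GL_on (range (\<lambda>x. g ** v x ** matrix_inv g))) GL_coords (\<lambda>x. g ** v x ** matrix_inv g)"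
    by (simp add: alg_group_iso_def w_def[abs_def])
  have "range w = {A. invertible A \<and> matrix_inv g ** A ** g \<in> range v}"
  proof safe
    fix x
    have "invertible (v x)" using closed by (auto simp: zariski_closed_iff)
    thus "invertible (w x)" using g by (simp add: w_def invertible_mult invertible_matrix_inv)
    show "matrix_inv g ** w x ** g \<in> range v" using vw by simp
  next
    fix A x assume "matrix_inv g ** A ** g = v x"
    hence "A = w x" using g unfolding w_def
      by (metis matrix_mul_assoc mult_inv_cancel(2,3))
    thus "A \<in> range w" by simp
  qed
  moreover have "zariski_closed {A. invertible A \<and> matrix_inv g ** A ** g \<in> range v}"
    using g closed by (intro zariski_closed_vimage regular_map_GL_lr) (auto simp: invertible_mult invertible_matrix_inv)
  ultimately show "zariski_closed (range (\<lambda>x. g ** v x ** matrix_inv g))" by (simp add: w_def[abs_def])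
qed

context realized_D
begin

abbreviation "N \<equiv> carrier (NT R)"

lemma NT_simps [simp]: "mult (NT R) = (**)" "one (NT R) = mat 1"
  by (simp_all add: NT_def)

lemma N_sub: "subgroup N GL" and N_G: "N \<subseteq> G" and T_normal: "T \<lhd> NT R"
proof -
  interpret G: group "GL_on G" by (rule GH(5))
  have TG: "subgroup T (GL_on G)"
    by (rule group.subgroup_incl[OF group_GL T_sub G_sub T_G])
  have s: "subgroup (normalizer (GL_on G) T) (GL_on G)"
    using G.normalizer_imp_subgroup T_G by simp
  thus "N \<subseteq> G" using subgroup.subset[OF s] by (simp add: NT_def)
  show "subgroup N GL"
    using group.incl_subgroup[OF group_GL G_sub s] by (simp add: NT_def)
  show "T \<lhd> NT R" using G.subgroup_in_normalizer[OF TG] by (simp add: NT_def)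
qed

lemma NT_GL: "NT R = GL_on N"
  by (simp add: NT_def)

lemmas NH = GL_subgroup_facts[OF N_sub]

lemma NT_group: "group (NT R)"
  using NH(5) NT_GL by simp

lemma NT_inv: "g \<in> N \<Longrightarrow> inv\<^bsub>NT R\<^esub> g = matrix_inv g"
  using NH(6) NT_GL by metis

lemma T_N: "t \<in> T \<Longrightarrow> t \<in> N"
  using T_normal normal_imp_subgroup subgroup.mem_carrier by metis

lemma N_conj: "g \<in> N \<Longrightarrow> t \<in> T \<Longrightarrow> g ** t ** matrix_inv g \<in> T"
  using normal.inv_op_closed2[OF T_normal] by (metis NT_inv NT_simps(1))

lemma N_conj': "g \<in> N \<Longrightarrow> t \<in> T \<Longrightarrow> matrix_inv g ** t ** g \<in> T"
  using N_conj[OF NH(4)] matrix_inv_inv NH(1) by metis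

lemma realization_root:
  assumes "\<alpha> \<in> roots G T"
  shows param: "is_root_param G T \<alpha> (rsub R \<alpha>)"
    and param_unique: "is_root_param G T \<alpha> v \<Longrightarrow> range v = range (rsub R \<alpha>)"
    and sigma_root_N: "sigma_root R \<alpha> \<in> N"
    and sigma_root_proj: "proj R (sigma_root R \<alpha>) = refl R \<alpha>"
    and sigma_root_formula: "x \<noteq> 0 \<Longrightarrow>
     rsub R \<alpha> x ** rsub R (neg_char T \<alpha>) (- inverse x) ** rsub R \<alpha> x = coroot R \<alpha> x ** sigma_root R \<alpha>"
proof -
  note r = bspec[OF realization[unfolded realization_def Phi_def] assms]
  show "is_root_param G T \<alpha> (rsub R \<alpha>)" "sigma_root R \<alpha> \<in> N" "proj R (sigma_root R \<alpha>) = refl R \<alpha>"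
    "x \<noteq> 0 \<Longrightarrow>
     rsub R \<alpha> x ** rsub R (neg_char T \<alpha>) (- inverse x) ** rsub R \<alpha> x = coroot R \<alpha> x ** sigma_root R \<alpha>"
    using r by simp_all
  show "is_root_param G T \<alpha> v \<Longrightarrow> range v = range (rsub R \<alpha>)"
    using r unfolding is_root_subgroup_def by meson
qed

lemmas paramD = root_paramD[OF param G_sub]

lemma roots_characters: "\<alpha> \<in> roots G T \<Longrightarrow> \<alpha> \<in> characters T"
  by (simp add: roots_def)

lemmas rootD = charactersD[OF T_sub roots_characters]

lemma coroot_facts:
  assumes "\<alpha> \<in> roots G T"
  shows "coroot R \<alpha> \<in> cocharacters T" "x \<noteq> 0 \<Longrightarrow> \<alpha> (coroot R \<alpha> x) = x\<^sup>2"
  using coroot_is[OF assms] by (auto simp: is_coroot_def has_pairing_def)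

text \<open>Take a square root y of b and evaluate at the coroot of \<alpha>, where \<alpha> takes
  the value y^2.\<close>

lemma root_surj:
  assumes "\<alpha> \<in> roots G T" "b \<noteq> 0"
  obtains t where "t \<in> T" "\<alpha> t = b"
proof -
  obtain y where y: "y ^ 2 = b" using nth_root_exists[of 2 b] by auto
  hence "y \<noteq> 0" using assms(2) by auto
  thus ?thesis using that coroot_facts[OF assms(1)] cocharactersD(1)[OF T_sub] y by metis
qed

text \<open>The coroot condition applied to \<alpha> itself: the reflection of \<alpha> is \<alpha>
  - 2\<alpha>.\<close>

lemma neg_root:
  assumes \<alpha>: "\<alpha> \<in> roots G T"
  shows "neg_char T \<alpha> \<in> roots G T"
proof -
  obtain k where k: "has_pairing \<alpha> (coroot R \<alpha>) k" "(\<lambda>t\<in>T. \<alpha> t * \<alpha> t powi (- k)) \<in> roots G T"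
    using coroot_is[OF \<alpha>] \<alpha> by (auto simp: is_coroot_def)
  have "x powi k = x powi 2" if "x \<noteq> 0" for x :: 'f
    using k(1) coroot_facts(2)[OF \<alpha> that] that by (simp add: has_pairing_def)
  hence "k = 2" using powi_eq_iff[of k 2, where 'f = 'f] by blast
  moreover have "(\<lambda>t\<in>T. \<alpha> t * \<alpha> t powi (- 2)) = neg_char T \<alpha>"
    unfolding neg_char_def using rootD(2)[OF \<alpha>]
    by (intro restrict_ext) (simp add: power_int_minus power2_eq_square field_simps)
  ultimately show ?thesis using k(2) by simp
qed

text \<open>The conjugated parametrization is a root parametrization for \<beta>, so it has the same
  image as the given one and differs by a map f of the field. Equivariance under T gives f(bx) = b
  f(x) for all nonzero b, since \<beta> takes every nonzero value, so f is multiplication by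
  f(1).\<close>

lemma conj_rsub:
  assumes g: "g \<in> N" and \<alpha>: "\<alpha> \<in> roots G T" and \<beta>: "\<beta> \<in> roots G T"
    and act: "\<And>t. t \<in> T \<Longrightarrow> \<beta> t = \<alpha> (matrix_inv g ** t ** g)"
  obtains c where "c \<noteq> 0" "\<And>x. g ** rsub R \<alpha> x ** matrix_inv g = rsub R \<beta> (c * x)"
proof -
  have gi: "invertible g" and gG: "g \<in> G" using g NH N_G by auto
  define v where "v x = g ** rsub R \<alpha> x ** matrix_inv g" for x
  have vt: "t ** v x ** matrix_inv t = v (\<beta> t * x)" if t: "t \<in> T" for t x
  proof -
    have ti: "invertible t" using TH t by blast
    define s where "s = matrix_inv g ** t ** g"
    have s: "s \<in> T" unfolding s_def by (rule N_conj'[OF g t])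
    have tg: "t ** g = g ** s" using gi by (simp add: s_def matrix_mul_assoc matrix_inv_ex)
    have gt: "matrix_inv g ** matrix_inv t = matrix_inv s ** matrix_inv g"
      using gi ti by (simp add: s_def matrix_inv_mult invertible_mult invertible_matrix_inv matrix_inv_inv matrix_mul_assoc)
    have "t ** v x ** matrix_inv t = (t ** g) ** rsub R \<alpha> x ** (matrix_inv g ** matrix_inv t)"
      by (simp add: v_def matrix_mul_assoc)
    also have "\<dots> = g ** (s ** rsub R \<alpha> x ** matrix_inv s) ** matrix_inv g"
      unfolding tg gt by (simp add: matrix_mul_assoc)
    finally have "t ** v x ** matrix_inv t = g ** (s ** rsub R \<alpha> x ** matrix_inv s) ** matrix_inv g" .
    thus ?thesis using paramD(5)[OF \<alpha> s] act[OF t] by (simp add: v_def s_def)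
  qed
  have p: "alg_group_iso Ga Ga_coords (GL_on (range (rsub R \<alpha>))) GL_coords (rsub R \<alpha>)" "zariski_closed (range (rsub R \<alpha>))"
    using param[OF \<alpha>] by (auto simp: is_root_param_def)
  have "is_root_param G T \<beta> v"
    unfolding is_root_param_def
    using alg_group_iso_conj[OF p gi] vt GH(3,4) gG paramD(1)[OF \<alpha>] by (auto simp: v_def[abs_def])
  note vp = this
  have "\<exists>y. v x = rsub R \<beta> y" for x using param_unique[OF \<beta> vp] by blast
  then obtain f where f: "\<And>x. v x = rsub R \<beta> (f x)" by metis
  have hom: "f (b * x) = b * f x" if b: "b \<noteq> 0" for b x
  proof -
    obtain t where t: "t \<in> T" "\<beta> t = b" using root_surj[OF \<beta> b] .
    have "rsub R \<beta> (f (b * x)) = rsub R \<beta> (b * f x)"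
      using vt[OF t(1), of x] paramD(5)[OF \<beta> t(1), of "f x"] t(2) f by simp
    thus ?thesis using paramD(6)[OF \<beta>] by simp
  qed
  have f0: "f 0 = 0"
    using f[of 0] root_paramD(3)[OF vp G_sub] paramD(3,6)[OF \<beta>] by metis
  have "f 1 \<noteq> 0"
    using f f0 root_paramD(6)[OF vp G_sub, of 0 1] by (metis zero_neq_one)
  moreover have "f x = f 1 * x" for x
    using hom[of x 1] f0 by (cases "x = 0") (auto simp: mult.commute)
  ultimately show ?thesis using that[of "f 1"] f v_def by metis
qed

text \<open>A rank-one argument. Otherwise some nontrivial element of the opposite root subgroup
  would lie in the product of the root subgroup with T. Scaling by T then yields a common nontrivial
  element of both root subgroups, and their opposite weights are incompatible with
  additivity.\<close>

lemma opposite_unique: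
  fixes c c' :: 'f
  assumes \<alpha>: "\<alpha> \<in> roots G T" and c: "c \<noteq> 0" and t: "t \<in> T"
    and eq: "rsub R \<alpha> c ** rsub R (neg_char T \<alpha>) (- c') ** rsub R \<alpha> c = t ** sigma_root R \<alpha>"
  shows "c' = inverse c"
proof (rule ccontr)
  assume ne: "c' \<noteq> inverse c"
  define u w where "u = rsub R \<alpha>" and "w = rsub R (neg_char T \<alpha>)"
  note U = paramD[OF \<alpha>, folded u_def] and Wp = paramD[OF neg_root[OF \<alpha>], folded w_def]
  define s where "s = coroot R \<alpha> c"
  have s: "s \<in> T" unfolding s_def using coroot_facts(1)[OF \<alpha>] cocharactersD(1)[OF T_sub] c by blast
  have si: "invertible s" and ti: "invertible t" using s t TH by auto
  define t' where "t' = t ** matrix_inv s"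
  have t': "t' \<in> T" unfolding t'_def by (intro TH(3,4) s t)
  have t'i: "invertible t'" using t' TH by auto
  have \<sigma>: "sigma_root R \<alpha> = matrix_inv s ** (u c ** w (- inverse c) ** u c)"
    using sigma_root_formula[OF \<alpha> c] si by (simp add: u_def w_def s_def)
  define d where "d = inverse c - c'"
  have d: "d \<noteq> 0" using ne by (simp add: d_def)
  have "u c ** w (- c') ** u c = t' ** u c ** w (- inverse c) ** u c"
    using eq \<sigma> by (simp add: t'_def u_def w_def matrix_mul_assoc)
  hence "u c ** w (- c') ** u c ** matrix_inv (u c) ** w (inverse c) =
      t' ** u c ** w (- inverse c) ** u c ** matrix_inv (u c) ** w (inverse c)" by simp
  hence "u c ** (w (- c') ** w (inverse c)) = t' ** u c ** (w (- inverse c) ** w (inverse c))"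
    using U(8) by (simp add: matrix_mul_assoc)
  moreover have "w (- inverse c) ** w (inverse c) = mat 1" by (metis Wp(2,3) add.left_inverse)
  moreover have "w (- c') ** w (inverse c) = w d" using Wp(2)[of "- c'" "inverse c"] by (simp add: d_def)
  ultimately have 1: "u c ** w d = t' ** u c" by simp
  define e where "e = \<alpha> t' * c - c"
  have "t' ** u c = u (\<alpha> t' * c) ** t'" using U(5)[OF t', of c] t'i by (metis mult_inv_cancel(4))
  hence "u (- c) ** (u c ** w d) = u (- c) ** u (\<alpha> t' * c) ** t'" using 1 by (simp add: matrix_mul_assoc)
  moreover have "u (- c) ** u c = mat 1" by (metis U(2,3) add.left_inverse)
  moreover have "u (- c) ** u (\<alpha> t' * c) = u e" using U(2)[of "- c" "\<alpha> t' * c"] by (simp add: e_def)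
  ultimately have wd: "w d = u e ** t'" by (simp add: matrix_mul_assoc)
  have conj: "w (inverse b * x) = u (b * y) ** z" if b: "b \<noteq> 0" and z: "z \<in> T" and wx: "w x = u y ** z" for b x y z
  proof -
    obtain r where r: "r \<in> T" "\<alpha> r = b" using root_surj[OF \<alpha> b] .
    have ri: "invertible r" using r TH by auto
    have zr: "r ** z ** matrix_inv r = z" using T_comm[OF r(1) z] ri by simp
    have "w (inverse b * x) = r ** (u y ** z) ** matrix_inv r"
      using Wp(5)[OF r(1), of x] r wx by (simp add: neg_char_def)
    also have "\<dots> = (r ** u y ** matrix_inv r) ** (r ** z ** matrix_inv r)"
      using ri by (simp add: matrix_mul_assoc)
    finally show ?thesis using U(5)[OF r(1), of y] r zr by simp
  qed
  \<comment> \<open>The torus part t' does not change under conjugation by T, so it cancels in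
    quotients of conjugates of \<open>w d\<close>; such quotients lie in both root
    subgroups.\<close>
  have diff: "w (inverse b * d - d) = u (b * e - e)" if b: "b \<noteq> 0" for b
  proof -
    have "w (inverse b * d) ** matrix_inv (w d) = u (b * e) ** t' ** matrix_inv (u e ** t')"
      using conj[OF b t' wd] wd by simp
    also have "\<dots> = u (b * e) ** matrix_inv (u e)"
      using t'i U(8) by (simp add: matrix_inv_mult matrix_mul_assoc)
    finally show ?thesis using Wp(2)[of "inverse b * d" "- d"] Wp(4)[of d] U(2)[of "b * e" "- e"] U(4)[of e] by simp
  qed
  \<comment> \<open>A scaling factor b other than 1 makes the common element nontrivial.\<close>
  obtain b :: 'f where b: "b \<noteq> 0" "b \<noteq> 1"
    using ex_pow_ne_1[of 1, where 'f = 'f] by auto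
  define D E where "D = inverse b * d - d" and "E = b * e - e"
  have "D = (inverse b - 1) * d" by (simp add: D_def algebra_simps)
  moreover have "inverse b - 1 \<noteq> 0" using b by (metis eq_iff_diff_eq_0 inverse_eq_1_iff)
  ultimately have D: "D \<noteq> 0" using d by simp
  have wD: "w D = u E" using diff[OF b(1)] by (simp add: D_def E_def)
  have E: "E \<noteq> 0"
  proof
    assume "E = 0"
    hence "w D = w 0" using wD U(3) Wp(3) by simp
    thus False using Wp(6) D by simp
  qed
  have wm: "w (inverse m * D) = u (m * E)" if "m \<noteq> 0" for m
    using conj[OF that TH(2), of D E] wD by simp
  \<comment> \<open>Scaling by m multiplies E and divides D. Applied to D/m + D, additivity of both
    parametrizations forces 1/(1/m + 1) = m + 1.\<close>
  have quad: "m * m + m + 1 = 0" if m: "m \<noteq> 0" "m + 1 \<noteq> 0" for m :: 'f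
  proof -
    define m' where "m' = inverse (inverse m + 1)"
    have s0: "inverse m + 1 \<noteq> 0"
    proof
      assume "inverse m + 1 = 0"
      hence "m * (inverse m + 1) = 0" by simp
      thus False using m by (simp add: distrib_left add.commute)
    qed
    hence m': "m' \<noteq> 0" "inverse m' = inverse m + 1" by (auto simp: m'_def)
    have "u (m' * E) = w (inverse m * D + D)" using wm[OF m'(1)] m'(2) by (simp add: algebra_simps)
    also have "\<dots> = u (m * E + E)" using Wp(2) wm[OF m(1)] wD U(2) by simp
    finally have "m' * E = (m + 1) * E" using U(6) by (simp add: algebra_simps)
    hence "m' = m + 1" using E by simp
    moreover have "m' * (inverse m + 1) = 1" using s0 by (simp add: m'_def)
    ultimately have "(m + 1) * (inverse m + 1) = 1" by simp
    hence "(m + 1) * (inverse m + 1) * m = m" by simp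
    moreover have "(m + 1) * (inverse m + 1) * m = (m + 1) * (1 + m)" using m(1) by (simp add: field_simps)
    ultimately show ?thesis by (simp add: algebra_simps)
  qed
  \<comment> \<open>The factor m + 1 absorbs the excluded value m = -1; a nonzero polynomial cannot
    vanish at all nonzero elements of an infinite field.\<close>
  have "poly ([:1, 1, 1:] * [:1, 1:]) m = 0" if "m \<noteq> 0" for m :: 'f
  proof -
    have "poly [:1, 1, 1:] m = m * m + m + 1" "poly [:1, 1:] m = m + 1" by (simp_all add: algebra_simps)
    thus ?thesis unfolding poly_mult using quad[OF that] by (metis mult_zero_left mult_zero_right)
  qed
  hence "[:1, 1, 1:] * [:1, 1:] = (0 :: 'f poly)" by (intro poly_eqI_nonzero) simp
  thus False by simp
qed

text \<open>Conjugation by g rescales the two opposite root subgroups by factors c and c'.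
  Membership in the coset of \<open>sigma_root R \<beta>\<close> forces c' to be the inverse of c by
  \<open>opposite_unique\<close>, and the realization formula evaluates the resulting triple
  product.\<close>

lemma conj_sigma:
  assumes g: "g \<in> N" and \<alpha>: "\<alpha> \<in> roots G T" and \<beta>: "\<beta> \<in> roots G T"
    and act: "\<And>t. t \<in> T \<Longrightarrow> \<beta> t = \<alpha> (matrix_inv g ** t ** g)"
    and coset: "t \<in> T" "g ** sigma_root R \<alpha> ** matrix_inv g = t ** sigma_root R \<beta>"
  obtains c where "c \<noteq> 0" "g ** sigma_root R \<alpha> ** matrix_inv g = coroot R \<beta> c ** sigma_root R \<beta>"
proof -
  have gi: "invertible g" using g NH by auto
  obtain c where c: "c \<noteq> 0" "\<And>x. g ** rsub R \<alpha> x ** matrix_inv g = rsub R \<beta> (c * x)"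
    by (rule conj_rsub[OF g \<alpha> \<beta> act]) blast+
  have act': "neg_char T \<beta> t = neg_char T \<alpha> (matrix_inv g ** t ** g)" if "t \<in> T" for t
    using act[OF that] that N_conj'[OF g that] by (simp add: neg_char_def)
  obtain c' where c': "\<And>x. g ** rsub R (neg_char T \<alpha>) x ** matrix_inv g = rsub R (neg_char T \<beta>) (c' * x)"
    by (rule conj_rsub[OF g neg_root[OF \<alpha>] neg_root[OF \<beta>] act']) blast+
  have e: "g ** sigma_root R \<alpha> ** matrix_inv g =
      rsub R \<beta> c ** rsub R (neg_char T \<beta>) (- c') ** rsub R \<beta> c"
  proof -
    have "g ** sigma_root R \<alpha> ** matrix_inv g = (g ** rsub R \<alpha> 1 ** matrix_inv g) **
        (g ** rsub R (neg_char T \<alpha>) (- 1) ** matrix_inv g) ** (g ** rsub R \<alpha> 1 ** matrix_inv g)"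
      using gi by (simp add: sigma_root_def matrix_mul_assoc)
    thus ?thesis using c(2)[of 1] c'[of "- 1"] by simp
  qed
  have "c' = inverse c" using opposite_unique[OF \<beta> c(1) coset(1), of c'] e coset(2) by simp
  thus ?thesis using that[OF c(1)] e sigma_root_formula[OF \<beta> c(1)] by simp
qed

text \<open>At x = -1 the left side of the realization formula is the inverse of
  \<open>sigma_root R \<alpha>\<close>.\<close>

lemma sigma_root_square:
  assumes \<alpha>: "\<alpha> \<in> roots G T"
  shows "sigma_root R \<alpha> ** sigma_root R \<alpha> = coroot R \<alpha> (- 1)"
proof -
  note U = paramD[OF \<alpha>] and Wp = paramD[OF neg_root[OF \<alpha>]]
  have i: "invertible (sigma_root R \<alpha>)" using sigma_root_N[OF \<alpha>] NH by auto
  have "coroot R \<alpha> (- 1) ** sigma_root R \<alpha> = rsub R \<alpha> (- 1) ** rsub R (neg_char T \<alpha>) 1 ** rsub R \<alpha> (- 1)"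
    using sigma_root_formula[OF \<alpha>, of "- 1"] by simp
  also have "\<dots> = matrix_inv (sigma_root R \<alpha>)"
    using U(4)[of 1] Wp(4)[of "- 1"] U(8) Wp(8)
    by (simp add: sigma_root_def matrix_inv_mult invertible_mult matrix_mul_assoc)
  finally have a: "coroot R \<alpha> (- 1) ** sigma_root R \<alpha> = matrix_inv (sigma_root R \<alpha>)" .
  have t: "coroot R \<alpha> (- 1) \<in> T" using coroot_facts(1)[OF \<alpha>] cocharactersD(1)[OF T_sub] by simp
  have m: "matrix_inv (coroot R \<alpha> (- 1)) = coroot R \<alpha> (- 1)"
    using cocharactersD(6)[OF T_sub coroot_facts(1)[OF \<alpha>], of "- 1"] by simp
  have "coroot R \<alpha> (- 1) ** sigma_root R \<alpha> ** sigma_root R \<alpha> = mat 1" using a i matrix_inv_ex by simp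
  hence "matrix_inv (coroot R \<alpha> (- 1)) ** (coroot R \<alpha> (- 1) ** (sigma_root R \<alpha> ** sigma_root R \<alpha>)) =
      matrix_inv (coroot R \<alpha> (- 1))" by (simp add: matrix_mul_assoc)
  hence "sigma_root R \<alpha> ** sigma_root R \<alpha> = matrix_inv (coroot R \<alpha> (- 1))"
    unfolding mult_inv_cancel(1)[OF TH(1)[OF t]] .
  thus ?thesis using m by simp
qed

end

section \<open>Braid relations\<close>

context realized_D
begin

abbreviation "\<sigma> \<equiv> sigma R"

lemma sigma_N: "i \<in> {1..n} \<Longrightarrow> \<sigma> i \<in> N"
  using sigma_root_N[OF a_root] by (simp add: sigma_def)

lemma sigma_inv: "i \<in> {1..n} \<Longrightarrow> invertible (\<sigma> i)"
  using sigma_N NH by blast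

lemma proj_eq: "proj R g = (\<lambda>t. t ** g) ` T"
  by (auto simp: proj_def r_coset_def)

lemma proj_sigma: "i \<in> {1..n} \<Longrightarrow> proj R (\<sigma> i) = srefl R i"
  using sigma_root_proj[OF a_root] by (simp add: sigma_def srefl_def)

lemma act_sigma:
  assumes i: "i \<in> {1..n}" and t: "t \<in> T"
  shows "\<sigma> i ** t ** matrix_inv (\<sigma> i) = t ** matrix_inv (c i (a i t))"
proof -
  have "mat 1 ** \<sigma> i \<in> proj R (\<sigma> i)" unfolding proj_eq using TH(2) by blast
  hence "\<sigma> i \<in> refl R (a i)" using proj_sigma[OF i] by (simp add: srefl_def)
  thus ?thesis using t by (simp add: refl_def)
qed

lemma refl_coset:
  assumes i: "i \<in> {1..n}" and g: "g \<in> N" and act: "\<And>t. t \<in> T \<Longrightarrow> g ** t ** matrix_inv g = \<sigma> i ** t ** matrix_inv (\<sigma> i)"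
  obtains t where "t \<in> T" "g = t ** \<sigma> i"
proof -
  have "g \<in> refl R (a i)" using g act act_sigma[OF i] by (simp add: refl_def)
  hence "g \<in> proj R (\<sigma> i)" using proj_sigma[OF i] by (simp add: srefl_def)
  thus ?thesis using that by (auto simp: proj_eq)
qed

text \<open>If g centralizes T, then g \<sigma>_1 acts on T like s_1. By definition
  \<open>refl\<close> contains all elements of N acting this way, and the realization identifies it
  with the coset T \<sigma>_1; cancelling \<sigma>_1 puts g into T.\<close>

lemma centralizer_T:
  assumes g: "g \<in> N" and act: "\<And>t. t \<in> T \<Longrightarrow> g ** t ** matrix_inv g = t"
  shows "g \<in> T"
proof -
  have one: "1 \<in> {1..n}" using rank by simp
  have i: "invertible g" "invertible (\<sigma> 1)" using g NH sigma_inv[OF one] by auto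
  have "(g ** \<sigma> 1) ** t ** matrix_inv (g ** \<sigma> 1) = \<sigma> 1 ** t ** matrix_inv (\<sigma> 1)" if t: "t \<in> T" for t
  proof -
    have "(g ** \<sigma> 1) ** t ** matrix_inv (g ** \<sigma> 1) = g ** (\<sigma> 1 ** t ** matrix_inv (\<sigma> 1)) ** matrix_inv g"
      using i by (simp add: matrix_inv_mult matrix_mul_assoc)
    thus ?thesis using act[OF N_conj[OF sigma_N[OF one] t]] by simp
  qed
  then obtain t where t: "t \<in> T" "g ** \<sigma> 1 = t ** \<sigma> 1"
    using refl_coset[OF one NH(3)[OF g sigma_N[OF one]]] by metis
  hence "g = t" using i by (metis mult_inv_cancel(3))
  thus ?thesis using t by simp
qed

text \<open>The reflection s_i on coordinate vectors: the last one exchanges two coordinates and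
  inverts them, the others only exchange.\<close>

definition sact :: "nat \<Rightarrow> (nat \<Rightarrow> 'f) \<Rightarrow> nat \<Rightarrow> 'f" where
  "sact i d = (\<lambda>k. if i < n then (if k = i then d (i + 1) else if k = i + 1 then d i else d k)
     else (if k = n - 1 then inverse (d n) else if k = n then inverse (d (n - 1)) else d k))"

lemma sact_apply:
  "sact i d k = (if i < n then (if k = i then d (i + 1) else if k = i + 1 then d i else d k)
     else (if k = n - 1 then inverse (d n) else if k = n then inverse (d (n - 1)) else d k))"
  by (simp add: sact_def)

lemma nz_sact: "i \<in> {1..n} \<Longrightarrow> nz d \<Longrightarrow> nz (sact i d)"
  using rank by (auto simp: nz_def sact_def)

lemma sact_invol: "sact i (sact i d) = d"
  using rank by (auto simp: sact_def fun_eq_iff)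

lemma nz_inverse: "nz d \<Longrightarrow> nz (\<lambda>k. inverse (d k))"
  by (simp add: nz_def)

lemma act_tau:
  assumes i: "i \<in> {1..n}" and d: "nz d"
  shows "\<sigma> i ** tau d ** matrix_inv (\<sigma> i) = tau (sact i d)"
proof -
  let ?x = "a i (tau d)"
  have x: "?x \<noteq> 0" using aD(2)[OF i tau_in[OF d]] .
  have "\<sigma> i ** tau d ** matrix_inv (\<sigma> i) = tau d ** matrix_inv (tau (co i ?x))"
    using act_sigma[OF i tau_in[OF d]] tau_co[OF i x] by simp
  also have "\<dots> = tau (\<lambda>k. d k * inverse (co i ?x k))"
    using tau_inverse[OF nz_co[OF x]] tau_mult[OF d nz_inverse[OF nz_co[OF x]]] by simp
  also have "\<dots> = tau (sact i d)"
  proof (rule tau_cong)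
    fix k assume k: "1 \<le> k" "k \<le> n"
    show "d k * inverse (co i ?x k) = sact i d k"
    proof (cases "i < n")
      case True
      thus ?thesis using nzD[OF d, of i] nzD[OF d, of "i + 1"] i
        by (simp add: a_tau[OF i d] co_def sact_def field_simps)
    next
      case False
      hence "i = n" using i by simp
      hence x: "?x = d (n - 1) * d n" using a_tau[OF i d] by simp
      have nz: "d (n - 1) \<noteq> 0" "d n \<noteq> 0" using nzD[OF d, of "n - 1"] nzD[OF d, of n] rank by auto
      have ne: "n - 1 \<noteq> n" using rank by simp
      consider "k = n - 1" | "k = n" | "k \<noteq> n - 1" "k \<noteq> n" by blast
      thus ?thesis unfolding x
        by cases (use nz ne \<open>i = n\<close> in \<open>simp_all add: co_def sact_def\<close>)
    qed
  qed
  finally show ?thesis .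
qed

lemma act_tau':
  assumes i: "i \<in> {1..n}" and d: "nz d"
  shows "matrix_inv (\<sigma> i) ** tau d ** \<sigma> i = tau (sact i d)"
proof -
  have "tau d = \<sigma> i ** tau (sact i d) ** matrix_inv (\<sigma> i)"
    using act_tau[OF i nz_sact[OF i d]] by (simp add: sact_invol)
  thus ?thesis using sigma_inv[OF i] by (simp add: matrix_mul_assoc matrix_inv_ex)
qed

lemma sigma_square: "i \<in> {1..n} \<Longrightarrow> \<sigma> i ** \<sigma> i = tau (co i (- 1))"
  using sigma_root_square[OF a_root] tau_co[of i "- 1"] by (simp add: sigma_def)

lemma D_cartan_self:
  assumes "i \<in> {1..n}"
  shows "D_cartan n i i = 2"
proof (cases "i < n")
  case True
  thus ?thesis using D_cartan_lt[of i n i] assms by (simp add: D_simple_def)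
next
  case False
  hence "i = n" using assms by simp
  thus ?thesis using D_cartan_n[of n n] rank by (simp add: D_simple_def)
qed

lemma D_cartan_orthogonal:
  assumes "i \<in> {1..n}" "j \<in> {1..n}" "i \<noteq> j" "\<not> D_adj n i j"
  shows "D_cartan n i j = 0"
proof (cases "i < n")
  case True
  thus ?thesis using D_cartan_lt[of i n j] assms by (auto simp: D_simple_def D_adj_def)
next
  case False
  hence "i = n" using assms by simp
  thus ?thesis using D_cartan_n[of n j] rank assms by (auto simp: D_simple_def D_adj_def)
qed

text \<open>The character P\<alpha>_i + Q\<alpha>_j.\<close>

definition chi :: "nat \<Rightarrow> nat \<Rightarrow> int \<Rightarrow> int \<Rightarrow> 'f ^'m ^'m \<Rightarrow> 'f" where
  "chi i j P Q = (\<lambda>t\<in>T. a i t powi P * a j t powi Q)"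

lemma chi_prod:
  assumes "i \<in> {1..n}" "j \<in> {1..n}" "i \<noteq> j" "t \<in> T"
  shows "chi i j P Q t = (\<Prod>l=1..n. a l t powi (if l = i then P else if l = j then Q else 0))"
proof -
  have "(\<Prod>l=1..n. a l t powi (if l = i then P else if l = j then Q else 0)) =
      (\<Prod>l\<in>{i, j}. a l t powi (if l = i then P else if l = j then Q else 0))"
    using assms by (intro prod.mono_neutral_right) auto
  thus ?thesis using assms by (simp add: chi_def)
qed

lemma chi_nontrivial:
  assumes "i \<in> {1..n}" "j \<in> {1..n}" "i \<noteq> j" "P \<noteq> 0"
  shows "\<exists>t\<in>T. chi i j P Q t \<noteq> 1"
proof (rule ccontr)
  assume "\<not> ?thesis"
  hence "\<forall>t\<in>T. (\<Prod>l=1..n. a l t powi (if l = i then P else if l = j then Q else 0)) = 1"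
    using chi_prod[OF assms(1-3)] by auto
  from root_indep[OF this assms(1)] show False using assms by simp
qed

text \<open>The coefficients of a root in the base all have the same sign, and they are unique
  because the simple roots are independent.\<close>

lemma chi_mixed_not_root:
  assumes i: "i \<in> {1..n}" "j \<in> {1..n}" "i \<noteq> j" and P: "P * Q < 0"
  shows "chi i j P Q \<notin> roots G T"
proof
  assume "chi i j P Q \<in> roots G T"
  then obtain k :: "nat \<Rightarrow> nat" where
    "(\<forall>t\<in>T. chi i j P Q t = (\<Prod>l=1..n. a l t ^ k l)) \<or> (\<forall>t\<in>T. chi i j P Q t = inverse (\<Prod>l=1..n. a l t ^ k l))"
    using root_combination by blast
  then obtain s :: int where s: "s = 1 \<or> s = - 1"
    and eq: "\<And>t. t \<in> T \<Longrightarrow> chi i j P Q t = (\<Prod>l=1..n. a l t powi (s * int (k l)))"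
  proof
    assume "\<forall>t\<in>T. chi i j P Q t = (\<Prod>l=1..n. a l t ^ k l)"
    thus ?thesis using that[of 1] by simp
  next
    assume *: "\<forall>t\<in>T. chi i j P Q t = inverse (\<Prod>l=1..n. a l t ^ k l)"
    have "inverse (\<Prod>l=1..n. a l t ^ k l) = (\<Prod>l=1..n. inverse (a l t ^ k l))" for t
      using prod_inversef[of "\<lambda>l. a l t ^ k l" "{1..n}"] by (simp add: o_def)
    thus ?thesis using that[of "- 1"] * by (simp add: power_int_minus)
  qed
  define e where "e l = (if l = i then P else if l = j then Q else 0)" for l
  have "\<forall>t\<in>T. (\<Prod>l=1..n. a l t powi (e l - s * int (k l))) = 1"
  proof
    fix t assume t: "t \<in> T"
    have "(\<Prod>l=1..n. a l t powi (e l - s * int (k l))) =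
        (\<Prod>l=1..n. a l t powi e l) / (\<Prod>l=1..n. a l t powi (s * int (k l)))"
      unfolding prod_dividef[symmetric] using aD(2) t by (intro prod.cong) (auto simp: power_int_diff)
    also have "(\<Prod>l=1..n. a l t powi e l) = (\<Prod>l=1..n. a l t powi (s * int (k l)))"
      using eq[OF t] chi_prod[OF i t, of P Q] by (simp add: e_def)
    also have "(\<Prod>l=1..n. a l t powi (s * int (k l))) / (\<Prod>l=1..n. a l t powi (s * int (k l))) = 1"
      using aD(2) t by (intro divide_self) auto
    finally show "(\<Prod>l=1..n. a l t powi (e l - s * int (k l))) = 1" .
  qed
  from root_indep[OF this i(1)] root_indep[OF this i(2)]
  have PQ: "P = s * int (k i)" "Q = s * int (k j)" using i(3) by (auto simp: e_def)
  have "0 \<le> P * Q" using s unfolding PQ by auto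
  thus False using P by simp
qed

text \<open>For orthogonal simple roots the reflection \<open>s\<^sub>i\<close> turns a positive combination into a mixed one.\<close>

lemma chi_not_root:
  assumes i: "i \<in> {1..n}" "j \<in> {1..n}" "i \<noteq> j" and adj: "\<not> D_adj n i j" and P: "P \<noteq> 0" "Q \<noteq> 0"
  shows "chi i j P Q \<notin> roots G T"
proof
  assume r: "chi i j P Q \<in> roots G T"
  have pos: "0 < P * Q" using chi_mixed_not_root[OF i, of P Q] r P by (metis linorder_neqE mult_eq_0_iff)
  obtain k where k: "has_pairing (chi i j P Q) (c i) k" "(\<lambda>t\<in>T. chi i j P Q t * a i t powi (- k)) \<in> roots G T"
    using coroot_is[OF a_root[OF i(1)]] r unfolding is_coroot_def by blast
  have "x powi k = x powi (2 * P)" if x: "x \<noteq> 0" for x :: 'f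
  proof -
    have "chi i j P Q (c i x) = x powi k" using k(1) x by (simp add: has_pairing_def)
    moreover have "chi i j P Q (c i x) = (x powi 2) powi P * (x powi 0) powi Q"
      using cD(1)[OF i(1) x] a_c[OF i(1) i(1) x] a_c[OF i(1,2) x] D_cartan_self[OF i(1)]
        D_cartan_orthogonal[OF i adj] by (simp add: chi_def)
    ultimately show ?thesis by (simp add: power_int_mult)
  qed
  hence "k = 2 * P" using powi_eq_iff[of k "2 * P", where 'f = 'f] by blast
  moreover have "(\<lambda>t\<in>T. chi i j P Q t * a i t powi (- (2 * P))) = chi i j (- P) Q"
    unfolding chi_def
  proof (rule restrict_ext)
    fix t assume t: "t \<in> T"
    have "a i t powi (- P) = a i t powi (P + - (2 * P))" by simp
    also have "\<dots> = a i t powi P * a i t powi (- (2 * P))"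
      by (rule power_int_add) (use aD(2)[OF i(1) t] in simp)
    finally show "(\<lambda>t\<in>T. a i t powi P * a j t powi Q) t * a i t powi (- (2 * P)) = a i t powi (- P) * a j t powi Q"
      using t by simp
  qed
  ultimately have "chi i j (- P) Q \<in> roots G T" using k(2) by simp
  moreover have "- P * Q < 0" using pos by simp
  ultimately show False using chi_mixed_not_root[OF i] by blast
qed

definition sroot_sign :: "int \<Rightarrow> nat \<Rightarrow> 'f ^'m ^'m \<Rightarrow> 'f" where
  "sroot_sign s i = (if s = 1 then a i else neg_char T (a i))"

lemma sroot_sign:
  assumes "i \<in> {1..n}" "s = 1 \<or> s = - 1"
  shows "sroot_sign s i \<in> roots G T" "t \<in> T \<Longrightarrow> sroot_sign s i t = a i t powi s"
  using assms a_root neg_root by (auto simp: sroot_sign_def neg_char_def power_int_minus)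

lemma rsub_commute:
  assumes i: "i \<in> {1..n}" "j \<in> {1..n}" "i \<noteq> j" and adj: "\<not> D_adj n i j"
    and s: "s = 1 \<or> s = - 1" "s' = 1 \<or> s' = - 1"
  shows "rsub R (sroot_sign s i) x ** rsub R (sroot_sign s' j) y = rsub R (sroot_sign s' j) y ** rsub R (sroot_sign s i) x"
proof -
  note r = sroot_sign[OF i(1) s(1)] sroot_sign[OF i(2) s(2)]
  have chi: "sroot_sign s i t ^ k * sroot_sign s' j t ^ l = chi i j (s * int k) (s' * int l) t" if "t \<in> T" for t k l
    using r(2,4) that by (simp add: chi_def power_int_mult)
  show ?thesis
  proof (rule root_params_commute[OF G_sub T_sub T_G roots_characters[OF r(1)] roots_characters[OF r(3)] param[OF r(1)] param[OF r(3)]])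
    fix k l :: nat assume kl: "1 \<le> k" "1 \<le> l"
    have nz: "s * int k \<noteq> 0" "s' * int l \<noteq> 0" using s kl by auto
    show "\<exists>t\<in>T. sroot_sign s i t ^ k * sroot_sign s' j t ^ l \<noteq> 1"
      using chi_nontrivial[OF i nz(1)] chi by metis
    have "(\<lambda>t\<in>T. sroot_sign s i t ^ k * sroot_sign s' j t ^ l) = chi i j (s * int k) (s' * int l)"
      unfolding chi_def using r(2,4) by (intro restrict_ext) (simp add: power_int_mult)
    thus "(\<lambda>t\<in>T. sroot_sign s i t ^ k * sroot_sign s' j t ^ l) \<notin> roots G T"
      using chi_not_root[OF i adj nz] by simp
  qed
qed

text \<open>Each \<sigma>_i is a product of three elements of the root subgroups of \<alpha>_i and
  -\<alpha>_i, and for orthogonal i and j these commute for all four choices of signs.\<close>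

lemma sigma_comm:
  assumes i: "i \<in> {1..n}" "j \<in> {1..n}" "i \<noteq> j" and adj: "\<not> D_adj n i j"
  shows "\<sigma> i ** \<sigma> j = \<sigma> j ** \<sigma> i"
proof -
  have \<sigma>: "\<sigma> i = rsub R (sroot_sign 1 i) 1 ** rsub R (sroot_sign (- 1) i) (- 1) ** rsub R (sroot_sign 1 i) 1" for i
    by (simp add: sigma_def sigma_root_def sroot_sign_def)
  have three: "A ** (B1 ** B2 ** B3) = (B1 ** B2 ** B3) ** A"
    if "A ** B1 = B1 ** A" "A ** B2 = B2 ** A" "A ** B3 = B3 ** A" for A B1 B2 B3 :: "'f ^'m ^'m"
    using that by (metis matrix_mul_assoc)
  have "rsub R (sroot_sign s i) x ** \<sigma> j = \<sigma> j ** rsub R (sroot_sign s i) x" if "s = 1 \<or> s = - 1" for s x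
    unfolding \<sigma>[of j] by (intro three rsub_commute[OF i adj that]) auto
  hence "\<sigma> j ** \<sigma> i = \<sigma> i ** \<sigma> j" unfolding \<sigma>[of i] by (intro three) auto
  thus ?thesis by simp
qed

text \<open>The element g = \<sigma>_i \<sigma>_j carries \<alpha>_i to \<alpha>_j. Hence g
  \<sigma>_i g^-1 acts on T like s_j and lies in T \<sigma>_j, and \<open>conj_sigma\<close> reduces
  the torus factor to a value of the coroot of \<alpha>_j.\<close>

lemma sigma_braid_up_to_coroot:
  assumes i: "i \<in> {1..n}" "j \<in> {1..n}" and adj: "D_adj n i j"
  obtains x where "x \<noteq> 0" "\<sigma> i ** \<sigma> j ** \<sigma> i = tau (co j x) ** (\<sigma> j ** \<sigma> i ** \<sigma> j)"
proof -
  note inv = sigma_inv[OF i(1)] sigma_inv[OF i(2)]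
  define g where "g = \<sigma> i ** \<sigma> j"
  have g: "g \<in> N" "invertible g" unfolding g_def using NH(3) sigma_N i inv by (auto simp: invertible_mult)
  have ig: "matrix_inv g = matrix_inv (\<sigma> j) ** matrix_inv (\<sigma> i)" using inv by (simp add: g_def matrix_inv_mult)
  from adj consider "j = i + 1" "j < n" | "i = j + 1" "i < n" | "i + 2 = n" "j = n" | "i = n" "j + 2 = n"
    by (auto simp: D_adj_def)
  note cases = this
  have act: "a j t = a i (matrix_inv g ** t ** g)" if t: "t \<in> T" for t
  proof -
    obtain d where d: "nz d" "t = tau d" using tau_surj[OF t] .
    note d1 = nz_sact[OF i(1) d(1)]
    note d2 = nz_sact[OF i(2) d1]
    have "matrix_inv g ** t ** g = matrix_inv (\<sigma> j) ** (matrix_inv (\<sigma> i) ** tau d ** \<sigma> i) ** \<sigma> j"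
      unfolding ig d(2) by (simp add: g_def matrix_mul_assoc)
    hence e: "matrix_inv g ** t ** g = tau (sact j (sact i d))"
      using act_tau'[OF i(1) d(1)] act_tau'[OF i(2) d1] by simp
    show ?thesis unfolding e unfolding d(2) a_tau[OF i(2) d(1)] a_tau[OF i(1) d2]
      using rank i by (cases rule: cases) (auto simp: sact_def)
  qed
  define h where "h = g ** \<sigma> i ** matrix_inv g"
  have h: "h \<in> N" unfolding h_def using NH(3,4) g sigma_N i by auto
  have hact: "h ** t ** matrix_inv h = \<sigma> j ** t ** matrix_inv (\<sigma> j)" if t: "t \<in> T" for t
  proof -
    obtain d where d: "nz d" "t = tau d" using tau_surj[OF t] .
    note d1 = nz_sact[OF i(1) d(1)]
    note d2 = nz_sact[OF i(2) d1]
    note d3 = nz_sact[OF i(1) d2]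
    note d4 = nz_sact[OF i(2) d3]
    have "h ** t ** matrix_inv h = \<sigma> i ** (\<sigma> j ** (\<sigma> i ** (matrix_inv (\<sigma> j) ** (matrix_inv (\<sigma> i) ** tau d ** \<sigma> i) ** \<sigma> j)
        ** matrix_inv (\<sigma> i)) ** matrix_inv (\<sigma> j)) ** matrix_inv (\<sigma> i)"
      unfolding h_def d(2) using inv g
      by (simp add: matrix_inv_mult invertible_mult invertible_matrix_inv matrix_inv_inv ig)
        (simp add: g_def matrix_mul_assoc)
    also have "\<dots> = tau (sact i (sact j (sact i (sact j (sact i d)))))"
      using act_tau'[OF i(1) d(1)] act_tau'[OF i(2) d1] act_tau[OF i(1) d2] act_tau[OF i(2) d3] act_tau[OF i(1) d4]
      by simp
    also have "sact i (sact j (sact i (sact j (sact i d)))) = sact j d"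
    proof
      fix k
      show "sact i (sact j (sact i (sact j (sact i d)))) k = sact j d k"
      proof (cases rule: cases)
      case 1
      hence nn: "j = i + 1" "i < n" "i + 1 < n" by simp_all
      consider "k = i" | "k = i + 1" | "k = i + 2" | "k \<noteq> i" "k \<noteq> i + 1" "k \<noteq> i + 2" by blast
      thus ?thesis by cases (use nn in \<open>simp_all add: sact_apply\<close>)
      next
      case 2
      hence nn: "i = j + 1" "j < n" "j + 1 < n" by simp_all
      consider "k = j" | "k = j + 1" | "k = j + 2" | "k \<noteq> j" "k \<noteq> j + 1" "k \<noteq> j + 2" by blast
      thus ?thesis by cases (use nn in \<open>simp_all add: sact_apply\<close>)
      next
      case 3
      hence nn: "n = i + 2" "j = i + 2" by simp_all
      consider "k = i" | "k = i + 1" | "k = i + 2" | "k \<noteq> i" "k \<noteq> i + 1" "k \<noteq> i + 2" by blast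
      thus ?thesis by cases (use nn in \<open>simp_all add: sact_apply\<close>)
      next
      case 4
      hence nn: "n = j + 2" "i = j + 2" by simp_all
      consider "k = j" | "k = j + 1" | "k = j + 2" | "k \<noteq> j" "k \<noteq> j + 1" "k \<noteq> j + 2" by blast
      thus ?thesis by cases (use nn in \<open>simp_all add: sact_apply\<close>)
      qed
    qed
    also have "tau (sact j d) = \<sigma> j ** t ** matrix_inv (\<sigma> j)" using act_tau[OF i(2) d(1)] d(2) by simp
    finally show ?thesis .
  qed
  obtain t where t: "t \<in> T" "h = t ** \<sigma> j" using refl_coset[OF i(2) h hact] .
  have coset: "g ** sigma_root R (a i) ** matrix_inv g = t ** sigma_root R (a j)" using t(2) by (simp add: h_def sigma_def)
  obtain x where x: "x \<noteq> 0" "g ** sigma_root R (a i) ** matrix_inv g = coroot R (a j) x ** sigma_root R (a j)"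
    using conj_sigma[OF g(1) a_root[OF i(1)] a_root[OF i(2)] act t(1) coset] by metis
  hence "g ** \<sigma> i ** matrix_inv g ** g = tau (co j x) ** \<sigma> j ** g" using tau_co[OF i(2) x(1)] by (simp add: sigma_def)
  hence "g ** \<sigma> i = tau (co j x) ** \<sigma> j ** g" using g by simp
  thus ?thesis using that[OF x(1)] by (simp add: g_def matrix_mul_assoc)
qed

text \<open>Using the previous relation for (i, j) and for (j, i) gives a product of values of the
  two coroots equal to 1. In each case there is a coordinate on which only the coroot of \<alpha>_j
  is nontrivial, which forces x = 1.\<close>

lemma sigma_braid:
  assumes i: "i \<in> {1..n}" "j \<in> {1..n}" and adj: "D_adj n i j"
  shows "\<sigma> i ** \<sigma> j ** \<sigma> i = \<sigma> j ** \<sigma> i ** \<sigma> j"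
proof -
  obtain x where x: "x \<noteq> 0" "\<sigma> i ** \<sigma> j ** \<sigma> i = tau (co j x) ** (\<sigma> j ** \<sigma> i ** \<sigma> j)"
    using sigma_braid_up_to_coroot[OF i adj] .
  have adj': "D_adj n j i" using adj by (auto simp: D_adj_def)
  obtain y where y: "y \<noteq> 0" "\<sigma> j ** \<sigma> i ** \<sigma> j = tau (co i y) ** (\<sigma> i ** \<sigma> j ** \<sigma> i)"
    using sigma_braid_up_to_coroot[OF i(2,1) adj'] .
  define b where "b = \<sigma> i ** \<sigma> j ** \<sigma> i"
  have b: "invertible b" unfolding b_def using sigma_inv i by (simp add: invertible_mult)
  have "b = tau (co j x) ** (tau (co i y) ** b)" using x(2)[unfolded y(2)] unfolding b_def .
  hence "mat 1 ** b = (tau (co j x) ** tau (co i y)) ** b"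
    unfolding matrix_mul_assoc matrix_mul_lid .
  hence "tau (\<lambda>k. co j x k * co i y k) = mat 1"
    using tau_mult[OF nz_co[OF x(1)] nz_co[OF y(1)]] mult_inv_cancel(3)[OF b] by metis
  note ker = tau_kernel[OF nz_mult[OF nz_co[OF x(1)] nz_co[OF y(1)]] this]
  have "x = 1"
  proof -
    from adj consider "j = i + 1" "j < n" | "i = j + 1" "i < n" | "i + 2 = n" "j = n" | "i = n" "j + 2 = n"
      by (auto simp: D_adj_def)
    thus ?thesis
    proof cases
      case 1
      thus ?thesis using ker[of "j + 1"] i by (simp add: co_def)
    next
      case 2
      thus ?thesis using ker[of j] i by (simp add: co_def)
    next
      case 3
      thus ?thesis using ker[of n] i by (simp add: co_def)
    next
      case 4
      moreover from this have "j \<noteq> n - 1" by linarith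
      ultimately show ?thesis using ker[of j] i by (simp add: co_def)
    qed
  qed
  hence "tau (co j x) = mat 1" using tau_cong[of "co j x" "\<lambda>_. 1"] tau_one by (simp add: co_def)
  thus ?thesis using x(2) by simp
qed

end

section \<open>Words and sections\<close>

lemma (in D_weyl) simple_perm_outside: "i \<in> {1..n} \<Longrightarrow> \<not> signed_idx n k \<Longrightarrow> sp i k = k"
  by (erule simple_perm_cases) (use n_ge in \<open>auto simp: signed_idx_def\<close>)

lemma (in D_weyl) word_perm_outside: "set ws \<subseteq> {1..n} \<Longrightarrow> \<not> signed_idx n k \<Longrightarrow> wp ws k = k"
  by (induction ws) (auto simp: simple_perm_outside)

sublocale realized_D \<subseteq> W: D_weyl "rk R"
  by unfold_locales (use rank in simp)

context realized_D
begin

text \<open>Coordinates at negative indices are inverses, in accordance with e_{-k} = -e_k; the Weyl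
  group then acts by permuting the arguments.\<close>

definition ext :: "(nat \<Rightarrow> 'f) \<Rightarrow> int \<Rightarrow> 'f" where
  "ext d k = (if 0 < k then d (nat k) else inverse (d (nat (- k))))"

lemma ext_minus: "k \<noteq> 0 \<Longrightarrow> ext d (- k) = inverse (ext d k)"
  by (simp add: ext_def)

lemma ext_sact:
  assumes i: "i \<in> {1..n}" and k: "signed_idx n k"
  shows "ext (sact i d) k = ext d (simple_perm n i k)"
proof -
  have pos: "ext (sact i d) (int m) = ext d (simple_perm n i (int m))" if m: "1 \<le> m" "m \<le> n" for m
    using i
  proof (cases rule: W.simple_perm_cases)
    case 1
    show ?thesis unfolding 1(4) using 1(1) m by (auto simp: ext_def sact_apply nat_add_distrib)
  next
    case 2
    have "nat (int n - 1) = n - 1" by simp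
    thus ?thesis unfolding 2(4) using 2(1) m rank by (auto simp: ext_def sact_apply of_nat_diff)
  qed
  show ?thesis
  proof (cases "0 < k")
    case True
    thus ?thesis using pos[of "nat k"] k by (simp add: signed_idx_def)
  next
    case False
    have m: "1 \<le> nat (- k)" "nat (- k) \<le> n" using False k by (auto simp: signed_idx_def)
    have p: "simple_perm n i (- k) \<noteq> 0"
      using W.simple_perm_idx[OF i, of "- k"] k by (simp add: signed_idx_def)
    have "ext (sact i d) (- k) = ext d (simple_perm n i (- k))" using pos[OF m] False by simp
    moreover have "ext (sact i d) (- k) = inverse (ext (sact i d) k)" using k by (intro ext_minus) (simp add: signed_idx_def)
    moreover have "ext d (simple_perm n i (- k)) = inverse (ext d (simple_perm n i k))"
      unfolding W.simple_perm_minus[OF i] using p W.simple_perm_minus[OF i, of k] by (intro ext_minus) simp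
    ultimately show ?thesis by simp
  qed
qed

definition wact :: "nat list \<Rightarrow> (nat \<Rightarrow> 'f) \<Rightarrow> nat \<Rightarrow> 'f" where
  "wact ws d = foldr sact ws d"

lemma wact_simps [simp]: "wact [] d = d" "wact (i # ws) d = sact i (wact ws d)"
  by (simp_all add: wact_def)

lemma nz_wact: "set ws \<subseteq> {1..n} \<Longrightarrow> nz d \<Longrightarrow> nz (wact ws d)"
  by (induction ws) (auto intro: nz_sact)

lemma ext_wact: "set ws \<subseteq> {1..n} \<Longrightarrow> signed_idx n k \<Longrightarrow> ext (wact ws d) k = ext d (word_perm n (rev ws) k)"
proof (induction ws arbitrary: k)
  case (Cons i ws)
  thus ?case using ext_sact[of i k "wact ws d"] W.simple_perm_idx[of i k] by (simp add: word_perm_append)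
qed simp

text \<open>By \<open>ext_wact\<close> a word acts on coordinate vectors through its signed
  permutation. Conversely two different images of an index are separated by a vector with a single
  nontrivial coordinate.\<close>

lemma wact_eq_iff:
  assumes ws: "set ws \<subseteq> {1..n}" and js: "set js \<subseteq> {1..n}"
  shows "(\<forall>d. nz d \<longrightarrow> (\<forall>k\<in>{1..n}. wact ws d k = wact js d k)) \<longleftrightarrow> word_perm n ws = word_perm n js"
proof
  assume eq: "word_perm n ws = word_perm n js"
  have "word_perm n (rev ws) = word_perm n (rev js)" by (rule W.word_perm_cong_rev[OF ws js eq])
  hence "ext (wact ws d) (int k) = ext (wact js d) (int k)" if "k \<in> {1..n}" for d k
    using that ext_wact[OF ws, of "int k"] ext_wact[OF js, of "int k"] by (simp add: signed_idx_def)
  thus "\<forall>d. nz d \<longrightarrow> (\<forall>k\<in>{1..n}. wact ws d k = wact js d k)" by (auto simp: ext_def)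
next
  assume *: "\<forall>d. nz d \<longrightarrow> (\<forall>k\<in>{1..n}. wact ws d k = wact js d k)"
  have rs: "set (rev ws) \<subseteq> {1..n}" "set (rev js) \<subseteq> {1..n}" using ws js by auto
  have "word_perm n (rev ws) k = word_perm n (rev js) k" for k
  proof (cases "signed_idx n k")
    case True
    define p q where "p = word_perm n (rev ws) k" and "q = word_perm n (rev js) k"
    have pq: "signed_idx n p" "signed_idx n q"
      unfolding p_def q_def using W.word_perm_idx[OF rs(1), of k] W.word_perm_idx[OF rs(2), of k] True by auto
    have ext: "ext d p = ext d q" if d: "nz d" for d
    proof -
      have "nat \<bar>k\<bar> \<in> {1..n}" using True by (auto simp: signed_idx_def)
      hence "wact ws d (nat \<bar>k\<bar>) = wact js d (nat \<bar>k\<bar>)" using * d by blast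
      hence "ext (wact ws d) k = ext (wact js d) k" by (auto simp: ext_def abs_if split: if_splits)
      thus ?thesis using ext_wact[OF ws True] ext_wact[OF js True] by (simp add: p_def q_def)
    qed
    \<comment> \<open>The condition on x^2 separates x from its inverse as well as from 1, which
      covers q = -p.\<close>
    obtain x :: 'f where x: "x \<noteq> 0" "x powi 2 \<noteq> 1" using ex_pow_ne_1[of 2, where 'f = 'f] by auto
    have x1: "x \<noteq> 1" "x \<noteq> inverse x" "inverse x \<noteq> 1" using x by (auto simp: power2_eq_square field_simps)
    have "p = q"
    proof (rule ccontr)
      assume ne: "p \<noteq> q"
      define d where "d j = (if int j = \<bar>p\<bar> then x else 1)" for j
      have "nz d" using x by (simp add: nz_def d_def)
      from ext[OF this] show False
        using x x1 ne pq by (auto simp: ext_def d_def signed_idx_def split: if_splits)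
    qed
    thus ?thesis by (simp add: p_def q_def)
  next
    case False
    thus ?thesis using W.word_perm_outside rs by simp
  qed
  hence "word_perm n (rev (rev ws)) = word_perm n (rev (rev js))"
    using W.word_perm_cong_rev[OF rs] by blast
  thus "word_perm n ws = word_perm n js" by simp
qed

lemma wact_tau:
  assumes "set ws \<subseteq> {1..n}" "nz d"
  shows "word_prod (NT R) \<sigma> ws \<in> N"
    "word_prod (NT R) \<sigma> ws ** tau d ** matrix_inv (word_prod (NT R) \<sigma> ws) = tau (wact ws d)"
proof -
  have N: "word_prod (NT R) \<sigma> ws \<in> N" if "set ws \<subseteq> {1..n}" for ws
    by (rule word_prod_closed[OF group.axioms(1)[OF NT_group]]) (use that sigma_N in auto)
  show "word_prod (NT R) \<sigma> ws \<in> N" using N[OF assms(1)] .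
  show "word_prod (NT R) \<sigma> ws ** tau d ** matrix_inv (word_prod (NT R) \<sigma> ws) = tau (wact ws d)"
    using assms(1)
  proof (induction ws)
    case Nil
    show ?case by simp
  next
    case (Cons i ws)
    let ?w = "word_prod (NT R) \<sigma> ws"
    have i: "i \<in> {1..n}" and ws: "set ws \<subseteq> {1..n}" using Cons.prems by auto
    have "\<sigma> i ** ?w ** tau d ** matrix_inv (\<sigma> i ** ?w) = \<sigma> i ** (?w ** tau d ** matrix_inv ?w) ** matrix_inv (\<sigma> i)"
      using NH(1)[OF N[OF ws]] sigma_inv[OF i] by (simp add: matrix_inv_mult matrix_mul_assoc)
    also have "\<dots> = tau (sact i (wact ws d))"
      unfolding Cons.IH[OF ws] by (rule act_tau[OF i nz_wact[OF ws assms(2)]])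
    finally show ?case by simp
  qed
qed

lemma proj_mult: "g \<in> N \<Longrightarrow> h \<in> N \<Longrightarrow> proj R g \<otimes>\<^bsub>Weyl R\<^esub> proj R h = proj R (g ** h)"
  using normal.rcos_sum[OF T_normal, of g h] by (simp add: Weyl_def proj_def)

lemma proj_one: "\<one>\<^bsub>Weyl R\<^esub> = proj R (mat 1)"
  by (simp add: Weyl_def FactGroup_def proj_eq)

lemma carrier_Weyl: "carrier (Weyl R) = proj R ` N"
  by (auto simp: Weyl_def carrier_FactGroup proj_def)

lemma Weyl_group: "group (Weyl R)"
  unfolding Weyl_def by (rule normal.factorgroup_is_group[OF T_normal])

lemma proj_eq_iff:
  assumes "g \<in> N" "h \<in> N"
  shows "proj R g = proj R h \<longleftrightarrow> (\<exists>t\<in>T. g = t ** h)"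
proof
  assume "proj R g = proj R h"
  moreover have "mat 1 ** g \<in> proj R g" unfolding proj_eq using TH(2) by blast
  ultimately show "\<exists>t\<in>T. g = t ** h" by (auto simp: proj_eq)
next
  assume "\<exists>t\<in>T. g = t ** h"
  then obtain t where t: "t \<in> T" "g = t ** h" by blast
  have ti: "invertible t" using TH t by auto
  show "proj R g = proj R h"
  proof
    show "proj R g \<subseteq> proj R h" using t TH(3) by (auto simp: proj_eq matrix_mul_assoc)
    have "s ** h = (s ** matrix_inv t) ** g" for s :: "'f ^'m ^'m" using ti t(2) by (simp add: matrix_mul_assoc)
    thus "proj R h \<subseteq> proj R g" unfolding proj_eq using TH(3,4) t(1) by blast
  qed
qed

text \<open>Left factors in T act trivially because T is commutative. Conversely, if g and h act
  alike, then g h^-1 centralizes T and lies in T by \<open>centralizer_T\<close>.\<close>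

lemma proj_eq_act:
  assumes "g \<in> N" "h \<in> N"
  shows "proj R g = proj R h \<longleftrightarrow> (\<forall>t\<in>T. g ** t ** matrix_inv g = h ** t ** matrix_inv h)"
proof
  have i: "invertible g" "invertible h" using NH assms by auto
  show "\<forall>t\<in>T. g ** t ** matrix_inv g = h ** t ** matrix_inv h" if eq: "proj R g = proj R h"
  proof
    fix t assume t: "t \<in> T"
    obtain s where s: "s \<in> T" "g = s ** h" using eq proj_eq_iff[OF assms] by blast
    have si: "invertible s" using TH s by auto
    have "g ** t ** matrix_inv g = s ** (h ** t ** matrix_inv h) ** matrix_inv s"
      using si i by (simp add: s(2) matrix_inv_mult matrix_mul_assoc)
    also have "s ** (h ** t ** matrix_inv h) = (h ** t ** matrix_inv h) ** s"
      using s N_conj[OF assms(2) t] by (intro T_comm)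
    finally show "g ** t ** matrix_inv g = h ** t ** matrix_inv h" using si by simp
  qed
  assume act: "\<forall>t\<in>T. g ** t ** matrix_inv g = h ** t ** matrix_inv h"
  have "matrix_inv h ** g \<in> N" using NH(3,4) assms by blast
  have "g ** matrix_inv h \<in> T"
  proof (rule centralizer_T)
    show "g ** matrix_inv h \<in> N" using NH(3,4) assms by blast
    fix t assume t: "t \<in> T"
    have "g ** matrix_inv h ** t ** matrix_inv (g ** matrix_inv h) = g ** (matrix_inv h ** t ** h) ** matrix_inv g"
      using i by (simp add: matrix_inv_mult matrix_inv_inv invertible_matrix_inv matrix_mul_assoc)
    also have "\<dots> = h ** (matrix_inv h ** t ** h) ** matrix_inv h" using act N_conj'[OF assms(2) t] by blast
    also have "\<dots> = t" using i by (simp add: matrix_mul_assoc matrix_inv_ex)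
    finally show "g ** matrix_inv h ** t ** matrix_inv (g ** matrix_inv h) = t" .
  qed
  moreover have "g = (g ** matrix_inv h) ** h" using i by simp
  ultimately show "proj R g = proj R h" using proj_eq_iff[OF assms] by blast
qed

lemma word_prod_proj:
  assumes "set ws \<subseteq> {1..n}" "\<And>i. i \<in> {1..n} \<Longrightarrow> g i \<in> N \<and> proj R (g i) = srefl R i"
  shows "word_prod (NT R) g ws \<in> N \<and> proj R (word_prod (NT R) g ws) = word_prod (Weyl R) (srefl R) ws"
  using assms(1)
proof (induction ws)
  case Nil
  show ?case using NH(2) by (simp add: proj_one)
next
  case (Cons i ws)
  hence gi: "g i \<in> N" "proj R (g i) = srefl R i" using assms(2) by auto
  have ws: "word_prod (NT R) g ws \<in> N" "proj R (word_prod (NT R) g ws) = word_prod (Weyl R) (srefl R) ws"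
    using Cons by auto
  show ?case using proj_mult[OF gi(1) ws(1)] gi(2) ws NH(3)[OF gi(1) ws(1)] by simp
qed

lemma sigma_lift: "i \<in> {1..n} \<Longrightarrow> \<sigma> i \<in> N \<and> proj R (\<sigma> i) = srefl R i"
  using sigma_N proj_sigma by blast

abbreviation "Wword \<equiv> word_prod (Weyl R) (srefl R)"

text \<open>Both sides say that the two words act alike on T: N/T acts faithfully, and in
  coordinates the action is by signed permutations. Through this bridge the combinatorics of reduced
  words becomes available in N/T.\<close>

lemma Wword_eq_iff:
  assumes ws: "set ws \<subseteq> {1..n}" and js: "set js \<subseteq> {1..n}"
  shows "Wword ws = Wword js \<longleftrightarrow> word_perm n ws = word_perm n js"
proof -
  note A = word_prod_proj[OF ws sigma_lift] and B = word_prod_proj[OF js sigma_lift]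
  have "Wword ws = Wword js \<longleftrightarrow> (\<forall>t\<in>T. word_prod (NT R) \<sigma> ws ** t ** matrix_inv (word_prod (NT R) \<sigma> ws) =
      word_prod (NT R) \<sigma> js ** t ** matrix_inv (word_prod (NT R) \<sigma> js))"
    using proj_eq_act[OF conjunct1[OF A] conjunct1[OF B]] A B by simp
  also have "\<dots> \<longleftrightarrow> (\<forall>d. nz d \<longrightarrow> tau (wact ws d) = tau (wact js d))"
  proof
    assume *: "\<forall>t\<in>T. word_prod (NT R) \<sigma> ws ** t ** matrix_inv (word_prod (NT R) \<sigma> ws) =
      word_prod (NT R) \<sigma> js ** t ** matrix_inv (word_prod (NT R) \<sigma> js)"
    show "\<forall>d. nz d \<longrightarrow> tau (wact ws d) = tau (wact js d)"
      using * wact_tau(2)[OF ws] wact_tau(2)[OF js] tau_in by metis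
  next
    assume *: "\<forall>d. nz d \<longrightarrow> tau (wact ws d) = tau (wact js d)"
    show "\<forall>t\<in>T. word_prod (NT R) \<sigma> ws ** t ** matrix_inv (word_prod (NT R) \<sigma> ws) =
      word_prod (NT R) \<sigma> js ** t ** matrix_inv (word_prod (NT R) \<sigma> js)"
      using * wact_tau(2)[OF ws] wact_tau(2)[OF js] tau_surj by metis
  qed
  also have "\<dots> \<longleftrightarrow> (\<forall>d. nz d \<longrightarrow> (\<forall>k\<in>{1..n}. wact ws d k = wact js d k))"
    using tau_inj[OF nz_wact[OF ws] nz_wact[OF js]] tau_cong[of "wact ws d" "wact js d" for d]
    by (metis atLeastAtMost_iff)
  finally show ?thesis using wact_eq_iff[OF ws js] by simp
qed

lemma reduced_iff: "reduced_word R ws \<longleftrightarrow> W.red ws"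
  unfolding reduced_word_def W.red_def using Wword_eq_iff by metis

lemma srefl_square: "i \<in> {1..n} \<Longrightarrow> srefl R i \<otimes>\<^bsub>Weyl R\<^esub> srefl R i = \<one>\<^bsub>Weyl R\<^esub>"
proof -
  assume i: "i \<in> {1..n}"
  have "proj R (\<sigma> i ** \<sigma> i) = proj R (mat 1)"
    using proj_eq_iff[OF NH(3)[OF sigma_N[OF i] sigma_N[OF i]] NH(2)] sigma_square[OF i] tau_in[OF nz_co[of "- 1" i]]
    by auto
  thus ?thesis using proj_mult[OF sigma_N[OF i] sigma_N[OF i]] proj_sigma[OF i] proj_one by simp
qed

lemma srefl_carrier: "i \<in> {1..n} \<Longrightarrow> srefl R i \<in> carrier (Weyl R)"
  using sigma_lift carrier_Weyl by blast

lemma Wword_carrier: "set ws \<subseteq> {1..n} \<Longrightarrow> Wword ws \<in> carrier (Weyl R)"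
  by (rule word_prod_closed[OF group.axioms(1)[OF Weyl_group]]) (use srefl_carrier in blast)

lemma Wword_append:
  assumes "set ws \<subseteq> {1..n}" "set js \<subseteq> {1..n}"
  shows "Wword (ws @ js) = Wword ws \<otimes>\<^bsub>Weyl R\<^esub> Wword js"
  by (rule word_prod_append[OF group.is_monoid[OF Weyl_group]]) (use assms srefl_carrier in blast)

lemma Weyl_word:
  assumes "w \<in> carrier (Weyl R)"
  obtains ws where "W.red ws" "w = Wword ws"
proof -
  have "w \<in> generate (Weyl R) (srefl R ` {1..n})"
    using assms weyl_gen unfolding weyl_generated_def by blast
  hence "\<exists>ws. set ws \<subseteq> {1..n} \<and> w = Wword ws"
  proof (induction rule: generate.induct)
    case one
    show ?case by (intro exI[of _ "[]"]) simp
  next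
    case (incl h)
    then obtain i where "i \<in> {1..n}" "h = srefl R i" by blast
    thus ?case using srefl_carrier group.is_monoid[OF Weyl_group]
      by (intro exI[of _ "[i]"]) (simp add: monoid.r_one)
  next
    case (inv h)
    then obtain i where i: "i \<in> {1..n}" "h = srefl R i" by blast
    have "inv\<^bsub>Weyl R\<^esub> h = h"
      using group.inv_equality[OF Weyl_group srefl_square[OF i(1)]] srefl_carrier[OF i(1)] i(2) by simp
    thus ?case using i srefl_carrier group.is_monoid[OF Weyl_group]
      by (intro exI[of _ "[i]"]) (simp add: monoid.r_one)
  next
    case (eng h1 h2)
    then obtain ws js where "set ws \<subseteq> {1..n}" "h1 = Wword ws" "set js \<subseteq> {1..n}" "h2 = Wword js" by blast
    thus ?case using Wword_append[of ws js] by (intro exI[of _ "ws @ js"]) simp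
  qed
  then obtain ws where ws: "set ws \<subseteq> {1..n}" "w = Wword ws" by blast
  obtain r where r: "W.red r" "word_perm n r = word_perm n ws" using W.red_exists[OF ws(1)] .
  have "Wword r = Wword ws" using Wword_eq_iff[OF W.redD[OF r(1)] ws(1)] r(2) by simp
  thus ?thesis using that[OF r(1)] ws(2) by simp
qed

section \<open>Sections as lifts satisfying the braid relations\<close>

lemma sectionD:
  assumes "is_section R S"
  shows "w \<in> carrier (Weyl R) \<Longrightarrow> S w \<in> N" "w \<in> carrier (Weyl R) \<Longrightarrow> proj R (S w) = w"
    "W.red ws \<Longrightarrow> S (Wword ws) = word_prod (NT R) (\<lambda>i. S (srefl R i)) ws"
    "S \<in> extensional (carrier (Weyl R))"
  using assms reduced_iff by (auto simp: is_section_def PiE_def)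

text \<open>Both sides of a braid relation are reduced words of the same element, so
  multiplicativity along reduced words evaluates the section on both.\<close>

lemma section_braid:
  assumes S: "is_section R S"
  shows "D_braid n (NT R) (\<lambda>i. S (srefl R i))"
proof -
  note D = sectionD[OF S]
  have W2: "Wword ws = Wword js" if "set ws \<subseteq> {1..n}" "set js \<subseteq> {1..n}" "word_perm n ws = word_perm n js" for ws js
    using Wword_eq_iff that by blast
  show ?thesis
  proof (intro D_braid.intro D_braid_axioms.intro)
    show "D_weyl n" by (rule W.D_weyl_axioms)
    show "Group.monoid (NT R)" using NT_group by (rule group.is_monoid)
    show N: "S (srefl R i) \<in> N" if "i \<in> {1..n}" for i using D(1)[OF srefl_carrier[OF that]] .
    fix i j assume ij: "i \<in> {1..n}" "j \<in> {1..n}"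
    show "S (srefl R i) \<otimes>\<^bsub>NT R\<^esub> S (srefl R j) = S (srefl R j) \<otimes>\<^bsub>NT R\<^esub> S (srefl R i)"
      if "i \<noteq> j" "\<not> D_adj n i j"
    proof -
      have "Wword [i, j] = Wword [j, i]" using ij W.simple_perm_commute[OF ij that] by (intro W2) auto
      thus ?thesis using D(3)[OF W.red_pair[OF ij that(1)]] D(3)[OF W.red_pair[OF ij(2,1)]] that(1) by simp
    qed
    show "S (srefl R i) \<otimes>\<^bsub>NT R\<^esub> (S (srefl R j) \<otimes>\<^bsub>NT R\<^esub> S (srefl R i)) =
        S (srefl R j) \<otimes>\<^bsub>NT R\<^esub> (S (srefl R i) \<otimes>\<^bsub>NT R\<^esub> S (srefl R j))" if "D_adj n i j"
    proof -
      have "Wword [i, j, i] = Wword [j, i, j]" using ij W.simple_perm_braid[OF ij that] by (intro W2) auto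
      thus ?thesis using D(3)[OF W.red_triple[OF ij that]] D(3)[OF W.red_triple[OF ij(2,1) W.adj_sym[OF that]]] by simp
    qed
  qed
qed

text \<open>The value at w is the product along a chosen reduced word; Matsumoto's theorem makes it
  independent of the choice.\<close>

lemma section_exists:
  assumes br: "D_braid n (NT R) g" and g: "\<And>i. i \<in> {1..n} \<Longrightarrow> g i \<in> N \<and> proj R (g i) = srefl R i"
  obtains S where "is_section R S" "\<And>i. i \<in> {1..n} \<Longrightarrow> S (srefl R i) = g i"
proof -
  define S where "S = (\<lambda>w\<in>carrier (Weyl R). word_prod (NT R) g (SOME ws. W.red ws \<and> w = Wword ws))"
  have Sw: "S (Wword ws) = word_prod (NT R) g ws" if ws: "W.red ws" for ws
  proof -
    define r where "r = (SOME r. W.red r \<and> Wword ws = Wword r)"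
    have r: "W.red r" "Wword ws = Wword r" unfolding r_def by (metis (mono_tags, lifting) someI ws)+
    have "word_prod (NT R) g r = word_prod (NT R) g ws"
      using D_braid.red_word_prod_eq[OF br r(1) ws] Wword_eq_iff[OF W.redD[OF ws] W.redD[OF r(1)]] r(2) by simp
    thus ?thesis using Wword_carrier[OF W.redD[OF ws]] by (simp add: S_def r_def)
  qed
  have Ss: "S (srefl R i) = g i" if i: "i \<in> {1..n}" for i
  proof -
    have "Wword [i] = srefl R i" using srefl_carrier[OF i] by (simp add: monoid.r_one[OF group.is_monoid[OF Weyl_group]])
    thus ?thesis using Sw[OF W.red_single[OF i]] by simp
  qed
  have word_cong: "word_prod (NT R) (\<lambda>i. S (srefl R i)) ws = word_prod (NT R) g ws" if "set ws \<subseteq> {1..n}" for ws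
    using that Ss by (induction ws) auto
  have "is_section R S"
    unfolding is_section_def
  proof (intro conjI ballI allI impI)
    show "S \<in> carrier (Weyl R) \<rightarrow>\<^sub>E N"
    proof
      fix w assume "w \<in> carrier (Weyl R)"
      then obtain ws where ws: "W.red ws" "w = Wword ws" using Weyl_word by blast
      thus "S w \<in> N" using Sw word_prod_proj[OF W.redD[OF ws(1)] g] by simp
    qed (simp add: S_def)
    show "proj R (S w) = w" if wC: "w \<in> carrier (Weyl R)" for w
    proof -
      obtain ws where ws: "W.red ws" "w = Wword ws" using Weyl_word[OF wC] .
      thus ?thesis using Sw word_prod_proj[OF W.redD[OF ws(1)] g] by simp
    qed
    show "S (Wword ws) = word_prod (NT R) (\<lambda>i. S (srefl R i)) ws" if "reduced_word R ws" for ws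
      using that Sw word_cong W.redD by (simp add: reduced_iff)
  qed
  thus ?thesis using that Ss by blast
qed

lemma section_conj:
  assumes S: "is_section R S" and S': "is_section R S'" and t: "t \<in> T"
    and eq: "\<And>i. i \<in> {1..n} \<Longrightarrow> t ** S (srefl R i) ** matrix_inv t = S' (srefl R i)"
    and w: "w \<in> carrier (Weyl R)"
  shows "t ** S w ** matrix_inv t = S' w"
proof -
  obtain ws where ws: "W.red ws" "w = Wword ws" using Weyl_word[OF w] .
  have ti: "invertible t" using TH t by blast
  have "t ** word_prod (NT R) (\<lambda>i. S (srefl R i)) ws ** matrix_inv t = word_prod (NT R) (\<lambda>i. S' (srefl R i)) ws"
    using W.redD[OF ws(1)]
  proof (induction ws)
    case Nil
    show ?case using ti by (simp add: matrix_inv_ex)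
  next
    case (Cons i ws)
    have "t ** (S (srefl R i) ** word_prod (NT R) (\<lambda>i. S (srefl R i)) ws) ** matrix_inv t =
        (t ** S (srefl R i) ** matrix_inv t) ** (t ** word_prod (NT R) (\<lambda>i. S (srefl R i)) ws ** matrix_inv t)"
      using ti by (simp add: matrix_mul_assoc)
    thus ?case using Cons eq[of i] by simp
  qed
  thus ?thesis using sectionD(3)[OF S ws(1)] sectionD(3)[OF S' ws(1)] ws(2) by simp
qed

lemma section_unique:
  assumes "is_section R S" "is_section R S'" "\<And>i. i \<in> {1..n} \<Longrightarrow> S (srefl R i) = S' (srefl R i)"
  shows "S = S'"
proof (rule extensionalityI[OF sectionD(4)[OF assms(1)] sectionD(4)[OF assms(2)]])
  fix w assume "w \<in> carrier (Weyl R)"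
  thus "S w = S' w" using section_conj[OF assms(1,2) TH(2), of w] assms(3) by simp
qed

lemma section_of_eq:
  assumes "is_section R S" "given_by R t S"
  shows "section_of R t = S"
  unfolding section_of_def
proof (rule the_equality)
  fix S' assume "is_section R S' \<and> given_by R t S'"
  thus "S' = S" using assms by (intro section_unique) (auto simp: given_by_def)
qed (use assms in simp)

text \<open>A concatenation of two reduced words need not be reduced, but by
  \<open>invol_word_prod_eq\<close> its product agrees with that of a reduced word of the same
  element.\<close>

lemma section_hom:
  assumes S: "is_section R S" and sq: "\<And>i. i \<in> {1..n} \<Longrightarrow> S (srefl R i) ** S (srefl R i) = mat 1"
  shows "homomorphic R S"
  unfolding homomorphic_def
proof (rule homI)
  note br = section_braid[OF S]
  let ?g = "\<lambda>i. S (srefl R i)"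
  show "S w \<in> N" if "w \<in> carrier (Weyl R)" for w using sectionD(1)[OF S that] .
  fix v w assume "v \<in> carrier (Weyl R)" "w \<in> carrier (Weyl R)"
  then obtain vs ws where vs: "W.red vs" "v = Wword vs" and ws: "W.red ws" "w = Wword ws" using Weyl_word by metis
  have sub: "set (vs @ ws) \<subseteq> {1..n}" using W.redD vs(1) ws(1) by auto
  have vw: "v \<otimes>\<^bsub>Weyl R\<^esub> w = Wword (vs @ ws)"
    using Wword_append[OF W.redD[OF vs(1)] W.redD[OF ws(1)]] vs(2) ws(2) by simp
  obtain r where r: "W.red r" "word_perm n r = word_perm n (vs @ ws)" using W.red_exists[OF sub] .
  have "Wword r = Wword (vs @ ws)" using Wword_eq_iff[OF W.redD[OF r(1)] sub] r(2) by simp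
  hence "S (v \<otimes>\<^bsub>Weyl R\<^esub> w) = word_prod (NT R) ?g r" using vw sectionD(3)[OF S r(1)] by simp
  also have "\<dots> = word_prod (NT R) ?g (vs @ ws)"
    using D_braid.invol_word_prod_eq[OF br _ W.redD[OF r(1)] sub r(2)] sq by simp
  also have "\<dots> = word_prod (NT R) ?g vs \<otimes>\<^bsub>NT R\<^esub> word_prod (NT R) ?g ws"
    using sub sectionD(1)[OF S srefl_carrier] by (intro word_prod_append[OF group.is_monoid[OF NT_group]]) auto
  also have "\<dots> = S v \<otimes>\<^bsub>NT R\<^esub> S w" using sectionD(3)[OF S] vs ws by simp
  finally show "S (v \<otimes>\<^bsub>Weyl R\<^esub> w) = S v \<otimes>\<^bsub>NT R\<^esub> S w" .
qed

end

section \<open>Sections in coordinates\<close>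

context realized_D
begin

text \<open>Moving \<sigma>_i past a torus element applies s_i to its coordinates; repeated use
  collects all torus factors on the left.\<close>

lemma mult_tau_sigma:
  fixes g :: "'f ^'m ^'m"
  assumes "i \<in> {1..n}" "nz d" "nz e"
  shows "(tau d ** \<sigma> i) ** (tau e ** g) = tau (\<lambda>k. d k * sact i e k) ** (\<sigma> i ** g)"
proof -
  have "\<sigma> i ** tau e = tau (sact i e) ** \<sigma> i"
    using act_tau[OF assms(1,3)] sigma_inv[OF assms(1)] by (metis mult_inv_cancel(4))
  hence "(tau d ** \<sigma> i) ** (tau e ** g) = tau d ** (tau (sact i e) ** \<sigma> i) ** g"
    by (metis matrix_mul_assoc)
  thus ?thesis using tau_mult[OF assms(2) nz_sact[OF assms(1,3)]] by (simp add: matrix_mul_assoc)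
qed

lemma tau_mult_eq_iff:
  fixes g :: "'f ^'m ^'m"
  assumes "nz d" "nz e" "invertible g"
  shows "tau d ** g = tau e ** g \<longleftrightarrow> (\<forall>k\<in>{1..n}. d k = e k)"
proof
  assume "tau d ** g = tau e ** g"
  hence "tau d = tau e" using mult_inv_cancel(3)[OF assms(3)] by metis
  thus "\<forall>k\<in>{1..n}. d k = e k" using tau_inj[OF assms(1,2)] by blast
next
  assume "\<forall>k\<in>{1..n}. d k = e k"
  thus "tau d ** g = tau e ** g" using tau_cong[of d e] by simp
qed

section \<open>The braid relations as equations between coordinates\<close>

definition comm_rel :: "nat \<Rightarrow> nat \<Rightarrow> (nat \<Rightarrow> 'f) \<Rightarrow> (nat \<Rightarrow> 'f) \<Rightarrow> bool" where
  "comm_rel i j d e \<longleftrightarrow> (\<forall>k\<in>{1..n}. d k * sact i e k = e k * sact j d k)"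

definition braid_rel :: "nat \<Rightarrow> nat \<Rightarrow> (nat \<Rightarrow> 'f) \<Rightarrow> (nat \<Rightarrow> 'f) \<Rightarrow> bool" where
  "braid_rel i j d e \<longleftrightarrow> (\<forall>k\<in>{1..n}. d k * (sact i e k * sact i (sact j d) k) = e k * (sact j d k * sact j (sact i e) k))"

lemma comm_rel_iff:
  assumes i: "i \<in> {1..n}" "j \<in> {1..n}" "i \<noteq> j" "\<not> D_adj n i j" and d: "nz d" "nz e"
  shows "(tau d ** \<sigma> i) ** (tau e ** \<sigma> j) = (tau e ** \<sigma> j) ** (tau d ** \<sigma> i) \<longleftrightarrow> comm_rel i j d e"
proof -
  have "invertible (\<sigma> i ** \<sigma> j)" using sigma_inv i by (simp add: invertible_mult)
  thus ?thesis
    unfolding comm_rel_def mult_tau_sigma[OF i(1) d] mult_tau_sigma[OF i(2) d(2,1)] sigma_comm[OF i, symmetric]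
    by (intro tau_mult_eq_iff nz_mult nz_sact d i)
qed

lemma braid_rel_iff:
  assumes i: "i \<in> {1..n}" "j \<in> {1..n}" "D_adj n i j" and d: "nz d" "nz e"
  shows "(tau d ** \<sigma> i) ** ((tau e ** \<sigma> j) ** (tau d ** \<sigma> i)) = (tau e ** \<sigma> j) ** ((tau d ** \<sigma> i) ** (tau e ** \<sigma> j))
    \<longleftrightarrow> braid_rel i j d e"
proof -
  have l: "(tau d ** \<sigma> i) ** ((tau e ** \<sigma> j) ** (tau d ** \<sigma> i)) =
      tau (\<lambda>k. d k * (sact i e k * sact i (sact j d) k)) ** (\<sigma> i ** \<sigma> j ** \<sigma> i)"
    if i: "i \<in> {1..n}" "j \<in> {1..n}" and d: "nz d" "nz e" for i j d e
  proof -
    have "sact i (\<lambda>k. e k * sact j d k) = (\<lambda>k. sact i e k * sact i (sact j d) k)"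
      by (rule ext) (simp add: sact_apply[of i])
    thus ?thesis
      unfolding mult_tau_sigma[OF i(2) d(2,1)]
        mult_tau_sigma[OF i(1) d(1) nz_mult[OF d(2) nz_sact[OF i(2) d(1)]]]
      by (simp add: matrix_mul_assoc)
  qed
  have "invertible (\<sigma> i ** \<sigma> j ** \<sigma> i)" using sigma_inv i by (simp add: invertible_mult)
  moreover have "nz (\<lambda>k. d k * (sact i e k * sact i (sact j d) k))" "nz (\<lambda>k. e k * (sact j d k * sact j (sact i e) k))"
    by (intro nz_mult nz_sact d i)+
  ultimately show ?thesis
    unfolding braid_rel_def l[OF i(1,2) d] l[OF i(2,1) d(2,1)] sigma_braid[OF i, symmetric]
    by (intro tau_mult_eq_iff)
qed

text \<open>For i < n the two moved coordinates have product q. Since the last reflection also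
  inverts, for i = n it is their quotient that equals q.\<close>

definition cf :: "'f \<Rightarrow> 'f \<Rightarrow> 'f \<Rightarrow> nat \<Rightarrow> nat \<Rightarrow> 'f" where
  "cf p q b i k = (if i < n then (if k = i then b else if k = i + 1 then q * inverse b else p)
     else (if k = n - 1 then q * b else if k = n then b else p))"

lemma nz_cf: "p \<noteq> 0 \<Longrightarrow> q \<noteq> 0 \<Longrightarrow> b \<noteq> 0 \<Longrightarrow> nz (cf p q b i)"
  by (simp add: nz_def cf_def)

lemma comm_rel_sym: "comm_rel i j d e \<longleftrightarrow> comm_rel j i e d"
  by (auto simp: comm_rel_def)

lemma braid_rel_sym: "braid_rel i j d e \<longleftrightarrow> braid_rel j i e d"
  by (auto simp: braid_rel_def)

lemma sq_one_inverse: "(p :: 'f)\<^sup>2 = 1 \<Longrightarrow> p \<noteq> 0 \<and> inverse p = p"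
  by (metis inverse_unique power2_eq_square zero_neq_one mult_zero_left)

text \<open>By symmetry i < j. The relation is a formal identity for two nodes of the chain. The
  nodes n-1 and n move the same two coordinates and need q^2 = 1; for node n and a node further
  away, the inversion requires p^2 = 1.\<close>

lemma cf_comm_rel:
  assumes pq: "p\<^sup>2 = 1" "q\<^sup>2 = 1" and b: "b \<noteq> 0" "b' \<noteq> 0"
    and i: "i \<in> {1..n}" "j \<in> {1..n}" "i \<noteq> j" "\<not> D_adj n i j"
  shows "comm_rel i j (cf p q b i) (cf p q b' j)"
proof -
  note P = sq_one_inverse[OF pq(1)] and Q = sq_one_inverse[OF pq(2)]
  have qq: "q * q = 1" "q * (q * x) = x" for x using pq(2) by (simp_all add: power2_eq_square flip: mult.assoc)
  have lt: "comm_rel i j (cf p q b i) (cf p q b' j)"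
    if i: "i \<in> {1..n}" "j \<in> {1..n}" "i < j" "\<not> D_adj n i j" and b: "b \<noteq> 0" "b' \<noteq> 0" for i j b b'
  proof -
    have "(i + 1 < j \<and> j < n) \<or> (i + 1 = n \<and> j = n) \<or> (i + 2 < n \<and> j = n)"
      using i unfolding D_adj_def atLeastAtMost_iff by presburger
    then consider "i + 1 < j" "j < n" | "i + 1 = n" "j = n" | "i + 2 < n" "j = n" by blast
    thus ?thesis
    proof cases
      case 1
      show ?thesis unfolding comm_rel_def
      proof
        fix k
        consider "k = i" | "k = i + 1" | "k = j" | "k = j + 1" | "k \<noteq> i" "k \<noteq> i + 1" "k \<noteq> j" "k \<noteq> j + 1" by blast
        thus "cf p q b i k * sact i (cf p q b' j) k = cf p q b' j k * sact j (cf p q b i) k"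
          by cases (use 1 in \<open>simp_all add: cf_def sact_apply\<close>)
      qed
    next
      case 2
      hence nn: "n = i + 1" "j = i + 1" by simp_all
      show ?thesis unfolding comm_rel_def
      proof
        fix k
        consider "k = i" | "k = i + 1" | "k \<noteq> i" "k \<noteq> i + 1" by blast
        thus "cf p q b i k * sact i (cf p q b' j) k = cf p q b' j k * sact j (cf p q b i) k"
          by cases (use nn b Q qq in \<open>simp_all add: cf_def sact_apply field_simps\<close>)
      qed
    next
      case 3
      hence ne: "n - 1 \<noteq> i" "n - 1 \<noteq> i + 1" "i < n" "i \<noteq> n - 1" "n \<noteq> n - 1" by auto
      show ?thesis unfolding comm_rel_def
      proof
        fix k
        consider "k = i" | "k = i + 1" | "k = n - 1" | "k = n" | "k \<noteq> i" "k \<noteq> i + 1" "k \<noteq> n - 1" "k \<noteq> n" by blast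
        thus "cf p q b i k * sact i (cf p q b' j) k = cf p q b' j k * sact j (cf p q b i) k"
          by cases (use 3 P ne in \<open>simp_all add: cf_def sact_apply\<close>)
      qed
    qed
  qed
  show ?thesis
  proof (cases "i < j")
    case True
    thus ?thesis using lt i b by blast
  next
    case False
    hence "comm_rel j i (cf p q b' j) (cf p q b i)" using i b by (intro lt) (auto simp: D_adj_def)
    thus ?thesis using comm_rel_sym by blast
  qed
qed

lemma cf_braid_rel:
  assumes pq: "p\<^sup>2 = 1" "q\<^sup>2 = 1" and b: "b \<noteq> 0" "b' \<noteq> 0"
    and i: "i \<in> {1..n}" "j \<in> {1..n}" "D_adj n i j"
  shows "braid_rel i j (cf p q b i) (cf p q b' j)"
proof -
  note P = sq_one_inverse[OF pq(1)] and Q = sq_one_inverse[OF pq(2)]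
  have qq: "q * q = 1" "q * (q * x) = x" "p * p = 1" "p * (p * x) = x" for x
    using pq by (simp_all add: power2_eq_square flip: mult.assoc)
  have lt: "braid_rel i j (cf p q b i) (cf p q b' j)"
    if i: "i \<in> {1..n}" "j \<in> {1..n}" "i < j" "D_adj n i j" and b: "b \<noteq> 0" "b' \<noteq> 0" for i j b b'
  proof -
    have "(j = i + 1 \<and> i + 1 < n) \<or> (n = i + 2 \<and> j = i + 2)"
      using i unfolding D_adj_def atLeastAtMost_iff by presburger
    then consider "j = i + 1" "i + 1 < n" | "n = i + 2" "j = i + 2" by blast
    thus ?thesis
    proof cases
      case 1
      show ?thesis unfolding braid_rel_def
      proof
        fix k
        consider "k = i" | "k = i + 1" | "k = i + 2" | "k \<noteq> i" "k \<noteq> i + 1" "k \<noteq> i + 2" by blast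
        thus "cf p q b i k * (sact i (cf p q b' j) k * sact i (sact j (cf p q b i)) k) =
            cf p q b' j k * (sact j (cf p q b i) k * sact j (sact i (cf p q b' j)) k)"
          by cases (use 1 b Q qq in \<open>simp_all add: cf_def sact_apply field_simps\<close>)
      qed
    next
      case 2
      show ?thesis unfolding braid_rel_def
      proof
        fix k
        consider "k = i" | "k = i + 1" | "k = i + 2" | "k \<noteq> i" "k \<noteq> i + 1" "k \<noteq> i + 2" by blast
        thus "cf p q b i k * (sact i (cf p q b' j) k * sact i (sact j (cf p q b i)) k) =
            cf p q b' j k * (sact j (cf p q b i) k * sact j (sact i (cf p q b' j)) k)"
          by cases (use 2 b P Q qq in \<open>simp_all add: cf_def sact_apply mult_ac inverse_mult_distrib\<close>)
      qed
    qed
  qed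
  show ?thesis
  proof (cases "i < j")
    case True
    thus ?thesis using lt i b by blast
  next
    case False
    hence "braid_rel j i (cf p q b' j) (cf p q b i)" using i b by (intro lt) (auto simp: D_adj_def)
    thus ?thesis using braid_rel_sym by blast
  qed
qed

text \<open>Reading the relations coordinate by coordinate propagates equalities along the chain of
  nodes below n. The relations involving node n then force the two common values to be
  signs.\<close>

lemma relations_solution:
  assumes d: "\<And>i. i \<in> {1..n} \<Longrightarrow> nz (d i)"
    and comm: "\<And>i j. i \<in> {1..n} \<Longrightarrow> j \<in> {1..n} \<Longrightarrow> i \<noteq> j \<Longrightarrow> \<not> D_adj n i j \<Longrightarrow> comm_rel i j (d i) (d j)"
    and braid: "\<And>i j. i \<in> {1..n} \<Longrightarrow> j \<in> {1..n} \<Longrightarrow> D_adj n i j \<Longrightarrow> braid_rel i j (d i) (d j)"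
  obtains p q b where "p\<^sup>2 = 1" "q\<^sup>2 = 1" "\<And>i. i \<in> {1..n} \<Longrightarrow> b i \<noteq> 0"
    "\<And>i k. i \<in> {1..n} \<Longrightarrow> k \<in> {1..n} \<Longrightarrow> d i k = cf p q (b i) i k"
proof -
  have nzd: "d i k \<noteq> 0" if "1 \<le> i" "i \<le> n" "1 \<le> k" "k \<le> n" for i k using d nzD that by auto
  \<comment> \<open>From commuting nodes below n: away from its own two positions, each coordinate
    vector is constant on either side.\<close>
  have A: "d j i = d j (i + 1)" if "1 \<le> i" "i < n" "1 \<le> j" "j < n" "i + 1 < j \<or> j + 1 < i" for i j
  proof -
    have "comm_rel i j (d i) (d j)" using that by (intro comm) (auto simp: D_adj_def)
    hence "d i i * sact i (d j) i = d j i * sact j (d i) i" using that by (simp add: comm_rel_def)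
    moreover have "sact j (d i) i = d i i" using that by (auto simp: sact_apply)
    moreover have "sact i (d j) i = d j (i + 1)" using that by (simp add: sact_apply)
    ultimately show ?thesis using nzd[of i i] that by (simp add: mult.commute)
  qed
  have br: "d i k * (sact i (d (i + 1)) k * sact i (sact (i + 1) (d i)) k) =
      d (i + 1) k * (sact (i + 1) (d i) k * sact (i + 1) (sact i (d (i + 1))) k)"
    if "1 \<le> i" "i + 1 < n" "1 \<le> k" "k \<le> n" for i k
    using braid[of i "i + 1"] that by (simp add: braid_rel_def D_adj_def)
  \<comment> \<open>The braid relation of i and i+1 read at a coordinate outside i, i+1, i+2;
    \<open>D2\<close> and \<open>D3\<close> read it at i and at i+1.\<close>
  have D1: "d i k = d (i + 1) k" if i: "1 \<le> i" "i + 1 < n" and k: "1 \<le> k" "k \<le> n" "k < i \<or> i + 2 < k" for i k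
  proof -
    have "k \<noteq> i" "k \<noteq> i + 1" "k \<noteq> i + 2" using k(3) by auto
    hence "d i k * (d (i + 1) k * d i k) = d (i + 1) k * (d i k * d (i + 1) k)"
      using br[OF i k(1,2)] i by (simp add: sact_apply)
    thus ?thesis using nzd[of i k] nzd[of "i + 1" k] i k by simp
  qed
  have D2: "d (i + 1) i = d i (i + 2)" if i: "1 \<le> i" "i + 1 < n" for i
  proof -
    have "d i i * (d (i + 1) (i + 1) * d i (i + 2)) = d (i + 1) i * (d i i * d (i + 1) (i + 1))"
      using br[OF i, of i] i by (simp add: sact_apply)
    thus ?thesis using nzd[of i i] nzd[of "i + 1" "i + 1"] i by simp
  qed
  have D3: "d i i * d i (i + 1) = d (i + 1) (i + 1) * d (i + 1) (i + 2)" if i: "1 \<le> i" "i + 1 < n" for i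
  proof -
    have "d i (i + 1) * (d (i + 1) i * d i i) = d (i + 1) (i + 1) * (d i (i + 2) * d (i + 1) (i + 2))"
      using br[OF i, of "i + 1"] i by (simp add: sact_apply)
    hence "d (i + 1) i * (d i i * d i (i + 1)) = d (i + 1) i * (d (i + 1) (i + 1) * d (i + 1) (i + 2))"
      by (simp only: D2[OF i, symmetric] mult_ac)
    moreover have "d (i + 1) i \<noteq> 0" using nzd[of "i + 1" i] i by simp
    ultimately show ?thesis by (metis mult_left_cancel)
  qed
  have right: "d j k = d j n" if j: "1 \<le> j" "j + 1 < k" "k \<le> n" for j k
  proof -
    have "d j k = d j m" if "k \<le> m" "m \<le> n" for m
      using that by (induction m rule: dec_induct) (use A j in auto)
    thus ?thesis using j by simp
  qed
  have left: "d j k = d j (j - 1)" if j: "1 \<le> k" "k < j" "j < n" for j k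
  proof -
    have "d j k = d j m" if "k \<le> m" "m + 1 \<le> j" for m
      using that by (induction m rule: dec_induct) (use A j in auto)
    thus ?thesis using j by simp
  qed
  define p q b where "p = d 1 n" and "q = d 1 1 * d 1 2" and "b i = (if i < n then d i i else d n n)" for i
  have R: "d i n = p" if "1 \<le> i" "i + 2 \<le> n" for i
    using that
  proof (induction i rule: dec_induct)
    case base
    show ?case by (simp add: p_def)
  next
    case (step i)
    thus ?case using D1[of i n] by simp
  qed
  \<comment> \<open>The value to the left of position j equals, by \<open>D2\<close>, the value to
    the right for node j-1; so left and right values of all nodes below n coincide with p.\<close>
  have off: "d j k = p" if j: "1 \<le> j" "j < n" and k: "1 \<le> k" "k \<le> n" "k \<noteq> j" "k \<noteq> j + 1" for j k
  proof (cases "k < j")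
    case True
    have "d j k = d (j - 1 + 1) (j - 1)" using left[of k j] True j k by simp
    also have "\<dots> = d (j - 1) (j - 1 + 2)" using D2[of "j - 1"] True j k by simp
    also have "\<dots> = d (j - 1) n" using right[of "j - 1" "j - 1 + 2"] True j k by simp
    also have "\<dots> = p" using R[of "j - 1"] True j k by simp
    finally show ?thesis .
  next
    case False
    hence "j + 1 < k" using k by simp
    thus ?thesis using right[of j k] R[of j] j k by simp
  qed
  \<comment> \<open>Node n inverts the coordinates it moves, so commuting with node 1 compares p
    with its inverse.\<close>
  have pp: "p * p = 1"
  proof -
    have "comm_rel 1 n (d 1) (d n)" using rank by (intro comm) (auto simp: D_adj_def)
    hence "d 1 n * sact 1 (d n) n = d n n * sact n (d 1) n" using rank by (simp add: comm_rel_def)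
    moreover have "sact 1 (d n) n = d n n" "sact n (d 1) n = inverse (d 1 (n - 1))" using rank by (simp_all add: sact_apply)
    moreover have "d 1 (n - 1) = p" using rank by (intro off) auto
    ultimately have "p * d n n = inverse p * d n n" by (simp add: p_def mult.commute)
    hence "p = inverse p" using nzd[of n n] rank by simp
    moreover have "p \<noteq> 0" using nzd[of 1 n] rank by (simp add: p_def)
    ultimately show ?thesis by (metis right_inverse)
  qed
  have Q: "d i i * d i (i + 1) = q" if "1 \<le> i" "i < n" for i
    using that
  proof (induction i rule: dec_induct)
    case base
    show ?case by (simp add: q_def numeral_2_eq_2)
  next
    case (step i)
    thus ?case using D3[of i] by simp
  qed
  \<comment> \<open>Nodes n-1 and n commute although both move the last two coordinates. The two
    coordinate equations link the quotient for node n with the product q for node n-1 in both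
    directions, which gives q^2 = 1.\<close>
  have C: "q * d n n = d n (n - 1)" "q * d n (n - 1) = d n n"
  proof -
    have r: "comm_rel (n - 1) n (d (n - 1)) (d n)" using rank by (intro comm) (auto simp: D_adj_def)
    have nn: "n - 1 < n" "n - 1 \<noteq> n" "n - 1 + 1 = n" "n - 1 \<in> {1..n}" "n \<in> {1..n}" using rank by auto
    define u v s t where "u = d (n - 1) (n - 1)" and "v = d (n - 1) n" and "s = d n (n - 1)" and "t = d n n"
    have nz: "u \<noteq> 0" "v \<noteq> 0" "s \<noteq> 0" "t \<noteq> 0" unfolding u_def v_def s_def t_def using rank by (simp_all add: nzd)
    have "u * t = s * inverse v"
      using bspec[OF r[unfolded comm_rel_def] nn(4)] nn(1-3) unfolding sact_apply u_def v_def s_def t_def by simp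
    moreover have "v * s = t * inverse u"
      using bspec[OF r[unfolded comm_rel_def] nn(5)] nn(1-3) unfolding sact_apply u_def v_def s_def t_def by simp
    moreover have "q = u * v" using Q[of "n - 1"] nn unfolding u_def v_def by simp
    ultimately show "q * d n n = d n (n - 1)" "q * d n (n - 1) = d n n"
      unfolding s_def[symmetric] t_def[symmetric] using nz by (simp_all add: field_simps)
  qed
  have qq: "q * q = 1"
  proof -
    have "q * q * d n n = d n n" using C by (simp add: mult.assoc)
    thus ?thesis using nzd[of n n] rank by simp
  qed
  \<comment> \<open>The braid relation of n-2 and n transfers the value p, known for node n-2, to
    node n.\<close>
  have last: "d n k = p" if k: "1 \<le> k" "k + 2 \<le> n" for k
  proof -
    define m where "m = n - 2"
    have m: "n = m + 2" "4 \<le> m" using rank by (auto simp: m_def)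
    have "braid_rel m n (d m) (d n)" using m by (intro braid) (auto simp: D_adj_def)
    hence e: "d m k * (sact m (d n) k * sact m (sact n (d m)) k) = d n k * (sact n (d m) k * sact n (sact m (d n)) k)"
      using k by (simp add: braid_rel_def)
    have nn: "m < n" "\<not> n < n" "n - 1 = m + 1" "n \<noteq> m" "n \<noteq> m + 1" using m by auto
    show ?thesis
    proof (cases "k = m")
      case True
      have "d m m * (d n (m + 1) * inverse (d m n)) = d n m * (d m m * d n (m + 1))"
        using e nn unfolding True by (simp add: sact_apply)
      hence "d n m = inverse (d m n)" using nzd[of m m] nzd[of n "m + 1"] m by (simp add: mult_ac)
      also have "d m n = p" using R[of m] m by simp
      also have "inverse p = p" using pp by (metis inverse_unique)
      finally show ?thesis using True by simp
    next
      case False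
      hence km: "k < m" using k m by simp
      hence kn: "k \<noteq> m" "k \<noteq> m + 1" "k \<noteq> n" using m by auto
      have z: "d m k \<noteq> 0" "d n k \<noteq> 0" using nzd[of m k] nzd[of n k] k m by auto
      have "d n k = d m k" using e nn kn z by (simp add: sact_apply)
      thus ?thesis using off[of m k] km k m by simp
    qed
  qed
  show ?thesis
  proof (rule that[of p q b])
    show "p\<^sup>2 = 1" "q\<^sup>2 = 1" using pp qq by (simp_all add: power2_eq_square)
    show "b i \<noteq> 0" if "i \<in> {1..n}" for i using nzd[of i i] nzd[of n n] that by (simp add: b_def)
    fix i k assume ik: "i \<in> {1..n}" "k \<in> {1..n}"
    show "d i k = cf p q (b i) i k"
    proof (cases "i < n")
      case True
      have "d i (i + 1) = q * inverse (d i i)" using Q[of i] True ik nzd[of i i] by (auto simp: field_simps)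
      thus ?thesis using off[of i k] True ik by (auto simp: cf_def b_def)
    next
      case False
      hence i: "i = n" using ik by simp
      consider "k = n - 1" | "k = n" | "k + 2 \<le> n" using ik by fastforce
      thus ?thesis
      proof cases
        case 1
        thus ?thesis using C(1) i by (simp add: cf_def b_def)
      next
        case 2
        have "n \<noteq> n - 1" using rank by simp
        thus ?thesis using i 2 by (simp add: cf_def b_def)
      next
        case 3
        hence "k \<noteq> n" "k \<noteq> n - 1" by auto
        thus ?thesis using last[of k] 3 i ik by (simp add: cf_def)
      qed
    qed
  qed
qed

definition has_pq :: "'f \<Rightarrow> 'f \<Rightarrow> ('f, 'm) sect \<Rightarrow> bool" where
  "has_pq p q S \<longleftrightarrow> (\<exists>b. (\<forall>i\<in>{1..n}. b i \<noteq> 0) \<and> (\<forall>i\<in>{1..n}. S (srefl R i) = tau (cf p q (b i) i) ** \<sigma> i))"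

lemma section_has_pq:
  assumes S: "is_section R S"
  obtains p q where "p\<^sup>2 = 1" "q\<^sup>2 = 1" "has_pq p q S"
proof -
  have "\<exists>d. nz d \<and> S (srefl R i) = tau d ** \<sigma> i" if i: "i \<in> {1..n}" for i
  proof -
    have "proj R (S (srefl R i)) = proj R (\<sigma> i)"
      using sectionD(2)[OF S srefl_carrier[OF i]] proj_sigma[OF i] by simp
    then obtain t where t: "t \<in> T" "S (srefl R i) = t ** \<sigma> i"
      using proj_eq_iff[OF sectionD(1)[OF S srefl_carrier[OF i]] sigma_N[OF i]] by blast
    thus ?thesis using tau_surj[OF t(1)] by metis
  qed
  then obtain d where d: "\<And>i. i \<in> {1..n} \<Longrightarrow> nz (d i)" "\<And>i. i \<in> {1..n} \<Longrightarrow> S (srefl R i) = tau (d i) ** \<sigma> i"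
    by metis
  note br = section_braid[OF S]
  have comm: "comm_rel i j (d i) (d j)" if i: "i \<in> {1..n}" "j \<in> {1..n}" "i \<noteq> j" "\<not> D_adj n i j" for i j
    using D_braid.g_comm[OF br i] comm_rel_iff[OF i d(1)[OF i(1)] d(1)[OF i(2)]] d(2)[OF i(1)] d(2)[OF i(2)] by simp
  have braid: "braid_rel i j (d i) (d j)" if i: "i \<in> {1..n}" "j \<in> {1..n}" "D_adj n i j" for i j
    using D_braid.g_braid[OF br i] braid_rel_iff[OF i d(1)[OF i(1)] d(1)[OF i(2)]] d(2)[OF i(1)] d(2)[OF i(2)] by simp
  show ?thesis
  proof (rule relations_solution[of d, OF d(1) comm braid])
    fix p q b assume pq: "p\<^sup>2 = 1" "q\<^sup>2 = 1" and b: "\<And>i. i \<in> {1..n} \<Longrightarrow> b i \<noteq> 0"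
      and eq: "\<And>i k. i \<in> {1..n} \<Longrightarrow> k \<in> {1..n} \<Longrightarrow> d i k = cf p q (b i) i k"
    have "tau (d i) = tau (cf p q (b i) i)" if "i \<in> {1..n}" for i
      using eq[OF that] by (intro tau_cong) auto
    hence "has_pq p q S" unfolding has_pq_def using b d(2) by (intro exI[of _ b]) auto
    thus thesis by (rule that[OF pq])
  qed
qed

lemma has_pq_exists:
  assumes pq: "p\<^sup>2 = 1" "q\<^sup>2 = 1" and b: "\<And>i. i \<in> {1..n} \<Longrightarrow> b i \<noteq> 0"
  obtains S where "is_section R S" "\<And>i. i \<in> {1..n} \<Longrightarrow> S (srefl R i) = tau (cf p q (b i) i) ** \<sigma> i"
proof -
  define g where "g i = tau (cf p q (b i) i) ** \<sigma> i" for i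
  note P = sq_one_inverse[OF pq(1)] and Q = sq_one_inverse[OF pq(2)]
  have nz: "nz (cf p q (b i) i)" if "i \<in> {1..n}" for i using nz_cf P Q b that by blast
  have g: "g i \<in> N \<and> proj R (g i) = srefl R i" if i: "i \<in> {1..n}" for i
  proof -
    have t: "tau (cf p q (b i) i) \<in> T" using tau_in[OF nz[OF i]] .
    have "g i \<in> N" unfolding g_def using NH(3) T_N[OF t] sigma_N[OF i] by blast
    thus ?thesis using proj_eq_iff[of "g i" "\<sigma> i"] sigma_N[OF i] t proj_sigma[OF i] by (auto simp: g_def)
  qed
  have "D_braid n (NT R) g"
  proof (intro D_braid.intro D_braid_axioms.intro)
    show "D_weyl n" by (rule W.D_weyl_axioms)
    show "Group.monoid (NT R)" using NT_group by (rule group.is_monoid)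
    show "g i \<in> N" if "i \<in> {1..n}" for i using g that by blast
    fix i j assume ij: "i \<in> {1..n}" "j \<in> {1..n}"
    show "g i \<otimes>\<^bsub>NT R\<^esub> g j = g j \<otimes>\<^bsub>NT R\<^esub> g i" if "i \<noteq> j" "\<not> D_adj n i j"
      using comm_rel_iff[OF ij that nz[OF ij(1)] nz[OF ij(2)]] cf_comm_rel[OF pq b[OF ij(1)] b[OF ij(2)] ij that]
      by (simp add: g_def)
    show "g i \<otimes>\<^bsub>NT R\<^esub> (g j \<otimes>\<^bsub>NT R\<^esub> g i) = g j \<otimes>\<^bsub>NT R\<^esub> (g i \<otimes>\<^bsub>NT R\<^esub> g j)" if "D_adj n i j"
      using braid_rel_iff[OF ij that nz[OF ij(1)] nz[OF ij(2)]] cf_braid_rel[OF pq b[OF ij(1)] b[OF ij(2)] ij that]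
      by (simp add: g_def)
  qed
  then obtain S where S: "is_section R S" "\<And>i. i \<in> {1..n} \<Longrightarrow> S (srefl R i) = g i"
    using section_exists[OF _ g] by blast
  show ?thesis by (rule that[of S]) (use S in \<open>simp_all add: g_def\<close>)
qed

text \<open>Conjugation by t multiplies by t s_i(t)^-1, which is the coroot of \<alpha>_i evaluated
  at \<alpha>_i(t).\<close>

lemma conj_tau_sigma:
  assumes i: "i \<in> {1..n}" and d: "nz d" and e: "nz e"
  shows "tau e ** (tau d ** \<sigma> i) ** matrix_inv (tau e) = tau (\<lambda>k. co i (a i (tau e)) k * d k) ** \<sigma> i"
proof -
  let ?x = "a i (tau e)"
  have x: "?x \<noteq> 0" using aD(2)[OF i tau_in[OF e]] .
  have inv: "tau (\<lambda>k. inverse (e k)) = matrix_inv (tau e)" by (rule tau_inverse[OF e])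
  note ie = nz_inverse[OF e]
  have "tau e ** (tau d ** \<sigma> i) ** matrix_inv (tau e) = tau e ** ((tau d ** \<sigma> i) ** (matrix_inv (tau e) ** mat 1))"
    by (simp add: matrix_mul_assoc)
  also have "\<dots> = tau e ** (tau (\<lambda>k. d k * sact i (\<lambda>k. inverse (e k)) k) ** (\<sigma> i ** mat 1))"
    unfolding inv[symmetric] mult_tau_sigma[OF i d ie] ..
  also have "\<dots> = tau (\<lambda>k. e k * (d k * sact i (\<lambda>k. inverse (e k)) k)) ** \<sigma> i"
    using tau_mult[OF e nz_mult[OF d nz_sact[OF i ie]]] by (simp add: matrix_mul_assoc)
  also have "tau (\<lambda>k. e k * (d k * sact i (\<lambda>k. inverse (e k)) k)) = tau (\<lambda>k. co i ?x k * d k)"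
  proof (rule tau_cong)
    fix k assume k: "1 \<le> k" "k \<le> n"
    note ek = nzD[OF e k]
    show "e k * (d k * sact i (\<lambda>k. inverse (e k)) k) = co i ?x k * d k"
    proof (cases "i < n")
      case True
      thus ?thesis using ek by (simp add: a_tau[OF i e] co_def sact_apply)
    next
      case False
      hence i': "i = n" using i by simp
      hence x: "?x = e (n - 1) * e n" using a_tau[OF i e] by simp
      have ne: "n \<noteq> n - 1" using rank by simp
      consider "k = n - 1" | "k = n" | "k \<noteq> n - 1" "k \<noteq> n" by blast
      thus ?thesis unfolding x by cases (use ek ne i' in \<open>simp_all add: co_def sact_apply\<close>)
    qed
  qed
  finally show ?thesis .
qed

lemma conj_cf:
  assumes i: "i \<in> {1..n}" and nz: "p \<noteq> 0" "q \<noteq> 0" "b \<noteq> 0" and e: "nz e"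
  shows "tau e ** (tau (cf p q b i) ** \<sigma> i) ** matrix_inv (tau e) = tau (cf p q (a i (tau e) * b) i) ** \<sigma> i"
proof -
  have "(\<lambda>k. co i x k * cf p q b i k) = cf p q (x * b) i" for x
    using rank by (auto simp: co_def cf_def fun_eq_iff)
  thus ?thesis using conj_tau_sigma[OF i nz_cf[OF nz] e] by simp
qed

text \<open>The conditions at i < n are the recursion e_k = y_k e_{k+1} starting from e_n = z. The
  condition at n then reads y_{n-1} z^2 = y_n, which only requires a square root.\<close>

lemma roots_prescribed:
  assumes y: "\<And>i. i \<in> {1..n} \<Longrightarrow> y i \<noteq> 0"
  obtains e where "nz e" "\<And>i. i \<in> {1..n} \<Longrightarrow> a i (tau e) = y i"
proof -
  have n: "n \<in> {1..n}" "n - 1 \<in> {1..n}" "n - 1 < n" "n - 1 + 1 = n" using rank by auto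
  obtain z where z: "z\<^sup>2 = y n * inverse (y (n - 1))" using nth_root_exists[of 2 "y n * inverse (y (n - 1))"] by auto
  have z0: "z \<noteq> 0" using z y[OF n(1)] y[OF n(2)] by auto
  define e where "e k = z * (\<Prod>l=k..<n. y l)" for k
  have e: "nz e" using z0 y by (auto simp: nz_def e_def)
  have step: "e k = y k * e (k + 1)" if "k < n" for k
    using that by (simp add: e_def prod.atLeast_Suc_lessThan)
  have "a i (tau e) = y i" if i: "i \<in> {1..n}" for i
  proof (cases "i < n")
    case True
    thus ?thesis using a_tau[OF i e] step[OF True] nzD[OF e, of "i + 1"] by simp
  next
    case False
    hence i': "i = n" using i by simp
    have "e (n - 1) * e n = y (n - 1) * z\<^sup>2" using step[OF n(3)] n(4) by (simp add: e_def power2_eq_square)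
    also have "\<dots> = y n" using z y[OF n(2)] by simp
    finally show ?thesis using a_tau[OF i e] i' by simp
  qed
  thus ?thesis using that e by blast
qed

text \<open>Conjugation changes only the units b_i, each by the factor \<alpha>_i(t), and these
  factors can be prescribed independently. Agreement on the s_i extends to all of N/T along reduced
  words.\<close>

lemma T_conjugate_iff:
  assumes S: "is_section R S" and S': "is_section R S'" and pq: "p\<^sup>2 = 1" "q\<^sup>2 = 1" and h: "has_pq p q S"
  shows "T_conjugate R S S' \<longleftrightarrow> has_pq p q S'"
proof -
  note P = sq_one_inverse[OF pq(1)] and Q = sq_one_inverse[OF pq(2)]
  obtain b where b: "\<And>i. i \<in> {1..n} \<Longrightarrow> b i \<noteq> 0" "\<And>i. i \<in> {1..n} \<Longrightarrow> S (srefl R i) = tau (cf p q (b i) i) ** \<sigma> i"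
    using h unfolding has_pq_def by blast
  show ?thesis
  proof
    assume "T_conjugate R S S'"
    then obtain t where t: "t \<in> T" "\<And>w. w \<in> carrier (Weyl R) \<Longrightarrow> t ** S w ** matrix_inv t = S' w"
      by (auto simp: T_conjugate_def)
    obtain e where e: "nz e" "t = tau e" using tau_surj[OF t(1)] .
    have "S' (srefl R i) = tau (cf p q (a i (tau e) * b i) i) ** \<sigma> i" if i: "i \<in> {1..n}" for i
      using t(2)[OF srefl_carrier[OF i]] conj_cf[OF i _ _ b(1)[OF i] e(1)] P Q e(2) b(2)[OF i] by auto
    moreover have "a i (tau e) * b i \<noteq> 0" if i: "i \<in> {1..n}" for i using aD(2)[OF i tau_in[OF e(1)]] b(1)[OF i] by simp
    ultimately show "has_pq p q S'" unfolding has_pq_def by (intro exI[of _ "\<lambda>i. a i (tau e) * b i"]) auto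
  next
    assume "has_pq p q S'"
    then obtain b' where b': "\<And>i. i \<in> {1..n} \<Longrightarrow> b' i \<noteq> 0" "\<And>i. i \<in> {1..n} \<Longrightarrow> S' (srefl R i) = tau (cf p q (b' i) i) ** \<sigma> i"
      unfolding has_pq_def by blast
    obtain e where e: "nz e" "\<And>i. i \<in> {1..n} \<Longrightarrow> a i (tau e) = b' i * inverse (b i)"
      using roots_prescribed[of "\<lambda>i. b' i * inverse (b i)"] b(1) b'(1) by auto
    have "tau e ** S (srefl R i) ** matrix_inv (tau e) = S' (srefl R i)" if i: "i \<in> {1..n}" for i
    proof -
      have "a i (tau e) * b i = b' i" using e(2)[OF i] b(1)[OF i] by (simp add: mult.assoc)
      thus ?thesis using conj_cf[OF i _ _ b(1)[OF i] e(1)] P Q b(2)[OF i] b'(2)[OF i] by simp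
    qed
    thus "T_conjugate R S S'"
      unfolding T_conjugate_def using section_conj[OF S S' tau_in[OF e(1)]] tau_in[OF e(1)] by blast
  qed
qed

text \<open>In the square the two moved coordinates combine to q and the others to p^2 = 1, while
  \<sigma>_i^2 contributes the value of the coroot at -1. The vector \<open>cf 1 1 (- q) i\<close>
  has -q at both places because q is its own inverse.\<close>

lemma cf_square:
  assumes i: "i \<in> {1..n}" and pq: "p\<^sup>2 = 1" "q\<^sup>2 = 1" and b: "b \<noteq> 0"
  shows "(tau (cf p q b i) ** \<sigma> i) ** (tau (cf p q b i) ** \<sigma> i) = tau (cf 1 1 (- q) i)"
proof -
  note P = sq_one_inverse[OF pq(1)] and Q = sq_one_inverse[OF pq(2)]
  have pp: "p * p = 1" "q * q = 1" using pq by (auto simp: power2_eq_square)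
  have nz: "nz (cf p q b i)" using nz_cf P Q b by blast
  have "(tau (cf p q b i) ** \<sigma> i) ** (tau (cf p q b i) ** \<sigma> i) =
      tau (\<lambda>k. (cf p q b i k * sact i (cf p q b i) k) * co i (- 1) k)"
    unfolding mult_tau_sigma[OF i nz nz] sigma_square[OF i]
    using nz_mult[OF nz nz_sact[OF i nz]] nz_co[of "- 1" i] by (intro tau_mult[symmetric]) auto
  also have "\<dots> = tau (cf 1 1 (- q) i)"
  proof (rule tau_cong)
    fix k
    have ne: "n \<noteq> n - 1" using rank by simp
    show "(cf p q b i k * sact i (cf p q b i) k) * co i (- 1) k = cf 1 1 (- q) i k"
    proof (cases "i < n")
      case True
      consider "k = i" | "k = i + 1" | "k \<noteq> i" "k \<noteq> i + 1" by blast
      thus ?thesis by cases (use True b pp Q in \<open>simp_all add: cf_def sact_apply co_def inverse_minus_eq\<close>)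
    next
      case False
      hence i': "i = n" using i by simp
      consider "k = n - 1" | "k = n" | "k \<noteq> n - 1" "k \<noteq> n" by blast
      thus ?thesis by cases (use i' ne b pp Q in \<open>simp_all add: cf_def sact_apply co_def\<close>)
    qed
  qed
  finally show ?thesis .
qed

lemma tau_cf_one: "q = - 1 \<Longrightarrow> tau (cf 1 1 (- q) i) = mat 1"
  using tau_cong[of "cf 1 1 1 i" "\<lambda>_. 1"] tau_one by (simp add: cf_def)

lemma tau_cf_ne_one:
  assumes i: "i \<in> {1..n}" and q: "q \<noteq> 0" "q \<noteq> - 1"
  shows "tau (cf 1 1 (- q) i) \<noteq> mat 1"
proof
  assume "tau (cf 1 1 (- q) i) = mat 1"
  hence "cf 1 1 (- q) i i = 1" using tau_kernel[OF nz_cf[of 1 1 "- q"] _ i] q by simp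
  moreover have "cf 1 1 (- q) i i = - q" using i rank by (auto simp: cf_def)
  ultimately have "- q = 1" by simp
  thus False using q(2) by (metis minus_minus)
qed

text \<open>Otherwise \<sigma>_i would lie in T and act trivially on it, whereas s_i inverts the
  values of the coroot of \<alpha>_i; so its value at x^2 would be trivial for some x^2 other than
  1. This rules out order 1.\<close>

lemma sigma_not_T:
  assumes i: "i \<in> {1..n}" and t: "t \<in> T"
  shows "t ** \<sigma> i \<noteq> mat 1"
proof
  assume "t ** \<sigma> i = mat 1"
  hence "\<sigma> i = matrix_inv t" by (metis matrix_inv_eq)
  hence \<sigma>T: "\<sigma> i \<in> T" using TH(4)[OF t] by simp
  obtain x :: 'f where x: "x \<noteq> 0" "x powi 2 \<noteq> 1" using ex_pow_ne_1[of 2, where 'f = 'f] by auto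
  have xT: "c i x \<in> T" using cD(1)[OF i x(1)] .
  have "\<sigma> i ** c i x ** matrix_inv (\<sigma> i) = c i x"
    using T_comm[OF \<sigma>T xT] sigma_inv[OF i] by simp
  hence "c i x = c i x ** matrix_inv (c i (a i (c i x)))" using act_sigma[OF i xT] by simp
  hence "matrix_inv (c i x) ** c i x = matrix_inv (c i x) ** (c i x ** matrix_inv (c i (a i (c i x))))" by simp
  hence m: "matrix_inv (c i (a i (c i x))) = mat 1" using TH(1)[OF xT] by (simp add: matrix_inv_ex)
  have y: "a i (c i x) = x\<^sup>2" using coroot_facts(2)[OF a_root[OF i] x(1)] .
  have "c i (x\<^sup>2) \<in> T" using cD(1)[OF i] x(1) by simp
  hence "c i (x\<^sup>2) = mat 1" using m y matrix_inv_inv[OF TH(1)] by (metis matrix_inv_mat1)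
  hence one: "tau (co i (x\<^sup>2)) = mat 1" using tau_co[OF i, of "x\<^sup>2"] x(1) by simp
  have "co i (x\<^sup>2) i = 1" using tau_kernel[OF nz_co one i] x(1) by simp
  thus False using x(2) i rank by (auto simp: co_def split: if_splits)
qed

lemma GL_pow: "(g :: 'f ^'m ^'m) [^]\<^bsub>GL\<^esub> (2::nat) = g ** g" "g [^]\<^bsub>GL\<^esub> (4::nat) = (g ** g) ** (g ** g)"
  if "invertible g" for g
  by (simp_all add: numeral_eq_Suc nat_pow_def matrix_mul_assoc)

lemma elt_order_values:
  fixes g :: "'f ^'m ^'m"
  assumes g: "invertible g"
  shows "g \<noteq> mat 1 \<Longrightarrow> g ** g = mat 1 \<Longrightarrow> elt_order g = 2"
    "g ** g \<noteq> mat 1 \<Longrightarrow> (g ** g) ** (g ** g) = mat 1 \<Longrightarrow> elt_order g = 4"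
proof -
  have gc: "g \<in> carrier GL" using g by simp
  note pow = group.pow_eq_id[OF group_GL gc] and p = GL_pow[OF g]
  have one: "g [^]\<^bsub>GL\<^esub> (1::nat) = g" by (simp add: nat_pow_def)
  show "elt_order g = 2" if "g \<noteq> mat 1" "g ** g = mat 1"
  proof -
    have d: "group.ord GL g dvd 2" using pow[of 2] p(1) that by simp
    have nd: "\<not> group.ord GL g dvd 1" using pow[of 1] one that by simp
    have "group.ord GL g \<le> 2" using d by (rule dvd_imp_le) simp
    hence "group.ord GL g \<in> {0, 1, 2}" by auto
    \<comment> \<open>The value 0, which encodes infinite order, is excluded because it does not
      divide 2.\<close>
    hence "group.ord GL g = 2" using d nd by auto
    thus ?thesis by (simp add: elt_order_def numeral_eq_enat)
  qed
  show "elt_order g = 4" if "g ** g \<noteq> mat 1" "(g ** g) ** (g ** g) = mat 1"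
  proof -
    have d: "group.ord GL g dvd 4" using pow[of 4] p(2) that by simp
    have nd: "\<not> group.ord GL g dvd 2" using pow[of 2] p(1) that by simp
    have "group.ord GL g \<le> 4" using d by (rule dvd_imp_le) simp
    hence "group.ord GL g \<in> {0, 1, 2, 3, 4}" by auto
    hence "group.ord GL g = 4" using d nd by auto
    thus ?thesis by (simp add: elt_order_def numeral_eq_enat)
  qed
qed

lemma has_pq_square:
  assumes pq: "p\<^sup>2 = 1" "q\<^sup>2 = 1" and h: "has_pq p q S" and i: "i \<in> {1..n}"
  shows "S (srefl R i) ** S (srefl R i) = tau (cf 1 1 (- q) i)"
  using h cf_square[OF i pq] i by (auto simp: has_pq_def)

lemma has_pq_order:
  assumes pq: "p\<^sup>2 = 1" "q\<^sup>2 = 1" and h: "has_pq p q S" and i: "i \<in> {1..n}"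
  shows "elt_order (S (srefl R i)) = (if q = - 1 then 2 else 4)"
proof -
  note P = sq_one_inverse[OF pq(1)] and Q = sq_one_inverse[OF pq(2)]
  obtain b where b: "b \<noteq> 0" "S (srefl R i) = tau (cf p q b i) ** \<sigma> i" using h i unfolding has_pq_def by blast
  have t: "tau (cf p q b i) \<in> T" using tau_in nz_cf P Q b(1) by blast
  have inv: "invertible (S (srefl R i))" using b(2) TH(1)[OF t] sigma_inv[OF i] by (simp add: invertible_mult)
  have sq: "S (srefl R i) ** S (srefl R i) = tau (cf 1 1 (- q) i)" by (rule has_pq_square[OF pq h i])
  show ?thesis
  proof (cases "q = - 1")
    case True
    thus ?thesis using elt_order_values(1)[OF inv] sq tau_cf_one sigma_not_T[OF i t] b(2) by simp
  next
    case False
    have nz: "nz (cf 1 1 (- q) i)" using nz_cf[of 1 1 "- q"] Q by simp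
    have "tau (\<lambda>k. cf 1 1 (- q) i k * cf 1 1 (- q) i k) = tau (\<lambda>_. 1)"
      using pq(2) Q by (intro tau_cong) (auto simp: cf_def power2_eq_square)
    hence "tau (cf 1 1 (- q) i) ** tau (cf 1 1 (- q) i) = mat 1" using tau_mult[OF nz nz] tau_one by simp
    thus ?thesis using elt_order_values(2)[OF inv] sq tau_cf_ne_one[OF i _ False] Q False by simp
  qed
qed

section \<open>Translation of the given parametrization\<close>

lemma finprod_tau:
  assumes "finite A" and v: "\<And>k. k \<in> A \<Longrightarrow> nz (v k)"
  shows "finprod (GL_on T) (\<lambda>k. tau (v k)) A = tau (\<lambda>j. \<Prod>k\<in>A. v k j)"
proof -
  have "group (GL_on T)" using subgroup.subgroup_is_group[OF T_sub group_GL] .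
  then interpret TT: comm_group "GL_on T"
    by (rule group.group_comm_groupI) (simp add: T_comm)
  show ?thesis using assms
  proof (induction A)
    case empty
    show ?case using tau_one by simp
  next
    case (insert k A)
    have A: "finprod (GL_on T) (\<lambda>k. tau (v k)) A = tau (\<lambda>j. \<Prod>k\<in>A. v k j)" using insert by blast
    have nzA: "nz (\<lambda>j. \<Prod>k\<in>A. v k j)" using insert by (auto simp: nz_def)
    have "finprod (GL_on T) (\<lambda>k. tau (v k)) (insert k A) = tau (v k) ** finprod (GL_on T) (\<lambda>k. tau (v k)) A"
      using TT.finprod_insert[OF insert(1,2), of "\<lambda>k. tau (v k)"] insert(4) tau_in by auto
    also have "\<dots> = tau (\<lambda>j. v k j * (\<Prod>k\<in>A. v k j))" unfolding A using tau_mult[OF _ nzA] insert(4) by simp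
    finally show ?case using insert(1,2) by simp
  qed
qed

definition lam_vec :: "nat \<Rightarrow> 'f \<Rightarrow> nat \<Rightarrow> 'f" where
  "lam_vec k x = (if k < n then co k x else (\<lambda>j. if j = 1 then x else 1))"

text \<open>Base change from the \<lambda>_k to the e_j: the coroot of index j contributes x_j, the
  one of index j-1 the inverse of x_{j-1}, and \<omega>_1 contributes x_n at j = 1 only.\<close>

definition coord_vec :: "(nat \<Rightarrow> 'f) \<Rightarrow> nat \<Rightarrow> 'f" where
  "coord_vec x j = (if j < n then x j else 1) * (if j = 1 then x n else inverse (x (j - 1)))"

lemma tor_coords_tau:
  assumes x: "\<And>k. k \<in> {1..n} \<Longrightarrow> x k \<noteq> 0"
  shows "tor_coords R x = tau (coord_vec x)"
proof -
  have nz: "nz (lam_vec k (x k))" if "k \<in> {1..n}" for k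
    using x[OF that] nz_co by (auto simp: lam_vec_def nz_def)
  have "tau (lam_vec k (x k)) = lam R k (x k)" if k: "k \<in> {1..n}" for k
  proof (cases "k < n")
    case True
    thus ?thesis using tau_co[OF k x[OF k]] by (simp add: lam_vec_def lam_def)
  next
    case False
    thus ?thesis using tau_single[of 1 "x k"] x[OF k] rank by (simp add: lam_vec_def lam_def)
  qed
  moreover have "lam R k (x k) \<in> T" if k: "k \<in> {1..n}" for k
    using calculation[OF k] tau_in[OF nz[OF k]] by simp
  ultimately have "tor_coords R x = finprod (GL_on T) (\<lambda>k. tau (lam_vec k (x k))) {1..n}"
    unfolding tor_coords_def
    by (intro comm_monoid.finprod_cong' comm_group.axioms(1)[OF group.group_comm_groupI
        [OF subgroup.subgroup_is_group[OF T_sub group_GL]]]) (auto simp: T_comm)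
  also have "\<dots> = tau (\<lambda>j. \<Prod>k=1..n. lam_vec k (x k) j)" using nz by (intro finprod_tau) auto
  also have "\<dots> = tau (coord_vec x)"
  proof (rule tau_cong)
    fix j assume j: "1 \<le> j" "j \<le> n"
    have "(\<Prod>k=1..n. lam_vec k (x k) j) = (\<Prod>k=1..n. (if k = j then (if j < n then x j else 1) else 1) *
        ((if k = j - 1 then inverse (x (j - 1)) else 1) * (if k = n then (if j = 1 then x n else 1) else 1)))"
      using j rank by (intro prod.cong) (auto simp: lam_vec_def co_def)
    also have "\<dots> = coord_vec x j"
      unfolding prod.distrib using j rank by (auto simp: coord_vec_def)
    finally show "(\<Prod>k=1..n. lam_vec k (x k) j) = coord_vec x j" .
  qed
  finally show ?thesis .
qed

text \<open>For i < n, q is the product of the coordinates of t_i at e_i and e_{i+1}. The free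
  a_{i,i} cancels there; the given coordinates of t_i around position i leave y or xy according to
  the parity of n.\<close>

definition q_of :: "'f \<Rightarrow> 'f \<Rightarrow> 'f" where
  "q_of x y = (if even n then y else x * y)"

text \<open>The inverse of the given coordinate of t_i at i-1, which the base change multiplies to
  a_{i,i}; for i = 1 it is the \<omega>_1-coordinate y instead.\<close>

definition sign_fac :: "'f \<Rightarrow> 'f \<Rightarrow> nat \<Rightarrow> 'f" where
  "sign_fac x y i = (if even i then x * y else y)"

definition b_of :: "(nat \<Rightarrow> 'f) \<Rightarrow> 'f \<Rightarrow> 'f \<Rightarrow> 'f \<Rightarrow> nat \<Rightarrow> 'f" where
  "b_of u z x y i = (if i < n then u i * sign_fac x y i else x * inverse z)"

text \<open>The base change takes quotients of consecutive given coordinates, so their alternating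
  pattern collapses to the constant x away from the moved places, and the powers of z cancel there.
  The cases locate j relative to i, the boundary j = n being special.\<close>

lemma t_elt_tau:
  fixes u :: "nat \<Rightarrow> 'f"
  assumes adm: "admissible R u z x y" and i: "i \<in> {1..n}"
  shows "t_elt R u z x y i = tau (cf x (q_of x y) (b_of u z x y i) i)"
proof -
  have xy: "x\<^sup>2 = 1" "y\<^sup>2 = 1" "z \<noteq> 0" and u: "\<And>i. 1 \<le> i \<Longrightarrow> i < n \<Longrightarrow> u i \<noteq> 0" using adm by (auto simp: admissible_def)
  have X: "x \<noteq> 0" "inverse x = x" and Y: "y \<noteq> 0" "inverse y = y"
    using sq_one_inverse[OF xy(1)] sq_one_inverse[OF xy(2)] by auto
  have s: "x * x = 1" "y * y = 1" "x * (x * w) = w" "y * (y * w) = w" "z * (inverse z * w) = w" "z * inverse z = 1" for w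
    using xy by (auto simp: power2_eq_square mult.assoc[symmetric])
  have t0: "t_coord n u z x y i k \<noteq> 0" if "k \<in> {1..n}" for k
    using i that X(1) Y(1) xy(3) u[of i] by (auto simp: t_coord_def)
  note rules = t_coord_def cf_def b_of_def q_of_def sign_fac_def coord_vec_def X(2) Y(2) s power2_eq_square mult_ac inverse_mult_distrib
  have "coord_vec (t_coord n u z x y i) j = cf x (q_of x y) (b_of u z x y i) i j" if j: "1 \<le> j" "j \<le> n" for j
  proof (cases "i < n")
    case True
    note ai = u[of i]
    consider "j = 1" | "2 \<le> j" "j < i" | "2 \<le> j" "j = i" | "2 \<le> j" "j = i + 1" "j < n" | "2 \<le> j" "j = i + 1" "j = n"
      | "i + 1 < j" "j < n" | "i + 1 < j" "j = n" using j by linarith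
    thus ?thesis
    proof cases
      case 1
      thus ?thesis using True i rank by (auto simp: rules)
    next
      case 2
      then obtain l where "j = Suc l" "1 \<le> l" by (cases j) auto
      thus ?thesis using True i 2 by (auto simp: rules)
    next
      case 3
      then obtain l where "j = Suc l" "1 \<le> l" by (cases j) auto
      thus ?thesis using True i 3 by (auto simp: rules)
    next
      case 4
      thus ?thesis using True i by (auto simp: rules)
    next
      case 5
      hence "even n \<longleftrightarrow> odd i" by auto
      thus ?thesis using 5 True i by (auto simp: rules)
    next
      case 6
      then obtain l where "j = Suc l" "1 \<le> l" by (cases j) auto
      thus ?thesis using True i 6 by (auto simp: rules)
    next
      case 7
      define l where "l = n - 1"
      have l: "n = Suc l" "j = Suc l" "1 \<le> l" using 7 rank by (auto simp: l_def)
      hence "even n \<longleftrightarrow> odd l" by simp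
      thus ?thesis using True i 7 l by (auto simp: rules)
    qed
  next
    case False
    hence i': "i = n" using i by simp
    consider "j = 1" | "2 \<le> j" "j + 2 \<le> n" | "j + 1 = n" | "j = n" using j by linarith
    thus ?thesis
    proof cases
      case 1
      thus ?thesis using i' rank by (auto simp: rules)
    next
      case 2
      then obtain l where "j = Suc l" "1 \<le> l" by (cases j) auto
      thus ?thesis using i' 2 by (auto simp: rules)
    next
      case 3
      define l where "l = n - 2"
      have l: "n = l + 2" "j = l + 1" "1 \<le> l" using 3 rank by (auto simp: l_def)
      hence "even n \<longleftrightarrow> even l" by auto
      thus ?thesis using i' l by (auto simp: rules)
    next
      case 4
      have "n - 1 + 1 = n" "n \<noteq> n - 1" "1 < n" using rank by auto
      thus ?thesis using i' 4 by (auto simp: rules)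
    qed
  qed
  hence "tau (coord_vec (t_coord n u z x y i)) = tau (cf x (q_of x y) (b_of u z x y i) i)" by (rule tau_cong)
  thus ?thesis unfolding t_elt_def using tor_coords_tau[of "t_coord n u z x y i"] t0 by simp
qed

lemma q_of_square: "x\<^sup>2 = 1 \<Longrightarrow> y\<^sup>2 = 1 \<Longrightarrow> (q_of x y)\<^sup>2 = 1"
  by (simp add: q_of_def power_mult_distrib)

lemma b_of_nz: "admissible R u z x y \<Longrightarrow> i \<in> {1..n} \<Longrightarrow> b_of u z x y i \<noteq> 0"
  using sq_one_inverse[of x] sq_one_inverse[of y] by (auto simp: admissible_def b_of_def sign_fac_def)

text \<open>For fixed x and y the map from (a, z) to b is invertible: \<open>sign_fac\<close> is its
  own inverse, and z is recovered from b_n.\<close>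

lemma has_xy_iff: "has_xy R S x y \<longleftrightarrow> x\<^sup>2 = 1 \<and> y\<^sup>2 = 1 \<and> has_pq x (q_of x y) S"
proof
  assume "has_xy R S x y"
  then obtain u z where az: "admissible R u z x y" "given_by R (t_elt R u z x y) S" by (auto simp: has_xy_def)
  have "has_pq x (q_of x y) S"
    unfolding has_pq_def using az(2) t_elt_tau[OF az(1)] b_of_nz[OF az(1)]
    by (intro exI[of _ "b_of u z x y"]) (auto simp: given_by_def)
  thus "x\<^sup>2 = 1 \<and> y\<^sup>2 = 1 \<and> has_pq x (q_of x y) S" using az(1) by (simp add: admissible_def)
next
  assume as: "x\<^sup>2 = 1 \<and> y\<^sup>2 = 1 \<and> has_pq x (q_of x y) S"
  then obtain b where b: "\<And>i. i \<in> {1..n} \<Longrightarrow> b i \<noteq> 0"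
    "\<And>i. i \<in> {1..n} \<Longrightarrow> S (srefl R i) = tau (cf x (q_of x y) (b i) i) ** \<sigma> i" unfolding has_pq_def by blast
  have X: "x \<noteq> 0" "inverse x = x" and Y: "y \<noteq> 0" "inverse y = y"
    using sq_one_inverse[of x] sq_one_inverse[of y] as by auto
  define e z where "e i = b i * sign_fac x y i" and "z = x * inverse (b n)" for i
  have nn: "n \<in> {1..n}" using rank by simp
  have adm: "admissible R e z x y"
    using as b(1) b(1)[OF nn] X Y by (auto simp: admissible_def e_def z_def sign_fac_def)
  have "sign_fac x y i * sign_fac x y i = 1" for i
    using as by (auto simp: sign_fac_def power2_eq_square algebra_simps)
  hence "b_of e z x y i = b i" if "i \<in> {1..n}" for i
    using that X b(1)[OF nn] as by (auto simp: b_of_def e_def z_def mult.assoc power2_eq_square)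
  hence "given_by R (t_elt R e z x y) S" using b(2) t_elt_tau[OF adm] by (simp add: given_by_def)
  thus "has_xy R S x y" using adm by (auto simp: has_xy_def)
qed

lemma section_of_admissible:
  assumes adm: "admissible R u z x y"
  shows "is_section R (section_of R (t_elt R u z x y))" "has_pq x (q_of x y) (section_of R (t_elt R u z x y))"
proof -
  have xy: "x\<^sup>2 = 1" "y\<^sup>2 = 1" using adm by (auto simp: admissible_def)
  obtain S where S: "is_section R S"
    "\<And>i. i \<in> {1..n} \<Longrightarrow> S (srefl R i) = tau (cf x (q_of x y) (b_of u z x y i) i) ** \<sigma> i"
    using has_pq_exists[of x "q_of x y" "b_of u z x y", OF xy(1) q_of_square[OF xy] b_of_nz[OF adm]] by blast
  have "given_by R (t_elt R u z x y) S" using S(2) t_elt_tau[OF adm] by (simp add: given_by_def)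
  hence "section_of R (t_elt R u z x y) = S" by (rule section_of_eq[OF S(1)])
  moreover have "has_pq x (q_of x y) S"
    unfolding has_pq_def using S(2) b_of_nz[OF adm] by (intro exI[of _ "b_of u z x y"]) auto
  ultimately show "is_section R (section_of R (t_elt R u z x y))"
    "has_pq x (q_of x y) (section_of R (t_elt R u z x y))" using S(1) by simp_all
qed

lemma tits_section_facts: "is_section R (tits_section R)" "has_pq 1 1 (tits_section R)"
proof -
  obtain S where S: "is_section R S" "\<And>i. i \<in> {1..n} \<Longrightarrow> S (srefl R i) = tau (cf 1 1 1 i) ** \<sigma> i"
    using has_pq_exists[of 1 1 "\<lambda>_. 1", OF power_one power_one one_neq_zero] by blast
  \<comment> \<open>The Tits section has p = q = 1 and all b_i = 1; the all-ones vector is obtained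
    from \<open>tau_cf_one\<close> at q = -1 because of the sign there.\<close>
  have one: "tau (cf 1 1 1 i) = mat 1" for i using tau_cf_one[of "- 1" i] by simp
  have "given_by R (\<lambda>_. mat 1) S" using S(2) unfolding one by (simp add: given_by_def)
  hence "tits_section R = S" unfolding tits_section_def by (rule section_of_eq[OF S(1)])
  moreover have "has_pq 1 1 S" unfolding has_pq_def using S(2) by (intro exI[of _ "\<lambda>_. 1"]) auto
  ultimately show "is_section R (tits_section R)" "has_pq 1 1 (tits_section R)" using S(1) by simp_all
qed

section \<open>Order profiles and the final equivalence\<close>

definition const_profile :: "enat \<Rightarrow> nat \<Rightarrow> enat" where
  "const_profile k = (\<lambda>i\<in>{1..n}. k)"

lemma const_profile_inj: "const_profile k = const_profile l \<longleftrightarrow> k = l"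
proof
  assume "const_profile k = const_profile l"
  hence "const_profile k 1 = const_profile l 1" by simp
  thus "k = l" using rank by (simp add: const_profile_def)
qed simp

lemma has_pq_profile:
  assumes "p\<^sup>2 = 1" "q\<^sup>2 = 1" "has_pq p q S"
  shows "order_profile R S = const_profile (if q = - 1 then 2 else 4)"
  unfolding order_profile_def const_profile_def using has_pq_order[OF assms] by (intro restrict_ext) simp

text \<open>The order depends only on whether q = -1 and not on the node, so profiles are constant;
  both signs q occur and differ outside characteristic 2.\<close>

lemma order_profiles_eq: "order_profiles R = {const_profile 2, const_profile 4}"
proof -
  have ex: "const_profile (if q = - 1 then 2 else 4) \<in> order_profiles R" if q: "q\<^sup>2 = 1" for q :: 'f
  proof -
    obtain S where S: "is_section R S" "\<And>i. i \<in> {1..n} \<Longrightarrow> S (srefl R i) = tau (cf 1 q 1 i) ** \<sigma> i"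
      using has_pq_exists[of 1 q "\<lambda>_. 1", OF power_one q one_neq_zero] by blast
    have "has_pq 1 q S" unfolding has_pq_def using S(2) by (intro exI[of _ "\<lambda>_. 1"]) auto
    thus ?thesis
      unfolding order_profiles_def using has_pq_profile[of 1 q S] q S(1) by (intro image_eqI[of _ _ S]) auto
  qed
  have ne: "(1 :: 'f) \<noteq> - 1" using minus_one_ne_one[OF char_ne_2] by metis
  have "const_profile 2 \<in> order_profiles R" "const_profile 4 \<in> order_profiles R"
    using ex[of "- 1"] ex[of 1] ne by simp_all
  moreover have "order_profile R S \<in> {const_profile 2, const_profile 4}" if S: "is_section R S" for S
  proof -
    obtain p q where "p\<^sup>2 = 1" "q\<^sup>2 = 1" "has_pq p q S" using section_has_pq[OF S] .
    from has_pq_profile[OF this] show ?thesis by simp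
  qed
  ultimately show ?thesis by (auto simp: order_profiles_def)
qed

lemma maximal_profile_iff: "maximal_profile R p \<longleftrightarrow> p = const_profile 2"
proof -
  have less: "profile_less R (const_profile k) (const_profile l) \<longleftrightarrow> l < k" for k l
    using rank by (auto simp: profile_less_def const_profile_def)
  have two: "(2 :: enat) < 4" by (simp add: numeral_eq_enat)
  show ?thesis
    unfolding maximal_profile_def order_profiles_eq using less two by (auto simp: less_imp_not_less)
qed

lemma optimal_iff:
  assumes "is_section R S" "p\<^sup>2 = 1" "q\<^sup>2 = 1" "has_pq p q S"
  shows "optimal R S \<longleftrightarrow> q = - 1"
proof -
  have all: "(\<forall>p. p = v \<longleftrightarrow> p = w) \<longleftrightarrow> v = w" for v w :: "nat \<Rightarrow> enat" by auto
  thus ?thesis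
    using assms(1) by (simp add: optimal_def maximal_profile_iff has_pq_profile[OF assms(2-4)] all const_profile_inj)
qed

lemma optimal_homomorphic:
  assumes adm: "admissible R u z x y" and q: "q_of x y = - 1"
  shows "optimal R (section_of R (t_elt R u z x y)) \<and> homomorphic R (section_of R (t_elt R u z x y))"
proof -
  note S = section_of_admissible[OF adm]
  have xy: "x\<^sup>2 = 1" "(q_of x y)\<^sup>2 = 1" using adm q_of_square by (auto simp: admissible_def)
  show ?thesis
    using optimal_iff[OF S(1) xy S(2)] section_hom[OF S(1)] has_pq_square[OF xy S(2)] tau_cf_one[OF q] q by simp
qed

text \<open>For a given parity of n the pairs (x, y) and (p, q) determine each other, and
  \<open>T_conjugate_iff\<close> describes conjugacy by (p, q).\<close>

lemma T_conjugate_iff_has_xy: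
  assumes S: "is_section R S" "is_section R S'"
  shows "T_conjugate R S S' \<longleftrightarrow> (\<exists>x y. has_xy R S x y \<and> has_xy R S' x y)"
proof
  assume conj: "T_conjugate R S S'"
  obtain p q where pq: "p\<^sup>2 = 1" "q\<^sup>2 = 1" "has_pq p q S" using section_has_pq[OF S(1)] .
  have pp: "p * (p * q) = q" using pq(1) by (simp add: power2_eq_square mult.assoc[symmetric])
  \<comment> \<open>This inverts \<open>q_of p\<close>; for odd n it works because p is its own
    inverse.\<close>
  define y where "y = (if even n then q else p * q)"
  have y: "y\<^sup>2 = 1" "q_of p y = q" using pq(1,2) pp by (auto simp: y_def q_of_def power_mult_distrib)
  have "has_pq p q S'" using T_conjugate_iff[OF S pq] conj by simp
  hence "has_xy R S p y" "has_xy R S' p y" using pq y by (simp_all add: has_xy_iff)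
  thus "\<exists>x y. has_xy R S x y \<and> has_xy R S' x y" by blast
next
  assume "\<exists>x y. has_xy R S x y \<and> has_xy R S' x y"
  then obtain x y where "x\<^sup>2 = 1" "y\<^sup>2 = 1" "has_pq x (q_of x y) S" "has_pq x (q_of x y) S'" by (auto simp: has_xy_iff)
  thus "T_conjugate R S S'" using T_conjugate_iff[OF S _ q_of_square] by blast
qed

end

theorem proposition3p12:
  fixes R :: "('f::alg_closed_field, 'm::finite) realized_group"
  assumes "CHAR('f) \<noteq> 2"
    and "connected_reductive (grp R)"
    and "almost_simple (grp R)"
    and "maximal_torus (grp R) (tor R)"
    and "rk R \<ge> 6"
    and "type_D R"
    and "cochar_lattice_omega1 R"
    and "realization R"
    and "weyl_generated R"
  shows
    "(even (rk R) \<longrightarrow>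
        (\<forall>a z x y. admissible R a z x y \<and> y = - 1 \<longrightarrow>
           optimal R (section_of R (t_elt R a z x y)) \<and>
           homomorphic R (section_of R (t_elt R a z x y))))
   \<and> (odd (rk R) \<longrightarrow>
        (\<forall>a z x y. admissible R a z x y \<and> x * y = - 1 \<longrightarrow>
           optimal R (section_of R (t_elt R a z x y)) \<and>
           homomorphic R (section_of R (t_elt R a z x y))))
   \<and> is_section R (tits_section R)
   \<and> \<not> optimal R (tits_section R)
   \<and> (\<forall>i\<in>{1..rk R}. tits_section R (srefl R i) ** tits_section R (srefl R i) \<noteq> mat 1)
   \<and> card (order_profiles R) = 2
   \<and> (\<forall>S S'. is_section R S \<and> is_section R S' \<longrightarrow>
        (T_conjugate R S S' \<longleftrightarrow> (\<exists>x y. has_xy R S x y \<and> has_xy R S' x y)))"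
proof -
  interpret realized_D R by unfold_locales (use assms in auto)
  have ne: "(1 :: 'f) \<noteq> - 1" using minus_one_ne_one[OF char_ne_2] by metis
  have hom: "optimal R (section_of R (t_elt R u z x y)) \<and> homomorphic R (section_of R (t_elt R u z x y))"
    if "admissible R u z x y" "q_of x y = - 1" for u z x y
    using optimal_homomorphic[OF that] .
  have q_even: "q_of x y = y" if "even (rk R)" for x y :: 'f using that by (simp add: q_of_def)
  have q_odd: "q_of x y = x * y" if "odd (rk R)" for x y :: 'f using that by (simp add: q_of_def)
  have "\<not> optimal R (tits_section R)" using optimal_iff[OF tits_section_facts(1) _ _ tits_section_facts(2)] ne by simp
  moreover have "\<forall>i\<in>{1..rk R}. tits_section R (srefl R i) ** tits_section R (srefl R i) \<noteq> mat 1"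
    using has_pq_square[OF _ _ tits_section_facts(2)] tau_cf_ne_one[of _ 1] ne by simp
  moreover have "card (order_profiles R) = 2"
    unfolding order_profiles_eq by (simp add: const_profile_inj numeral_eq_enat)
  ultimately show ?thesis
    using hom q_even q_odd tits_section_facts(1) T_conjugate_iff_has_xy by (intro conjI) auto
qed

end
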